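(* Let $E$ be a compact metric space, $0<\alpha<1$, let $a,b:E\to(0,\infty)$ be continuous functions that are uniformly positive, and let $m$ be a non-null finite Borel measure on $E$. Let $\mathcal{L}_\alpha$ be the generator of the measure-valued $\alpha$-CIR model with triplet $(a,b,m)$, and let $\overline{\mathcal{L}_\alpha}^{(2)}$ be its closure in $L^2(Q_\alpha)$, where $Q_\alpha$ is the stationary distribution (all defined in the context). Then $$\mathrm{gap}\big(\overline{\mathcal{L}_\alpha}^{(2)}\big)=\frac12\,\mathop{\mathrm{ess\,inf}}_{(E,m)} b,$$ where $\mathop{\mathrm{ess\,inf}}_{(E,m)}$ denotes the essential infimum with respect to $m$.
   Context: $E$ is a compact metric space; $C_{++}(E)$ is the set of continuous functions on $E$ that are uniformly positive; $B_+(E)$ is the set of nonnegative bounded Borel functions on $E$; $\mathcal{M}(E)$ is the space of finite Borel measures on $E$ with the weak topology; $\mathcal{M}(E)^\circ$ is the set of non-null elements of $\mathcal M(E)$. Write $\langle\eta,f\rangle=\int_E f\,d\eta$, and $\frac{\delta\Psi}{\delta\eta}(r)=\frac{d}{d\epsilon}\Psi(\eta+\epsilon\delta_r)\big|_{\epsilon=0}$. For $0<\alpha<1$, $a,b\in C_{++}(E)$, $m\in\mathcal{M}(E)^\circ$, the operator $\mathcal{L}_\alpha$ is $$\mathcal{L}_\alpha\Psi(\eta)=\frac{\alpha+1}{\Gamma(1-\alpha)}\int_0^\infty\frac{dz}{z^{2+\alpha}}\int_E\eta(dr)a(r)\Big[\Psi(\eta+z\delta_r)-\Psi(\eta)-z\frac{\delta\Psi}{\delta\eta}(r)\Big]-\frac1\alpha\Big\langle\eta,b\frac{\delta\Psi}{\delta\eta}\Big\rangle+\frac{\alpha}{\Gamma(1-\alpha)}\int_0^\infty\frac{dz}{z^{1+\alpha}}\int_E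 m(dr)\big[\Psi(\eta+z\delta_r)-\Psi(\eta)\big].$$ $\mathcal F$ is the class of functions $\Psi(\eta)=\varphi(\langle\eta,f_1\rangle,\dots,\langle\eta,f_n\rangle)$ with $n\ge1$, $\varphi\in C^2(\mathbb{R}_+^n)$ of compact support, $f_i\in C_{++}(E)$ ($\mathbb{R}_+=[0,\infty)$). The closure of $(\mathcal{L}_\alpha,\mathcal F)$ in $C_\infty(\mathcal M(E))$ (continuous functions vanishing at infinity) generates a $C_0$-semigroup of a Markov process on $\mathcal M(E)$, the measure-valued $\alpha$-CIR model with triplet $(a,b,m)$. Its unique stationary distribution $Q_\alpha$ is the probability measure on $\mathcal M(E)^\circ$ with $\int Q_\alpha(d\eta)e^{-\langle\eta,f\rangle}=\exp[-\langle m,a^{-1}\log(1+ab^{-1}f^\alpha)\rangle]$ for $f\in B_+(E)$. The operator $(\mathcal{L}_\alpha,\mathcal F)$ is closable in $L^2(Q_\alpha)$, and its closure $(\overline{\mathcal{L}_\alpha}^{(2)},D(\overline{\mathcal{L}_\alpha}^{(2)}))$ generates a $C_0$-semigroup on $L^2(Q_\alpha)$. For $\Psi\in D(\overline{\mathcal{L}_\alpha}^{(2)})$ put $\mathcal{E}(\Psi)=E^{Q_\alpha}[(-\overline{\mathcal{L}_\alpha}^{(2)})\Psi\cdot\Psi]$, let $\mathrm{var}(\Psi)$ be the variance of $\Psi$ under $Q_\alpha$, and define $$\mathrm{gap}(\overline{\mathcal{L}_\alpha}^{(2)})=\inf\{\mathcal{E}(\Psi):\ \mathrm{var}(\Psi)=1,\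 \Psi\in D(\overline{\mathcal{L}_\alpha}^{(2)})\}.$$ *)

theory Defs
  imports "HOL-Probability.Probability_Measure"
begin

section \<open>Finite Borel measures with the weak topology\<close>

definition fin_measures :: "'e::topological_space measure set" where
  "fin_measures = {\<eta>. sets \<eta> = sets borel \<and> finite_measure \<eta>}"

definition nonnull_measures :: "'e::topological_space measure set" where
  "nonnull_measures = {\<eta> \<in> fin_measures. emeasure \<eta> UNIV \<noteq> 0}"

definition weak_topology :: "'e::topological_space measure topology" where
  "weak_topology = topology_generated_by
     {{\<eta> \<in> fin_measures. (\<integral>r. f r \<partial>\<eta>) \<in> U} | (f :: 'e \<Rightarrow> real) U.
        continuous_on UNIV f \<and> bounded (range f) \<and> open U}"

definition weak_borel :: "'e::topological_space measure measure" where
  "weak_borel = sigma fin_measures {U. openin weak_topology U}"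

text \<open>The measure \<open>\<eta> + z \<delta>\<^sub>r\<close>, for \<open>z \<ge> 0\<close>.\<close>

definition add_dirac :: "'e::topological_space measure \<Rightarrow> real \<Rightarrow> 'e \<Rightarrow> 'e measure" where
  "add_dirac \<eta> z r =
     measure_of UNIV (sets borel) (\<lambda>A. emeasure \<eta> A + ennreal z * indicator A r)"

text \<open>Since \<open>\<eta> + \<epsilon> \<delta>\<^sub>r\<close> is in general not a (nonnegative) measure for \<open>\<epsilon> < 0\<close>, the derivative
  at \<open>\<epsilon> = 0\<close> is taken from the right.\<close>

definition fun_deriv :: "('e::topological_space measure \<Rightarrow> real) \<Rightarrow> 'e measure \<Rightarrow> 'e \<Rightarrow> real" where
  "fun_deriv \<Psi> \<eta> r = vector_derivative (\<lambda>\<epsilon>. \<Psi> (add_dirac \<eta> \<epsilon> r)) (at 0 within {0..})"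


section \<open>Function classes\<close>

definition Cpp :: "('e::topological_space \<Rightarrow> real) set" where
  "Cpp = {f. continuous_on UNIV f \<and> (\<exists>c>0. \<forall>r. c \<le> f r)}"

definition Bplus :: "('e::topological_space \<Rightarrow> real) set" where
  "Bplus = {f \<in> borel_measurable borel. bounded (range f) \<and> (\<forall>r. 0 \<le> f r)}"

text \<open>The orthant \<open>[0,\<infinity>)\<^sup>n\<close>, encoded as functions on the naturals vanishing from \<open>n\<close> on. On this
  set the product topology of \<^typ>\<open>nat \<Rightarrow> real\<close> is the Euclidean topology.\<close>

definition orthant :: "nat \<Rightarrow> (nat \<Rightarrow> real) set" where
  "orthant n = {x. (\<forall>i<n. 0 \<le> x i) \<and> (\<forall>i\<ge>n. x i = 0)}"

text \<open>\<open>g\<close> is the \<open>i\<close>-th partial derivative of \<open>\<phi>\<close> on the orthant, one-sided on the face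
  \<open>x\<^sub>i = 0\<close>.\<close>

definition partial_on_orthant ::
    "nat \<Rightarrow> nat \<Rightarrow> ((nat \<Rightarrow> real) \<Rightarrow> real) \<Rightarrow> ((nat \<Rightarrow> real) \<Rightarrow> real) \<Rightarrow> bool" where
  "partial_on_orthant n i \<phi> g \<longleftrightarrow>
     (\<forall>x \<in> orthant n. ((\<lambda>t. \<phi> (x(i := t))) has_real_derivative g x) (at (x i) within {0..}))"

definition C2_orthant :: "nat \<Rightarrow> ((nat \<Rightarrow> real) \<Rightarrow> real) \<Rightarrow> bool" where
  "C2_orthant n \<phi> \<longleftrightarrow> continuous_on (orthant n) \<phi> \<and>
     (\<exists>g h. \<forall>i<n. partial_on_orthant n i \<phi> (g i) \<and> continuous_on (orthant n) (g i) \<and>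
        (\<forall>j<n. partial_on_orthant n j (g i) (h i j) \<and> continuous_on (orthant n) (h i j)))"

definition compact_support_orthant :: "nat \<Rightarrow> ((nat \<Rightarrow> real) \<Rightarrow> real) \<Rightarrow> bool" where
  "compact_support_orthant n \<phi> \<longleftrightarrow> compact (closure {x \<in> orthant n. \<phi> x \<noteq> 0})"

definition test_functions :: "('e::topological_space measure \<Rightarrow> real) set" where
  "test_functions = {\<Psi>. \<exists>n \<phi> f. 1 \<le> n \<and> C2_orthant n \<phi> \<and> compact_support_orthant n \<phi> \<and>
     (\<forall>i<n. f i \<in> Cpp) \<and>
     (\<forall>\<eta> \<in> fin_measures. \<Psi> \<eta> = \<phi> (\<lambda>i. if i < n then (\<integral>r. f i r \<partial>\<eta>) else 0))}"


section \<open>The operator and its stationary distribution\<close>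

definition cir_op :: "real \<Rightarrow> ('e::topological_space \<Rightarrow> real) \<Rightarrow> ('e \<Rightarrow> real) \<Rightarrow> 'e measure \<Rightarrow>
    ('e measure \<Rightarrow> real) \<Rightarrow> 'e measure \<Rightarrow> real" where
  "cir_op \<alpha> a b m \<Psi> \<eta> =
     (\<alpha> + 1) / Gamma (1 - \<alpha>) *
       (LINT z:{0<..}|lborel. (1 / z powr (2 + \<alpha>)) *
          (\<integral>r. a r * (\<Psi> (add_dirac \<eta> z r) - \<Psi> \<eta> - z * fun_deriv \<Psi> \<eta> r) \<partial>\<eta>))
     - (1 / \<alpha>) * (\<integral>r. b r * fun_deriv \<Psi> \<eta> r \<partial>\<eta>)
     + \<alpha> / Gamma (1 - \<alpha>) *
       (LINT z:{0<..}|lborel. (1 / z powr (1 + \<alpha>)) *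
          (\<integral>r. (\<Psi> (add_dirac \<eta> z r) - \<Psi> \<eta>) \<partial>m))"

text \<open>\<open>Q\<close> is the (unique) stationary distribution of the \<open>\<alpha>\<close>-CIR model with triplet \<open>(a, b, m)\<close>,
  a probability measure on the non-null measures identified by its Laplace functional.\<close>

definition cir_stationary :: "real \<Rightarrow> ('e::topological_space \<Rightarrow> real) \<Rightarrow> ('e \<Rightarrow> real) \<Rightarrow> 'e measure \<Rightarrow>
    'e measure measure \<Rightarrow> bool" where
  "cir_stationary \<alpha> a b m Q \<longleftrightarrow>
     sets Q = sets (restrict_space weak_borel nonnull_measures) \<and> prob_space Q \<and>
     (\<forall>f \<in> Bplus. (\<integral>\<eta>. exp (- (\<integral>r. f r \<partial>\<eta>)) \<partial>Q) =
        exp (- (\<integral>r. inverse (a r) * ln (1 + a r * inverse (b r) * f r powr \<alpha>) \<partial>m)))"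


section \<open>Closure in \<open>L\<^sup>2\<close> and the spectral gap\<close>

text \<open>Elements of \<open>L\<^sup>2(Q)\<close> are represented by functions, not by classes modulo null sets.\<close>

definition L2 :: "'x measure \<Rightarrow> ('x \<Rightarrow> real) set" where
  "L2 Q = {u \<in> borel_measurable Q. integrable Q (\<lambda>x. (u x)\<^sup>2)}"

definition L2_tendsto :: "'x measure \<Rightarrow> (nat \<Rightarrow> 'x \<Rightarrow> real) \<Rightarrow> ('x \<Rightarrow> real) \<Rightarrow> bool" where
  "L2_tendsto Q us u \<longleftrightarrow> (\<forall>k. us k \<in> L2 Q) \<and> u \<in> L2 Q \<and>
     (\<lambda>k. \<integral>x. (us k x - u x)\<^sup>2 \<partial>Q) \<longlonglongrightarrow> 0"

text \<open>The closure in \<open>L\<^sup>2(Q) \<times> L\<^sup>2(Q)\<close> of the graph of the operator \<open>L\<close> with domain \<open>F\<close>, and the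
  resulting closed operator. If \<open>(L, F)\<close> is closable, then \<open>closure_op Q L F u\<close> is determined by \<open>u\<close>
  up to \<open>Q\<close>-null sets, so that \<open>dirichlet_form\<close> does not depend on the choice of representative.\<close>

definition graph_closure :: "'x measure \<Rightarrow> (('x \<Rightarrow> real) \<Rightarrow> 'x \<Rightarrow> real) \<Rightarrow> ('x \<Rightarrow> real) set \<Rightarrow>
    (('x \<Rightarrow> real) \<times> ('x \<Rightarrow> real)) set" where
  "graph_closure Q L F =
     {(u, v). \<exists>us. (\<forall>k. us k \<in> F) \<and> L2_tendsto Q us u \<and> L2_tendsto Q (\<lambda>k. L (us k)) v}"

definition closure_dom :: "'x measure \<Rightarrow> (('x \<Rightarrow> real) \<Rightarrow> 'x \<Rightarrow> real) \<Rightarrow> ('x \<Rightarrow> real) set \<Rightarrow>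
    ('x \<Rightarrow> real) set" where
  "closure_dom Q L F = Domain (graph_closure Q L F)"

definition closure_op :: "'x measure \<Rightarrow> (('x \<Rightarrow> real) \<Rightarrow> 'x \<Rightarrow> real) \<Rightarrow> ('x \<Rightarrow> real) set \<Rightarrow>
    ('x \<Rightarrow> real) \<Rightarrow> 'x \<Rightarrow> real" where
  "closure_op Q L F u = (SOME v. (u, v) \<in> graph_closure Q L F)"

definition dirichlet_form :: "'x measure \<Rightarrow> (('x \<Rightarrow> real) \<Rightarrow> 'x \<Rightarrow> real) \<Rightarrow> ('x \<Rightarrow> real) set \<Rightarrow>
    ('x \<Rightarrow> real) \<Rightarrow> real" where
  "dirichlet_form Q L F u = (\<integral>x. (- closure_op Q L F u x) * u x \<partial>Q)"

definition var :: "'x measure \<Rightarrow> ('x \<Rightarrow> real) \<Rightarrow> real" where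
  "var Q u = (\<integral>x. (u x - (\<integral>y. u y \<partial>Q))\<^sup>2 \<partial>Q)"

text \<open>The infimum is taken in the extended reals, where no nonemptiness or boundedness is needed.\<close>

definition spectral_gap :: "'x measure \<Rightarrow> (('x \<Rightarrow> real) \<Rightarrow> 'x \<Rightarrow> real) \<Rightarrow> ('x \<Rightarrow> real) set \<Rightarrow> ereal" where
  "spectral_gap Q L F =
     Inf {ereal (dirichlet_form Q L F u) | u. var Q u = 1 \<and> u \<in> closure_dom Q L F}"

definition essinf :: "'x measure \<Rightarrow> ('x \<Rightarrow> real) \<Rightarrow> ereal" where
  "essinf M f = Sup {c. AE x in M. c \<le> ereal (f x)}"

end

theory Submission
  imports Defs "HOL-Analysis.Analysis"
begin

text \<open>The stationary measure is a Poisson cluster: independent atoms \<open>w \<delta>\<^sub>r\<close> are thrown with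
  intensity \<open>m(dr) (\<alpha> / a(r)) G\<^sub>r(w) dw / w\<close>, where \<open>G\<^sub>r\<close> is a Mittag-Leffler function whose
  positivity is read off from a fractional relaxation equation. By the Mecke formula the Dirichlet
  form of \<open>\<Psi>\<close> is the integral over \<open>X\<close> and \<open>r\<close> of a one-dimensional energy of
  \<open>t \<mapsto> \<Psi> (X + t \<delta>\<^sub>r)\<close>; a ground state transform with respect to \<open>w \<mapsto> w\<close> bounds this energy from below by
  \<open>b(r) / 2\<close> times the squared jumps integrated against the cluster intensity, and the latter dominate
  the variance by a Poincare inequality. Both formulas are proved for sums of
  exponentials, where everything is explicit, and carried over to test functions by Bernstein
  polynomials in \<open>exp (- \<langle>X, f\<^sub>i\<rangle>)\<close>. Exponentials \<open>exp (- \<langle>X, f\<rangle>)\<close> of small \<open>f\<close> concentrated where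
  \<open>b\<close> is nearly minimal show that the bound is sharp.\<close>

section \<open>Mittag-Leffler functions\<close>

text \<open>The intensity is read off the Laplace functional: for a constant c, the c-derivative of
  (1 / a) log(1 + (a / b) c^\<alpha>) is (\<alpha> / a) c^(\<alpha> - 1) / (b / a + c^\<alpha>), and
  c^(\<alpha> - 1) / (\<beta> + c^\<alpha>) is the Laplace transform of w |-> E_\<alpha>(- \<beta>
  w^\<alpha>); dividing by w undoes the differentiation. So each site carries a relaxation equation
  with rate \<beta> = b / a. The constant is sharp because for small f the energy of exp(- <X, f>)
  is dominated by immigration, (2 - 2^\<alpha>) / 2 times <m, f^\<alpha>>, the branching jumps being
  of order f^(2 \<alpha>), while the variance is about (2 - 2^\<alpha>) <m, f^\<alpha> / b>: the
  quotient is half a mean of b. Two mismatches shape the rest. Exponentials have no compact support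
  and test functions are not exponential sums, so one passes from exponentials to test functions by
  uniform approximation and tests the bound by a cut-off. And the closed operator is an arbitrary
  selection from the graph closure, so <v, u> has to be shown independent of the v attached to
  u.\<close>

abbreviation pos :: "real \<Rightarrow> real" where
  "pos \<equiv> indicator {0<..}"

text \<open>Euler's integral is restricted to t >= \<open>R\<close>, where t^(s - 1) >= R^(s - 1).
  As \<open>R\<close> is free, Gamma outgrows every geometric sequence.\<close>

lemma Gamma_ge_powr:
  fixes s R :: real
  assumes "1 \<le> s" "0 < R"
  shows "R powr (s - 1) / exp R \<le> Gamma s"
proof -
  have J: "((\<lambda>t. R powr (s - 1) * exp (- t)) has_integral R powr (s - 1) * exp (- R)) {R..}"
    using has_integral_mult_right[OF has_integral_exp_minus_to_infinity[of 1 R], of "R powr (s - 1)"]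
    by simp
  have "ennreal (R powr (s - 1) * exp (- R)) = (\<integral>\<^sup>+t. ennreal (R powr (s - 1) * exp (- t)) * indicator {R..} t \<partial>lborel)"
    by (rule nn_integral_has_integral_lebesgue'[OF _ J, symmetric]) simp
  also have "\<dots> \<le> (\<integral>\<^sup>+t. ennreal (indicator {0..} t * t powr (s - 1) / exp t) \<partial>lborel)"
    using assms by (intro nn_integral_mono)
      (auto simp: indicator_def exp_minus field_simps intro!: ennreal_leI powr_mono2)
  also have "\<dots> = ennreal (Gamma s)"
    using Gamma_conv_nn_integral_real[of s] assms by simp
  finally have "R powr (s - 1) * exp (- R) \<le> Gamma s"
    using assms by (subst (asm) ennreal_le_iff) (auto intro!: less_imp_le Gamma_real_pos)
  then show ?thesis by (simp add: exp_minus field_simps)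
qed

lemma has_integral_powr_Beta:
  fixes x a b :: real
  assumes "0 < x" "0 < a" "0 < b"
  shows "((\<lambda>w. w powr (a - 1) * (x - w) powr (b - 1)) has_integral x powr (a + b - 1) * Beta a b) {0<..<x}"
proof -
  have "((\<lambda>w. (w / x) powr (a - 1) * (1 - w / x) powr (b - 1)) has_integral (x * Beta a b)) {0..x}"
    using has_integral_affinity'[OF has_integral_Beta_real[OF assms(2,3), unfolded box_real(2)[symmetric]], of "1/x" 0] assms
    by simp
  then have "((\<lambda>w. x powr (a + b - 2) * ((w / x) powr (a - 1) * (1 - w / x) powr (b - 1)))
      has_integral x powr (a + b - 2) * (x * Beta a b)) {0<..<x}"
    by (intro has_integral_mult_right) (simp add: has_integral_Icc_iff_Ioo)
  moreover have "x powr (a + b - 2) * (x * Beta a b) = x powr (a + b - 1) * Beta a b"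
    using assms powr_mult_base[of x "a + b - 2"] by (simp add: algebra_simps)
  moreover have "x powr (a + b - 2) * ((w / x) powr (a - 1) * (1 - w / x) powr (b - 1)) =
      w powr (a - 1) * (x - w) powr (b - 1)" if "w \<in> {0<..<x}" for w
  proof -
    have e: "1 - w / x = (x - w) / x" using assms by (simp add: field_simps)
    have "x powr (a + b - 2) = x powr (a - 1) * x powr (b - 1)"
      by (simp add: powr_add[symmetric])
    then show ?thesis using that assms unfolding e by (simp add: powr_divide)
  qed
  ultimately show ?thesis by (metis (no_types, lifting) has_integral_cong)
qed

lemma summable_Mittag_Leffler:
  fixes y \<alpha> c :: real
  assumes "0 < \<alpha>" "1 \<le> c"
  shows "summable (\<lambda>k. y ^ k / Gamma (\<alpha> * real k + c))"
proof -
  \<comment> \<open>Chosen so that R^\<alpha> = 2 (|y| + 1): the Gamma bound then beats |y|^k by a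
    factor 2^k.\<close>
  define R where "R = (2 * (\<bar>y\<bar> + 1)) powr (1 / \<alpha>)"
  have R: "0 < R" "R powr \<alpha> = 2 * (\<bar>y\<bar> + 1)"
    using assms by (auto simp: R_def powr_powr)
  have "norm (y ^ k / Gamma (\<alpha> * real k + c)) \<le> exp R / R powr (c - 1) * (1 / 2) ^ k" for k
  proof -
    have g: "0 < Gamma (\<alpha> * real k + c)"
      using assms by (intro Gamma_real_pos add_nonneg_pos) auto
    have "R powr (\<alpha> * real k + c - 1) / exp R \<le> Gamma (\<alpha> * real k + c)"
      using assms R by (intro Gamma_ge_powr add_increasing) auto
    also have "R powr (\<alpha> * real k + c - 1) = (2 * (\<bar>y\<bar> + 1)) ^ k * R powr (c - 1)"
      using R by (simp add: powr_add[symmetric] powr_powr[symmetric] powr_realpow add_diff_eq[symmetric] del: R(2))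
        (simp add: R(2)[symmetric] powr_powr[symmetric] powr_add powr_realpow)
    finally have le: "(2 * (\<bar>y\<bar> + 1)) ^ k * R powr (c - 1) / exp R \<le> Gamma (\<alpha> * real k + c)" .
    have "(\<bar>y\<bar> * 2) ^ k \<le> (2 * (\<bar>y\<bar> + 1)) ^ k" by (intro power_mono) auto
    then have "\<bar>y\<bar> ^ k * 2 ^ k \<le> (2 * (\<bar>y\<bar> + 1)) ^ k" by (simp only: power_mult_distrib)
    then have "\<bar>y\<bar> ^ k * 2 ^ k * R powr (c - 1) / exp R \<le> (2 * (\<bar>y\<bar> + 1)) ^ k * R powr (c - 1) / exp R"
      by (intro divide_right_mono mult_right_mono) auto
    from order_trans[OF this le]
    have "\<bar>y\<bar> ^ k * 2 ^ k * R powr (c - 1) / exp R \<le> Gamma (\<alpha> * real k + c)" .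
    then have "\<bar>y\<bar> ^ k / Gamma (\<alpha> * real k + c) \<le> exp R / R powr (c - 1) / 2 ^ k"
      using g R by (simp add: field_simps)
    also have "\<dots> = exp R / R powr (c - 1) * (1 / 2) ^ k"
      by (simp add: power_divide)
    finally show ?thesis using g by (simp add: power_abs)
  qed
  note bound = this
  have "summable (\<lambda>k. exp R / R powr (c - 1) * (1 / 2) ^ k)"
    by (intro summable_mult summable_geometric) simp
  then show ?thesis
    by (rule summable_comparison_test'[where N = 0]) (rule bound)
qed

text \<open>The Mittag-Leffler function E_\<alpha> at - y; the sign is built in because only
  arguments - y \<le> 0 matter.\<close>

definition mlf :: "real \<Rightarrow> real \<Rightarrow> real" where
  "mlf \<alpha> y = (\<Sum>k. (- y) ^ k / Gamma (\<alpha> * real k + 1))"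

lemma mlf_has_derivative:
  assumes "0 < \<alpha>"
  shows "\<exists>D. (mlf \<alpha> has_real_derivative D) (at y)"
proof -
  have s: "summable (\<lambda>k. 1 / Gamma (\<alpha> * real k + 1) * y ^ k)" for y
    using summable_Mittag_Leffler[OF assms, of 1 y] by simp
  have "\<exists>D. ((\<lambda>y. \<Sum>k. 1 / Gamma (\<alpha> * real k + 1) * y ^ k) has_real_derivative D) (at (- y))"
    using termdiffs_strong_converges_everywhere[OF s] by blast
  then obtain D where "((\<lambda>y. \<Sum>k. 1 / Gamma (\<alpha> * real k + 1) * y ^ k) has_real_derivative D) (at (- y))" ..
  then have "((\<lambda>y. \<Sum>k. 1 / Gamma (\<alpha> * real k + 1) * (- y) ^ k) has_real_derivative - D) (at y)"
    using DERIV_chain2[of "\<lambda>y. \<Sum>k. 1 / Gamma (\<alpha> * real k + 1) * y ^ k" D uminus y "- 1" UNIV]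
      DERIV_minus[OF DERIV_ident, where s = UNIV and x = y] by simp
  then show ?thesis by (auto simp: mlf_def[abs_def])
qed

lemma continuous_on_mlf: "0 < \<alpha> \<Longrightarrow> continuous_on A (mlf \<alpha>)"
  using mlf_has_derivative DERIV_isCont by (metis continuous_at_imp_continuous_on)

lemma mlf_0: "mlf \<alpha> 0 = 1"
proof -
  have "(\<lambda>k. (- 0) ^ k / Gamma (\<alpha> * real k + 1)) sums ((- 0) ^ 0 / Gamma (\<alpha> * real 0 + 1))"
    by (rule sums_If_finite_set[of "{0}", simplified, THEN sums_cong[THEN iffD1, rotated]]) auto
  then show ?thesis by (simp add: mlf_def sums_iff)
qed

text \<open>The functions \<open>w \<mapsto> mlf \<alpha> (\<beta> w\<^sup>\<alpha>)\<close> solve the fractional relaxation equation, stated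
  here in integrated form: Beta integrals are applied to each term of the series.\<close>

lemma mlf_series_integral:
  fixes \<alpha> \<beta> x s :: real
  assumes "0 < \<alpha>" "0 < x" "0 < s"
  shows "has_bochner_integral lborel
      (\<lambda>w. indicator {0<..<x} w * (mlf \<alpha> (\<beta> * w powr \<alpha>) * (x - w) powr (s - 1)))
      (\<Sum>k. (- \<beta>) ^ k * x powr (\<alpha> * real k + s) * Gamma s / Gamma (\<alpha> * real k + s + 1))"
    (is "has_bochner_integral _ _ (\<Sum>k. ?I k)")
proof -
  define c where "c k = (- \<beta>) ^ k / Gamma (\<alpha> * real k + 1)" for k
  define f where "f k w = indicator {0<..<x} w * (c k * (w powr (\<alpha> * real k) * (x - w) powr (s - 1)))" for k w
  have Gp: "0 < Gamma (\<alpha> * real k + 1)" for k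
    using assms by (intro Gamma_real_pos add_nonneg_pos) auto
  have hb0: "has_bochner_integral lborel (\<lambda>w. indicator {0<..<x} w * (w powr (\<alpha> * real k) * (x - w) powr (s - 1)))
      (x powr (\<alpha> * real k + s) * Beta (\<alpha> * real k + 1) s)" (is "has_bochner_integral _ ?h ?v") for k
  proof (rule has_bochner_integral_nn_integral)
    have *: "((\<lambda>w. w powr (\<alpha> * real k) * (x - w) powr (s - 1)) has_integral ?v) {0<..<x}"
    proof -
      have "0 < \<alpha> * real k + 1" using assms by (simp add: add_nonneg_pos)
      then show ?thesis using has_integral_powr_Beta[of x "\<alpha> * real k + 1" s] assms by (simp add: add_ac)
    qed
    show "(\<integral>\<^sup>+w. ennreal (?h w) \<partial>lborel) = ennreal ?v"
      using nn_integral_has_integral_lebesgue[OF _ *] by simp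
    show "0 \<le> ?v" using * by (rule has_integral_nonneg) auto
  qed auto
  have hb: "has_bochner_integral lborel (f k) (?I k)" for k
  proof -
    have "has_bochner_integral lborel (\<lambda>w. c k * (indicator {0<..<x} w * (w powr (\<alpha> * real k) * (x - w) powr (s - 1))))
      (c k * (x powr (\<alpha> * real k + s) * Beta (\<alpha> * real k + 1) s))"
      by (intro has_bochner_integral_mult_right hb0)
    moreover have "c k * (x powr (\<alpha> * real k + s) * Beta (\<alpha> * real k + 1) s) = ?I k"
      using Gp[of k] by (simp add: c_def Beta_def add.commute add.left_commute)
    moreover have "(\<lambda>w. c k * (indicator {0<..<x} w * (w powr (\<alpha> * real k) * (x - w) powr (s - 1)))) = f k"
      by (auto simp: f_def)
    ultimately show ?thesis by simp
  qed
  have fe: "f k w = indicator {0<..<x} w * ((- (\<beta> * w powr \<alpha>)) ^ k / Gamma (\<alpha> * real k + 1) * (x - w) powr (s - 1))" for k w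
  proof (cases "w \<in> {0<..<x}")
    case True
    then have "w powr (\<alpha> * real k) = (w powr \<alpha>) ^ k"
      by (simp add: powr_powr[symmetric] powr_realpow)
    then show ?thesis
      by (simp add: f_def c_def power_mult_distrib[symmetric])
  qed (simp add: f_def)
  have sums: "(\<lambda>k. f k w) sums (indicator {0<..<x} w * (mlf \<alpha> (\<beta> * w powr \<alpha>) * (x - w) powr (s - 1)))" for w
    unfolding fe mlf_def using summable_Mittag_Leffler[OF assms(1), of 1 "- (\<beta> * w powr \<alpha>)"]
    by (intro sums_mult sums_mult2 summable_sums) auto
  have nrm: "norm (f k w) = indicator {0<..<x} w * (\<bar>\<beta>\<bar> ^ k / Gamma (\<alpha> * real k + 1) * (w powr (\<alpha> * real k) * (x - w) powr (s - 1)))" for k w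
    using Gp[of k] by (auto simp: f_def c_def abs_mult power_abs split: split_indicator)
  have int_norm: "(LBINT w. norm (f k w)) = \<bar>\<beta>\<bar> ^ k * x powr (\<alpha> * real k + s) * Gamma s / Gamma (\<alpha> * real k + s + 1)" for k
  proof -
    have "(LBINT w. norm (f k w)) = (LBINT w. \<bar>\<beta>\<bar> ^ k / Gamma (\<alpha> * real k + 1) * (indicator {0<..<x} w * (w powr (\<alpha> * real k) * (x - w) powr (s - 1))))"
      unfolding nrm by (intro Bochner_Integration.integral_cong) auto
    also have "\<dots> = \<bar>\<beta>\<bar> ^ k / Gamma (\<alpha> * real k + 1) * (x powr (\<alpha> * real k + s) * Beta (\<alpha> * real k + 1) s)"
      using has_bochner_integral_integral_eq[OF hb0[of k]] by simp
    also have "\<dots> = \<bar>\<beta>\<bar> ^ k * x powr (\<alpha> * real k + s) * Gamma s / Gamma (\<alpha> * real k + s + 1)"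
      using Gp[of k] by (simp add: Beta_def add.commute add.left_commute)
    finally show ?thesis .
  qed
  \<comment> \<open>The integrated norms form a Mittag-Leffler series again, with second parameter
    \<open>s + 1\<close> and argument |\<beta>| x^\<alpha>.\<close>
  have sm: "summable (\<lambda>k. LBINT w. norm (f k w))"
  proof -
    have "summable (\<lambda>k. x powr s * Gamma s * ((\<bar>\<beta>\<bar> * x powr \<alpha>) ^ k / Gamma (\<alpha> * real k + (s + 1))))"
      using assms by (intro summable_mult summable_Mittag_Leffler) auto
    also have "(\<lambda>k. x powr s * Gamma s * ((\<bar>\<beta>\<bar> * x powr \<alpha>) ^ k / Gamma (\<alpha> * real k + (s + 1)))) =
        (\<lambda>k. LBINT w. norm (f k w))"
      using assms(2) unfolding int_norm
      by (auto simp: fun_eq_iff powr_add power_mult_distrib powr_powr[symmetric] powr_realpow add.assoc)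
    finally show ?thesis .
  qed
  have sm': "AE w in lborel. summable (\<lambda>k. norm (f k w))"
  proof (rule AE_I2)
    fix w
    have "norm (f k w) = indicator {0<..<x} w * (x - w) powr (s - 1) * ((\<bar>\<beta>\<bar> * w powr \<alpha>) ^ k / Gamma (\<alpha> * real k + 1))" for k
      using Gp[of k] by (auto simp: fe abs_mult power_abs split: split_indicator)
    then show "summable (\<lambda>k. norm (f k w))"
      using summable_mult[OF summable_Mittag_Leffler[OF assms(1), of 1 "\<bar>\<beta>\<bar> * w powr \<alpha>"]] by simp
  qed
  have i: "integrable lborel (f k)" for k using hb by (simp add: has_bochner_integral_iff)
  have "has_bochner_integral lborel (\<lambda>w. \<Sum>k. f k w) (\<Sum>k. integral\<^sup>L lborel (f k))"
    using integrable_suminf[OF i sm' sm] integral_suminf[OF i sm' sm] by (simp add: has_bochner_integral_iff)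
  moreover have "(\<lambda>w. \<Sum>k. f k w) = (\<lambda>w. indicator {0<..<x} w * (mlf \<alpha> (\<beta> * w powr \<alpha>) * (x - w) powr (s - 1)))"
    using sums by (simp add: sums_iff)
  moreover have "integral\<^sup>L lborel (f k) = ?I k" for k
    using hb by (simp add: has_bochner_integral_iff)
  ultimately show ?thesis by simp
qed

lemma mlf_integral:
  assumes "0 < \<alpha>" "0 < x"
  shows "has_bochner_integral lborel (\<lambda>w. indicator {0<..<x} w * mlf \<alpha> (\<beta> * w powr \<alpha>))
      (\<Sum>k. (- \<beta>) ^ k * x powr (\<alpha> * real k + 1) / Gamma (\<alpha> * real k + 2))"
proof -
  have eq: "(\<lambda>w. indicator {0<..<x} w * (mlf \<alpha> (\<beta> * w powr \<alpha>) * (x - w) powr (1 - 1))) =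
      (\<lambda>w. indicator {0<..<x} w * mlf \<alpha> (\<beta> * w powr \<alpha>))"
    by (auto split: split_indicator)
  show ?thesis
    using mlf_series_integral[OF assms zero_less_one, of \<beta>] unfolding eq by (simp add: add.assoc)
qed

text \<open>Up to \<open>Gamma (1 - \<alpha>)\<close> the integral is the fractional integral of
  order 1 - \<alpha>. In the series for s = 1 - \<alpha> the term k + 1 is - \<beta>
  \<open>Gamma (1 - \<alpha>)\<close> times the term k of the plain integral, because \<alpha> (k +
  1) + (1 - \<alpha>) = \<alpha> k + 1; only the term k = 0 is left over.\<close>

lemma mlf_fractional_equation:
  assumes "0 < \<alpha>" "\<alpha> < 1" "0 < x"
  shows "has_bochner_integral lborel
      (\<lambda>w. indicator {0<..<x} w * (mlf \<alpha> (\<beta> * w powr \<alpha>) * (x - w) powr (- \<alpha>)))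
      (x powr (1 - \<alpha>) / (1 - \<alpha>) - \<beta> * Gamma (1 - \<alpha>) *
        (LBINT w. indicator {0<..<x} w * mlf \<alpha> (\<beta> * w powr \<alpha>)))"
proof -
  define a where "a k = (- \<beta>) ^ k * x powr (\<alpha> * real k + (1 - \<alpha>)) * Gamma (1 - \<alpha>) / Gamma (\<alpha> * real k + (1 - \<alpha>) + 1)" for k
  define c where "c k = (- \<beta>) ^ k * x powr (\<alpha> * real k + 1) / Gamma (\<alpha> * real k + 2)" for k
  have pm: "(- (\<beta> * p)) ^ k = (- \<beta>) ^ k * p ^ k" for p k
    by (simp add: power_mult_distrib[symmetric])
  have "summable (\<lambda>k. x powr (1 - \<alpha>) * Gamma (1 - \<alpha>) * ((- \<beta> * x powr \<alpha>) ^ k / Gamma (\<alpha> * real k + ((1 - \<alpha>) + 1))))"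
    using assms by (intro summable_mult summable_Mittag_Leffler) auto
  also have "(\<lambda>k. x powr (1 - \<alpha>) * Gamma (1 - \<alpha>) * ((- \<beta> * x powr \<alpha>) ^ k / Gamma (\<alpha> * real k + ((1 - \<alpha>) + 1)))) = a"
    using assms unfolding a_def
    by (auto simp: fun_eq_iff powr_add[of x "\<alpha> * real _"] power_mult_distrib powr_powr[symmetric] powr_realpow add.assoc pm)
  finally have sa: "summable a" .
  have "summable (\<lambda>k. x * ((- \<beta> * x powr \<alpha>) ^ k / Gamma (\<alpha> * real k + 2)))"
    using assms by (intro summable_mult summable_Mittag_Leffler) auto
  also have "(\<lambda>k. x * ((- \<beta> * x powr \<alpha>) ^ k / Gamma (\<alpha> * real k + 2))) = c"
    using assms unfolding c_def
    by (auto simp: fun_eq_iff powr_add[of x "\<alpha> * real _"] power_mult_distrib powr_powr[symmetric] powr_realpow add.assoc pm)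
  finally have sc: "summable c" .
  have "a (Suc k) = - \<beta> * Gamma (1 - \<alpha>) * c k" for k
  proof -
    have e: "\<alpha> * real (Suc k) + (1 - \<alpha>) = \<alpha> * real k + 1" "\<alpha> * real k + 1 + 1 = \<alpha> * real k + 2"
      by (simp_all add: algebra_simps)
    show ?thesis unfolding a_def c_def e by simp
  qed
  then have "suminf a = a 0 - \<beta> * Gamma (1 - \<alpha>) * suminf c"
    using suminf_split_head[OF sa] suminf_mult[OF sc, of "- \<beta> * Gamma (1 - \<alpha>)"] by simp
  also have "a 0 = x powr (1 - \<alpha>) / (1 - \<alpha>)"
  proof -
    have "1 - \<alpha> \<notin> \<int>\<^sub>\<le>\<^sub>0" using assms by (auto elim!: nonpos_Ints_cases)
    from Gamma_plus1[OF this] have "Gamma (1 - \<alpha> + 1) = (1 - \<alpha>) * Gamma (1 - \<alpha>)" .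
    moreover have "Gamma (1 - \<alpha>) \<noteq> 0" using Gamma_real_pos[of "1 - \<alpha>"] assms by linarith
    ultimately show ?thesis using assms by (simp add: a_def)
  qed
  finally show ?thesis
    using mlf_series_integral[of \<alpha> x "1 - \<alpha>" \<beta>] assms
      has_bochner_integral_integral_eq[OF mlf_integral[OF assms(1,3), of \<beta>]]
    by (simp add: a_def[abs_def] c_def[abs_def])
qed

text \<open>At a negative minimum \<open>x0\<close> the fractional derivative would be nonpositive, whereas the
  equation makes it positive.\<close>

lemma mlf_nonneg:
  assumes \<alpha>: "0 < \<alpha>" "\<alpha> < 1" and "0 < \<beta>" "0 \<le> X"
  shows "0 \<le> mlf \<alpha> (\<beta> * X powr \<alpha>)"
proof (rule ccontr)
  define g where "g w = mlf \<alpha> (\<beta> * w powr \<alpha>)" for w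
  define \<Gamma> where "\<Gamma> = Gamma (1 - \<alpha>)"
  have \<Gamma>: "0 < \<Gamma>" using \<alpha> by (simp add: \<Gamma>_def Gamma_real_pos)
  have g0: "g 0 = 1" using \<alpha> by (simp add: g_def mlf_0)
  have contg: "continuous_on {0..c} g" for c
    unfolding g_def using \<alpha>
    by (intro continuous_on_compose2[OF continuous_on_mlf[OF \<alpha>(1), of UNIV]] continuous_intros continuous_on_powr') auto
  assume "\<not> 0 \<le> mlf \<alpha> (\<beta> * X powr \<alpha>)"
  then have gX: "g X < 0" by (simp add: g_def)
  have "\<exists>x\<in>{0..X}. \<forall>y\<in>{0..X}. g x \<le> g y"
    using contg assms by (intro continuous_attains_inf) auto
  then obtain x0 where x0: "0 \<le> x0" "x0 \<le> X" "\<And>y. 0 \<le> y \<Longrightarrow> y \<le> X \<Longrightarrow> g x0 \<le> g y"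
    by auto
  define d where "d w = g w - g x0" for w
  have m: "g x0 < 0" using x0(3)[of X] gX assms by simp
  then have x0p: "0 < x0" using g0 x0(1) by (metis less_eq_real_def not_one_less_zero)
  \<comment> \<open>By the fractional equation \<open>P x\<close> is the integral of d w (x - w)^(-
    \<alpha>) over 0 < w < x. The formula makes its derivative at \<open>x0\<close> strictly
    positive, but its left difference quotients tend to something at most 0, because
    \<open>d\<close> is nonnegative and vanishes at \<open>x0\<close>.\<close>
  define P where "P x = x powr (1 - \<alpha>) / (1 - \<alpha>) * (1 - g x0) - \<beta> * \<Gamma> * integral {0..x} g" for x
  have hbP: "has_bochner_integral lborel (\<lambda>w. indicator {0<..<x} w * (d w * (x - w) powr (- \<alpha>))) (P x)" if x: "0 < x" for x
  proof -
    have Sx: "(LBINT w. indicator {0<..<x} w * g w) = integral {0..x} g"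
    proof -
      have "set_integrable lborel {0<..<x} g"
        using mlf_integral[OF \<alpha>(1) x, of \<beta>] by (simp add: g_def set_integrable_def has_bochner_integral_iff)
      then have "(LBINT w. indicator {0<..<x} w * g w) = integral {0<..<x} g"
        using set_borel_integral_eq_integral(2)[of "{0<..<x}" g] by (simp add: set_lebesgue_integral_def)
      then show ?thesis by (simp add: integral_open_interval_real)
    qed
    have 1: "has_bochner_integral lborel (\<lambda>w. indicator {0<..<x} w * (g w * (x - w) powr (- \<alpha>)))
        (x powr (1 - \<alpha>) / (1 - \<alpha>) - \<beta> * \<Gamma> * integral {0..x} g)"
      using mlf_fractional_equation[OF \<alpha> x, of \<beta>] Sx by (simp add: g_def \<Gamma>_def)
    \<comment> \<open>For \<beta> = 0 the function is constantly 1, which yields the integral of the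
      bare kernel.\<close>
    have 2: "has_bochner_integral lborel (\<lambda>w. indicator {0<..<x} w * (x - w) powr (- \<alpha>)) (x powr (1 - \<alpha>) / (1 - \<alpha>))"
      using mlf_fractional_equation[OF \<alpha> x, of 0] by (simp add: mlf_0)
    have "has_bochner_integral lborel (\<lambda>w. indicator {0<..<x} w * (g w * (x - w) powr (- \<alpha>))
         - g x0 * (indicator {0<..<x} w * (x - w) powr (- \<alpha>)))
        (x powr (1 - \<alpha>) / (1 - \<alpha>) - \<beta> * \<Gamma> * integral {0..x} g - g x0 * (x powr (1 - \<alpha>) / (1 - \<alpha>)))"
      by (intro has_bochner_integral_diff has_bochner_integral_mult_right 1 2)
    moreover have "(\<lambda>w. indicator {0<..<x} w * (g w * (x - w) powr (- \<alpha>))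
         - g x0 * (indicator {0<..<x} w * (x - w) powr (- \<alpha>))) =
        (\<lambda>w. indicator {0<..<x} w * (d w * (x - w) powr (- \<alpha>)))"
      by (auto simp: fun_eq_iff d_def left_diff_distrib split: split_indicator)
    moreover have "x powr (1 - \<alpha>) / (1 - \<alpha>) - \<beta> * \<Gamma> * integral {0..x} g - g x0 * (x powr (1 - \<alpha>) / (1 - \<alpha>)) = P x"
      unfolding P_def right_diff_distrib by (simp only: mult.commute mult_1 diff_diff_eq add.commute)
    ultimately show ?thesis by (simp only:)
  qed
  have dP: "(P has_real_derivative x0 powr (- \<alpha>) * (1 - g x0) - \<beta> * \<Gamma> * g x0) (at x0 within {0..x0})"
  proof -
    have "((\<lambda>x. integral {0..x} g) has_real_derivative g x0) (at x0 within {0..x0})"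
      using x0 contg[of x0] by (intro integral_has_real_derivative) auto
    from DERIV_cmult[OF this, of "\<beta> * \<Gamma>"]
    have 1: "((\<lambda>x. \<beta> * \<Gamma> * integral {0..x} g) has_real_derivative \<beta> * \<Gamma> * g x0) (at x0 within {0..x0})" .
    have "((\<lambda>x. x powr (1 - \<alpha>) / (1 - \<alpha>)) has_real_derivative x0 powr (- \<alpha>)) (at x0 within {0..x0})"
      using DERIV_cdivide[OF DERIV_subset[OF has_real_derivative_powr[OF x0p, of "1 - \<alpha>"]], of "{0..x0}" "1 - \<alpha>"] \<alpha>
      by simp
    from DERIV_diff[OF DERIV_cmult_right[OF this, of "1 - g x0"] 1]
    show ?thesis unfolding P_def by (simp add: mult.commute)
  qed
  obtain D where D: "(g has_real_derivative D) (at x0)"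
  proof -
    obtain D' where "(mlf \<alpha> has_real_derivative D') (at (\<beta> * x0 powr \<alpha>))"
      using mlf_has_derivative[OF \<alpha>(1)] by blast
    moreover have "((\<lambda>x. \<beta> * x powr \<alpha>) has_real_derivative \<beta> * (\<alpha> * x0 powr (\<alpha> - 1))) (at x0)"
      by (intro DERIV_cmult has_real_derivative_powr x0p)
    ultimately have "((\<lambda>w. mlf \<alpha> (\<beta> * w powr \<alpha>)) has_real_derivative D' * (\<beta> * (\<alpha> * x0 powr (\<alpha> - 1)))) (at x0)"
      by (rule DERIV_chain2)
    then show ?thesis using that unfolding g_def by blast
  qed
  \<comment> \<open>Differentiability at \<open>x0\<close> gives d w \<le> L (x0 - w) just left of
    \<open>x0\<close>; this linear zero absorbs the singularity of (x0 - w)^(- \<alpha>).\<close>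
  define L where "L = \<bar>D\<bar> + 1"
  have "\<forall>\<^sub>F w in at x0. \<bar>(g w - g x0) / (w - x0) - D\<bar> < 1"
    using D tendstoD[of "\<lambda>w. (g w - g x0) / (w - x0)" D "at x0" 1]
    by (simp add: has_field_derivative_iff dist_real_def)
  then obtain \<delta> where \<delta>: "0 < \<delta>" "\<And>w. w \<noteq> x0 \<Longrightarrow> \<bar>w - x0\<bar> < \<delta> \<Longrightarrow> \<bar>(g w - g x0) / (w - x0) - D\<bar> < 1"
    by (auto simp: eventually_at dist_real_def)
  have dL: "d w \<le> L * (x0 - w)" if "x0 - \<delta> < w" "w < x0" for w
  proof -
    have "\<bar>(g w - g x0) / (w - x0)\<bar> \<le> L" using \<delta>(2)[of w] that unfolding L_def by linarith
    then have "\<bar>g w - g x0\<bar> \<le> L * \<bar>w - x0\<bar>" using that by (simp add: abs_divide pos_divide_le_eq)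
    then show ?thesis using that by (simp add: d_def)
  qed
  have bound: "P x0 - P x \<le> L * (x0 - x) powr (1 - \<alpha>) * (x0 - x)" if x: "0 < x" "x0 - \<delta> < x" "x < x0" for x
  proof -
    let ?c = "L * (x0 - x) powr (1 - \<alpha>)"
    have hb1: "has_bochner_integral lborel (\<lambda>w. indicator {0<..<x0} w * (d w * (x0 - w) powr - \<alpha>) - indicator {0<..<x} w * (d w * (x - w) powr - \<alpha>)) (P x0 - P x)"
      by (intro has_bochner_integral_diff hbP x0p x)
    have hb2: "has_bochner_integral lborel (\<lambda>w. indicator {x..x0} w *\<^sub>R ?c) ((x0 - x) *\<^sub>R ?c)"
      using has_bochner_integral_indicator[of "{x..x0}" lborel ?c] x by simp
    \<comment> \<open>Left of \<open>x\<close> the kernel decreases as its pole moves from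
      \<open>x\<close> to \<open>x0\<close>, so this part of the difference is at most 0; only the
      window from \<open>x\<close> to \<open>x0\<close> contributes.\<close>
    have "indicator {0<..<x0} w * (d w * (x0 - w) powr - \<alpha>) - indicator {0<..<x} w * (d w * (x - w) powr - \<alpha>)
        \<le> indicator {x..x0} w *\<^sub>R ?c" for w
    proof -
      have L: "0 \<le> L" by (simp add: L_def)
      consider "w \<le> 0 \<or> x0 \<le> w" | "0 < w" "w < x" | "x \<le> w" "w < x0" by linarith
      then show ?thesis
      proof cases
        case 2
        have "0 \<le> d w" using x0(2) x0(3)[of w] 2 x by (simp add: d_def)
        moreover have "(x0 - w) powr - \<alpha> \<le> (x - w) powr - \<alpha>"
          using 2 x \<alpha> by (intro powr_mono2') auto
        ultimately have "d w * (x0 - w) powr - \<alpha> \<le> d w * (x - w) powr - \<alpha>"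
          by (rule mult_left_mono[rotated])
        then show ?thesis using 2 x by simp
      next
        case 3
        have "d w * (x0 - w) powr - \<alpha> \<le> L * (x0 - w) * (x0 - w) powr - \<alpha>"
          using dL[of w] 3 x by (intro mult_right_mono) auto
        also have "\<dots> = L * (x0 - w) powr (1 - \<alpha>)"
          using 3 powr_mult_base[of "x0 - w" "- \<alpha>"] by (simp add: mult.assoc)
        also have "\<dots> \<le> ?c"
          using 3 L \<alpha> by (intro mult_left_mono powr_mono2) auto
        finally show ?thesis using 3 x by simp
      next
        case 1
        then show ?thesis using L x by (auto split: split_indicator)
      qed
    qed
    then have "(LBINT w. indicator {0<..<x0} w * (d w * (x0 - w) powr - \<alpha>) - indicator {0<..<x} w * (d w * (x - w) powr - \<alpha>))
        \<le> (LBINT w. indicator {x..x0} w *\<^sub>R ?c)"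
      using has_bochner_integral_iff[THEN iffD1, OF hb1] has_bochner_integral_iff[THEN iffD1, OF hb2]
      by (intro integral_mono) blast+
    then have "P x0 - P x \<le> (x0 - x) *\<^sub>R ?c"
      unfolding has_bochner_integral_integral_eq[OF hb1] has_bochner_integral_integral_eq[OF hb2] .
    then show ?thesis by (simp add: mult.commute)
  qed
  have l1: "((\<lambda>x. (P x - P x0) / (x - x0)) \<longlongrightarrow> x0 powr (- \<alpha>) * (1 - g x0) - \<beta> * \<Gamma> * g x0) (at x0 within {0..x0})"
    using dP by (simp add: has_field_derivative_iff)
  have l2: "((\<lambda>x. L * (x0 - x) powr (1 - \<alpha>)) \<longlongrightarrow> L * 0) (at x0 within {0..x0})"
  proof (intro tendsto_mult tendsto_const)
    have "continuous_on {0..x0} (\<lambda>x. (x0 - x) powr (1 - \<alpha>))"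
      using \<alpha> by (intro continuous_intros continuous_on_powr') auto
    then show "((\<lambda>x. (x0 - x) powr (1 - \<alpha>)) \<longlongrightarrow> 0) (at x0 within {0..x0})"
      using x0 \<alpha> unfolding continuous_on_def by force
  qed
  have l3: "\<forall>\<^sub>F x in at x0 within {0..x0}. (P x - P x0) / (x - x0) \<le> L * (x0 - x) powr (1 - \<alpha>)"
    unfolding eventually_at
  proof (intro exI[of _ "min \<delta> x0"] conjI ballI impI)
    show "0 < min \<delta> x0" using \<delta> x0p by simp
    fix x assume "x \<in> {0..x0}" "x \<noteq> x0 \<and> dist x x0 < min \<delta> x0"
    then have x: "0 < x" "x0 - \<delta> < x" "x < x0" by (auto simp: dist_real_def)
    have "(P x - P x0) / (x - x0) = (P x0 - P x) / (x0 - x)" using x by (simp add: field_simps)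
    also have "\<dots> \<le> L * (x0 - x) powr (1 - \<alpha>)"
      using bound[OF x] x by (simp add: pos_divide_le_eq)
    finally show "(P x - P x0) / (x - x0) \<le> L * (x0 - x) powr (1 - \<alpha>)" .
  qed
  have l4: "at x0 within {0..x0} \<noteq> bot"
    using x0p by (simp add: trivial_limit_within islimpt_Icc)
  have "x0 powr (- \<alpha>) * (1 - g x0) - \<beta> * \<Gamma> * g x0 \<le> 0"
    using tendsto_le[OF l4 l2 l1 l3] by simp
  moreover have "0 < x0 powr (- \<alpha>) * (1 - g x0)" using x0p m by (intro mult_pos_pos) auto
  moreover have "\<beta> * \<Gamma> * g x0 < 0" using m \<Gamma> assms by (intro mult_pos_neg mult_pos_pos)
  ultimately show False by linarith
qed

section \<open>The relaxation kernel\<close>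

lemma has_bochner_integral_of_has_integral:
  fixes f :: "real \<Rightarrow> real"
  assumes "f \<in> borel_measurable borel" "\<Omega> \<in> sets borel" "\<And>x. x \<in> \<Omega> \<Longrightarrow> 0 \<le> f x" "(f has_integral I) \<Omega>"
  shows "has_bochner_integral lborel (\<lambda>x. indicator \<Omega> x * f x) I"
proof (rule has_bochner_integral_nn_integral)
  show "(\<integral>\<^sup>+ x. ennreal (indicator \<Omega> x * f x) \<partial>lborel) = ennreal I"
    using nn_integral_has_integral_lebesgue[OF assms(3,4)] by simp
  show "0 \<le> I" using assms(4,3) by (rule has_integral_nonneg)
qed (use assms in \<open>auto simp: indicator_def\<close>)

lemma has_bochner_integral_nonneg:
  fixes f :: "'a \<Rightarrow> real"
  assumes "has_bochner_integral M f x" "\<And>y. 0 \<le> f y"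
  shows "0 \<le> x"
  using assms Bochner_Integration.integral_nonneg[of M f] by (simp add: has_bochner_integral_iff)

lemma lborel_integral_swap:
  fixes f :: "real \<Rightarrow> real \<Rightarrow> real"
  assumes "(\<lambda>(x, y). f x y) \<in> borel_measurable (lborel \<Otimes>\<^sub>M lborel)"
    and "\<And>x. integrable lborel (f x)"
    and "integrable lborel (\<lambda>x. LBINT y. \<bar>f x y\<bar>)"
  shows "integrable lborel (\<lambda>y. LBINT x. f x y)"
    and "integrable lborel (\<lambda>x. LBINT y. f x y)"
    and "(LBINT y. (LBINT x. f x y)) = (LBINT x. (LBINT y. f x y))"
proof -
  have i: "integrable (lborel \<Otimes>\<^sub>M lborel) (\<lambda>(x, y). f x y)"
    using assms by (intro lborel_pair.Fubini_integrable) auto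
  show "integrable lborel (\<lambda>x. LBINT y. f x y)"
    using lborel_pair.integrable_fst'[OF i] by simp
  show "integrable lborel (\<lambda>y. LBINT x. f x y)"
    using lborel_pair.integrable_snd[OF i] .
  show "(LBINT y. (LBINT x. f x y)) = (LBINT x. (LBINT y. f x y))"
    by (rule lborel_pair.Fubini_integral[OF i])
qed

lemma has_bochner_integral_powr_tail:
  fixes u p :: real
  assumes "0 < u" "0 < p"
  shows "has_bochner_integral lborel (\<lambda>z. indicator {u..} z * z powr (- 1 - p)) (u powr (- p) / p)"
  using has_integral_powr_to_inf[of "- 1 - p" u] assms
  by (intro has_bochner_integral_of_has_integral) auto

text \<open>Fubini over 0 < u \<le> z, where the integral of z^(-1 - p) over z >= u is u^(-p) / p.
  It trades an increment for a derivative at the price of one power of z, once with p = \<alpha> and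
  once with p = 1 + \<alpha>.\<close>

lemma hardy_swap:
  fixes q :: "real \<Rightarrow> real"
  assumes p: "0 < p" and [measurable]: "q \<in> borel_measurable borel"
    and int: "integrable lborel (\<lambda>u. pos u * (u powr (- p) * q u))"
  shows "integrable lborel (\<lambda>z. pos z * (z powr (- 1 - p) * (LBINT u. indicator {0<..z} u * q u)))"
    and "(LBINT z. pos z * (z powr (- 1 - p) * (LBINT u. indicator {0<..z} u * q u)))
      = (1 / p) * (LBINT u. pos u * (u powr (- p) * q u))"
proof -
  define f where "f u z = (pos u * q u) * (indicator {u..} z * z powr (- 1 - p))" for u z :: real
  have fm: "(\<lambda>(u, z). f u z) \<in> borel_measurable (lborel \<Otimes>\<^sub>M lborel)"
  proof -
    have "(\<lambda>(u, z). f u z) = (\<lambda>x. (pos (fst x) * q (fst x)) * (indicator {x. fst x \<le> snd x} x * snd x powr (- 1 - p)))"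
      by (auto simp: f_def fun_eq_iff indicator_def)
    then show ?thesis by simp
  qed
  have hb: "has_bochner_integral lborel (f u) (pos u * q u * (u powr (- p) / p))" for u
  proof (cases "0 < u")
    case True
    show ?thesis unfolding f_def
      by (intro has_bochner_integral_mult_right has_bochner_integral_powr_tail True p)
  qed (simp add: f_def[abs_def] has_bochner_integral_zero)
  have hba: "has_bochner_integral lborel (\<lambda>z. \<bar>f u z\<bar>) \<bar>pos u * (u powr (- p) * q u) / p\<bar>" for u
  proof (cases "0 < u")
    case True
    have "has_bochner_integral lborel (\<lambda>z. \<bar>q u\<bar> * (indicator {u..} z * z powr (- 1 - p))) (\<bar>q u\<bar> * (u powr (- p) / p))"
      by (intro has_bochner_integral_mult_right has_bochner_integral_powr_tail True p)
    moreover have "(\<lambda>z. \<bar>q u\<bar> * (indicator {u..} z * z powr (- 1 - p))) = (\<lambda>z. \<bar>f u z\<bar>)"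
      using True by (auto simp: f_def abs_mult fun_eq_iff indicator_def)
    ultimately show ?thesis using True p by (simp add: abs_mult mult.commute)
  qed (simp add: f_def[abs_def] has_bochner_integral_zero)
  have i2: "integrable lborel (\<lambda>u. LBINT z. \<bar>f u z\<bar>)"
  proof -
    have "integrable lborel (\<lambda>u. \<bar>pos u * (u powr (- p) * q u) / p\<bar>)"
      using int by (intro integrable_abs integrable_divide)
    then show ?thesis using hba by (simp add: has_bochner_integral_iff)
  qed
  have i1: "integrable lborel (f u)" for u using hb by (simp add: has_bochner_integral_iff)
  note sw = lborel_integral_swap[OF fm i1 i2]
  have e1: "(LBINT u. f u z) = pos z * (z powr (- 1 - p) * (LBINT u. indicator {0<..z} u * q u))" for z
  proof -
    have "(LBINT u. f u z) = (LBINT u. (pos z * z powr (- 1 - p)) * (indicator {0<..z} u * q u))"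
      by (intro Bochner_Integration.integral_cong) (auto simp: f_def indicator_def)
    then show ?thesis by simp
  qed
  have e2: "(LBINT z. f u z) = (1 / p) * (pos u * (u powr (- p) * q u))" for u
    using hb[of u] by (simp add: has_bochner_integral_iff)
  show "integrable lborel (\<lambda>z. pos z * (z powr (- 1 - p) * (LBINT u. indicator {0<..z} u * q u)))"
    using sw(1) unfolding e1 .
  show "(LBINT z. pos z * (z powr (- 1 - p) * (LBINT u. indicator {0<..z} u * q u)))
      = (1 / p) * (LBINT u. pos u * (u powr (- p) * q u))"
    using sw(3) unfolding e1 e2 by simp
qed

lemma integrable_powr_min:
  fixes s :: real
  assumes "- 1 < s" "s < 1"
  shows "integrable lborel (\<lambda>x. pos x * (x powr s * min 1 (1 / x\<^sup>2)))"
proof -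
  have "has_bochner_integral lborel (\<lambda>x. indicator {0..1} x * x powr s) (1 powr (s + 1) / (s + 1))"
    using assms has_integral_powr_from_0[of s 1] by (intro has_bochner_integral_of_has_integral) auto
  moreover have "has_bochner_integral lborel (\<lambda>z. indicator {1..} z * z powr (- 1 - (1 - s))) (1 powr (- (1 - s)) / (1 - s))"
    using assms by (intro has_bochner_integral_powr_tail) auto
  ultimately have "integrable lborel (\<lambda>x. indicator {0..1} x * x powr s + indicator {1..} x * x powr (- 1 - (1 - s)))"
    by (auto simp: has_bochner_integral_iff)
  then show ?thesis
  proof (rule Bochner_Integration.integrable_bound)
    show "AE x in lborel. norm (pos x * (x powr s * min 1 (1 / x\<^sup>2))) \<le>
        norm (indicator {0..1} x * x powr s + indicator {1..} x * x powr (- 1 - (1 - s)))"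
    proof (rule AE_I2)
      fix x :: real
      have "x powr s / x\<^sup>2 = x powr (- 1 - (1 - s))" if "0 < x"
        using that powr_diff[of x s 2] by (simp add: powr_numeral)
      moreover have "x powr s * min 1 (1 / x\<^sup>2) \<le> x powr s" by (simp add: mult_left_le)
      moreover have "x powr s * min 1 (1 / x\<^sup>2) \<le> x powr s / x\<^sup>2"
        using mult_left_mono[of "min 1 (1 / x\<^sup>2)" "1 / x\<^sup>2" "x powr s"] by simp
      ultimately show "norm (pos x * (x powr s * min 1 (1 / x\<^sup>2))) \<le>
          norm (indicator {0..1} x * x powr s + indicator {1..} x * x powr (- 1 - (1 - s)))"
        by (cases "0 < x"; cases "x \<le> 1") (auto simp: indicator_def)
    qed
  qed auto
qed

lemma set_integral_FTC_tail:
  fixes h q :: "real \<Rightarrow> real"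
  assumes "0 \<le> y" "\<And>x. y \<le> x \<Longrightarrow> (h has_real_derivative q x) (at x within {y..})"
    and "continuous_on {y..} q" "integrable lborel (\<lambda>x. indicator {y..} x * q x)" "(h \<longlongrightarrow> 0) at_top"
  shows "(LBINT x. indicator {y..} x * q x) = - h y"
proof -
  have "((\<lambda>M. LBINT x. indicator {..M} x *\<^sub>R (indicator {y..} x * q x)) \<longlongrightarrow> (LBINT x. indicator {y..} x * q x)) at_top"
    using assms(4) by (intro tendsto_integral_at_top) auto
  moreover have "\<forall>\<^sub>F M in at_top. (LBINT x. indicator {..M} x *\<^sub>R (indicator {y..} x * q x)) = h M - h y"
    using eventually_ge_at_top[of y]
  proof eventually_elim
    case (elim M)
    have "(LBINT x. indicator {..M} x *\<^sub>R (indicator {y..} x * q x)) = (LBINT x. indicator {y..M} x *\<^sub>R q x)"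
      by (intro Bochner_Integration.integral_cong) (auto simp: indicator_def)
    also have "\<dots> = h M - h y"
    proof (rule integral_FTC_atLeastAtMost[OF elim])
      show "(h has_vector_derivative q x) (at x within {y..M})" if "y \<le> x" "x \<le> M" for x
        using assms(2)[OF that(1)] by (auto simp: has_real_derivative_iff_has_vector_derivative intro: has_vector_derivative_within_subset)
      show "continuous_on {y..M} q" using assms(3) by (rule continuous_on_subset) auto
    qed
    finally show ?case .
  qed
  ultimately have "((\<lambda>M. h M - h y) \<longlongrightarrow> (LBINT x. indicator {y..} x * q x)) at_top"
    by (rule tendsto_cong[THEN iffD1, rotated])
  moreover have "((\<lambda>M. h M - h y) \<longlongrightarrow> 0 - h y) at_top"
    by (intro tendsto_diff assms tendsto_const)
  ultimately have "(LBINT x. indicator {y..} x * q x) = 0 - h y"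
    by (rule tendsto_unique[OF trivial_limit_at_top_linorder])
  then show ?thesis by simp
qed

text \<open>The Fubini step shared by the three kernels of \<open>weak_equation\<close>: growth x^s
  with s < 1 of the inner integral \<open>M\<close> against decay x^(-2) of \<open>q\<close> keeps
  the double integral absolutely convergent, and s > -1 handles x near 0.\<close>

lemma kernel_swap:
  fixes K :: "real \<Rightarrow> real \<Rightarrow> real" and q M :: "real \<Rightarrow> real"
  assumes s: "s < 1" "- 1 < s"
    and [measurable]: "(\<lambda>x. K (fst x) (snd x)) \<in> borel_measurable (borel \<Otimes>\<^sub>M borel)" "q \<in> borel_measurable borel" "M \<in> borel_measurable borel"
    and K: "\<And>w x. 0 \<le> K w x" and hb: "\<And>x. 0 < x \<Longrightarrow> has_bochner_integral lborel (\<lambda>w. indicator {0<..<x} w * K w x) (M x)"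
    and M: "\<And>x. 0 < x \<Longrightarrow> M x \<le> B * x powr s" and q: "\<And>x. 0 < x \<Longrightarrow> \<bar>q x\<bar> \<le> C * min 1 (1 / x\<^sup>2)"
  shows "integrable lborel (\<lambda>w. pos w * (LBINT x. indicator {w<..} x * (K w x * q x)))"
    and "integrable lborel (\<lambda>x. pos x * (q x * M x))"
    and "(LBINT w. pos w * (LBINT x. indicator {w<..} x * (K w x * q x))) =
      (LBINT x. pos x * (q x * M x))"
proof -
  define f where "f x w = (pos x * q x) * (indicator {0<..<x} w * K w x)" for x w :: real
  have fm: "(\<lambda>(x, w). f x w) \<in> borel_measurable (lborel \<Otimes>\<^sub>M lborel)"
  proof -
    have "(\<lambda>(x, w). f x w) = (\<lambda>x. (pos (fst x) * q (fst x)) * (indicator {x. 0 < snd x \<and> snd x < fst x} x * K (snd x) (fst x)))"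
      by (auto simp: f_def fun_eq_iff indicator_def)
    moreover have "(\<lambda>x. K (snd x) (fst x)) \<in> borel_measurable (borel \<Otimes>\<^sub>M borel)"
      using measurable_compose[OF measurable_Pair[OF measurable_snd measurable_fst] assms(3)] by simp
    ultimately show ?thesis by simp
  qed
  have hb': "has_bochner_integral lborel (f x) (pos x * (q x * M x))" for x
  proof (cases "0 < x")
    case True
    show ?thesis unfolding f_def
      using has_bochner_integral_mult_right[OF hb[OF True], of "pos x * q x"] by (simp add: mult.assoc)
  qed (simp add: f_def[abs_def] has_bochner_integral_zero)
  have M0: "0 \<le> M x" if "0 < x" for x
    using has_bochner_integral_nonneg[OF hb[OF that]] K by simp
  have hba: "has_bochner_integral lborel (\<lambda>w. \<bar>f x w\<bar>) \<bar>pos x * (q x * M x)\<bar>" for x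
  proof (cases "0 < x")
    case True
    have "has_bochner_integral lborel (\<lambda>w. \<bar>q x\<bar> * (indicator {0<..<x} w * K w x)) (\<bar>q x\<bar> * M x)"
      by (intro has_bochner_integral_mult_right hb True)
    moreover have "(\<lambda>w. \<bar>q x\<bar> * (indicator {0<..<x} w * K w x)) = (\<lambda>w. \<bar>f x w\<bar>)"
      using True K by (auto simp: f_def abs_mult fun_eq_iff indicator_def)
    ultimately show ?thesis using True M0[OF True] by (simp add: abs_mult)
  qed (simp add: f_def[abs_def] has_bochner_integral_zero)
  have iM: "integrable lborel (\<lambda>x. pos x * (q x * M x))"
  proof (rule Bochner_Integration.integrable_bound)
    show "integrable lborel (\<lambda>x. \<bar>C\<bar> * \<bar>B\<bar> * (pos x * (x powr s * min 1 (1 / x\<^sup>2))))"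
      using integrable_powr_min[OF s(2,1)] by (intro integrable_mult_right)
    show "AE x in lborel. norm (pos x * (q x * M x)) \<le> norm (\<bar>C\<bar> * \<bar>B\<bar> * (pos x * (x powr s * min 1 (1 / x\<^sup>2))))"
    proof (rule AE_I2)
      fix x :: real
      show "norm (pos x * (q x * M x)) \<le> norm (\<bar>C\<bar> * \<bar>B\<bar> * (pos x * (x powr s * min 1 (1 / x\<^sup>2))))"
      proof (cases "0 < x")
        case True
        have "C * min 1 (1 / x\<^sup>2) \<le> \<bar>C\<bar> * min 1 (1 / x\<^sup>2)" by (intro mult_right_mono) auto
        then have 1: "\<bar>q x\<bar> \<le> \<bar>C\<bar> * min 1 (1 / x\<^sup>2)" using q[OF True] by linarith
        have "B * x powr s \<le> \<bar>B\<bar> * x powr s" by (intro mult_right_mono) auto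
        then have 2: "M x \<le> \<bar>B\<bar> * x powr s" using M[OF True] by linarith
        have "\<bar>q x\<bar> * M x \<le> (\<bar>C\<bar> * min 1 (1 / x\<^sup>2)) * (\<bar>B\<bar> * x powr s)"
          using 1 2 M0[OF True] by (intro mult_mono) auto
        then show ?thesis using True M0[OF True] by (simp add: abs_mult mult_ac)
      qed simp
    qed
  qed measurable
  have i2: "integrable lborel (\<lambda>x. LBINT w. \<bar>f x w\<bar>)"
    using integrable_abs[OF iM] hba by (simp add: has_bochner_integral_iff)
  have i1: "integrable lborel (f x)" for x using hb' by (simp add: has_bochner_integral_iff)
  note sw = lborel_integral_swap[OF fm i1 i2]
  have e1: "(LBINT x. f x w) = pos w * (LBINT x. indicator {w<..} x * (K w x * q x))" for w
  proof -
    have "(LBINT x. f x w) = (LBINT x. pos w * (indicator {w<..} x * (K w x * q x)))"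
      by (intro Bochner_Integration.integral_cong) (auto simp: f_def indicator_def)
    then show ?thesis by simp
  qed
  have e2: "(LBINT w. f x w) = pos x * (q x * M x)" for x
    using hb'[of x] by (simp add: has_bochner_integral_iff)
  show "integrable lborel (\<lambda>x. pos x * (q x * M x))" by (rule iM)
  show "integrable lborel (\<lambda>w. pos w * (LBINT x. indicator {w<..} x * (K w x * q x)))"
    using sw(1) unfolding e1 .
  show "(LBINT w. pos w * (LBINT x. indicator {w<..} x * (K w x * q x))) =
      (LBINT x. pos x * (q x * M x))"
    using sw(3) unfolding e1 e2 .
qed

lemma mlf_nonneg':
  assumes "0 < \<alpha>" "\<alpha> < 1" "0 \<le> y"
  shows "0 \<le> mlf \<alpha> y"
  using mlf_nonneg[OF assms(1,2) zero_less_one, of "y powr (1 / \<alpha>)"] assms by (simp add: powr_powr)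

text \<open>One site at a time: \<beta> will be b r / a r, and \<open>G\<close> the solution of the
  relaxation equation started from 1.\<close>

locale relaxation =
  fixes \<alpha> \<beta> :: real
  assumes \<alpha>: "0 < \<alpha>" "\<alpha> < 1" and \<beta>: "0 < \<beta>"
begin

definition G :: "real \<Rightarrow> real" where
  "G w = mlf \<alpha> (\<beta> * w powr \<alpha>)"

abbreviation \<Gamma>\<^sub>\<alpha> :: real where
  "\<Gamma>\<^sub>\<alpha> \<equiv> Gamma (1 - \<alpha>)"

lemma \<Gamma>_pos: "0 < \<Gamma>\<^sub>\<alpha>"
  using \<alpha> by (intro Gamma_real_pos) simp

lemma G_nonneg: "0 \<le> G w"
  using \<alpha> \<beta> by (auto simp: G_def intro!: mlf_nonneg')

lemma G_measurable [measurable]: "G \<in> borel_measurable borel"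
proof -
  have [measurable]: "mlf \<alpha> \<in> borel_measurable borel"
    by (rule borel_measurable_continuous_onI[OF continuous_on_mlf[OF \<alpha>(1)]])
  show ?thesis unfolding G_def[abs_def] by measurable
qed

definition S :: "real \<Rightarrow> real" where
  "S x = (LBINT w. indicator {0<..<x} w * G w)"

lemma S_measurable [measurable]: "S \<in> borel_measurable borel"
proof -
  have "(\<lambda>x. LBINT w. indicator {x. 0 < snd x \<and> snd x < fst x} (x, w) * G w) \<in> borel_measurable borel"
    by (intro lborel.borel_measurable_lebesgue_integral) measurable
  moreover have "indicator {x. 0 < snd x \<and> snd x < fst x} (x, w) = (indicator {0<..<x} w :: real)" for x w :: real
    by (auto simp: indicator_def)
  ultimately show ?thesis by (simp add: S_def[abs_def])
qed

lemma has_bochner_integral_S: "0 < x \<Longrightarrow> has_bochner_integral lborel (\<lambda>w. indicator {0<..<x} w * G w) (S x)"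
  using mlf_integral[OF \<alpha>(1), of x \<beta>] by (simp add: S_def G_def has_bochner_integral_iff)

lemma fractional_equation:
  "0 < x \<Longrightarrow> has_bochner_integral lborel (\<lambda>w. indicator {0<..<x} w * (G w * (x - w) powr (- \<alpha>)))
      (x powr (1 - \<alpha>) / (1 - \<alpha>) - \<beta> * \<Gamma>\<^sub>\<alpha> * S x)"
  using mlf_fractional_equation[OF \<alpha>, of x \<beta>] by (simp add: S_def G_def)

lemma S_nonneg: "0 < x \<Longrightarrow> 0 \<le> S x"
  using has_bochner_integral_nonneg[OF has_bochner_integral_S] G_nonneg by simp

text \<open>Nonnegativity of \<open>G\<close> makes the left side of the fractional equation
  nonnegative, which bounds \<open>S\<close> by the remaining term.\<close>

lemma S_le: "0 < x \<Longrightarrow> S x \<le> 1 / ((1 - \<alpha>) * \<beta> * \<Gamma>\<^sub>\<alpha>) * x powr (1 - \<alpha>)"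
proof -
  assume x: "0 < x"
  have "0 \<le> x powr (1 - \<alpha>) / (1 - \<alpha>) - \<beta> * \<Gamma>\<^sub>\<alpha> * S x"
    using has_bochner_integral_nonneg[OF fractional_equation[OF x]] G_nonneg by simp
  then show ?thesis using \<Gamma>_pos \<alpha> \<beta> by (simp add: field_simps)
qed

text \<open>Decay x^(-2) suffices since the kernel integrals grow like x^(1 - \<alpha>). The class
  contains compactly supported continuous functions, exponentials and the derivative of (f w)^2 / w,
  the three choices made below.\<close>

definition decaying :: "(real \<Rightarrow> real) \<Rightarrow> bool" where
  "decaying q \<longleftrightarrow> q \<in> borel_measurable borel \<and> (\<exists>C. \<forall>x>0. \<bar>q x\<bar> \<le> C * min 1 (1 / x\<^sup>2))"

text \<open>The adjoint form of the fractional equation, with \<open>h\<close> an antiderivative of \<open>q\<close> vanishing at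
  infinity.\<close>

lemma weak_equation:
  assumes q: "decaying q"
    and h: "\<And>y. 0 < y \<Longrightarrow> (LBINT x. indicator {y<..} x * q x) = - h y"
  defines "V \<equiv> \<lambda>w. LBINT x. indicator {w<..} x * ((x - w) powr (- \<alpha>) * q x)"
  shows "integrable lborel (\<lambda>w. pos w * (G w * V w))"
    and "integrable lborel (\<lambda>y. pos y * (y powr (- \<alpha>) * h y))"
    and "integrable lborel (\<lambda>y. pos y * (G y * h y))"
    and "(LBINT w. pos w * (G w * V w)) =
      - (LBINT y. pos y * (y powr (- \<alpha>) * h y))
      + \<beta> * \<Gamma>\<^sub>\<alpha> * (LBINT y. pos y * (G y * h y))"
proof -
  have [measurable]: "q \<in> borel_measurable borel" using q by (simp add: decaying_def)
  obtain C where C: "\<And>x. 0 < x \<Longrightarrow> \<bar>q x\<bar> \<le> C * min 1 (1 / x\<^sup>2)" using q by (auto simp: decaying_def)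
  have s: "1 - \<alpha> < 1" "- 1 < 1 - \<alpha>" using \<alpha> by auto
  define N where "N x = x powr (1 - \<alpha>) / (1 - \<alpha>)" for x
  have [measurable]: "N \<in> borel_measurable borel" unfolding N_def[abs_def] by measurable
  have N: "has_bochner_integral lborel (\<lambda>w. indicator {0<..<x} w * w powr (- \<alpha>)) (N x)" if "0 < x" for x
    using has_bochner_integral_of_has_integral[of "\<lambda>w. w powr (- \<alpha>)" "{0<..<x}" "N x"]
      has_integral_powr_from_0[of "- \<alpha>" x] that \<alpha> by (simp add: N_def has_integral_Icc_iff_Ioo)
  have k1: "has_bochner_integral lborel (\<lambda>w. indicator {0<..<x} w * (G w * (x - w) powr (- \<alpha>))) (N x - \<beta> * \<Gamma>\<^sub>\<alpha> * S x)" if "0 < x" for x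
    using fractional_equation[OF that] by (simp add: N_def)
  have le1: "N x - \<beta> * \<Gamma>\<^sub>\<alpha> * S x \<le> 1 / (1 - \<alpha>) * x powr (1 - \<alpha>)" if "0 < x" for x
    using S_nonneg[OF that] \<beta> \<Gamma>_pos by (simp add: N_def)
  have le2: "N x \<le> 1 / (1 - \<alpha>) * x powr (1 - \<alpha>)" if "0 < x" for x by (simp add: N_def)
  \<comment> \<open>The three kernels G w (x - w)^(- \<alpha>), w^(- \<alpha>) and G w, integrated
    over 0 < w < x, are exactly the three terms related by the fractional equation.\<close>
  note sw1 = kernel_swap[where s = "1 - \<alpha>" and q = q and C = C and K = "\<lambda>w x. G w * (x - w) powr (- \<alpha>)" and M = "\<lambda>x. N x - \<beta> * \<Gamma>\<^sub>\<alpha> * S x" and B = "1 / (1 - \<alpha>)",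
      OF s _ _ _ _ k1 le1 C]
  note sw2 = kernel_swap[where s = "1 - \<alpha>" and q = q and C = C and K = "\<lambda>w x. w powr (- \<alpha>)" and M = N and B = "1 / (1 - \<alpha>)",
      OF s _ _ _ _ N le2 C]
  note sw3 = kernel_swap[where s = "1 - \<alpha>" and q = q and C = C and K = "\<lambda>w x. G w" and M = S and B = "1 / ((1 - \<alpha>) * \<beta> * \<Gamma>\<^sub>\<alpha>)",
      OF s _ _ _ _ has_bochner_integral_S S_le C]
  have e1: "(LBINT x. indicator {w<..} x * (G w * (x - w) powr (- \<alpha>) * q x)) = G w * V w" for w
  proof -
    have "(LBINT x. indicator {w<..} x * (G w * (x - w) powr (- \<alpha>) * q x)) = (LBINT x. G w * (indicator {w<..} x * ((x - w) powr (- \<alpha>) * q x)))"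
      by (intro Bochner_Integration.integral_cong) (auto simp: indicator_def)
    then show ?thesis by (simp add: V_def)
  qed
  have e2: "pos w * (LBINT x. indicator {w<..} x * (c * q x)) = - (pos w * (c * h w))" for w c :: real
  proof (cases "0 < w")
    case True
    have "(LBINT x. indicator {w<..} x * (c * q x)) = (LBINT x. c * (indicator {w<..} x * q x))"
      by (intro Bochner_Integration.integral_cong) (auto simp: indicator_def)
    then show ?thesis using True h[OF True] by simp
  qed simp
  show "integrable lborel (\<lambda>w. pos w * (G w * V w))"
    using sw1(1) G_nonneg unfolding e1 by simp
  have "integrable lborel (\<lambda>w. - (pos w * (w powr (- \<alpha>) * h w)))"
    using sw2(1) unfolding e2 by simp
  then show "integrable lborel (\<lambda>w. pos w * (w powr (- \<alpha>) * h w))"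
    by simp
  have "integrable lborel (\<lambda>w. - (pos w * (G w * h w)))"
    using sw3(1) G_nonneg unfolding e2 by simp
  then show "integrable lborel (\<lambda>w. pos w * (G w * h w))"
    by simp
  have "(LBINT w. pos w * (G w * V w)) = (LBINT x. pos x * (q x * (N x - \<beta> * \<Gamma>\<^sub>\<alpha> * S x)))"
    using sw1(3) G_nonneg unfolding e1 by simp
  also have "\<dots> = (LBINT x. pos x * (q x * N x) - \<beta> * \<Gamma>\<^sub>\<alpha> * (pos x * (q x * S x)))"
    by (intro Bochner_Integration.integral_cong) (auto simp: indicator_def algebra_simps)
  also have "\<dots> = (LBINT x. pos x * (q x * N x)) - \<beta> * \<Gamma>\<^sub>\<alpha> * (LBINT x. pos x * (q x * S x))"
    using sw2(2) sw3(2) G_nonneg by (subst Bochner_Integration.integral_diff) auto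
  also have "(LBINT x. pos x * (q x * N x)) = - (LBINT y. pos y * (y powr (- \<alpha>) * h y))"
    using sw2(3) unfolding e2 by simp
  also have "(LBINT x. pos x * (q x * S x)) = - (LBINT y. pos y * (G y * h y))"
    using sw3(3) G_nonneg unfolding e2 by simp
  finally show "(LBINT w. pos w * (G w * V w)) =
      - (LBINT y. pos y * (y powr (- \<alpha>) * h y))
      + \<beta> * \<Gamma>\<^sub>\<alpha> * (LBINT y. pos y * (G y * h y))"
    by simp
qed

end

section \<open>Energies on the half-line\<close>

lemma has_bochner_integral_Gamma:
  fixes s c :: real
  assumes "0 < s" "0 < c"
  shows "has_bochner_integral lborel (\<lambda>u. pos u * (u powr (s - 1) * exp (- c * u))) (Gamma s / c powr s)"
proof -
  have "has_bochner_integral lborel (\<lambda>t. indicator {0..} t * (t powr (s - 1) / exp t)) (Gamma s)"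
    using Gamma_integral_real[OF assms(1)] by (intro has_bochner_integral_of_has_integral) auto
  then have "has_bochner_integral lborel (\<lambda>u. indicator {0..} (0 + c * u) * ((0 + c * u) powr (s - 1) / exp (0 + c * u))) (Gamma s /\<^sub>R \<bar>c\<bar>)"
    using assms by (subst lborel_has_bochner_integral_real_affine_iff[symmetric]) auto
  from has_bochner_integral_mult_right[OF this, of "c powr (1 - s)"]
  have "has_bochner_integral lborel (\<lambda>u. c powr (1 - s) * (indicator {0..} (c * u) * ((c * u) powr (s - 1) / exp (c * u)))) (c powr (1 - s) * (Gamma s / c))"
    using assms by (simp add: divide_inverse mult.commute)
  moreover have "(\<lambda>u. c powr (1 - s) * (indicator {0..} (c * u) * ((c * u) powr (s - 1) / exp (c * u)))) =
      (\<lambda>u. pos u * (u powr (s - 1) * exp (- c * u)))"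
  proof
    fix u :: real
    show "c powr (1 - s) * (indicator {0..} (c * u) * ((c * u) powr (s - 1) / exp (c * u))) =
      pos u * (u powr (s - 1) * exp (- c * u))"
    proof (cases "0 < u")
      case True
      have "c powr (1 - s) * c powr (s - 1) = 1" using assms by (simp add: powr_add[symmetric])
      then show ?thesis using True assms
        by (simp add: powr_mult exp_minus divide_inverse mult.assoc[symmetric])
    next
      case False
      then show ?thesis using assms by (cases "u = 0") (auto simp: indicator_def zero_le_mult_iff)
    qed
  qed
  moreover have "c powr (1 - s) * (Gamma s / c) = Gamma s / c powr s"
    using assms by (simp add: powr_diff)
  ultimately show ?thesis by simp
qed

lemma integral_open_closed_lower:
  fixes q :: "real \<Rightarrow> real"
  assumes [measurable]: "q \<in> borel_measurable borel"
  shows "(LBINT x. indicator {y<..} x * q x) = (LBINT x. indicator {y..} x * q x)"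
    and "(LBINT x. indicator {y<..z} x * q x) = (LBINT x. indicator {y..z} x * q x)"
proof -
  have "AE x in lborel. x \<noteq> y" by (rule AE_lborel_singleton)
  then show "(LBINT x. indicator {y<..} x * q x) = (LBINT x. indicator {y..} x * q x)"
    "(LBINT x. indicator {y<..z} x * q x) = (LBINT x. indicator {y..z} x * q x)"
    by (intro integral_cong_AE; auto simp: indicator_def elim!: eventually_mono)+
qed

lemma halfline_FTC:
  fixes H h :: "real \<Rightarrow> real"
  assumes d: "\<And>t. 0 \<le> t \<Longrightarrow> (H has_real_derivative h t) (at t within {0..})"
    and c: "continuous_on UNIV h" and "0 \<le> w" "0 \<le> z"
  shows "(LBINT u. indicator {0<..z} u * h (w + u)) = H (w + z) - H w"
proof -
  have cm: "continuous_on UNIV (\<lambda>u. h (w + u))"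
    by (intro continuous_on_compose2[OF c] continuous_intros) auto
  have "(LBINT u. indicator {0..z} u *\<^sub>R h (w + u)) = H (w + z) - H (w + 0)"
  proof (rule integral_FTC_atLeastAtMost[OF assms(4)])
    show "((\<lambda>u. H (w + u)) has_vector_derivative h (w + x)) (at x within {0..z})" if "0 \<le> x" "x \<le> z" for x
    proof -
      have "(H has_real_derivative h (w + x)) (at (w + x) within (+) w ` {0..z})"
        using assms that by (intro DERIV_subset[OF d]) auto
      moreover have "((\<lambda>u. w + u) has_real_derivative 1) (at x within {0..z})"
        by (auto intro!: derivative_eq_intros)
      ultimately have "((H \<circ> (+) w) has_real_derivative h (w + x) * 1) (at x within {0..z})"
        by (intro DERIV_image_chain) auto
      then show ?thesis by (simp add: o_def has_real_derivative_iff_has_vector_derivative)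
    qed
    show "continuous_on {0..z} (\<lambda>u. h (w + u))" using cm by (rule continuous_on_subset) simp
  qed
  then show ?thesis
    using integral_open_closed_lower(2)[OF borel_measurable_continuous_onI[OF cm], of 0 z] by simp
qed

text \<open>Derivatives are one-sided at 0 but the functions live on the whole line: t |-> \<Psi> (X
  + t \<delta>_r) is frozen for t < 0, as \<open>add_dirac\<close> ignores negative weights.\<close>

definition C2_compact :: "(real \<Rightarrow> real) \<Rightarrow> (real \<Rightarrow> real) \<Rightarrow> (real \<Rightarrow> real) \<Rightarrow> bool" where
  "C2_compact F F' F'' \<longleftrightarrow> continuous_on UNIV F \<and> continuous_on UNIV F' \<and> continuous_on UNIV F'' \<and>
     (\<forall>t\<ge>0. (F has_real_derivative F' t) (at t within {0..})) \<and>
     (\<forall>t\<ge>0. (F' has_real_derivative F'' t) (at t within {0..})) \<and>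
     (\<exists>R>0. \<forall>t\<ge>R. F t = 0 \<and> F' t = 0 \<and> F'' t = 0)"

text \<open>Allows the linear stationarity identity to be applied to F^2 as well as to F.\<close>

lemma C2_compact_square:
  assumes "C2_compact F F' F''"
  shows "C2_compact (\<lambda>t. (F t)\<^sup>2) (\<lambda>t. 2 * F t * F' t) (\<lambda>t. 2 * (F' t)\<^sup>2 + 2 * F t * F'' t)"
  using assms unfolding C2_compact_def
  apply (intro conjI allI impI continuous_intros)
      apply (auto)[7]
    apply (auto intro!: derivative_eq_intros simp: power2_eq_square)[2]
  apply force
  done

lemma compact_support_bound:
  fixes q :: "real \<Rightarrow> real"
  assumes "continuous_on UNIV q" "\<And>t. R \<le> t \<Longrightarrow> q t = 0"
  obtains B where "0 \<le> B" "\<And>x. 0 \<le> x \<Longrightarrow> \<bar>q x\<bar> \<le> B"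
proof -
  have "compact (q ` {0..R})"
    using assms(1) by (intro compact_continuous_image continuous_on_subset[OF assms(1)]) auto
  then obtain B where B: "\<And>x. x \<in> {0..R} \<Longrightarrow> \<bar>q x\<bar> \<le> B"
    by (fastforce dest!: compact_imp_bounded simp: bounded_iff)
  have "\<bar>q x\<bar> \<le> max B 0" if "0 \<le> x" for x
    using B[of x] assms(2)[of x] that by (cases "x \<le> R") auto
  then show ?thesis using that[of "max B 0"] by auto
qed

text \<open>(1 - exp(- c w)) / w is the integral of exp(- s w) over 0 < s < c: integrating a Laplace
  transform in its argument divides the density by w and so produces Levy exponents.\<close>

lemma has_bochner_integral_laplace_primitive:
  fixes g L :: "real \<Rightarrow> real"
  assumes [measurable]: "g \<in> borel_measurable borel" and g0: "\<And>w. 0 < w \<Longrightarrow> 0 \<le> g w"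
    and L: "\<And>s. 0 < s \<Longrightarrow> has_bochner_integral lborel (\<lambda>w. pos w * (g w * exp (- s * w))) (L s)"
    and I: "has_bochner_integral lborel (\<lambda>s. indicator {0<..<c} s * L s) I" and c: "0 < c"
  shows "has_bochner_integral lborel (\<lambda>w. pos w * (g w / w * (1 - exp (- c * w)))) I"
proof -
  define f where "f s w = indicator {0<..<c} s * (pos w * (g w * exp (- s * w)))" for s w :: real
  have fm: "(\<lambda>(s, w). f s w) \<in> borel_measurable (lborel \<Otimes>\<^sub>M lborel)"
  proof -
    have "(\<lambda>(s, w). f s w) = (\<lambda>x. indicator {0<..<c} (fst x) * (pos (snd x) * (g (snd x) * exp (- fst x * snd x))))"
      by (auto simp: f_def fun_eq_iff)
    then show ?thesis by simp
  qed
  have hb: "has_bochner_integral lborel (f s) (indicator {0<..<c} s * L s)" for s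
  proof (cases "0 < s")
    case True
    show ?thesis unfolding f_def by (intro has_bochner_integral_mult_right L True)
  qed (simp add: f_def[abs_def] has_bochner_integral_zero)
  have f0: "0 \<le> f s w" for s w using g0 by (simp add: f_def indicator_def)
  have i2: "integrable lborel (\<lambda>s. LBINT w. \<bar>f s w\<bar>)"
    using hb I f0 by (simp add: has_bochner_integral_iff)
  have i1: "integrable lborel (f s)" for s using hb by (simp add: has_bochner_integral_iff)
  note sw = lborel_integral_swap[OF fm i1 i2]
  have e1: "(LBINT s. f s w) = pos w * (g w / w * (1 - exp (- c * w)))" for w
  proof (cases "0 < w")
    case True
    have "has_bochner_integral lborel (\<lambda>s. indicator {0<..<c} s * exp (- s * w)) (- exp (- c * w) / w - (- exp (- 0 * w) / w))"
    proof (rule has_bochner_integral_of_has_integral)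
      have "((\<lambda>s. exp (- s * w)) has_integral (- exp (- c * w) / w - (- exp (- 0 * w) / w))) {0..c}"
        using c True by (intro fundamental_theorem_of_calculus)
          (auto intro!: derivative_eq_intros simp: has_real_derivative_iff_has_vector_derivative[symmetric])
      then show "((\<lambda>s. exp (- s * w)) has_integral (- exp (- c * w) / w - (- exp (- 0 * w) / w))) {0<..<c}"
        by (simp add: has_integral_Icc_iff_Ioo)
    qed auto
    from has_bochner_integral_mult_right[OF this, of "g w"]
    have "(LBINT s. g w * (indicator {0<..<c} s * exp (- s * w))) = g w / w * (1 - exp (- c * w))"
      by (simp add: has_bochner_integral_iff algebra_simps)
    then show ?thesis using True by (simp add: f_def mult.left_commute)
  qed (simp add: f_def)
  have "(LBINT s. (LBINT w. f s w)) = I"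
    using hb I by (simp add: has_bochner_integral_iff)
  then show ?thesis using sw(1,3) unfolding e1 by (simp add: has_bochner_integral_iff)
qed

context relaxation
begin

lemma decaying_compact_support:
  assumes "continuous_on UNIV q" "0 < R" "\<And>t. R \<le> t \<Longrightarrow> q t = 0"
  shows "decaying q"
proof -
  obtain B where B: "0 \<le> B" "\<And>x. 0 \<le> x \<Longrightarrow> \<bar>q x\<bar> \<le> B"
    using compact_support_bound[OF assms(1,3)] by blast
  have "\<bar>q x\<bar> \<le> B * (1 + R\<^sup>2) * min 1 (1 / x\<^sup>2)" if "0 < x" for x
  proof (cases "x \<le> R")
    case True
    have "1 \<le> (1 + R\<^sup>2) * min 1 (1 / x\<^sup>2)"
    proof (cases "x \<le> 1")
      case True
      then have "x\<^sup>2 \<le> 1" using that by (simp add: power_le_one)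
      then have "min 1 (1 / x\<^sup>2) = 1" using that by (simp add: min_def)
      then show ?thesis by simp
    next
      case False
      then have "1 \<le> x\<^sup>2" by simp
      then have "1 / x\<^sup>2 \<le> 1" using that by (simp add: divide_le_eq_1_pos)
      then have "min 1 (1 / x\<^sup>2) = 1 / x\<^sup>2" by (rule min_absorb2)
      moreover have "x\<^sup>2 \<le> R\<^sup>2" using True that by (intro power_mono) auto
      then have "1 \<le> (1 + R\<^sup>2) * (1 / x\<^sup>2)" using that by (simp add: le_divide_eq)
      ultimately show ?thesis by simp
    qed
    from mult_left_mono[OF this B(1)] show ?thesis using B(2)[of x] that by (simp add: mult.assoc)
  qed (use B assms(3)[of x] that in auto)
  then show ?thesis
    using borel_measurable_continuous_onI[OF assms(1)] unfolding decaying_def by blast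
qed

lemma decaying_shift_integrable:
  assumes q: "decaying q" and "0 \<le> w"
  shows "integrable lborel (\<lambda>u. pos u * (u powr (- \<alpha>) * q (w + u)))"
proof -
  obtain C where [measurable]: "q \<in> borel_measurable borel" and C: "\<And>x. 0 < x \<Longrightarrow> \<bar>q x\<bar> \<le> C * min 1 (1 / x\<^sup>2)"
    using q by (auto simp: decaying_def)
  have "integrable lborel (\<lambda>x. \<bar>C\<bar> * (pos x * (x powr (- \<alpha>) * min 1 (1 / x\<^sup>2))))"
    using integrable_powr_min[of "- \<alpha>"] \<alpha> by (intro integrable_mult_right) auto
  then show ?thesis
  proof (rule Bochner_Integration.integrable_bound)
    show "AE x in lborel. norm (pos x * (x powr - \<alpha> * q (w + x))) \<le> norm (\<bar>C\<bar> * (pos x * (x powr - \<alpha> * min 1 (1 / x\<^sup>2))))"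
    proof (rule AE_I2)
      fix x :: real
      show "norm (pos x * (x powr - \<alpha> * q (w + x))) \<le> norm (\<bar>C\<bar> * (pos x * (x powr - \<alpha> * min 1 (1 / x\<^sup>2))))"
      proof (cases "0 < x")
        case True
        have "\<bar>q (w + x)\<bar> \<le> C * min 1 (1 / (w + x)\<^sup>2)" using C[of "w + x"] True assms(2) by simp
        also have "\<dots> \<le> \<bar>C\<bar> * min 1 (1 / (w + x)\<^sup>2)" by (intro mult_right_mono) auto
        also have "min 1 (1 / (w + x)\<^sup>2) \<le> min 1 (1 / x\<^sup>2)"
          using True assms(2) by (intro min.mono frac_le power_mono) auto
        finally have "\<bar>q (w + x)\<bar> \<le> \<bar>C\<bar> * min 1 (1 / x\<^sup>2)" by (simp add: mult_left_mono)
        then have "x powr - \<alpha> * \<bar>q (w + x)\<bar> \<le> x powr - \<alpha> * (\<bar>C\<bar> * min 1 (1 / x\<^sup>2))"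
          by (intro mult_left_mono) auto
        then show ?thesis using True by (simp add: abs_mult mult_ac)
      qed simp
    qed
  qed measurable
qed

text \<open>Up to the factor \<open>Gamma (1 - \<alpha>)\<close>, the right-sided fractional
  integral of order 1 - \<alpha> of \<open>q\<close>.\<close>

definition V :: "(real \<Rightarrow> real) \<Rightarrow> real \<Rightarrow> real" where
  "V q w = (LBINT x. indicator {w<..} x * ((x - w) powr (- \<alpha>) * q x))"

lemma V_shift: "V q w = (LBINT u. pos u * (u powr (- \<alpha>) * q (w + u)))"
proof -
  have "V q w = \<bar>1\<bar> *\<^sub>R (LBINT u. indicator {w<..} (w + 1 * u) * ((w + 1 * u - w) powr (- \<alpha>) * q (w + 1 * u)))"
    unfolding V_def by (rule lborel_integral_real_affine) simp
  also have "\<dots> = (LBINT u. pos u * (u powr (- \<alpha>) * q (w + u)))"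
    by (simp add: indicator_def)
  finally show ?thesis .
qed

text \<open>Marchaud's form of the fractional derivative of \<open>k\<close>. Only increments of
  \<open>k\<close> starting at \<open>w\<close> enter, so \<open>k\<close> may be singular at 0 when
  w > 0.\<close>

lemma fractional_difference:
  assumes q: "decaying q" and "0 \<le> w"
    and k: "\<And>z. 0 < z \<Longrightarrow> (LBINT u. indicator {0<..z} u * q (w + u)) = k (w + z) - k w"
  shows "integrable lborel (\<lambda>z. pos z * (z powr (- 1 - \<alpha>) * (k (w + z) - k w)))"
    and "(LBINT z. pos z * (z powr (- 1 - \<alpha>) * (k (w + z) - k w))) = V q w / \<alpha>"
proof -
  have [measurable]: "q \<in> borel_measurable borel" using q by (simp add: decaying_def)
  have e: "pos z * (z powr (- 1 - \<alpha>) * (LBINT u. indicator {0<..z} u * q (w + u))) =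
      pos z * (z powr (- 1 - \<alpha>) * (k (w + z) - k w))" for z
    using k[of z] by (cases "0 < z") auto
  note h = hardy_swap[OF \<alpha>(1) _ decaying_shift_integrable[OF q assms(2)]]
  show "integrable lborel (\<lambda>z. pos z * (z powr (- 1 - \<alpha>) * (k (w + z) - k w)))"
    using h(1) unfolding e by simp
  show "(LBINT z. pos z * (z powr (- 1 - \<alpha>) * (k (w + z) - k w))) = V q w / \<alpha>"
    using h(2) unfolding e V_shift by simp
qed

definition jump :: "(real \<Rightarrow> real) \<Rightarrow> (real \<Rightarrow> real) \<Rightarrow> real \<Rightarrow> real" where
  "jump F F' w = (LBINT z. pos z * (z powr (- 2 - \<alpha>) * (F (w + z) - F w - z * F' w)))"

text \<open>Two exchanges: p = 1 + \<alpha> turns the compensated increment of \<open>H\<close> into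
  increments of \<open>H'\<close>, and p = \<alpha> turns those into \<open>H''\<close>.\<close>

lemma jump_eq:
  assumes H: "C2_compact H H' H''" and w: "0 \<le> w"
  shows "integrable lborel (\<lambda>z. pos z * (z powr (- 2 - \<alpha>) * (H (w + z) - H w - z * H' w)))"
    and "jump H H' w = V H'' w / (\<alpha> * (1 + \<alpha>))"
proof -
  obtain R where R: "0 < R" "\<And>t. R \<le> t \<Longrightarrow> H'' t = 0" using H by (auto simp: C2_compact_def)
  have c: "continuous_on UNIV H'" "continuous_on UNIV H''" using H by (auto simp: C2_compact_def)
  have q: "decaying H''" by (rule decaying_compact_support[OF c(2) R])
  have d1: "\<And>t. 0 \<le> t \<Longrightarrow> (H has_real_derivative H' t) (at t within {0..})"
    and d2: "\<And>t. 0 \<le> t \<Longrightarrow> (H' has_real_derivative H'' t) (at t within {0..})"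
    using H by (auto simp: C2_compact_def)
  note fd = fractional_difference[OF q w halfline_FTC[OF d2 c(2) w less_imp_le]]
  have cw: "continuous_on UNIV (\<lambda>u. H' (w + u) - H' w)"
    by (intro continuous_on_compose2[OF c(1)] continuous_intros) auto
  have [measurable]: "(\<lambda>u. H' (w + u) - H' w) \<in> borel_measurable borel"
    by (rule borel_measurable_continuous_onI[OF cw])
  have i1: "integrable lborel (\<lambda>u. pos u * (u powr (- (1 + \<alpha>)) * (H' (w + u) - H' w)))"
    using fd(1) by simp
  have "\<And>z. 0 < z \<Longrightarrow> (LBINT u. indicator {0<..z} u * (H' (w + u) - H' w)) = H (w + z) - H w - z * H' w"
  proof -
    fix z :: real assume z: "0 < z"
    have dd: "((\<lambda>t. H t - t * H' w) has_real_derivative H' t - H' w) (at t within {0..})" if "0 \<le> t" for t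
      using d1[OF that] by (auto intro!: derivative_eq_intros)
    have "continuous_on UNIV (\<lambda>t. H' t - H' w)" by (intro continuous_intros c)
    from halfline_FTC[OF dd this w, of z] z
    show "(LBINT u. indicator {0<..z} u * (H' (w + u) - H' w)) = H (w + z) - H w - z * H' w"
      by (simp add: algebra_simps)
  qed
  then have e: "pos z * (z powr (- 1 - (1 + \<alpha>)) * (LBINT u. indicator {0<..z} u * (H' (w + u) - H' w))) =
      pos z * (z powr (- 2 - \<alpha>) * (H (w + z) - H w - z * H' w))" for z
    by (cases "0 < z") auto
  have "0 < 1 + \<alpha>" using \<alpha> by simp
  note h = hardy_swap[OF this _ i1]
  show "integrable lborel (\<lambda>z. pos z * (z powr (- 2 - \<alpha>) * (H (w + z) - H w - z * H' w)))"
    using h(1) unfolding e by simp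
  have "jump H H' w = (1 / (1 + \<alpha>)) * (LBINT u. pos u * (u powr (- (1 + \<alpha>)) * (H' (w + u) - H' w)))"
    using h(2) unfolding e jump_def by simp
  also have "(LBINT u. pos u * (u powr (- (1 + \<alpha>)) * (H' (w + u) - H' w))) = V H'' w / \<alpha>"
    using fd(2) by simp
  finally show "jump H H' w = V H'' w / (\<alpha> * (1 + \<alpha>))" by (simp add: mult.commute)
qed

text \<open>The weak equation with q = H'' and h = H'. It expresses stationarity at one site:
  branching and drift, weighted by \<open>G\<close> along the cluster size, cancel immigration out
  of size 0.\<close>

lemma G_times_jump:
  assumes H: "C2_compact H H' H''"
  shows "integrable lborel (\<lambda>w. pos w * (G w * jump H H' w))"
    and "integrable lborel (\<lambda>w. pos w * (G w * H' w))"
    and "integrable lborel (\<lambda>z. pos z * (z powr (- 1 - \<alpha>) * (H z - H 0)))"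
    and "\<alpha> * (\<alpha> + 1) * (LBINT w. pos w * (G w * jump H H' w))
      - \<beta> * \<Gamma>\<^sub>\<alpha> * (LBINT w. pos w * (G w * H' w))
      + \<alpha> * (LBINT z. pos z * (z powr (- 1 - \<alpha>) * (H z - H 0))) = 0"
proof -
  obtain R where R: "0 < R" "\<And>t. R \<le> t \<Longrightarrow> H' t = 0 \<and> H'' t = 0" using H by (auto simp: C2_compact_def)
  have c: "continuous_on UNIV H'" "continuous_on UNIV H''" using H by (auto simp: C2_compact_def)
  have q: "decaying H''" "decaying H'" using R by (auto intro!: decaying_compact_support c)
  have [measurable]: "H'' \<in> borel_measurable borel" by (rule borel_measurable_continuous_onI[OF c(2)])
  have d1: "\<And>t. 0 \<le> t \<Longrightarrow> (H has_real_derivative H' t) (at t within {0..})"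
    and d2: "\<And>t. 0 \<le> t \<Longrightarrow> (H' has_real_derivative H'' t) (at t within {0..})"
    using H by (auto simp: C2_compact_def)
  have tail: "(LBINT x. indicator {y<..} x * H'' x) = - H' y" if y: "0 < y" for y
  proof -
    have "(LBINT x. indicator {y<..} x * H'' x) = (LBINT x. pos (x - y) * H'' x)"
      by (simp add: indicator_def)
    also have "\<dots> = \<bar>1\<bar> *\<^sub>R (LBINT u. pos ((y + 1 * u) - y) * H'' (y + 1 * u))"
      by (rule lborel_integral_real_affine) simp
    also have "\<dots> = (LBINT u. indicator {0<..R} u * H'' (y + u))"
      using R y by (simp, intro Bochner_Integration.integral_cong) (auto simp: indicator_def)
    also have "\<dots> = H' (y + R) - H' y"
      using y R(1) by (intro halfline_FTC[OF d2 c(2)]) auto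
    also have "H' (y + R) = 0" using R(2)[of "y + R"] y by simp
    finally show ?thesis by simp
  qed
  note we = weak_equation[OF q(1) tail, folded V_def]
  note je = jump_eq[OF H]
  have e: "pos w * (G w * jump H H' w) = (1 / (\<alpha> * (1 + \<alpha>))) * (pos w * (G w * V H'' w))" for w
    using je(2)[of w] by (cases "0 < w") auto
  show "integrable lborel (\<lambda>w. pos w * (G w * jump H H' w))"
    unfolding e by (intro integrable_mult_right we)
  show "integrable lborel (\<lambda>w. pos w * (G w * H' w))" by (rule we)
  have "(LBINT u. indicator {0<..z} u * H' (0 + u)) = H (0 + z) - H 0" if "0 < z" for z
    using that by (intro halfline_FTC[OF d1 c(1)]) auto
  note fd = fractional_difference[OF q(2) order_refl this]
  show "integrable lborel (\<lambda>z. pos z * (z powr (- 1 - \<alpha>) * (H z - H 0)))"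
    using fd(1) by simp
  have 3: "(LBINT z. pos z * (z powr (- 1 - \<alpha>) * (H z - H 0))) = (LBINT y. pos y * (y powr (- \<alpha>) * H' y)) / \<alpha>"
    using fd(2) by (simp add: V_shift)
  have 1: "(LBINT w. pos w * (G w * jump H H' w)) = (1 / (\<alpha> * (1 + \<alpha>))) * (LBINT w. pos w * (G w * V H'' w))"
    unfolding e by simp
  show "\<alpha> * (\<alpha> + 1) * (LBINT w. pos w * (G w * jump H H' w))
      - \<beta> * \<Gamma>\<^sub>\<alpha> * (LBINT w. pos w * (G w * H' w))
      + \<alpha> * (LBINT z. pos z * (z powr (- 1 - \<alpha>) * (H z - H 0))) = 0"
    unfolding 1 3 using we(4) \<alpha> by (simp add: add.commute)
qed

definition sq_jump :: "(real \<Rightarrow> real) \<Rightarrow> real \<Rightarrow> real" where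
  "sq_jump F w = (LBINT z. pos z * (z powr (- 2 - \<alpha>) * (F (w + z) - F w)\<^sup>2))"

text \<open>The one-site share of - <L \<Psi>, \<Psi>>. The Mecke formula weights cluster size w by
  w times (\<alpha> / a) G w / w; the w cancels and a is absorbed into \<beta> = b / a. The last
  term is immigration, which starts from size 0.\<close>

definition energy :: "(real \<Rightarrow> real) \<Rightarrow> (real \<Rightarrow> real) \<Rightarrow> real" where
  "energy F F' =
     - (LBINT w. pos w * (G w * (F w * (\<alpha> * ((\<alpha> + 1) / \<Gamma>\<^sub>\<alpha>) * jump F F' w - \<beta> * F' w))))
     - F 0 * (\<alpha> / \<Gamma>\<^sub>\<alpha> * (LBINT z. pos z * (z powr (- 1 - \<alpha>) * (F z - F 0))))"

text \<open>The square of an increment of \<open>F\<close> is the increment of F^2 minus 2 F w times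
  the increment of \<open>F\<close>; the first-order compensators agree since (F^2)' = 2 F
  F'.\<close>

lemma sq_jump_eq:
  assumes F: "C2_compact F F' F''" and w: "0 \<le> w"
  shows "integrable lborel (\<lambda>z. pos z * (z powr (- 2 - \<alpha>) * (F (w + z) - F w)\<^sup>2))"
    and "sq_jump F w = jump (\<lambda>t. (F t)\<^sup>2) (\<lambda>t. 2 * F t * F' t) w - 2 * (F w * jump F F' w)"
proof -
  note i1 = jump_eq(1)[OF C2_compact_square[OF F] w] and i2 = jump_eq(1)[OF F w]
  have e: "(\<lambda>z. pos z * (z powr (- 2 - \<alpha>) * (F (w + z) - F w)\<^sup>2)) =
     (\<lambda>z. pos z * (z powr (- 2 - \<alpha>) * ((F (w + z))\<^sup>2 - (F w)\<^sup>2 - z * (2 * F w * F' w)))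
      - 2 * F w * (pos z * (z powr (- 2 - \<alpha>) * (F (w + z) - F w - z * F' w))))"
    by (auto simp: fun_eq_iff indicator_def power2_eq_square algebra_simps)
  show "integrable lborel (\<lambda>z. pos z * (z powr (- 2 - \<alpha>) * (F (w + z) - F w)\<^sup>2))"
    unfolding e by (intro Bochner_Integration.integrable_diff integrable_mult_right i1 i2)
  show "sq_jump F w = jump (\<lambda>t. (F t)\<^sup>2) (\<lambda>t. 2 * F t * F' t) w - 2 * (F w * jump F F' w)"
    unfolding sq_jump_def e using i1 i2
    by (subst Bochner_Integration.integral_diff) (auto simp: jump_def)
qed

text \<open>\<open>G_times_jump\<close> applied to F^2 removes everything but squares of increments,
  just as invariance of a measure gives - <L u, u> as half the mean of the carre du champ.\<close>

lemma energy_eq: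
  assumes F: "C2_compact F F' F''"
  shows "integrable lborel (\<lambda>w. pos w * (G w * sq_jump F w))"
    and "integrable lborel (\<lambda>z. pos z * (z powr (- 1 - \<alpha>) * (F z - F 0)\<^sup>2))"
    and "energy F F' = (1 / 2) * (\<alpha> * ((\<alpha> + 1) / \<Gamma>\<^sub>\<alpha>) * (LBINT w. pos w * (G w * sq_jump F w))
       + \<alpha> / \<Gamma>\<^sub>\<alpha> * (LBINT z. pos z * (z powr (- 1 - \<alpha>) * (F z - F 0)\<^sup>2)))"
proof -
  let ?H = "\<lambda>t. (F t)\<^sup>2" and ?H' = "\<lambda>t. 2 * F t * F' t"
  note g1 = G_times_jump[OF C2_compact_square[OF F]] and g2 = G_times_jump[OF F]
  obtain R where R: "0 < R" "\<And>t. R \<le> t \<Longrightarrow> F t = 0" using F by (auto simp: C2_compact_def)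
  have cF: "continuous_on UNIV F" using F by (auto simp: C2_compact_def)
  obtain B where B: "0 \<le> B" "\<And>x. 0 \<le> x \<Longrightarrow> \<bar>F x\<bar> \<le> B" using compact_support_bound[OF cF R(2)] by blast
  have [measurable]: "F \<in> borel_measurable borel" by (rule borel_measurable_continuous_onI[OF cF])
  have iF: "integrable lborel (\<lambda>w. F w * (pos w * (G w * jump F F' w)))"
  proof (rule Bochner_Integration.integrable_bound[OF integrable_mult_right[OF g2(1), of B]])
    show "AE w in lborel. norm (F w * (pos w * (G w * jump F F' w))) \<le> norm (B * (pos w * (G w * jump F F' w)))"
    proof (rule AE_I2)
      fix w :: real
      show "norm (F w * (pos w * (G w * jump F F' w))) \<le> norm (B * (pos w * (G w * jump F F' w)))"
        using B(2)[of w] B(1) by (cases "0 < w") (auto simp: abs_mult intro!: mult_right_mono)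
    qed
    show "(\<lambda>w. F w * (pos w * (G w * jump F F' w))) \<in> borel_measurable lborel"
      by (rule borel_measurable_times[OF _ borel_measurable_integrable[OF g2(1)]]) simp
  qed
  let ?S = "LBINT w. pos w * (G w * sq_jump F w)"
  let ?P = "LBINT w. F w * (pos w * (G w * jump F F' w))"
  let ?HJ = "LBINT w. pos w * (G w * jump ?H ?H' w)"
  let ?D = "LBINT w. pos w * (G w * ?H' w)"
  let ?L = "LBINT z. pos z * (z powr (- 1 - \<alpha>) * (F z - F 0))"
  let ?N = "LBINT z. pos z * (z powr (- 1 - \<alpha>) * (?H z - ?H 0))"
  have e: "pos w * (G w * sq_jump F w) =
      pos w * (G w * jump ?H ?H' w) - 2 * (F w * (pos w * (G w * jump F F' w)))" for w
  proof (cases "0 < w")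
    case True
    then have j: "jump ?H ?H' w = sq_jump F w + 2 * (F w * jump F F' w)"
      using sq_jump_eq(2)[OF F, of w] by simp
    show ?thesis unfolding j by (simp add: algebra_simps)
  qed simp
  show "integrable lborel (\<lambda>w. pos w * (G w * sq_jump F w))"
    unfolding e by (intro Bochner_Integration.integrable_diff integrable_mult_right g1 iF)
  have S: "?S = ?HJ - 2 * ?P"
    unfolding e using g1(1) iF by (subst Bochner_Integration.integral_diff) auto
  have e3: "(\<lambda>z. pos z * (z powr (- 1 - \<alpha>) * (F z - F 0)\<^sup>2)) =
      (\<lambda>z. pos z * (z powr (- 1 - \<alpha>) * (?H z - ?H 0)) - 2 * F 0 * (pos z * (z powr (- 1 - \<alpha>) * (F z - F 0))))"
    by (auto simp: fun_eq_iff indicator_def power2_eq_square algebra_simps)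
  show "integrable lborel (\<lambda>z. pos z * (z powr (- 1 - \<alpha>) * (F z - F 0)\<^sup>2))"
    unfolding e3 by (intro Bochner_Integration.integrable_diff integrable_mult_right g1(3) g2(3))
  have N: "(LBINT z. pos z * (z powr (- 1 - \<alpha>) * (F z - F 0)\<^sup>2)) = ?N - 2 * F 0 * ?L"
    unfolding e3 using g1(3) g2(3) by (subst Bochner_Integration.integral_diff) auto
  have "(LBINT w. pos w * (G w * (F w * (\<alpha> * ((\<alpha> + 1) / \<Gamma>\<^sub>\<alpha>) * jump F F' w - \<beta> * F' w)))) =
    (LBINT w. \<alpha> * ((\<alpha> + 1) / \<Gamma>\<^sub>\<alpha>) * (F w * (pos w * (G w * jump F F' w))) - \<beta> / 2 * (pos w * (G w * ?H' w)))"
    by (intro Bochner_Integration.integral_cong) (auto simp: algebra_simps)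
  also have "\<dots> = \<alpha> * ((\<alpha> + 1) / \<Gamma>\<^sub>\<alpha>) * ?P - \<beta> / 2 * ?D"
    using Bochner_Integration.integral_diff[OF integrable_mult_right[OF iF, of "\<alpha> * ((\<alpha> + 1) / \<Gamma>\<^sub>\<alpha>)"] integrable_mult_right[OF g1(2), of "\<beta> / 2"]]
    by (simp only: integral_mult_right_zero)
  finally have E: "energy F F' = - (\<alpha> * ((\<alpha> + 1) / \<Gamma>\<^sub>\<alpha>) * ?P - \<beta> / 2 * ?D) - F 0 * (\<alpha> / \<Gamma>\<^sub>\<alpha> * ?L)"
    unfolding energy_def by simp
  have alg: "\<alpha> * ((\<alpha> + 1) / g) * h - \<beta> * d + \<alpha> / g * n = (\<alpha> * (\<alpha> + 1) * h - \<beta> * g * d + \<alpha> * n) / g"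
    if "0 < g" for g h d n :: real
    using that by (simp add: field_simps)
  have Z: "\<alpha> * ((\<alpha> + 1) / \<Gamma>\<^sub>\<alpha>) * ?HJ - \<beta> * ?D + \<alpha> / \<Gamma>\<^sub>\<alpha> * ?N = 0"
    unfolding alg[OF \<Gamma>_pos] using g1(4) by simp
  have "energy F F' * 2 = \<alpha> * ((\<alpha> + 1) / \<Gamma>\<^sub>\<alpha>) * ?S + \<alpha> / \<Gamma>\<^sub>\<alpha> * (?N - 2 * F 0 * ?L)"
    unfolding E S using Z by (simp only: right_diff_distrib left_diff_distrib) (simp add: algebra_simps)
  then show "energy F F' = (1 / 2) * (\<alpha> * ((\<alpha> + 1) / \<Gamma>\<^sub>\<alpha>) * ?S
       + \<alpha> / \<Gamma>\<^sub>\<alpha> * (LBINT z. pos z * (z powr (- 1 - \<alpha>) * (F z - F 0)\<^sup>2)))"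
    unfolding N by simp
qed

lemma energy_nonneg:
  assumes F: "C2_compact F F' F''"
  shows "0 \<le> energy F F'"
proof -
  have "0 \<le> sq_jump F w" for w
    unfolding sq_jump_def by (intro Bochner_Integration.integral_nonneg) (auto simp: indicator_def)
  then show ?thesis
    unfolding energy_eq(3)[OF F] using \<alpha> \<Gamma>_pos G_nonneg
    by (intro mult_nonneg_nonneg add_nonneg_nonneg Bochner_Integration.integral_nonneg) auto
qed

text \<open>The first half of the estimate discards nothing but \<open>1 / (1 + \<alpha>)\<close> of the jump energy; the
  remaining fraction is bounded by the ground state transform with respect to \<open>w \<mapsto> w\<close>,
  \<open>(f (w + z) - f w)\<^sup>2 \<ge> z (k (w + z) - k w)\<close> with \<open>k w = (f w)\<^sup>2 / w\<close>, after which the weak equation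
  cancels the immigration part exactly.\<close>

lemma energy_ge:
  assumes F: "C2_compact F F' F''"
  shows "integrable lborel (\<lambda>w. pos w * (G w / w * (F w - F 0)\<^sup>2))"
    and "\<alpha> * \<beta> / 2 * (LBINT w. pos w * (G w / w * (F w - F 0)\<^sup>2)) \<le> energy F F'"
proof -
  obtain R where R: "0 < R" "\<And>t. R \<le> t \<Longrightarrow> F t = 0 \<and> F' t = 0" using F by (auto simp: C2_compact_def)
  have c: "continuous_on UNIV F" "continuous_on UNIV F'" using F by (auto simp: C2_compact_def)
  have [measurable]: "F \<in> borel_measurable borel" "F' \<in> borel_measurable borel"
    by (auto intro!: borel_measurable_continuous_onI c)
  have d1: "\<And>t. 0 \<le> t \<Longrightarrow> (F has_real_derivative F' t) (at t within {0..})"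
    using F by (auto simp: C2_compact_def)
  obtain B where B: "0 \<le> B" "\<And>x. 0 \<le> x \<Longrightarrow> \<bar>F' x\<bar> \<le> B"
    using compact_support_bound[OF c(2)] R(2) by blast
  define f where "f x = F x - F 0" for x
  have f_le: "\<bar>f x\<bar> \<le> B * x" if x: "0 \<le> x" for x
  proof -
    have "norm (F x - F 0) \<le> B * norm (x - 0)"
      using x B d1 by (intro field_differentiable_bound[of "{0..x}" F F'])
        (auto intro!: DERIV_subset[OF d1])
    then show ?thesis using x by (simp add: f_def)
  qed
  \<comment> \<open>\<open>f\<close> vanishes at 0, so |f x| \<le> B x keeps the derivative
    \<open>q\<close> of \<open>k\<close> bounded near 0, and beyond \<open>R\<close>, where f = - F
    0, it is - (F 0)^2 / x^2. Thus \<open>q\<close> is admissible in the weak equation, with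
    antiderivative \<open>k\<close>.\<close>
  define k where "k x = (f x)\<^sup>2 / x" for x
  define q where "q x = pos x * (2 * f x * F' x / x - (f x)\<^sup>2 / x\<^sup>2)" for x
  have [measurable]: "f \<in> borel_measurable borel" unfolding f_def[abs_def] by measurable
  have [measurable]: "q \<in> borel_measurable borel" unfolding q_def[abs_def] by measurable
  have dk: "(k has_real_derivative q x) (at x within A)" if x: "0 < x" for x A
  proof -
    have "(F has_real_derivative F' x) (at x within {0<..})"
      by (rule DERIV_subset[OF d1]) (use x in auto)
    then have "(F has_real_derivative F' x) (at x)"
      using x by (simp add: at_within_open[of x "{0<..}"])
    then have "(k has_real_derivative (2 * f x * F' x * x - (f x)\<^sup>2 * 1) / (x * x)) (at x)"
      unfolding k_def f_def using x by (auto intro!: derivative_eq_intros)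
    moreover have "(2 * f x * F' x * x - (f x)\<^sup>2 * 1) / (x * x) = q x"
      using x by (simp add: q_def diff_divide_distrib power2_eq_square)
    ultimately show ?thesis using has_field_derivative_at_within by metis
  qed
  have qb: "\<bar>q x\<bar> \<le> (3 * B\<^sup>2 + 3 * B\<^sup>2 * R\<^sup>2 + (F 0)\<^sup>2) * min 1 (1 / x\<^sup>2)" (is "_ \<le> ?C * _") if x: "0 < x" for x
  proof -
    have f2: "(f x)\<^sup>2 / x\<^sup>2 \<le> B\<^sup>2"
    proof -
      have "(f x)\<^sup>2 \<le> (B * x)\<^sup>2" using power_mono[OF f_le[of x], of 2] x by simp
      then show ?thesis using x by (simp add: divide_le_eq power_mult_distrib)
    qed
    have "\<bar>q x\<bar> \<le> ?C \<and> \<bar>q x\<bar> \<le> ?C / x\<^sup>2"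
    proof (cases "R \<le> x")
      case True
      then have e: "\<bar>q x\<bar> = (F 0)\<^sup>2 / x\<^sup>2" "(f x)\<^sup>2 = (F 0)\<^sup>2" using R(2)[of x] x by (auto simp: q_def f_def)
      have "(F 0)\<^sup>2 / x\<^sup>2 \<le> ?C / x\<^sup>2" by (intro divide_right_mono) auto
      moreover have "B\<^sup>2 \<le> ?C" using zero_le_power2[of "B * R"] by (simp add: power_mult_distrib)
      ultimately show ?thesis using f2 unfolding e by (intro conjI) linarith+
    next
      case False
      have "\<bar>f x / x\<bar> \<le> B" using f_le[of x] x by (simp add: divide_le_eq)
      then have "\<bar>f x / x\<bar> * \<bar>F' x\<bar> \<le> B * B" using B x by (intro mult_mono) auto
      then have "\<bar>2 * f x * F' x / x\<bar> \<le> 2 * B\<^sup>2" using x by (simp add: abs_mult power2_eq_square)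
      moreover have "0 \<le> (f x)\<^sup>2 / x\<^sup>2" by simp
      moreover have "q x = 2 * f x * F' x / x - (f x)\<^sup>2 / x\<^sup>2" using x by (simp add: q_def)
      ultimately have q3: "\<bar>q x\<bar> \<le> 3 * B\<^sup>2" using f2 by linarith
      have "x\<^sup>2 \<le> R\<^sup>2" using False x by (intro power_mono) auto
      then have "3 * B\<^sup>2 * x\<^sup>2 \<le> 3 * B\<^sup>2 * R\<^sup>2" by (intro mult_left_mono) auto
      then have "3 * B\<^sup>2 * x\<^sup>2 \<le> ?C" using zero_le_power2[of B] zero_le_power2[of "F 0"] by linarith
      then have "3 * B\<^sup>2 \<le> ?C / x\<^sup>2" using x by (simp add: le_divide_eq)
      moreover have "3 * B\<^sup>2 \<le> ?C" by simp
      ultimately show ?thesis using q3 by linarith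
    qed
    then show ?thesis by (auto simp: min_def)
  qed
  then have q: "decaying q" unfolding decaying_def by auto
  have iq: "integrable lborel (\<lambda>x. indicator {y..} x * q x)" if y: "0 < y" for y
  proof (rule Bochner_Integration.integrable_bound[OF integrable_mult_right[OF integrable_powr_min[of 0], of "3 * B\<^sup>2 + 3 * B\<^sup>2 * R\<^sup>2 + (F 0)\<^sup>2"]])
    show "AE x in lborel. norm (indicator {y..} x * q x) \<le> norm ((3 * B\<^sup>2 + 3 * B\<^sup>2 * R\<^sup>2 + (F 0)\<^sup>2) * (pos x * (x powr 0 * min 1 (1 / x\<^sup>2))))"
    proof (rule AE_I2)
      fix x :: real
      show "norm (indicator {y..} x * q x) \<le> norm ((3 * B\<^sup>2 + 3 * B\<^sup>2 * R\<^sup>2 + (F 0)\<^sup>2) * (pos x * (x powr 0 * min 1 (1 / x\<^sup>2))))"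
        using order_trans[OF qb[of x] abs_ge_self] y by (cases "y \<le> x") auto
    qed
  qed auto
  have k0: "(k \<longlongrightarrow> 0) at_top"
  proof (rule Lim_transform_eventually)
    show "((\<lambda>x. (F 0)\<^sup>2 / x) \<longlongrightarrow> 0) at_top"
      by (intro tendsto_divide_0[OF tendsto_const] filterlim_at_top_imp_at_infinity filterlim_ident)
    show "\<forall>\<^sub>F x in at_top. (F 0)\<^sup>2 / x = k x"
      using eventually_ge_at_top[of R] by eventually_elim (use R in \<open>auto simp: k_def f_def\<close>)
  qed
  have cq: "continuous_on {y..} q" if y: "0 < y" for y
  proof -
    have "continuous_on {y..} (\<lambda>x. 2 * f x * F' x / x - (f x)\<^sup>2 / x\<^sup>2)"
      unfolding f_def using y by (intro continuous_intros continuous_on_subset[OF c(1)] continuous_on_subset[OF c(2)]) auto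
    then show ?thesis
      by (rule continuous_on_cong[THEN iffD1, rotated -1]) (use y in \<open>auto simp: q_def\<close>)
  qed
  have tail: "(LBINT x. indicator {y<..} x * q x) = - k y" if y: "0 < y" for y
    unfolding integral_open_closed_lower(1)[OF \<open>q \<in> borel_measurable borel\<close>]
    using y by (intro set_integral_FTC_tail iq cq k0 dk) auto
  note we = weak_equation[OF q tail, folded V_def]
  have e1: "pos y * (G y * k y) = pos y * (G y / y * (F y - F 0)\<^sup>2)" for y
    by (simp add: k_def f_def)
  show "integrable lborel (\<lambda>w. pos w * (G w / w * (F w - F 0)\<^sup>2))"
    using we(3) unfolding e1 .
  have e2: "pos y * (y powr (- \<alpha>) * k y) = pos y * (y powr (- 1 - \<alpha>) * (F y - F 0)\<^sup>2)" for y
  proof (cases "0 < y")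
    case True
    have "y powr (- 1 - \<alpha>) = y powr (- \<alpha>) / y"
      using powr_diff[of y "- \<alpha>" 1] True unfolding minus_diff_commute[of \<alpha> 1] by simp
    then show ?thesis by (simp add: k_def f_def)
  qed simp
  have diffk: "(LBINT u. indicator {0<..z} u * q (w + u)) = k (w + z) - k w" if w: "0 < w" and z: "0 < z" for w z
  proof -
    have "(LBINT u. indicator {0<..z} u * q (w + u)) = (LBINT u. indicator {0..z} u *\<^sub>R q (w + u))"
      by (subst integral_open_closed_lower(2)) auto
    also have "\<dots> = k (w + z) - k (w + 0)"
    proof (rule integral_FTC_atLeastAtMost)
      show "((\<lambda>u. k (w + u)) has_vector_derivative q (w + x)) (at x within {0..z})" if "0 \<le> x" "x \<le> z" for x
      proof -
        have "(k has_real_derivative q (w + x)) (at (w + x))" using that w by (intro dk) auto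
        moreover have "((\<lambda>u. w + u) has_real_derivative 1) (at x within {0..z})"
          by (auto intro!: derivative_eq_intros)
        ultimately have "((\<lambda>u. k (w + u)) has_real_derivative q (w + x) * 1) (at x within {0..z})"
          by (rule DERIV_chain2)
        then show ?thesis by (simp add: has_real_derivative_iff_has_vector_derivative)
      qed
      show "continuous_on {0..z} (\<lambda>u. q (w + u))"
        by (intro continuous_on_compose2[OF cq[OF w]] continuous_intros) auto
    qed (use z in simp)
    finally show ?thesis by simp
  qed
  have sq: "V q w / \<alpha> \<le> sq_jump F w" if w: "0 < w" for w
  proof -
    note fd = fractional_difference[OF q less_imp_le[OF w] diffk[OF w]]
    have "z powr (- 1 - \<alpha>) * (k (w + z) - k w) \<le> z powr (- 2 - \<alpha>) * (F (w + z) - F w)\<^sup>2" if z: "0 < z" for z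
    proof -
      let ?a = "f (w + z)" and ?b = "f w"
      \<comment> \<open>The defect of the ground state inequality is a perfect square over w (w +
        z); it vanishes when f is proportional to the identity.\<close>
      have "(?a - ?b)\<^sup>2 - z * (k (w + z) - k w) = (w * ?a - (w + z) * ?b)\<^sup>2 / (w * (w + z))"
      proof -
        have alg: "(a - b)\<^sup>2 - (v - w) * (a\<^sup>2 / v - b\<^sup>2 / w) = (w * a - v * b)\<^sup>2 / (w * v)" if "0 < v" for a b v
          using w that by (simp add: field_simps power2_eq_square)
        show ?thesis using alg[of "w + z" ?a ?b] w z by (simp add: k_def)
      qed
      also have "\<dots> \<ge> 0" using w z by simp
      finally have "z * (k (w + z) - k w) \<le> (F (w + z) - F w)\<^sup>2" by (simp add: f_def)
      then have "z powr (- 2 - \<alpha>) * (z * (k (w + z) - k w)) \<le> z powr (- 2 - \<alpha>) * (F (w + z) - F w)\<^sup>2"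
        by (intro mult_left_mono) auto
      moreover have "z powr (- 2 - \<alpha>) * z = z powr (- 1 - \<alpha>)"
        using z powr_mult_base[of z "- 2 - \<alpha>"] by (simp add: mult.commute)
      ultimately show ?thesis by (simp add: mult.assoc[symmetric])
    qed
    then have "(LBINT z. pos z * (z powr (- 1 - \<alpha>) * (k (w + z) - k w))) \<le> sq_jump F w"
      unfolding sq_jump_def using fd(1) sq_jump_eq(1)[OF F less_imp_le[OF w]]
      by (intro integral_mono) (auto simp: indicator_def)
    then show ?thesis using fd(2) by simp
  qed
  let ?S = "LBINT w. pos w * (G w * sq_jump F w)"
  let ?N = "LBINT y. pos y * (y powr (- 1 - \<alpha>) * (F y - F 0)\<^sup>2)"
  let ?P = "LBINT y. pos y * (G y / y * (F y - F 0)\<^sup>2)"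
  have S0: "0 \<le> ?S" 
    unfolding sq_jump_def using G_nonneg by (intro Bochner_Integration.integral_nonneg mult_nonneg_nonneg) (auto simp: indicator_def)
  have "(LBINT w. 1 / \<alpha> * (pos w * (G w * V q w))) \<le> ?S"
    using sq G_nonneg we(1) energy_eq(1)[OF F]
    by (intro integral_mono integrable_mult_right) (auto simp: indicator_def intro: mult_left_mono[of "V q _ / \<alpha>", simplified])
  then have "(- ?N + \<beta> * \<Gamma>\<^sub>\<alpha> * ?P) / \<alpha> \<le> ?S"
    using we(4) unfolding e1 e2 by simp
  \<comment> \<open>Weight \<alpha>^2 / \<open>\<Gamma>\<^sub>\<alpha>\<close> out of the available
    \<alpha> (\<alpha> + 1) / \<open>\<Gamma>\<^sub>\<alpha>\<close>: with it the term
    \<open>- ?N\<close> comes out with exactly the factor \<alpha> /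
    \<open>\<Gamma>\<^sub>\<alpha>\<close> of the immigration energy.\<close>
  then have "\<alpha>\<^sup>2 / \<Gamma>\<^sub>\<alpha> * ((- ?N + \<beta> * \<Gamma>\<^sub>\<alpha> * ?P) / \<alpha>) \<le> \<alpha>\<^sup>2 / \<Gamma>\<^sub>\<alpha> * ?S"
    using \<Gamma>_pos by (intro mult_left_mono) auto
  also have "\<dots> \<le> \<alpha> * ((\<alpha> + 1) / \<Gamma>\<^sub>\<alpha>) * ?S"
    using \<Gamma>_pos \<alpha> S0 by (intro mult_right_mono) (auto simp: power2_eq_square field_simps)
  also have "\<alpha>\<^sup>2 / \<Gamma>\<^sub>\<alpha> * ((- ?N + \<beta> * \<Gamma>\<^sub>\<alpha> * ?P) / \<alpha>) = - (\<alpha> / \<Gamma>\<^sub>\<alpha> * ?N) + \<alpha> * \<beta> * ?P"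
  proof -
    have "\<alpha>\<^sup>2 / g * ((- n + \<beta> * g * p) / \<alpha>) = - (\<alpha> / g * n) + \<alpha> * \<beta> * p" if "0 < g" for g n p :: real
      using that \<alpha> by (simp add: power2_eq_square field_simps)
    then show ?thesis using \<Gamma>_pos by blast
  qed
  finally have "- (\<alpha> / \<Gamma>\<^sub>\<alpha> * ?N) + \<alpha> * \<beta> * ?P \<le> \<alpha> * ((\<alpha> + 1) / \<Gamma>\<^sub>\<alpha>) * ?S" .
  then show "\<alpha> * \<beta> / 2 * ?P \<le> energy F F'"
    unfolding energy_eq(3)[OF F] by simp
qed

lemma decaying_exp:
  assumes "0 < c"
  shows "decaying (\<lambda>x. c * exp (- c * x))"
proof -
  have "\<bar>c * exp (- c * x)\<bar> \<le> (c + 2 / c) * min 1 (1 / x\<^sup>2)" if x: "0 < x" for x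
  proof -
    have "(c * x)\<^sup>2 / 2 \<le> exp (c * x)"
    proof -
      have "0 \<le> c * x" using x assms by simp
      then show ?thesis using exp_lower_Taylor_quadratic[of "c * x"] by linarith
    qed
    then have "exp (- c * x) * x\<^sup>2 \<le> 2 / c\<^sup>2"
      using assms x by (simp add: exp_minus field_simps power2_eq_square)
    then have "c * exp (- c * x) \<le> (2 / c) / x\<^sup>2"
      using assms x by (simp add: field_simps power2_eq_square)
    also have "\<dots> \<le> (c + 2 / c) / x\<^sup>2" using assms by (intro divide_right_mono) auto
    finally have 1: "c * exp (- c * x) \<le> (c + 2 / c) / x\<^sup>2" .
    have "c * exp (- c * x) \<le> c * 1" using assms x by (intro mult_left_mono) auto
    also have "\<dots> \<le> c + 2 / c" using assms by simp
    finally show ?thesis using 1 assms by (auto simp: min_def)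
  qed
  then show ?thesis unfolding decaying_def by auto
qed

text \<open>Tested with q = c exp(- c x), for which h and V are again multiples of exp(- c w), the
  weak equation becomes a linear equation for the Laplace transform.\<close>

lemma G_laplace:
  assumes c: "0 < c"
  shows "has_bochner_integral lborel (\<lambda>w. pos w * (G w * exp (- c * w))) (c powr (\<alpha> - 1) / (\<beta> + c powr \<alpha>))"
proof -
  let ?q = "\<lambda>x. c * exp (- c * x)"
  have tail: "(LBINT x. indicator {y<..} x * ?q x) = - (- exp (- c * y))" if "0 < y" for y
  proof -
    have "has_bochner_integral lborel (\<lambda>x. indicator {y..} x * exp (- c * x)) (exp (- c * y) / c)"
      using has_integral_exp_minus_to_infinity[OF c, of y] by (intro has_bochner_integral_of_has_integral) auto
    from has_bochner_integral_mult_right[OF this, of c]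
    have "(LBINT x. c * (indicator {y..} x * exp (- c * x))) = exp (- c * y)"
      using c by (simp add: has_bochner_integral_iff)
    then show ?thesis
      by (subst integral_open_closed_lower(1)) (auto simp: mult.left_commute)
  qed
  note we = weak_equation[OF decaying_exp[OF c] tail, folded V_def]
  have g: "has_bochner_integral lborel (\<lambda>u. pos u * (u powr (- \<alpha>) * exp (- c * u))) (\<Gamma>\<^sub>\<alpha> / c powr (1 - \<alpha>))"
    using has_bochner_integral_Gamma[of "1 - \<alpha>" c] \<alpha> c by simp
  have V: "V ?q w = c * exp (- c * w) * (\<Gamma>\<^sub>\<alpha> / c powr (1 - \<alpha>))" for w
  proof -
    have "V ?q w = (LBINT u. c * exp (- c * w) * (pos u * (u powr (- \<alpha>) * exp (- c * u))))"
      unfolding V_shift by (intro Bochner_Integration.integral_cong) (auto simp: exp_add[symmetric] algebra_simps)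
    then show ?thesis using g by (simp add: has_bochner_integral_iff)
  qed
  let ?I = "LBINT w. pos w * (G w * exp (- c * w))"
  have i: "integrable lborel (\<lambda>w. pos w * (G w * exp (- c * w)))"
    using we(3) by simp
  have "(LBINT w. pos w * (G w * V ?q w)) = c * (\<Gamma>\<^sub>\<alpha> / c powr (1 - \<alpha>)) * ?I"
  proof -
    have "(LBINT w. pos w * (G w * V ?q w)) =
        (LBINT w. c * (\<Gamma>\<^sub>\<alpha> / c powr (1 - \<alpha>)) * (pos w * (G w * exp (- c * w))))"
      unfolding V by (intro Bochner_Integration.integral_cong) (auto simp: mult_ac)
    then show ?thesis by (simp only: integral_mult_right_zero)
  qed
  moreover have "(LBINT y. pos y * (y powr (- \<alpha>) * - exp (- c * y))) = - (\<Gamma>\<^sub>\<alpha> / c powr (1 - \<alpha>))"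
    using g by (simp add: has_bochner_integral_iff)
  moreover have "(LBINT y. pos y * (G y * - exp (- c * y))) = - ?I"
    by simp
  ultimately have eq: "c * (\<Gamma>\<^sub>\<alpha> / c powr (1 - \<alpha>)) * ?I = \<Gamma>\<^sub>\<alpha> / c powr (1 - \<alpha>) - \<beta> * \<Gamma>\<^sub>\<alpha> * ?I"
    using we(4) by simp
  have alg: "g * (i * (c / r + b)) = g * (1 / r)" if "c * (g / r) * i = g / r - b * g * i" for g i r b :: real
  proof -
    have "g * (i * (c / r + b)) = c * (g / r) * i + b * g * i"
      by (simp add: distrib_left mult_ac)
    then show ?thesis using that by simp
  qed
  from alg[OF eq] have "\<Gamma>\<^sub>\<alpha> * (?I * (c / c powr (1 - \<alpha>) + \<beta>)) = \<Gamma>\<^sub>\<alpha> * (1 / c powr (1 - \<alpha>))" .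
  then have "?I * (c / c powr (1 - \<alpha>) + \<beta>) = 1 / c powr (1 - \<alpha>)"
    by (rule mult_left_cancel[THEN iffD1, rotated]) (use \<Gamma>_pos in simp)
  moreover have "c / c powr (1 - \<alpha>) = c powr \<alpha>" "1 / c powr (1 - \<alpha>) = c powr (\<alpha> - 1)"
    using c by (simp_all add: powr_diff)
  moreover have "0 < c powr \<alpha> + \<beta>" using \<beta> by (simp add: add_nonneg_pos)
  ultimately have "?I = c powr (\<alpha> - 1) / (\<beta> + c powr \<alpha>)"
    by (simp add: eq_divide_eq add.commute)
  then show ?thesis using i by (simp add: has_bochner_integral_iff)
qed

text \<open>c^(\<alpha> - 1) / (\<beta> + c^\<alpha>) is the derivative of ln(\<beta> + c^\<alpha>)
  / \<alpha>. So \<alpha> G w / w dw is the Levy measure of a positive Linnik law, with exponent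
  ln(1 + c^\<alpha> / \<beta>).\<close>

lemma G_levy:
  assumes "0 \<le> c"
  shows "has_bochner_integral lborel (\<lambda>w. pos w * (G w / w * (1 - exp (- c * w)))) (ln (1 + c powr \<alpha> / \<beta>) / \<alpha>)"
proof (cases "c = 0")
  case True
  then show ?thesis by (simp add: has_bochner_integral_zero)
next
  case False
  then have c: "0 < c" using assms by simp
  have hb2: "has_bochner_integral lborel (\<lambda>s. indicator {0<..<c} s * (s powr (\<alpha> - 1) / (\<beta> + s powr \<alpha>)))
      (ln (\<beta> + c powr \<alpha>) / \<alpha> - ln (\<beta> + 0 powr \<alpha>) / \<alpha>)"
  proof (rule has_bochner_integral_of_has_integral)
    have pos: "0 < \<beta> + x powr \<alpha>" for x using \<beta> by (simp add: add_pos_nonneg)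
    have "((\<lambda>s. s powr (\<alpha> - 1) / (\<beta> + s powr \<alpha>)) has_integral (ln (\<beta> + c powr \<alpha>) / \<alpha> - ln (\<beta> + 0 powr \<alpha>) / \<alpha>)) {0..c}"
    proof (rule fundamental_theorem_of_calculus_interior)
      show "continuous_on {0..c} (\<lambda>s. ln (\<beta> + s powr \<alpha>) / \<alpha>)"
        using \<alpha> pos by (intro continuous_intros continuous_on_powr') (auto simp: less_imp_neq[symmetric])
      fix s assume s: "s \<in> {0<..<c}"
      have "((\<lambda>s. \<beta> + s powr \<alpha>) has_real_derivative 0 + \<alpha> * s powr (\<alpha> - 1)) (at s)"
        using s by (intro DERIV_add DERIV_const has_real_derivative_powr) auto
      from DERIV_cdivide[OF DERIV_chain2[OF DERIV_ln_divide[OF pos] this], of \<alpha>]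
      show "((\<lambda>s. ln (\<beta> + s powr \<alpha>) / \<alpha>) has_vector_derivative s powr (\<alpha> - 1) / (\<beta> + s powr \<alpha>)) (at s)"
        using \<alpha> by (simp add: has_real_derivative_iff_has_vector_derivative)
    qed (use c in simp)
    then show "((\<lambda>s. s powr (\<alpha> - 1) / (\<beta> + s powr \<alpha>)) has_integral (ln (\<beta> + c powr \<alpha>) / \<alpha> - ln (\<beta> + 0 powr \<alpha>) / \<alpha>)) {0<..<c}"
      by (simp add: has_integral_Icc_iff_Ioo)
    show "0 \<le> s powr (\<alpha> - 1) / (\<beta> + s powr \<alpha>)" for s using pos[of s] by simp
  qed auto
  have "ln (\<beta> + c powr \<alpha>) / \<alpha> - ln (\<beta> + 0 powr \<alpha>) / \<alpha> = ln (1 + c powr \<alpha> / \<beta>) / \<alpha>"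
  proof -
    have "1 + c powr \<alpha> / \<beta> = (\<beta> + c powr \<alpha>) / \<beta>" using \<beta> by (simp add: add_divide_distrib)
    moreover have "0 < \<beta> + c powr \<alpha>" using \<beta> by (simp add: add_pos_nonneg)
    ultimately show ?thesis using \<beta> by (simp add: ln_div diff_divide_distrib)
  qed
  moreover note has_bochner_integral_laplace_primitive[OF G_measurable G_nonneg G_laplace hb2 c]
  ultimately show ?thesis by simp
qed

end

section \<open>Adding point masses\<close>

lemma fin_measuresD:
  assumes "X \<in> fin_measures"
  shows "sets X = sets borel" "space X = UNIV" "finite_measure X"
  using assms sets_eq_imp_space_eq[of X borel] by (auto simp: fin_measures_def)

lemma add_dirac_sets [simp]: "sets (add_dirac X z r) = sets borel" "space (add_dirac X z r) = UNIV"
  using sets.sigma_sets_eq[of "borel :: 'a measure"] by (simp_all add: add_dirac_def)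

lemma emeasure_add_dirac:
  assumes "X \<in> fin_measures" "A \<in> sets borel"
  shows "emeasure (add_dirac X z r) A = emeasure X A + ennreal z * indicator A r"
proof -
  note s = fin_measuresD(1)[OF assms(1)]
  have "countably_additive (sets (add_dirac X z r)) (\<lambda>A. emeasure X A + ennreal z * indicator A r)"
  proof (rule countably_additiveI)
    fix B :: "nat \<Rightarrow> 'a set"
    assume B: "range B \<subseteq> sets (add_dirac X z r)" "disjoint_family B" "(\<Union>i. B i) \<in> sets (add_dirac X z r)"
    have 1: "(\<Sum>i. emeasure X (B i)) = emeasure X (\<Union>i. B i)"
      using B s by (intro suminf_emeasure) auto
    have 2: "(\<Sum>i. indicator (B i) r) = (indicator (\<Union>i. B i) r :: ennreal)"
      using B(2) by (intro suminf_indicator) auto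
    show "(\<Sum>i. emeasure X (B i) + ennreal z * indicator (B i) r) = emeasure X (\<Union>i. B i) + ennreal z * indicator (\<Union>i. B i) r"
      by (subst suminf_add[symmetric]) (auto simp: ennreal_suminf_cmult 1 2)
  qed
  then show ?thesis
    using assms(2) by (intro emeasure_measure_of[OF add_dirac_def])
      (auto simp: positive_def sets.sets_into_space)
qed

lemma add_dirac_fin: "X \<in> fin_measures \<Longrightarrow> add_dirac X z r \<in> fin_measures"
proof -
  assume X: "X \<in> fin_measures"
  interpret finite_measure X using X by (simp add: fin_measures_def)
  have "emeasure (add_dirac X z r) (space (add_dirac X z r)) \<noteq> \<infinity>"
    using emeasure_add_dirac[OF X, of UNIV z r] emeasure_finite[of UNIV]
    by (simp add: indicator_def)
  then show ?thesis by (auto simp: fin_measures_def intro!: finite_measureI)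
qed

lemma nn_integral_add_dirac:
  assumes X: "X \<in> fin_measures" and f: "f \<in> borel_measurable borel"
  shows "(\<integral>\<^sup>+x. f x \<partial>add_dirac X z r) = (\<integral>\<^sup>+x. f x \<partial>X) + ennreal z * f r"
proof -
  note s = fin_measuresD(1)[OF X]
  have m1: "borel_measurable (add_dirac X z r) = (borel_measurable borel :: ('a \<Rightarrow> ennreal) set)"
    and m2: "borel_measurable X = (borel_measurable borel :: ('a \<Rightarrow> ennreal) set)"
    by (rule measurable_cong_sets; simp add: s)+
  show ?thesis using f
  proof (induction rule: borel_measurable_induct)
    case (cong f g)
    then have "f = g" by (intro ext) simp
    with cong show ?case by simp
  next
    case (set A)
    then show ?case
      using s by (simp add: emeasure_add_dirac[OF X])
  next
    case (mult u v)
    then show ?case using m1 m2 by (simp add: nn_integral_cmult distrib_left mult_ac)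
  next
    case (add u v)
    then show ?case using m1 m2 by (simp add: nn_integral_add distrib_left add_ac)
  next
    case (seq U)
    have "(\<integral>\<^sup>+x. (SUP i. U i x) \<partial>add_dirac X z r) = (SUP i. \<integral>\<^sup>+x. U i x \<partial>add_dirac X z r)"
      using seq m1 by (intro nn_integral_monotone_convergence_SUP) auto
    also have "\<dots> = (SUP i. (\<integral>\<^sup>+x. U i x \<partial>X) + ennreal z * U i r)"
      using seq by simp
    also have "\<dots> = (SUP i. \<integral>\<^sup>+x. U i x \<partial>X) + (SUP i. ennreal z * U i r)"
      using seq(3) by (intro ennreal_SUP_add)
        (auto simp: incseq_def le_fun_def intro!: nn_integral_mono mult_left_mono)
    also have "\<dots> = (\<integral>\<^sup>+x. (SUP i. U i x) \<partial>X) + ennreal z * (SUP i. U i r)"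
      using seq m2 by (subst nn_integral_monotone_convergence_SUP) (auto simp: SUP_mult_left_ennreal)
    finally show ?case by (simp add: SUP_apply image_comp)
  qed
qed

lemma integral_add_dirac:
  assumes X: "X \<in> fin_measures" and [measurable]: "f \<in> borel_measurable borel" and "bounded (range f)" and "0 \<le> z"
  shows "(\<integral>x. f x \<partial>add_dirac X z r) = (\<integral>x. f x \<partial>X) + z * f r"
proof -
  obtain B where B: "\<And>x. \<bar>f x\<bar> \<le> B" using assms(3) by (auto simp: bounded_iff)
  have fin: "(\<integral>\<^sup>+x. ennreal (g x) \<partial>\<mu>) < \<infinity>" if "\<mu> \<in> fin_measures" "\<And>x. g x \<le> B" for \<mu> :: "'a measure" and g
  proof -
    interpret finite_measure \<mu> using that by (simp add: fin_measures_def)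
    have "(\<integral>\<^sup>+x. ennreal (g x) \<partial>\<mu>) \<le> (\<integral>\<^sup>+x. ennreal B \<partial>\<mu>)"
      using that by (intro nn_integral_mono) (simp add: ennreal_leI)
    also have "\<dots> < \<infinity>" by (simp add: emeasure_eq_measure ennreal_mult_less_top)
    finally show ?thesis .
  qed
  have i: "integrable \<mu> f" if "\<mu> \<in> fin_measures" for \<mu>
  proof -
    interpret finite_measure \<mu> using that by (simp add: fin_measures_def)
    have "f \<in> borel_measurable \<mu>" using fin_measuresD(1)[OF that] measurable_cong_sets by (metis assms(2))
    then show ?thesis by (intro integrable_const_bound[of _ B]) (auto intro!: AE_I2 simp: B)
  qed
  have e: "enn2real (\<integral>\<^sup>+x. ennreal (g x) \<partial>add_dirac X z r) = enn2real (\<integral>\<^sup>+x. ennreal (g x) \<partial>X) + z * max 0 (g r)"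
    if [measurable]: "g \<in> borel_measurable borel" and gB: "\<And>x. g x \<le> B" for g
  proof -
    have "(\<integral>\<^sup>+x. ennreal (g x) \<partial>add_dirac X z r) = (\<integral>\<^sup>+x. ennreal (g x) \<partial>X) + ennreal z * ennreal (g r)"
      by (rule nn_integral_add_dirac[OF X]) simp
    also have "enn2real \<dots> = enn2real (\<integral>\<^sup>+x. ennreal (g x) \<partial>X) + enn2real (ennreal z * ennreal (g r))"
      using fin[OF X gB] by (intro enn2real_plus) (auto simp: ennreal_mult_less_top)
    also have "enn2real (ennreal z * ennreal (g r)) = z * max 0 (g r)"
      using assms(4) by (cases "0 \<le> g r") (auto simp: enn2real_mult max_def ennreal_neg)
    finally show ?thesis .
  qed
  have "- f x \<le> B" "f x \<le> B" for x using B[of x] by auto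
  then show ?thesis
    using e[of f] e[of "\<lambda>x. - f x"] unfolding real_lebesgue_integral_def[OF i[OF X]] real_lebesgue_integral_def[OF i[OF add_dirac_fin[OF X]]]
    by (simp add: max_def algebra_simps split: if_splits)
qed

lemma add_dirac_add_dirac:
  assumes X: "X \<in> fin_measures" and "0 \<le> w" "0 \<le> z"
  shows "add_dirac (add_dirac X w r) z r = add_dirac X (w + z) r"
  by (rule measure_eqI)
    (use assms in \<open>auto simp: emeasure_add_dirac add_dirac_fin ennreal_plus distrib_right add.assoc\<close>)

text \<open>\<open>ennreal z\<close> is 0 for negative z, so the path t |->
  \<open>add_dirac X t r\<close> stays at X up to time 0.\<close>

lemma add_dirac_nonpos:
  assumes X: "X \<in> fin_measures" and "z \<le> 0"
  shows "add_dirac X z r = X"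
  by (rule measure_eqI)
    (use assms fin_measuresD(1)[OF X] in \<open>auto simp: emeasure_add_dirac ennreal_neg\<close>)


section \<open>The stationary measure and its cluster intensity\<close>

locale cir =
  fixes \<alpha> :: real
    and a b :: "'e::metric_space \<Rightarrow> real"
    and m :: "'e measure"
    and Q :: "'e measure measure"
  assumes compact_E: "compact (UNIV :: 'e set)"
    and \<alpha>: "0 < \<alpha>" "\<alpha> < 1"
    and a: "a \<in> Cpp" and b: "b \<in> Cpp"
    and m: "m \<in> nonnull_measures"
    and Q: "cir_stationary \<alpha> a b m Q"
begin

text \<open>\<open>Cpp\<close> without the positive lower bound. Admitting 0 makes constants
  exponential sums, and the class stays within \<open>Bplus\<close>, where the Laplace functional is
  known.\<close>

definition cnn :: "('e \<Rightarrow> real) \<Rightarrow> bool" where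
  "cnn g \<longleftrightarrow> continuous_on UNIV g \<and> (\<forall>r. 0 \<le> g r)"

abbreviation pairing :: "'e measure \<Rightarrow> ('e \<Rightarrow> real) \<Rightarrow> real" where
  "pairing X f \<equiv> \<integral>r. f r \<partial>X"

lemma a_pos: "0 < a r" and b_pos: "0 < b r"
  using a b by (auto simp: Cpp_def intro: less_le_trans)

lemma a_cont: "continuous_on UNIV a" and b_cont: "continuous_on UNIV b"
  using a b by (auto simp: Cpp_def)

lemma continuous_measurable: "continuous_on UNIV (f :: 'e \<Rightarrow> real) \<Longrightarrow> f \<in> borel_measurable borel"
  by (rule borel_measurable_continuous_onI)

lemma a_meas [measurable]: "a \<in> borel_measurable borel" and b_meas [measurable]: "b \<in> borel_measurable borel"
  using a_cont b_cont continuous_measurable by auto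

lemma continuous_bounded:
  assumes "continuous_on UNIV (f :: 'e \<Rightarrow> real)"
  shows "bounded (range f)"
  using compact_continuous_image[OF assms compact_E] by (rule compact_imp_bounded)

lemma continuous_bound:
  assumes "continuous_on UNIV (f :: 'e \<Rightarrow> real)"
  obtains B where "0 < B" "\<And>r. \<bar>f r\<bar> \<le> B"
proof -
  obtain B where "\<And>r. \<bar>f r\<bar> \<le> B" using continuous_bounded[OF assms] by (auto simp: bounded_iff)
  then show ?thesis using that[of "max B 1"] by (meson less_max_iff_disj max.coboundedI1 zero_less_one)
qed

lemma continuous_integrable:
  assumes "continuous_on UNIV f" "X \<in> fin_measures"
  shows "integrable X (f :: 'e \<Rightarrow> real)"
proof -
  interpret finite_measure X using assms by (simp add: fin_measures_def)
  obtain B where "\<And>r. \<bar>f r\<bar> \<le> B" using continuous_bound[OF assms(1)] by blast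
  moreover have "f \<in> borel_measurable X"
    using continuous_measurable[OF assms(1)] measurable_cong_sets[OF fin_measuresD(1)[OF assms(2)] refl] by blast
  ultimately show ?thesis by (intro integrable_const_bound[of _ B]) auto
qed

lemma pairing_add_dirac:
  assumes "continuous_on UNIV f" "X \<in> fin_measures" "0 \<le> z"
  shows "pairing (add_dirac X z r) f = pairing X f + z * f r"
  using assms by (intro integral_add_dirac continuous_measurable continuous_bounded)

lemma Cpp_cnn: "g \<in> Cpp \<Longrightarrow> cnn g"
  by (auto simp: Cpp_def cnn_def intro: order_trans less_imp_le)

lemma cnn_continuous: "cnn g \<Longrightarrow> continuous_on UNIV g" and cnn_nonneg: "cnn g \<Longrightarrow> 0 \<le> g r"
  by (auto simp: cnn_def)

lemma cnn_Bplus: "cnn g \<Longrightarrow> g \<in> Bplus"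
  by (auto simp: Bplus_def cnn_def continuous_measurable continuous_bounded)

lemma cnn_add: "cnn f \<Longrightarrow> cnn g \<Longrightarrow> cnn (\<lambda>r. f r + g r)"
  and cnn_cmult: "0 \<le> c \<Longrightarrow> cnn f \<Longrightarrow> cnn (\<lambda>r. c * f r)"
  and cnn_const: "0 \<le> c \<Longrightarrow> cnn (\<lambda>r. c)"
  by (auto simp: cnn_def intro!: continuous_intros)

lemma pairing_nonneg: "cnn g \<Longrightarrow> 0 \<le> pairing X g"
  by (intro Bochner_Integration.integral_nonneg) (auto simp: cnn_def)

lemma pairing_add: "cnn f \<Longrightarrow> cnn g \<Longrightarrow> X \<in> fin_measures \<Longrightarrow> pairing X (\<lambda>r. f r + g r) = pairing X f + pairing X g"
  by (intro Bochner_Integration.integral_add continuous_integrable) (auto simp: cnn_def)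

lemma m_fin: "m \<in> fin_measures" and sets_m [measurable_cong]: "sets m = sets borel" and space_m: "space m = UNIV"
  and finite_m: "finite_measure m"
  using m fin_measuresD[of m] by (auto simp: nonnull_measures_def)

sublocale m: finite_measure m by (rule finite_m)

sublocale Q: prob_space Q using Q by (simp add: cir_stationary_def)

lemma sets_Q: "sets Q = sets (restrict_space weak_borel nonnull_measures)"
  using Q by (simp add: cir_stationary_def)

lemma space_Q: "space Q = nonnull_measures"
proof -
  have "space Q = space (restrict_space weak_borel nonnull_measures)"
    using sets_Q by (rule sets_eq_imp_space_eq)
  also have "\<dots> = nonnull_measures"
    by (auto simp: space_restrict_space weak_borel_def space_measure_of_conv nonnull_measures_def)
  finally show ?thesis .
qed

lemma space_Q_fin: "X \<in> space Q \<Longrightarrow> X \<in> fin_measures"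
  by (auto simp: space_Q nonnull_measures_def)

text \<open>Preimages of open sets under a pairing are subbasic for \<open>weak_topology\<close>.
  Measurability of the other functionals on \<open>Q\<close> below is derived from this one by
  limits.\<close>

lemma pairing_measurable [measurable]:
  assumes "continuous_on UNIV f"
  shows "(\<lambda>X. pairing X f) \<in> borel_measurable Q"
proof (rule borel_measurableI)
  fix U :: "real set" assume "open U"
  let ?V = "{X \<in> fin_measures. pairing X f \<in> U}"
  have "openin weak_topology ?V"
    unfolding weak_topology_def using assms \<open>open U\<close> continuous_bounded[OF assms]
    by (intro topology_generated_by_Basis) auto
  moreover have "{U :: 'e measure set. openin weak_topology U} \<subseteq> Pow fin_measures"
  proof safe
    fix U :: "'e measure set" and x assume "openin weak_topology U" "x \<in> U"
    then have "x \<in> topspace weak_topology" using openin_subset by blast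
    then show "x \<in> fin_measures" by (auto simp: weak_topology_def)
  qed
  ultimately have "?V \<in> sets weak_borel"
    unfolding weak_borel_def by (auto intro: in_measure_of)
  then have "nonnull_measures \<inter> ?V \<in> sets Q"
    unfolding sets_Q by (auto simp: sets_restrict_space)
  moreover have "nonnull_measures \<inter> ?V = (\<lambda>X. pairing X f) -` U \<inter> space Q"
    by (auto simp: space_Q nonnull_measures_def)
  ultimately show "(\<lambda>X. pairing X f) -` U \<inter> space Q \<in> sets Q" by simp
qed

definition \<psi> :: "('e \<Rightarrow> real) \<Rightarrow> real" where
  "\<psi> f = (\<integral>r. inverse (a r) * ln (1 + a r * inverse (b r) * f r powr \<alpha>) \<partial>m)"

lemma laplace_Q:
  assumes "cnn g"
  shows "has_bochner_integral Q (\<lambda>X. exp (- pairing X g)) (exp (- \<psi> g))"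
proof -
  have "integrable Q (\<lambda>X. exp (- pairing X g))"
    using pairing_nonneg[OF assms] cnn_continuous[OF assms]
    by (intro Q.integrable_const_bound[of _ 1]) auto
  then show ?thesis
    using Q cnn_Bplus[OF assms] by (auto simp: has_bochner_integral_iff cir_stationary_def \<psi>_def)
qed

text \<open>The rate that rewrites 1 + (a / b) f^\<alpha> in the Laplace functional as 1 +
  f^\<alpha> / \<beta>.\<close>

definition \<beta> :: "'e \<Rightarrow> real" where
  "\<beta> r = b r / a r"

lemma \<beta>_pos: "0 < \<beta> r"
  using a_pos b_pos by (simp add: \<beta>_def)

lemma relaxation: "relaxation \<alpha> (\<beta> r)"
  using \<alpha> \<beta>_pos by unfold_locales

abbreviation G :: "'e \<Rightarrow> real \<Rightarrow> real" where
  "G r \<equiv> relaxation.G \<alpha> (\<beta> r)"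

lemma G_nonneg: "0 \<le> G r w"
  by (rule relaxation.G_nonneg[OF relaxation])

lemma G_measurable [measurable]: "(\<lambda>x. G (fst x) (snd x)) \<in> borel_measurable (borel \<Otimes>\<^sub>M borel)"
proof -
  have [measurable]: "mlf \<alpha> \<in> borel_measurable borel"
    by (rule borel_measurable_continuous_onI[OF continuous_on_mlf[OF \<alpha>(1)]])
  show ?thesis
    unfolding relaxation.G_def[OF relaxation] unfolding \<beta>_def by measurable
qed

text \<open>The intensity of the clusters constituting the stationary measure: under it, a cluster of
  size \<open>w\<close> is placed at \<open>r\<close>.\<close>

definition dens :: "'e \<Rightarrow> real \<Rightarrow> real" where
  "dens r w = pos w * (\<alpha> / a r * (G r w / w))"

definition \<nu> :: "('e \<times> real) measure" where
  "\<nu> = density (m \<Otimes>\<^sub>M lborel) (\<lambda>x. ennreal (dens (fst x) (snd x)))"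

lemma dens_nonneg: "0 \<le> dens r w"
  using G_nonneg a_pos[of r] \<alpha> by (auto simp: dens_def indicator_def)

lemma dens_measurable [measurable]: "(\<lambda>x. dens (fst x) (snd x)) \<in> borel_measurable (borel \<Otimes>\<^sub>M borel)"
  unfolding dens_def by measurable

lemma sets_mlborel [measurable_cong]: "sets (m \<Otimes>\<^sub>M lborel) = sets (borel \<Otimes>\<^sub>M borel)"
  by (rule sets_pair_measure_cong[OF sets_m sets_lborel])

lemma sets_\<nu> [measurable_cong]: "sets \<nu> = sets (borel \<Otimes>\<^sub>M borel)"
  unfolding \<nu>_def sets_density by (rule sets_mlborel)

sublocale mlb: pair_sigma_finite m lborel ..

text \<open>\<open>\<nu>\<close> has infinite mass near w = 0, where \<open>dens\<close> is of order
  1 / w, so integrability has to be computed: Tonelli in w at fixed r, then in r over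
  \<open>m\<close>.\<close>

lemma has_bochner_integral_\<nu>_nonneg:
  assumes [measurable]: "u \<in> borel_measurable (borel \<Otimes>\<^sub>M borel)" and u0: "\<And>r w. 0 < w \<Longrightarrow> 0 \<le> u (r, w)"
    and hb: "\<And>r. has_bochner_integral lborel (\<lambda>w. pos w * (G r w / w * u (r, w))) (v r)"
    and v: "has_bochner_integral m (\<lambda>r. \<alpha> / a r * v r) I"
  shows "has_bochner_integral \<nu> u I"
proof -
  have v0: "0 \<le> \<alpha> / a r * v r" for r
  proof -
    have "0 \<le> v r" using hb[of r]
      by (rule has_bochner_integral_nonneg) (auto simp: indicator_def G_nonneg u0)
    then show ?thesis using \<alpha> a_pos[of r] by simp
  qed
  have [measurable]: "(\<lambda>x. ennreal (dens (fst x) (snd x))) \<in> borel_measurable (m \<Otimes>\<^sub>M lborel)" by measurable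
  have [measurable]: "u \<in> borel_measurable (m \<Otimes>\<^sub>M lborel)" by measurable
  have nn: "(\<integral>\<^sup>+x. ennreal \<bar>u x\<bar> \<partial>\<nu>) = ennreal I"
  proof -
    have "(\<integral>\<^sup>+x. ennreal \<bar>u x\<bar> \<partial>\<nu>) = (\<integral>\<^sup>+x. ennreal (dens (fst x) (snd x)) * ennreal \<bar>u x\<bar> \<partial>(m \<Otimes>\<^sub>M lborel))"
      unfolding \<nu>_def by (rule nn_integral_density) measurable
    also have "\<dots> = (\<integral>\<^sup>+r. \<integral>\<^sup>+w. ennreal (dens r w) * ennreal \<bar>u (r, w)\<bar> \<partial>lborel \<partial>m)"
      by (subst lborel.nn_integral_fst[symmetric]) (auto simp: measurable_cong_sets[OF sets_mlborel refl])
    also have "\<dots> = (\<integral>\<^sup>+r. ennreal (\<alpha> / a r * v r) \<partial>m)"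
    proof (rule nn_integral_cong)
      fix r
      have "(\<integral>\<^sup>+w. ennreal (dens r w) * ennreal \<bar>u (r, w)\<bar> \<partial>lborel) =
          (\<integral>\<^sup>+w. ennreal (\<alpha> / a r * (pos w * (G r w / w * u (r, w)))) \<partial>lborel)"
        using u0 dens_nonneg by (intro nn_integral_cong) (auto simp: dens_def indicator_def ennreal_mult'[symmetric] mult.assoc)
      also have "\<dots> = ennreal (LBINT w. \<alpha> / a r * (pos w * (G r w / w * u (r, w))))"
        using has_bochner_integral_mult_right[OF hb[of r], of "\<alpha> / a r"] \<alpha> a_pos[of r] G_nonneg u0
        by (intro nn_integral_eq_integral) (auto simp: has_bochner_integral_iff indicator_def)
      also have "\<dots> = ennreal (\<alpha> / a r * v r)"
        using has_bochner_integral_mult_right[OF hb[of r], of "\<alpha> / a r"] by (simp add: has_bochner_integral_iff)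
      finally show "(\<integral>\<^sup>+w. ennreal (dens r w) * ennreal \<bar>u (r, w)\<bar> \<partial>lborel) = ennreal (\<alpha> / a r * v r)" .
    qed
    also have "\<dots> = ennreal I"
      using v v0 by (subst nn_integral_eq_integral) (auto simp: has_bochner_integral_iff)
    finally show ?thesis .
  qed
  have I0: "0 \<le> I" using has_bochner_integral_nonneg[OF v v0] .
  have AE: "AE x in \<nu>. u x = \<bar>u x\<bar>"
    unfolding \<nu>_def using u0
    by (subst AE_density) (auto intro!: AE_I2 simp: dens_def indicator_def)
  have "has_bochner_integral \<nu> (\<lambda>x. \<bar>u x\<bar>) I"
    by (rule has_bochner_integral_nn_integral) (auto simp: nn I0)
  then show ?thesis
    by (rule has_bochner_integral_cong_AE[THEN iffD1, rotated -1]) (use AE in auto)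
qed

lemma \<psi>_integrable:
  assumes "cnn g"
  shows "has_bochner_integral m (\<lambda>r. inverse (a r) * ln (1 + a r * inverse (b r) * g r powr \<alpha>)) (\<psi> g)"
proof -
  have cp: "continuous_on UNIV (\<lambda>r. g r powr \<alpha>)"
    using assms \<alpha> by (intro continuous_on_powr' continuous_on_const) (auto simp: cnn_def)
  have "continuous_on UNIV (\<lambda>r. inverse (a r) * ln (1 + a r * inverse (b r) * g r powr \<alpha>))"
  proof (intro cp continuous_intros a_cont b_cont)
    show "\<forall>r\<in>UNIV. a r \<noteq> 0" "\<forall>r\<in>UNIV. b r \<noteq> 0" using a_pos b_pos by (auto simp: less_imp_neq[symmetric])
    have "0 \<le> a r * inverse (b r) * g r powr \<alpha>" for r
      using a_pos[of r] b_pos[of r] by simp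
    then show "\<forall>r\<in>UNIV. 1 + a r * inverse (b r) * g r powr \<alpha> \<noteq> 0"
      by (smt (verit))
  qed
  then show ?thesis using continuous_integrable[OF _ m_fin] by (simp add: has_bochner_integral_iff \<psi>_def)
qed

text \<open>Levy-Khintchine: this identifies \<open>\<nu>\<close> as the Levy measure of
  \<open>Q\<close>, by \<open>G_levy\<close> at c = g r integrated over the sites.\<close>

lemma \<nu>_one_minus_exp:
  assumes g: "cnn g"
  shows "has_bochner_integral \<nu> (\<lambda>x. 1 - exp (- (snd x * g (fst x)))) (\<psi> g)"
proof (rule has_bochner_integral_\<nu>_nonneg)
  have [measurable]: "g \<in> borel_measurable borel" using g by (auto simp: cnn_def intro: continuous_measurable)
  show "(\<lambda>x. 1 - exp (- (snd x * g (fst x)))) \<in> borel_measurable (borel \<Otimes>\<^sub>M borel)" by measurable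
  show "0 \<le> 1 - exp (- (snd (r, w) * g (fst (r, w))))" if "0 < w" for r w
    using that cnn_nonneg[OF g] by simp
  show "has_bochner_integral lborel (\<lambda>w. pos w * (G r w / w * (1 - exp (- (snd (r, w) * g (fst (r, w))))))) (ln (1 + g r powr \<alpha> / \<beta> r) / \<alpha>)" for r
    using relaxation.G_levy[OF relaxation cnn_nonneg[OF g], of r r] by (simp add: mult.commute)
  show "has_bochner_integral m (\<lambda>r. \<alpha> / a r * (ln (1 + g r powr \<alpha> / \<beta> r) / \<alpha>)) (\<psi> g)"
  proof -
    have "\<alpha> / a r * (ln (1 + g r powr \<alpha> / \<beta> r) / \<alpha>) = inverse (a r) * ln (1 + a r * inverse (b r) * g r powr \<alpha>)" for r
      using \<alpha> by (simp add: \<beta>_def divide_inverse mult_ac)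
    then show ?thesis using \<psi>_integrable[OF g] by simp
  qed
qed

lemma \<nu>_two_exp:
  assumes f: "cnn f" and g: "cnn g"
  shows "has_bochner_integral \<nu> (\<lambda>x. exp (- (snd x * f (fst x))) * (1 - exp (- (snd x * g (fst x))))) (\<psi> (\<lambda>r. f r + g r) - \<psi> f)"
proof -
  have "has_bochner_integral \<nu> (\<lambda>x. (1 - exp (- (snd x * (f (fst x) + g (fst x))))) - (1 - exp (- (snd x * f (fst x))))) (\<psi> (\<lambda>r. f r + g r) - \<psi> f)"
    by (intro has_bochner_integral_diff \<nu>_one_minus_exp cnn_add f g)
  then show ?thesis by (simp add: algebra_simps exp_add exp_diff exp_minus divide_inverse)
qed

text \<open>exp(K f g) is the ratio of the \<open>Q\<close>-mean of the product of exp(- <X, f>) and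
  exp(- <X, g>) to the product of their means.\<close>

definition K :: "('e \<Rightarrow> real) \<Rightarrow> ('e \<Rightarrow> real) \<Rightarrow> real" where
  "K f g = \<psi> f + \<psi> g - \<psi> (\<lambda>r. f r + g r)"

text \<open>Presents \<open>K\<close> as a Gram kernel in L2 of \<open>\<nu>\<close>, the source of
  its positive semidefiniteness.\<close>

lemma \<nu>_K:
  assumes f: "cnn f" and g: "cnn g"
  shows "has_bochner_integral \<nu> (\<lambda>x. (1 - exp (- (snd x * f (fst x)))) * (1 - exp (- (snd x * g (fst x))))) (K f g)"
proof -
  have "has_bochner_integral \<nu> (\<lambda>x. (1 - exp (- (snd x * g (fst x)))) - exp (- (snd x * f (fst x))) * (1 - exp (- (snd x * g (fst x))))) (\<psi> g - (\<psi> (\<lambda>r. f r + g r) - \<psi> f))"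
    by (intro has_bochner_integral_diff \<nu>_one_minus_exp \<nu>_two_exp f g)
  then show ?thesis by (simp add: K_def algebra_simps)
qed

text \<open>The exponential weight is what makes cluster size integrable: c^(\<alpha> - 1) in
  \<open>G_laplace\<close> blows up as c tends to 0, so the unweighted size has infinite integral.
  The lower bound on \<open>g\<close> keeps away from this singularity.\<close>

lemma \<nu>_size:
  assumes g: "g \<in> Cpp" and h: "cnn h"
  shows "integrable \<nu> (\<lambda>x. snd x * h (fst x) * exp (- (snd x * g (fst x))))"
proof -
  have g': "cnn g" using g by (rule Cpp_cnn)
  obtain c where c: "0 < c" "\<And>r. c \<le> g r" using g by (auto simp: Cpp_def)
  have gp: "0 < g r" for r using c(1) c(2)[of r] by linarith
  have cg: "continuous_on UNIV g" and ch: "continuous_on UNIV h" using g' h by (auto simp: cnn_def)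
  have [measurable]: "g \<in> borel_measurable borel" "h \<in> borel_measurable borel" using cg ch by (auto intro: continuous_measurable)
  let ?v = "\<lambda>r. h r * (g r powr (\<alpha> - 1) / (\<beta> r + g r powr \<alpha>))"
  have "continuous_on UNIV (\<lambda>r. \<alpha> / a r * ?v r)"
    unfolding \<beta>_def
  proof (intro continuous_intros continuous_on_powr' a_cont b_cont cg ch)
    have "0 < b r / a r + g r powr \<alpha>" for r
      using a_pos[of r] b_pos[of r] by (simp add: add_pos_nonneg)
    then show "\<forall>r\<in>UNIV. b r / a r + g r powr \<alpha> \<noteq> 0" by (simp add: less_imp_neq[symmetric])
  qed (use gp a_pos in \<open>auto simp: less_imp_neq[symmetric] less_imp_le\<close>)
  then have "has_bochner_integral m (\<lambda>r. \<alpha> / a r * ?v r) (\<integral>r. \<alpha> / a r * ?v r \<partial>m)"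
    using continuous_integrable[OF _ m_fin] by (simp add: has_bochner_integral_iff)
  then have "has_bochner_integral \<nu> (\<lambda>x. snd x * h (fst x) * exp (- (snd x * g (fst x)))) (\<integral>r. \<alpha> / a r * ?v r \<partial>m)"
  proof (rule has_bochner_integral_\<nu>_nonneg[rotated -1])
    show "has_bochner_integral lborel (\<lambda>w. pos w * (G r w / w * (snd (r, w) * h (fst (r, w)) * exp (- (snd (r, w) * g (fst (r, w))))))) (?v r)" for r
    proof -
      have "has_bochner_integral lborel (\<lambda>w. h r * (pos w * (G r w * exp (- g r * w)))) (?v r)"
        by (intro has_bochner_integral_mult_right relaxation.G_laplace[OF relaxation] gp)
      moreover have "(\<lambda>w. h r * (pos w * (G r w * exp (- g r * w)))) =
          (\<lambda>w. pos w * (G r w / w * (snd (r, w) * h (fst (r, w)) * exp (- (snd (r, w) * g (fst (r, w)))))))"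
        by (auto simp: fun_eq_iff indicator_def mult_ac)
      ultimately show ?thesis by simp
    qed
  qed (use h in \<open>auto simp: cnn_def\<close>)
  then show ?thesis by (simp add: has_bochner_integral_iff)
qed

section \<open>The Mecke formula for exponentials\<close>

lemma difference_quotient_exp:
  assumes "0 \<le> (x :: real)"
  shows "(\<lambda>n. (1 - exp (- x * (1 / real (Suc n)))) / (1 / real (Suc n))) \<longlonglongrightarrow> x"
    and "(1 - exp (- x * (1 / real (Suc n)))) / (1 / real (Suc n)) \<le> x"
    and "0 \<le> (1 - exp (- x * (1 / real (Suc n)))) / (1 / real (Suc n))"
proof -
  have "((\<lambda>t. 1 - exp (- x * t)) has_real_derivative x) (at 0)"
    by (auto intro!: derivative_eq_intros)
  then have "((\<lambda>t. (1 - exp (- x * t)) / t) \<longlongrightarrow> x) (at 0)"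
    by (simp add: has_field_derivative_iff)
  moreover have "filterlim (\<lambda>n. 1 / real (Suc n)) (at 0) sequentially"
    using LIMSEQ_Suc[OF lim_1_over_n] by (auto simp: filterlim_at)
  ultimately show "(\<lambda>n. (1 - exp (- x * (1 / real (Suc n)))) / (1 / real (Suc n))) \<longlonglongrightarrow> x"
    by (rule filterlim_compose)
  have "1 + (- x * (1 / real (Suc n))) \<le> exp (- x * (1 / real (Suc n)))" by (rule exp_ge_add_one_self)
  then have "1 - exp (- x * (1 / real (Suc n))) \<le> x * (1 / real (Suc n))" by linarith
  then show "(1 - exp (- x * (1 / real (Suc n)))) / (1 / real (Suc n)) \<le> x"
    by (subst pos_divide_le_eq) auto
  show "0 \<le> (1 - exp (- x * (1 / real (Suc n)))) / (1 / real (Suc n))"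
    using assms by (intro divide_nonneg_nonneg) auto
qed

lemma size_times_exp_le:
  assumes "0 \<le> (x :: real)" shows "x * exp (- x) \<le> 1"
proof -
  have "x \<le> exp x" using exp_ge_add_one_self[of x] by linarith
  then show ?thesis by (simp add: exp_minus divide_inverse[symmetric] divide_le_eq)
qed

text \<open>Differentiate the Laplace functional at \<open>g\<close> in direction \<open>h\<close>,
  along t = 1 / (n + 1): under \<open>Q\<close> the quotient tends to <X, h> exp(- <X, g>), and the
  derivative of the exponent is the \<open>\<nu>\<close>-integral.\<close>

lemma mecke_exp_nonneg:
  assumes g: "g \<in> Cpp" and h: "cnn h"
  shows "has_bochner_integral Q (\<lambda>X. pairing X h * exp (- pairing X g))
    (exp (- \<psi> g) * (\<integral>x. snd x * h (fst x) * exp (- (snd x * g (fst x))) \<partial>\<nu>))"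
proof -
  have g': "cnn g" using g by (rule Cpp_cnn)
  obtain c where c: "0 < c" "\<And>r. c \<le> g r" using g by (auto simp: Cpp_def)
  have cg: "continuous_on UNIV g" and ch: "continuous_on UNIV h" using g' h by (auto simp: cnn_def)
  have [measurable]: "g \<in> borel_measurable borel" "h \<in> borel_measurable borel" using cg ch by (auto intro: continuous_measurable)
  note [measurable] = pairing_measurable[OF cg] pairing_measurable[OF ch]
  obtain B where B: "0 < B" "\<And>r. \<bar>h r\<bar> \<le> B" using continuous_bound[OF ch] by blast
  define t where "t n = 1 / real (Suc n)" for n
  have t: "0 < t n" for n by (simp add: t_def)
  have th: "cnn (\<lambda>r. t n * h r)" for n using t[of n] by (intro cnn_cmult h) simp
  note dq = difference_quotient_exp[folded t_def]
  \<comment> \<open>Domination of <X, h> by a multiple of <X, g>, so that x exp(- x) \<le> 1 bounds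
    the difference quotients uniformly in X.\<close>
  have le: "pairing X h \<le> B / c * pairing X g" if "X \<in> fin_measures" for X
  proof -
    have "h r \<le> B / c * g r" for r
    proof -
      have "h r \<le> B / c * c" using B(2)[of r] c by simp
      also have "\<dots> \<le> B / c * g r" using B c by (intro mult_left_mono) auto
      finally show ?thesis .
    qed
    then have "pairing X h \<le> (\<integral>r. B / c * g r \<partial>X)"
      using that by (intro integral_mono continuous_integrable ch continuous_intros cg) auto
    then show ?thesis by simp
  qed
  define u where "u n X = exp (- pairing X g) * ((1 - exp (- pairing X h * t n)) / t n)" for n X
  have u_lim: "(\<lambda>n. u n X) \<longlonglongrightarrow> exp (- pairing X g) * pairing X h" for X
    unfolding u_def by (intro tendsto_mult tendsto_const dq pairing_nonneg h)
  have u_le: "norm (u n X) \<le> B / c" if "X \<in> space Q" for n X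
  proof -
    have X: "X \<in> fin_measures" using that by (rule space_Q_fin)
    have "u n X \<le> exp (- pairing X g) * pairing X h"
      unfolding u_def by (intro mult_left_mono dq pairing_nonneg h) simp
    also have "\<dots> \<le> exp (- pairing X g) * (B / c * pairing X g)"
      using le[OF X] by (intro mult_left_mono) auto
    also have "\<dots> = B / c * (pairing X g * exp (- pairing X g))" by simp
    also have "\<dots> \<le> B / c * 1"
      using B c by (intro mult_left_mono size_times_exp_le pairing_nonneg g') auto
    finally have "u n X \<le> B / c" by simp
    moreover have "0 \<le> u n X" unfolding u_def by (intro mult_nonneg_nonneg dq pairing_nonneg h) simp
    ultimately show ?thesis by simp
  qed
  have u_int: "has_bochner_integral Q (u n) ((exp (- \<psi> g) - exp (- \<psi> (\<lambda>r. g r + t n * h r))) / t n)" for n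
  proof -
    have "has_bochner_integral Q (\<lambda>X. (exp (- pairing X g) - exp (- pairing X (\<lambda>r. g r + t n * h r))) / t n)
        ((exp (- \<psi> g) - exp (- \<psi> (\<lambda>r. g r + t n * h r))) / t n)"
      using laplace_Q[OF g'] laplace_Q[OF cnn_add[OF g' th[of n]]] t[of n]
      by (intro has_bochner_integral_divide_zero has_bochner_integral_diff) auto
    moreover have "(exp (- pairing X g) - exp (- pairing X (\<lambda>r. g r + t n * h r))) / t n = u n X" if "X \<in> space Q" for X
      using pairing_add[OF g' th[of n] space_Q_fin[OF that]] t[of n]
      by (simp add: u_def exp_diff exp_add exp_minus field_simps)
    ultimately show ?thesis by (subst has_bochner_integral_cong[OF refl _ refl, symmetric]) auto
  qed
  have [measurable]: "u n \<in> borel_measurable Q" for n unfolding u_def[abs_def] by measurable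
  have lim1: "(\<lambda>n. \<integral>X. u n X \<partial>Q) \<longlonglongrightarrow> (\<integral>X. exp (- pairing X g) * pairing X h \<partial>Q)"
    and int1: "integrable Q (\<lambda>X. exp (- pairing X g) * pairing X h)"
  proof -
    have m1: "(\<lambda>X. exp (- pairing X g) * pairing X h) \<in> borel_measurable Q" by measurable
    have m2: "u n \<in> borel_measurable Q" for n by measurable
    have m3: "integrable Q (\<lambda>_. B / c)" by simp
    have m4: "AE X in Q. (\<lambda>n. u n X) \<longlonglongrightarrow> exp (- pairing X g) * pairing X h" by (rule AE_I2) (rule u_lim)
    have m5: "AE X in Q. norm (u n X) \<le> B / c" for n by (rule AE_I2) (rule u_le)
    show "(\<lambda>n. \<integral>X. u n X \<partial>Q) \<longlonglongrightarrow> (\<integral>X. exp (- pairing X g) * pairing X h \<partial>Q)"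
      by (rule integral_dominated_convergence[OF m1 m2 m3 m4 m5])
    show "integrable Q (\<lambda>X. exp (- pairing X g) * pairing X h)"
      by (rule integrable_dominated_convergence[OF m1 m2 m3 m4 m5])
  qed
  define v where "v n x = exp (- (snd x * g (fst x))) * ((1 - exp (- (snd x * h (fst x)) * t n)) / t n)" for n and x :: "'e \<times> real"
  define \<kappa> where "\<kappa> = (\<integral>x. snd x * h (fst x) * exp (- (snd x * g (fst x))) \<partial>\<nu>)"
  have AEw: "AE x in \<nu>. 0 < snd x"
    unfolding \<nu>_def by (subst AE_density) (auto intro!: AE_I2 simp: dens_def indicator_def)
  have v_int: "has_bochner_integral \<nu> (v n) ((\<psi> (\<lambda>r. g r + t n * h r) - \<psi> g) / t n)" for n
  proof -
    have "has_bochner_integral \<nu> (\<lambda>x. exp (- (snd x * g (fst x))) * (1 - exp (- (snd x * (t n * h (fst x))))) / t n)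
        ((\<psi> (\<lambda>r. g r + t n * h r) - \<psi> g) / t n)"
      by (intro has_bochner_integral_divide_zero \<nu>_two_exp g' th)
    then show ?thesis by (simp add: v_def[abs_def] mult_ac)
  qed
  have lim2: "(\<lambda>n. \<integral>x. v n x \<partial>\<nu>) \<longlonglongrightarrow> (\<integral>x. exp (- (snd x * g (fst x))) * (snd x * h (fst x)) \<partial>\<nu>)"
  proof (rule integral_dominated_convergence[where w = "\<lambda>x. snd x * h (fst x) * exp (- (snd x * g (fst x)))"])
    show "integrable \<nu> (\<lambda>x. snd x * h (fst x) * exp (- (snd x * g (fst x))))" by (rule \<nu>_size[OF g h])
    show "AE x in \<nu>. (\<lambda>n. v n x) \<longlonglongrightarrow> exp (- (snd x * g (fst x))) * (snd x * h (fst x))"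
      using AEw
    proof eventually_elim
      case (elim x)
      then have "0 \<le> snd x * h (fst x)" using cnn_nonneg[OF h] by simp
      then show ?case unfolding v_def by (intro tendsto_mult tendsto_const dq)
    qed
    show "AE x in \<nu>. norm (v n x) \<le> snd x * h (fst x) * exp (- (snd x * g (fst x)))" for n
      using AEw
    proof eventually_elim
      case (elim x)
      have x: "0 \<le> snd x * h (fst x)" using elim cnn_nonneg[OF h] by simp
      have "norm (e * y) \<le> z * e" if "0 \<le> y" "y \<le> z" "0 \<le> e" for e y z :: real
        using mult_left_mono[OF that(2,3)] that by (simp add: mult.commute)
      then show ?case unfolding v_def using dq(3)[OF x, of n] dq(2)[OF x, of n] exp_ge_zero by blast
    qed
  qed (auto simp: v_def)
  define d where "d n = \<psi> (\<lambda>r. g r + t n * h r) - \<psi> g" for n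
  have dlim: "(\<lambda>n. d n / t n) \<longlonglongrightarrow> \<kappa>"
    using lim2 v_int by (simp add: has_bochner_integral_iff d_def \<kappa>_def mult.commute)
  have t0: "t \<longlonglongrightarrow> 0" unfolding t_def[abs_def] using LIMSEQ_Suc[OF lim_1_over_n] by simp
  have d0: "d \<longlonglongrightarrow> 0"
  proof -
    have "(\<lambda>n. d n / t n * t n) \<longlonglongrightarrow> \<kappa> * 0" by (intro tendsto_mult dlim t0)
    then show ?thesis using t by (simp add: less_imp_neq[symmetric])
  qed
  have "(\<lambda>n. exp (- \<psi> g) * ((1 - exp (- d n)) / t n)) \<longlonglongrightarrow> exp (- \<psi> g) * \<kappa>"
  proof (intro tendsto_mult tendsto_const)
    have dn: "0 \<le> d n" for n
    proof -
      have "0 \<le> (\<integral>x. v n x \<partial>\<nu>)"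
      proof (rule integral_nonneg_AE)
        show "AE x in \<nu>. 0 \<le> v n x" using AEw
        proof eventually_elim
          case (elim x)
          then have "0 \<le> snd x * h (fst x)" using cnn_nonneg[OF h] by simp
          then show ?case unfolding v_def by (rule mult_nonneg_nonneg[OF exp_ge_zero dq(3)])
        qed
      qed
      then have "0 \<le> d n / t n" using v_int[of n] by (simp add: has_bochner_integral_iff d_def)
      then show ?thesis using t[of n] by (simp add: zero_le_divide_iff)
    qed
    \<comment> \<open>For d >= 0, exp(- d) \<le> 1 - d + d^2; with d n -> 0 and d n / t n ->
      \<kappa> this squeezes the outer difference quotient.\<close>
    have lower: "d n / t n - d n / t n * d n \<le> (1 - exp (- d n)) / t n" for n
    proof -
      have "exp (- d n) * (1 + d n) \<le> exp (- d n) * exp (d n)" by (intro mult_left_mono exp_ge_add_one_self) auto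
      then have "exp (- d n) * (1 + d n) \<le> 1" by (simp add: exp_minus)
      moreover have "1 \<le> (1 - d n + d n * d n) * (1 + d n)" using dn[of n] by (simp add: algebra_simps)
      ultimately have "exp (- d n) * (1 + d n) \<le> (1 - d n + d n * d n) * (1 + d n)" by linarith
      then have "exp (- d n) \<le> 1 - d n + d n * d n" using dn[of n] by (simp add: mult_le_cancel_right)
      then have "(d n - d n * d n) / t n \<le> (1 - exp (- d n)) / t n" using t[of n] by (intro divide_right_mono) auto
      then show ?thesis by (simp add: diff_divide_distrib)
    qed
    have upper: "(1 - exp (- d n)) / t n \<le> d n / t n" for n
      using exp_ge_add_one_self[of "- d n"] t[of n] by (intro divide_right_mono) auto
    have "(\<lambda>n. d n / t n - d n / t n * d n) \<longlonglongrightarrow> \<kappa> - \<kappa> * 0"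
      by (intro tendsto_diff tendsto_mult dlim d0)
    then have l: "(\<lambda>n. d n / t n - d n / t n * d n) \<longlonglongrightarrow> \<kappa>" by simp
    have e1: "\<forall>\<^sub>F n in sequentially. d n / t n - d n / t n * d n \<le> (1 - exp (- d n)) / t n"
      and e2: "\<forall>\<^sub>F n in sequentially. (1 - exp (- d n)) / t n \<le> d n / t n"
      by (intro always_eventually allI lower upper)+
    show "(\<lambda>n. (1 - exp (- d n)) / t n) \<longlonglongrightarrow> \<kappa>"
      by (rule tendsto_sandwich[OF e1 e2 l dlim])
  qed
  moreover have "exp (- \<psi> g) * ((1 - exp (- d n)) / t n) = (\<integral>X. u n X \<partial>Q)" for n
    using u_int[of n] t[of n] by (simp add: has_bochner_integral_iff d_def right_diff_distrib exp_add[symmetric])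
  ultimately have "(\<lambda>n. \<integral>X. u n X \<partial>Q) \<longlonglongrightarrow> exp (- \<psi> g) * \<kappa>" by simp
  then have "(\<integral>X. exp (- pairing X g) * pairing X h \<partial>Q) = exp (- \<psi> g) * \<kappa>"
    using lim1 LIMSEQ_unique by blast
  then show ?thesis using int1 by (simp add: has_bochner_integral_iff \<kappa>_def mult.commute)
qed

text \<open>Both sides are linear in \<open>h\<close>, so a signed \<open>h\<close> is written as
  the nonnegative h + B minus the constant B.\<close>

lemma mecke_exp:
  assumes g: "g \<in> Cpp" and h: "continuous_on UNIV h"
  shows "has_bochner_integral Q (\<lambda>X. pairing X h * exp (- pairing X g))
      (exp (- \<psi> g) * (\<integral>x. snd x * h (fst x) * exp (- (snd x * g (fst x))) \<partial>\<nu>))"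
    and "integrable \<nu> (\<lambda>x. snd x * h (fst x) * exp (- (snd x * g (fst x))))"
proof -
  obtain B where B: "0 < B" "\<And>r. \<bar>h r\<bar> \<le> B" using continuous_bound[OF h] by blast
  have "0 \<le> h r + B" for r using B(2)[of r] by linarith
  then have 1: "cnn (\<lambda>r. h r + B)" using h by (auto simp: cnn_def intro!: continuous_intros)
  have 2: "cnn (\<lambda>r. B)" using B by (intro cnn_const) simp
  have p: "pairing X h = pairing X (\<lambda>r. h r + B) - pairing X (\<lambda>r. B)" if "X \<in> fin_measures" for X
    using Bochner_Integration.integral_add[of X h "\<lambda>r. B"] continuous_integrable[OF h that] continuous_integrable[of "\<lambda>r. B", OF _ that]
    by simp
  have e: "snd x * h (fst x) * exp (- (snd x * g (fst x))) = snd x * (h (fst x) + B) * exp (- (snd x * g (fst x))) - snd x * B * exp (- (snd x * g (fst x)))" for x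
    by (simp add: algebra_simps)
  note i1 = \<nu>_size[OF g 1] and i2 = \<nu>_size[OF g 2]
  show "integrable \<nu> (\<lambda>x. snd x * h (fst x) * exp (- (snd x * g (fst x))))"
    unfolding e by (intro Bochner_Integration.integrable_diff i1 i2)
  have n: "(\<integral>x. snd x * h (fst x) * exp (- (snd x * g (fst x))) \<partial>\<nu>) =
     (\<integral>x. snd x * (h (fst x) + B) * exp (- (snd x * g (fst x))) \<partial>\<nu>) - (\<integral>x. snd x * B * exp (- (snd x * g (fst x))) \<partial>\<nu>)"
    unfolding e by (intro Bochner_Integration.integral_diff i1 i2)
  have "has_bochner_integral Q (\<lambda>X. pairing X (\<lambda>r. h r + B) * exp (- pairing X g) - pairing X (\<lambda>r. B) * exp (- pairing X g))
     (exp (- \<psi> g) * (\<integral>x. snd x * (h (fst x) + B) * exp (- (snd x * g (fst x))) \<partial>\<nu>) - exp (- \<psi> g) * (\<integral>x. snd x * B * exp (- (snd x * g (fst x))) \<partial>\<nu>))"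
    by (intro has_bochner_integral_diff mecke_exp_nonneg g 1 2)
  then show "has_bochner_integral Q (\<lambda>X. pairing X h * exp (- pairing X g))
      (exp (- \<psi> g) * (\<integral>x. snd x * h (fst x) * exp (- (snd x * g (fst x))) \<partial>\<nu>))"
    unfolding n right_diff_distrib[of "exp (- \<psi> g)"]
    by (rule has_bochner_integral_cong[THEN iffD1, rotated -1])
      (use p space_Q_fin in \<open>auto simp: left_diff_distrib\<close>)
qed

end

section \<open>Bernstein operators in several variables\<close>

text \<open>The de Casteljau recursion: Pascal's rule exhibits a Bernstein sum as a convex
  combination of two of lower degree, with original and shifted coefficients.\<close>

lemma Bernstein_sum_Suc:
  fixes c :: "nat \<Rightarrow> real"
  shows "(\<Sum>k\<le>Suc N. c k * Bernstein (Suc N) k x) =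
    (1 - x) * (\<Sum>k\<le>N. c k * Bernstein N k x) + x * (\<Sum>k\<le>N. c (Suc k) * Bernstein N k x)"
proof -
  have B: "Bernstein (Suc N) (Suc k) x = (1 - x) * (if k < N then Bernstein N (Suc k) x else 0) + x * Bernstein N k x" if "k \<le> N" for k
  proof (cases "k < N")
    case True
    then have "(1 - x) ^ (N - k) = (1 - x) * (1 - x) ^ (N - Suc k)"
      by (metis Suc_diff_Suc power_Suc)
    moreover have "(c1 + c2) * (x * q) * (u * p) = u * (c2 * (x * q) * p) + x * (c1 * q * (u * p))" for c1 c2 q u p :: real
      by (simp add: algebra_simps)
    note this[of "real (N choose k)" "real (N choose Suc k)" "x ^ k" "1 - x" "(1 - x) ^ (N - Suc k)"]
    ultimately show ?thesis using True by (simp add: Bernstein_def)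
  next
    case False
    then show ?thesis using that by (simp add: Bernstein_def)
  qed
  have "(\<Sum>k\<le>Suc N. c k * Bernstein (Suc N) k x) = c 0 * Bernstein (Suc N) 0 x + (\<Sum>k\<le>N. c (Suc k) * Bernstein (Suc N) (Suc k) x)"
    by (subst sum.atMost_Suc_shift) simp
  also have "(\<Sum>k\<le>N. c (Suc k) * Bernstein (Suc N) (Suc k) x) =
      (1 - x) * (\<Sum>k\<le>N. c (Suc k) * (if k < N then Bernstein N (Suc k) x else 0)) + x * (\<Sum>k\<le>N. c (Suc k) * Bernstein N k x)"
    by (simp add: B sum_distrib_left sum.distrib[symmetric] algebra_simps)
  also have "(\<Sum>k\<le>N. c (Suc k) * (if k < N then Bernstein N (Suc k) x else 0)) = (\<Sum>k<N. c (Suc k) * Bernstein N (Suc k) x)"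
    by (simp add: lessThan_Suc_atMost[symmetric])
  also have "c 0 * Bernstein (Suc N) 0 x + ((1 - x) * (\<Sum>k<N. c (Suc k) * Bernstein N (Suc k) x) + x * (\<Sum>k\<le>N. c (Suc k) * Bernstein N k x)) =
      (1 - x) * (c 0 * Bernstein N 0 x + (\<Sum>k<N. c (Suc k) * Bernstein N (Suc k) x)) + x * (\<Sum>k\<le>N. c (Suc k) * Bernstein N k x)"
    by (simp add: Bernstein_def distrib_left)
  also have "c 0 * Bernstein N 0 x + (\<Sum>k<N. c (Suc k) * Bernstein N (Suc k) x) = (\<Sum>k\<le>N. c k * Bernstein N k x)"
    by (cases N) (simp_all add: sum.atMost_Suc_shift lessThan_Suc_atMost del: sum.atMost_Suc sum.lessThan_Suc)
  finally show ?thesis .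
qed

lemma Bernstein_average:
  fixes c :: "nat \<Rightarrow> real"
  assumes "0 \<le> x" "x \<le> 1" "\<And>k. k \<le> N \<Longrightarrow> \<bar>c k\<bar> \<le> D"
  shows "\<bar>\<Sum>k\<le>N. c k * Bernstein N k x\<bar> \<le> D"
proof -
  have "\<bar>\<Sum>k\<le>N. c k * Bernstein N k x\<bar> \<le> (\<Sum>k\<le>N. D * Bernstein N k x)"
    using assms by (intro order_trans[OF sum_abs] sum_mono) (auto simp: abs_mult Bernstein_nonneg intro!: mult_right_mono)
  also have "\<dots> = D" by (simp add: sum_distrib_left[symmetric])
  finally show ?thesis .
qed

lemma Bernstein_diff:
  fixes c d :: "nat \<Rightarrow> real"
  assumes "0 \<le> x" "x \<le> 1" "\<And>k. k \<le> N \<Longrightarrow> \<bar>c k - d k\<bar> \<le> D"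
  shows "\<bar>(\<Sum>k\<le>N. c k * Bernstein N k x) - (\<Sum>k\<le>N. d k * Bernstein N k x)\<bar> \<le> D"
  using Bernstein_average[OF assms(1,2), of N "\<lambda>k. c k - d k" D] assms(3)
  by (simp add: left_diff_distrib sum_subtractf)

text \<open>By de Casteljau, each rise in degree adds D |s - t|, from the change of weights, to the
  bound for the two lower sums.\<close>

lemma Bernstein_Lipschitz:
  fixes c :: "nat \<Rightarrow> real"
  assumes st: "0 \<le> s" "s \<le> 1" "0 \<le> t" "t \<le> 1" and "\<And>k. k < N \<Longrightarrow> \<bar>c (Suc k) - c k\<bar> \<le> D"
  shows "\<bar>(\<Sum>k\<le>N. c k * Bernstein N k s) - (\<Sum>k\<le>N. c k * Bernstein N k t)\<bar> \<le> real N * D * \<bar>s - t\<bar>"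
  using assms(5)
proof (induction N arbitrary: c)
  case 0
  then show ?case by (simp add: Bernstein_def)
next
  case (Suc N)
  define A where "A x = (\<Sum>k\<le>N. c k * Bernstein N k x)" for x
  define B where "B x = (\<Sum>k\<le>N. c (Suc k) * Bernstein N k x)" for x
  have 1: "\<bar>A s - A t\<bar> \<le> real N * D * \<bar>s - t\<bar>" unfolding A_def using Suc by simp
  have 2: "\<bar>B s - B t\<bar> \<le> real N * D * \<bar>s - t\<bar>" unfolding B_def using Suc.prems by (intro Suc.IH) simp
  have "B t - A t = (\<Sum>k\<le>N. (c (Suc k) - c k) * Bernstein N k t)"
    by (simp add: A_def B_def sum_subtractf left_diff_distrib)
  then have 3: "\<bar>B t - A t\<bar> \<le> D" using Bernstein_average[OF st(3,4)] Suc.prems by (metis less_Suc_eq_le)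
  have "(\<Sum>k\<le>Suc N. c k * Bernstein (Suc N) k s) - (\<Sum>k\<le>Suc N. c k * Bernstein (Suc N) k t)
      = ((1 - s) * (A s - A t) + s * (B s - B t)) + (s - t) * (B t - A t)"
    unfolding Bernstein_sum_Suc A_def[symmetric] B_def[symmetric] by (simp add: algebra_simps)
  also have "\<bar>\<dots>\<bar> \<le> \<bar>(1 - s) * (A s - A t)\<bar> + \<bar>s * (B s - B t)\<bar> + \<bar>(s - t) * (B t - A t)\<bar>"
    by linarith
  also have "\<dots> \<le> (1 - s) * (real N * D * \<bar>s - t\<bar>) + s * (real N * D * \<bar>s - t\<bar>) + \<bar>s - t\<bar> * D"
    using 1 2 3 st by (intro add_mono) (auto simp: abs_mult intro!: mult_left_mono)
  also have "\<dots> = real (Suc N) * D * \<bar>s - t\<bar>" by (simp add: algebra_simps)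
  finally show ?case .
qed

lemma Bernstein_second_moment:
  assumes "0 < N"
  shows "(\<Sum>k\<le>N. (real k / real N - x)\<^sup>2 * Bernstein N k x) = x * (1 - x) / real N"
proof -
  have "(\<Sum>k\<le>N. (real k - real N * x)\<^sup>2 * Bernstein N k x) =
     (\<Sum>k\<le>N. real k * (real k - 1) * Bernstein N k x) + (1 - 2 * real N * x) * (\<Sum>k\<le>N. real k * Bernstein N k x) + (real N * x)\<^sup>2 * (\<Sum>k\<le>N. Bernstein N k x)"
    unfolding sum_distrib_left sum.distrib[symmetric]
    by (intro sum.cong) (auto simp: power2_eq_square algebra_simps)
  also have "\<dots> = real N * x * (1 - x)"
    unfolding sum_kk_Bernstein sum_k_Bernstein sum_Bernstein by (simp add: power2_eq_square algebra_simps)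
  finally have "(\<Sum>k\<le>N. (real k - real N * x)\<^sup>2 * Bernstein N k x) = real N * x * (1 - x)" .
  moreover have "(\<Sum>k\<le>N. (real k / real N - x)\<^sup>2 * Bernstein N k x) = (\<Sum>k\<le>N. (real k - real N * x)\<^sup>2 * Bernstein N k x) / (real N)\<^sup>2"
    unfolding sum_divide_distrib
  proof (rule sum.cong[OF refl])
    fix k
    have "real k / real N - x = (real k - real N * x) / real N" using assms by (simp add: field_simps)
    then show "(real k / real N - x)\<^sup>2 * Bernstein N k x = (real k - real N * x)\<^sup>2 * Bernstein N k x / (real N)\<^sup>2"
      by (simp add: power_divide)
  qed
  ultimately show ?thesis using assms by (simp add: power2_eq_square)
qed

text \<open>A modulus of the form \<epsilon> plus a quadratic replaces the usual split into near and
  far grid points: the quadratic averages to the second moment x (1 - x) / N.\<close>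

lemma Bernstein_error:
  fixes c :: "nat \<Rightarrow> real"
  assumes x: "0 \<le> x" "x \<le> 1" and N: "0 < N" and "0 \<le> C"
    and c: "\<And>k. k \<le> N \<Longrightarrow> \<bar>c k - v\<bar> \<le> \<epsilon> + C * (real k / real N - x)\<^sup>2"
  shows "\<bar>(\<Sum>k\<le>N. c k * Bernstein N k x) - v\<bar> \<le> \<epsilon> + C / real N"
proof -
  have "(\<Sum>k\<le>N. c k * Bernstein N k x) - v = (\<Sum>k\<le>N. (c k - v) * Bernstein N k x)"
    by (simp add: left_diff_distrib sum_subtractf sum_distrib_left[symmetric])
  also have "\<bar>\<dots>\<bar> \<le> (\<Sum>k\<le>N. (\<epsilon> + C * (real k / real N - x)\<^sup>2) * Bernstein N k x)"
    using x c by (intro order_trans[OF sum_abs] sum_mono) (auto simp: abs_mult Bernstein_nonneg intro!: mult_right_mono)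
  also have "\<dots> = \<epsilon> * (\<Sum>k\<le>N. Bernstein N k x) + C * (\<Sum>k\<le>N. (real k / real N - x)\<^sup>2 * Bernstein N k x)"
    by (simp add: distrib_right sum.distrib sum_distrib_left mult.assoc del: sum_Bernstein)
  also have "\<dots> = \<epsilon> + C * (x * (1 - x) / real N)"
    using Bernstein_second_moment[OF N] by simp
  also have "x * (1 - x) / real N \<le> 1 / real N"
    using x mult_mono[of x 1 "1 - x" 1] by (intro divide_right_mono) auto
  then have "\<epsilon> + C * (x * (1 - x) / real N) \<le> \<epsilon> + C * (1 / real N)"
    using assms(4) by (intro add_left_mono mult_left_mono)
  finally show ?thesis by simp
qed

definition cube :: "nat \<Rightarrow> (nat \<Rightarrow> real) set" where
  "cube n = {y. (\<forall>i<n. 0 \<le> y i \<and> y i \<le> 1) \<and> (\<forall>i\<ge>n. y i = 0)}"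

lemma cube_update: "y \<in> cube n \<Longrightarrow> i < n \<Longrightarrow> 0 \<le> s \<Longrightarrow> s \<le> 1 \<Longrightarrow> y(i := s) \<in> cube n"
  by (auto simp: cube_def)

text \<open>The tensor product operator, built one coordinate at a time: with index i the
  coordinates below i are smoothed and the others are still plain arguments of \<theta>.\<close>

fun bernstein_op :: "nat \<Rightarrow> nat \<Rightarrow> ((nat \<Rightarrow> real) \<Rightarrow> real) \<Rightarrow> (nat \<Rightarrow> real) \<Rightarrow> real" where
  "bernstein_op N 0 \<theta> y = \<theta> y"
| "bernstein_op N (Suc i) \<theta> y = (\<Sum>k\<le>N. bernstein_op N i \<theta> (y(i := real k / real N)) * Bernstein N k (y i))"

lemma grid: "0 < N \<Longrightarrow> k \<le> N \<Longrightarrow> 0 \<le> real k / real N \<and> real k / real N \<le> 1"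
  by simp

text \<open>Coordinate j >= i is not yet smoothed, and convex averaging over the earlier coordinates
  preserves any modulus in j.\<close>

lemma bernstein_op_modulus:
  assumes N: "0 < N" and \<theta>: "\<And>y j s t. y \<in> cube n \<Longrightarrow> j < n \<Longrightarrow> s \<in> {0..1} \<Longrightarrow> t \<in> {0..1} \<Longrightarrow> \<bar>\<theta> (y(j := s)) - \<theta> (y(j := t))\<bar> \<le> \<omega> s t"
  shows "i \<le> j \<Longrightarrow> j < n \<Longrightarrow> y \<in> cube n \<Longrightarrow> s \<in> {0..1} \<Longrightarrow> t \<in> {0..1} \<Longrightarrow>
     \<bar>bernstein_op N i \<theta> (y(j := s)) - bernstein_op N i \<theta> (y(j := t))\<bar> \<le> \<omega> s t"
proof (induction i arbitrary: y)
  case 0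
  then show ?case unfolding bernstein_op.simps by (intro \<theta>)
next
  case (Suc i)
  have "\<bar>bernstein_op N i \<theta> ((y(j := s))(i := real k / real N)) - bernstein_op N i \<theta> ((y(j := t))(i := real k / real N))\<bar> \<le> \<omega> s t" if k: "k \<le> N" for k
    using Suc.prems grid[OF N k] unfolding fun_upd_twist[of j i, OF less_imp_neq[of i j, symmetric], OF Suc_le_lessD[OF Suc.prems(1)]]
    by (intro Suc.IH cube_update) auto
  moreover have eq: "(y(j := s)) i = y i" "(y(j := t)) i = y i" and y: "0 \<le> y i" "y i \<le> 1"
    using Suc.prems by (auto simp: cube_def)
  ultimately show ?case unfolding bernstein_op.simps eq by (intro Bernstein_diff y)
qed

text \<open>Each new coordinate is smoothed while the modulus of \<theta> in it is still intact, so
  the one-variable errors simply add.\<close>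

lemma bernstein_op_error:
  assumes N: "0 < N" and "0 \<le> C"
    and \<theta>: "\<And>y j s t. y \<in> cube n \<Longrightarrow> j < n \<Longrightarrow> s \<in> {0..1} \<Longrightarrow> t \<in> {0..1} \<Longrightarrow> \<bar>\<theta> (y(j := s)) - \<theta> (y(j := t))\<bar> \<le> \<epsilon> + C * (s - t)\<^sup>2"
  shows "i \<le> n \<Longrightarrow> y \<in> cube n \<Longrightarrow> \<bar>bernstein_op N i \<theta> y - \<theta> y\<bar> \<le> real i * (\<epsilon> + C / real N)"
proof (induction i)
  case (Suc i)
  have y: "0 \<le> y i" "y i \<le> 1" using Suc.prems by (auto simp: cube_def)
  have "\<bar>bernstein_op N (Suc i) \<theta> y - bernstein_op N i \<theta> y\<bar> \<le> \<epsilon> + C / real N"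
    unfolding bernstein_op.simps
  proof (rule Bernstein_error[OF y N assms(2)])
    fix k assume "k \<le> N"
    then show "\<bar>bernstein_op N i \<theta> (y(i := real k / real N)) - bernstein_op N i \<theta> y\<bar> \<le> \<epsilon> + C * (real k / real N - y i)\<^sup>2"
      using bernstein_op_modulus[where n = n and \<omega> = "\<lambda>s t. \<epsilon> + C * (s - t)\<^sup>2" and i = i and j = i and y = y and s = "real k / real N" and t = "y i", OF N \<theta>]
        Suc.prems y grid[OF N, of k] by simp
  qed
  moreover have "\<bar>bernstein_op N i \<theta> y - \<theta> y\<bar> \<le> real i * (\<epsilon> + C / real N)" using Suc by simp
  moreover have "real (Suc i) * x = real i * x + x" for x :: real by (simp add: algebra_simps)
  note this[of "\<epsilon> + C / real N"]
  ultimately show ?case by linarith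
qed simp

text \<open>Within the coordinate being smoothed, neighbouring grid values differ by at most L / N,
  and \<open>Bernstein_Lipschitz\<close> returns N (L / N) = L: the constant does not deteriorate
  with \<open>N\<close>.\<close>

lemma bernstein_op_Lipschitz:
  assumes N: "0 < N" and \<theta>: "\<And>y j s t. y \<in> cube n \<Longrightarrow> j < n \<Longrightarrow> s \<in> {0..1} \<Longrightarrow> t \<in> {0..1} \<Longrightarrow> \<bar>\<theta> (y(j := s)) - \<theta> (y(j := t))\<bar> \<le> L * \<bar>s - t\<bar>"
  shows "i \<le> n \<Longrightarrow> j < n \<Longrightarrow> y \<in> cube n \<Longrightarrow> s \<in> {0..1} \<Longrightarrow> t \<in> {0..1} \<Longrightarrow>
     \<bar>bernstein_op N i \<theta> (y(j := s)) - bernstein_op N i \<theta> (y(j := t))\<bar> \<le> L * \<bar>s - t\<bar>"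
proof (induction i arbitrary: y s t)
  case 0
  then show ?case unfolding bernstein_op.simps by (intro \<theta>)
next
  case (Suc i)
  show ?case
  proof (cases "j = i")
    case True
    define c where "c k = bernstein_op N i \<theta> (y(i := real k / real N))" for k
    have "\<bar>c (Suc k) - c k\<bar> \<le> L / real N" if k: "k < N" for k
    proof -
      have "\<bar>c (Suc k) - c k\<bar> \<le> L * \<bar>real (Suc k) / real N - real k / real N\<bar>"
        unfolding c_def using Suc.prems True k grid[OF N, of k] grid[OF N, of "Suc k"] by (intro Suc.IH[unfolded True]) auto
      also have "real (Suc k) / real N - real k / real N = 1 / real N" by (simp add: diff_divide_distrib[symmetric])
      finally show ?thesis by simp
    qed
    then have "\<bar>(\<Sum>k\<le>N. c k * Bernstein N k s) - (\<Sum>k\<le>N. c k * Bernstein N k t)\<bar> \<le> real N * (L / real N) * \<bar>s - t\<bar>"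
      using Suc.prems by (intro Bernstein_Lipschitz) auto
    moreover have "real N * (L / real N) = L" using N by simp
    ultimately show ?thesis unfolding True bernstein_op.simps c_def fun_upd_upd fun_upd_same by (simp only:)
  next
    case False
    have "\<bar>bernstein_op N i \<theta> ((y(j := s))(i := real k / real N)) - bernstein_op N i \<theta> ((y(j := t))(i := real k / real N))\<bar> \<le> L * \<bar>s - t\<bar>" if k: "k \<le> N" for k
      using Suc.prems grid[OF N k] unfolding fun_upd_twist[OF False]
      by (intro Suc.IH cube_update) auto
    moreover have eq: "(y(j := s)) i = y i" "(y(j := t)) i = y i" and y: "0 \<le> y i" "y i \<le> 1"
      using Suc.prems False by (auto simp: cube_def)
    ultimately show ?thesis unfolding bernstein_op.simps eq by (intro Bernstein_diff y)
  qed
qed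

lemma coordinatewise_Lipschitz:
  assumes \<theta>: "\<And>y j s t. y \<in> cube n \<Longrightarrow> j < n \<Longrightarrow> s \<in> {0..1} \<Longrightarrow> t \<in> {0..1} \<Longrightarrow> \<bar>\<theta> (y(j := s)) - \<theta> (y(j := t))\<bar> \<le> L * \<bar>s - t\<bar>"
    and y: "y \<in> cube n" "y' \<in> cube n"
  shows "\<bar>\<theta> y - \<theta> y'\<bar> \<le> (\<Sum>j<n. L * \<bar>y j - y' j\<bar>)"
proof -
  \<comment> \<open>Hybrid points: coordinates below i are already taken from \<open>y'\<close>, the
    rest still from \<open>y\<close>.\<close>
  define h where "h i j = (if j < i then y' j else y j)" for i j
  have "\<bar>\<theta> y - \<theta> (h i)\<bar> \<le> (\<Sum>j<i. L * \<bar>y j - y' j\<bar>)" if "i \<le> n" for i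
    using that
  proof (induction i)
    case 0
    have "h 0 = y" by (auto simp: h_def)
    then show ?case by simp
  next
    case (Suc i)
    have hc: "h i \<in> cube n" using y by (auto simp: cube_def h_def)
    have "h (Suc i) = (h i)(i := y' i)" by (auto simp: h_def fun_eq_iff)
    moreover have "h i = (h i)(i := y i)" by (auto simp: h_def fun_eq_iff)
    moreover have "\<bar>\<theta> ((h i)(i := y i)) - \<theta> ((h i)(i := y' i))\<bar> \<le> L * \<bar>y i - y' i\<bar>"
      using Suc.prems y by (intro \<theta> hc) (auto simp: cube_def)
    ultimately have "\<bar>\<theta> (h i) - \<theta> (h (Suc i))\<bar> \<le> L * \<bar>y i - y' i\<bar>" by metis
    then show ?case using Suc by simp
  qed
  from this[of n] have "\<bar>\<theta> y - \<theta> (h n)\<bar> \<le> (\<Sum>j<n. L * \<bar>y j - y' j\<bar>)" by simp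
  moreover have "h n = y'"
  proof
    fix j show "h n j = y' j" using y by (cases "j < n") (auto simp: h_def cube_def)
  qed
  ultimately show ?thesis by simp
qed

lemma compact_cube: "compact (cube n)"
proof -
  have "cube n = PiE UNIV (\<lambda>i. if i < n then {0..1} else {0})"
  proof (rule set_eqI)
    fix y :: "nat \<Rightarrow> real"
    have "y \<in> cube n \<longleftrightarrow> (\<forall>i. y i \<in> (if i < n then {0..1} else {0}))"
    proof
      assume "y \<in> cube n"
      then show "\<forall>i. y i \<in> (if i < n then {0..1} else {0})" by (simp add: cube_def)
    next
      assume *: "\<forall>i. y i \<in> (if i < n then {0..1} else {0})"
      then have "0 \<le> y i \<and> y i \<le> 1" if "i < n" for i using that spec[OF *, of i] by simp
      moreover have "y i = 0" if "n \<le> i" for i using that spec[OF *, of i] by simp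
      ultimately show "y \<in> cube n" by (simp add: cube_def)
    qed
    then show "y \<in> cube n \<longleftrightarrow> y \<in> PiE UNIV (\<lambda>i. if i < n then {0..1} else {0})"
      by (simp add: PiE_UNIV_domain Pi_iff)
  qed
  moreover have "compactin (product_topology (\<lambda>_. euclidean) UNIV) (PiE UNIV (\<lambda>i. if i < n then {0..1::real} else {0}))"
    by (subst compactin_PiE) auto
  ultimately show ?thesis by (simp add: euclidean_product_topology)
qed

text \<open>The metric on sequences sums the coordinate distances, cut at 1, with weights (1/2)^k;
  the 2 is the total weight.\<close>

lemma dist_fun_upd_le:
  fixes y :: "nat \<Rightarrow> real"
  shows "dist (y(i := s)) (y(i := t)) \<le> 2 * \<bar>s - t\<bar>"
proof -
  let ?f = "\<lambda>k. (1/2)^k * min (dist ((y(i := s)) (from_nat k)) ((y(i := t)) (from_nat k))) 1"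
  have g: "(\<lambda>k. (1/2)^k * \<bar>s - t\<bar>) sums (2 * \<bar>s - t\<bar>)"
    using sums_mult2[OF geometric_sums[of "1/2::real"], of "\<bar>s - t\<bar>"] by simp
  have le: "?f k \<le> (1/2)^k * \<bar>s - t\<bar>" for k
    by (intro mult_left_mono) (auto simp: dist_real_def)
  have "summable ?f"
    by (rule summable_comparison_test'[OF sums_summable[OF g], of 0]) (use le in simp)
  then have "suminf ?f \<le> 2 * \<bar>s - t\<bar>"
    using suminf_le[OF le _ sums_summable[OF g]] sums_unique[OF g] by simp
  then show ?thesis by (simp add: dist_fun_def)
qed

section \<open>Approximation by exponential sums\<close>

context cir
begin

text \<open>Functions of a measure and a site: the coefficients vary with the site, the exponents do
  not.\<close>

definition exp_sum :: "(('e \<Rightarrow> real) \<times> ('e \<Rightarrow> real)) list \<Rightarrow> 'e measure \<Rightarrow> 'e \<Rightarrow> real" where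
  "exp_sum xs X r = (\<Sum>(c, g)\<leftarrow>xs. c r * exp (- pairing X g))"

definition valid :: "(('e \<Rightarrow> real) \<times> ('e \<Rightarrow> real)) list \<Rightarrow> bool" where
  "valid xs \<longleftrightarrow> (\<forall>(c, g) \<in> set xs. continuous_on UNIV c \<and> cnn g)"

definition ES :: "('e measure \<Rightarrow> 'e \<Rightarrow> real) \<Rightarrow> bool" where
  "ES V \<longleftrightarrow> (\<exists>xs. valid xs \<and> (\<forall>X\<in>fin_measures. \<forall>r. V X r = exp_sum xs X r))"

text \<open>The uniform closure of \<open>ES\<close>. Measurability, integrability and the Mecke
  formula are checked on exponential sums and survive uniform limits.\<close>

definition NN :: "('e measure \<Rightarrow> 'e \<Rightarrow> real) \<Rightarrow> bool" where
  "NN V \<longleftrightarrow> (\<forall>\<epsilon>>0. \<exists>W. ES W \<and> (\<forall>X\<in>fin_measures. \<forall>r. \<bar>V X r - W X r\<bar> \<le> \<epsilon>))"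

lemma exp_sum_simps: "exp_sum [] X r = 0" "exp_sum ((c, g) # xs) X r = c r * exp (- pairing X g) + exp_sum xs X r"
  "exp_sum (xs @ ys) X r = exp_sum xs X r + exp_sum ys X r"
  by (auto simp: exp_sum_def)

lemma valid_simps: "valid []" "valid ((c, g) # xs) \<longleftrightarrow> continuous_on UNIV c \<and> cnn g \<and> valid xs"
  "valid (xs @ ys) \<longleftrightarrow> valid xs \<and> valid ys"
  by (auto simp: valid_def)

lemma ES_cong: "ES V \<Longrightarrow> (\<And>X r. X \<in> fin_measures \<Longrightarrow> V X r = W X r) \<Longrightarrow> ES W"
  by (auto simp: ES_def)

lemma ES_coeff: "continuous_on UNIV c \<Longrightarrow> ES (\<lambda>X r. c r)"
  unfolding ES_def by (intro exI[of _ "[(c, \<lambda>_. 0)]"]) (auto simp: valid_simps exp_sum_simps cnn_def)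

lemma ES_exp: "cnn g \<Longrightarrow> ES (\<lambda>X r. exp (- pairing X g))"
  unfolding ES_def by (intro exI[of _ "[(\<lambda>_. 1, g)]"]) (auto simp: valid_simps exp_sum_simps)

lemma ES_add:
  assumes "ES V" "ES W"
  shows "ES (\<lambda>X r. V X r + W X r)"
proof -
  obtain xs ys where "valid xs" "valid ys" "\<And>X r. X \<in> fin_measures \<Longrightarrow> V X r = exp_sum xs X r" "\<And>X r. X \<in> fin_measures \<Longrightarrow> W X r = exp_sum ys X r"
    using assms by (auto simp: ES_def)
  then show ?thesis unfolding ES_def by (intro exI[of _ "xs @ ys"]) (auto simp: valid_simps exp_sum_simps)
qed

lemma ES_mult_single:
  assumes "valid ys" "continuous_on UNIV c" "cnn g"
  shows "ES (\<lambda>X r. c r * exp (- pairing X g) * exp_sum ys X r)"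
  using assms(1)
proof (induction ys)
  case Nil
  show ?case using ES_coeff[of "\<lambda>_. 0"] by (simp add: exp_sum_simps)
next
  case (Cons y ys)
  obtain d h where y: "y = (d, h)" by (cases y)
  have 1: "continuous_on UNIV d" "cnn h" "valid ys" using Cons.prems by (auto simp: y valid_simps)
  have "ES (\<lambda>X r. (c r * d r) * exp (- pairing X (\<lambda>r. g r + h r)))"
    unfolding ES_def using assms 1
    by (intro exI[of _ "[(\<lambda>r. c r * d r, \<lambda>r. g r + h r)]"]) (auto simp: valid_simps exp_sum_simps intro!: continuous_intros cnn_add)
  from ES_add[OF this Cons.IH[OF 1(3)]] show ?case
    by (rule ES_cong) (simp add: y exp_sum_simps pairing_add[OF assms(3) 1(2)] exp_add[symmetric] algebra_simps)
qed

lemma ES_mult: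
  assumes "ES V" "ES W"
  shows "ES (\<lambda>X r. V X r * W X r)"
proof -
  obtain xs ys where xs: "valid xs" "\<And>X r. X \<in> fin_measures \<Longrightarrow> V X r = exp_sum xs X r"
    and ys: "valid ys" "\<And>X r. X \<in> fin_measures \<Longrightarrow> W X r = exp_sum ys X r"
    using assms by (auto simp: ES_def)
  have "ES (\<lambda>X r. exp_sum xs X r * exp_sum ys X r)"
    using xs(1)
  proof (induction xs)
    case Nil
    show ?case using ES_coeff[of "\<lambda>_. 0"] by (simp add: exp_sum_simps)
  next
    case (Cons x xs)
    obtain c g where x: "x = (c, g)" by (cases x)
    have "ES (\<lambda>X r. c r * exp (- pairing X g) * exp_sum ys X r + exp_sum xs X r * exp_sum ys X r)"
      using Cons by (intro ES_add ES_mult_single ys) (auto simp: x valid_simps)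
    then show ?case by (simp add: x exp_sum_simps distrib_right)
  qed
  then show ?thesis by (rule ES_cong) (simp add: xs ys)
qed

lemma ES_const: "ES (\<lambda>X r. c)"
  by (rule ES_coeff) simp

lemma ES_sum: "finite I \<Longrightarrow> (\<And>i. i \<in> I \<Longrightarrow> ES (V i)) \<Longrightarrow> ES (\<lambda>X r. \<Sum>i\<in>I. V i X r)"
  by (induction I rule: finite_induct) (auto intro: ES_const ES_add)

lemma ES_power: "ES V \<Longrightarrow> ES (\<lambda>X r. V X r ^ k)"
  by (induction k) (auto intro: ES_const ES_mult)

lemma ES_Bernstein: 
  assumes "ES V" shows "ES (\<lambda>X r. Bernstein N k (V X r))"
proof -
  have "ES (\<lambda>X r. real (N choose k) * V X r ^ k * (1 + (- 1) * V X r) ^ (N - k))"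
    by (intro ES_mult ES_power ES_add ES_const assms)
  then show ?thesis by (simp add: Bernstein_def)
qed

lemma ES_bounded:
  assumes "ES V"
  obtains B where "0 < B" "\<And>X r. X \<in> fin_measures \<Longrightarrow> \<bar>V X r\<bar> \<le> B"
proof -
  obtain xs where xs: "valid xs" "\<And>X r. X \<in> fin_measures \<Longrightarrow> V X r = exp_sum xs X r"
    using assms by (auto simp: ES_def)
  have "\<exists>B>0. \<forall>X r. \<bar>exp_sum xs X r\<bar> \<le> B" using xs(1)
  proof (induction xs)
    case Nil
    then show ?case by (auto simp: exp_sum_simps intro: exI[of _ 1])
  next
    case (Cons x xs)
    obtain c g where x: "x = (c, g)" by (cases x)
    obtain B where B: "B > 0" "\<And>X r. \<bar>exp_sum xs X r\<bar> \<le> B" using Cons by (auto simp: x valid_simps)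
    have c: "continuous_on UNIV c" and g: "cnn g" using Cons.prems by (auto simp: x valid_simps)
    obtain C where C: "0 < C" "\<And>r. \<bar>c r\<bar> \<le> C" using continuous_bound[OF c] by blast
    have "\<bar>exp_sum (x # xs) X r\<bar> \<le> C + B" for X r
    proof -
      have "\<bar>c r * exp (- pairing X g)\<bar> \<le> C * 1"
        unfolding abs_mult using C pairing_nonneg[OF g, of X] by (intro mult_mono) auto
      then show ?thesis using B(2)[of X r] unfolding x exp_sum_simps by linarith
    qed
    then show ?case using B C by (intro exI[of _ "C + B"]) auto
  qed
  then show ?thesis using that xs(2) by auto
qed

lemma NN_approx:
  assumes "NN V" "0 < \<epsilon>"
  obtains W where "ES W" "\<And>X r. X \<in> fin_measures \<Longrightarrow> \<bar>V X r - W X r\<bar> \<le> \<epsilon>"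
  using assms unfolding NN_def by blast

lemma NN_bounded:
  assumes "NN V"
  obtains B where "0 < B" "\<And>X r. X \<in> fin_measures \<Longrightarrow> \<bar>V X r\<bar> \<le> B"
proof -
  obtain W where W: "ES W" "\<And>X r. X \<in> fin_measures \<Longrightarrow> \<bar>V X r - W X r\<bar> \<le> 1"
    using NN_approx[OF assms zero_less_one] by blast
  obtain B where B: "0 < B" "\<And>X r. X \<in> fin_measures \<Longrightarrow> \<bar>W X r\<bar> \<le> B" using ES_bounded[OF W(1)] by blast
  have "\<bar>V X r\<bar> \<le> B + 1" if "X \<in> fin_measures" for X r
    using W(2)[OF that, of r] B(2)[OF that, of r] by linarith
  then show ?thesis using that[of "B + 1"] B by auto
qed

lemma ES_NN: "ES V \<Longrightarrow> NN V"
  by (auto simp: NN_def intro!: exI[of _ V])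

lemma NN_add:
  assumes "NN V" "NN W"
  shows "NN (\<lambda>X r. V X r + W X r)"
  unfolding NN_def
proof (intro allI impI)
  fix \<epsilon> :: real assume "0 < \<epsilon>"
  then have e: "0 < \<epsilon> / 2" by simp
  obtain V' where V': "ES V'" "\<And>X r. X \<in> fin_measures \<Longrightarrow> \<bar>V X r - V' X r\<bar> \<le> \<epsilon> / 2"
    using NN_approx[OF assms(1) e] by blast
  obtain W' where W': "ES W'" "\<And>X r. X \<in> fin_measures \<Longrightarrow> \<bar>W X r - W' X r\<bar> \<le> \<epsilon> / 2"
    using NN_approx[OF assms(2) e] by blast
  have "\<bar>V X r + W X r - (V' X r + W' X r)\<bar> \<le> \<epsilon>" if "X \<in> fin_measures" for X r
    using V'(2)[OF that, of r] W'(2)[OF that, of r] by linarith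
  then show "\<exists>U. ES U \<and> (\<forall>X\<in>fin_measures. \<forall>r. \<bar>V X r + W X r - U X r\<bar> \<le> \<epsilon>)"
    using ES_add[OF V'(1) W'(1)] by blast
qed

lemma NN_mult:
  assumes "NN V" "NN W"
  shows "NN (\<lambda>X r. V X r * W X r)"
  unfolding NN_def
proof (intro allI impI)
  fix \<epsilon> :: real assume \<epsilon>: "0 < \<epsilon>"
  obtain B where B: "0 < B" "\<And>X r. X \<in> fin_measures \<Longrightarrow> \<bar>V X r\<bar> \<le> B" using NN_bounded[OF assms(1)] by blast
  have e1: "0 < \<epsilon> / (2 * B)" using \<epsilon> B by simp
  obtain W' where W': "ES W'" "\<And>X r. X \<in> fin_measures \<Longrightarrow> \<bar>W X r - W' X r\<bar> \<le> \<epsilon> / (2 * B)"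
    using NN_approx[OF assms(2) e1] by blast
  obtain C where C: "0 < C" "\<And>X r. X \<in> fin_measures \<Longrightarrow> \<bar>W' X r\<bar> \<le> C" using ES_bounded[OF W'(1)] by blast
  have e2: "0 < \<epsilon> / (2 * C)" using \<epsilon> C by simp
  obtain V' where V': "ES V'" "\<And>X r. X \<in> fin_measures \<Longrightarrow> \<bar>V X r - V' X r\<bar> \<le> \<epsilon> / (2 * C)"
    using NN_approx[OF assms(1) e2] by blast
  have "\<bar>V X r * W X r - V' X r * W' X r\<bar> \<le> \<epsilon>" if "X \<in> fin_measures" for X r
  proof -
    have "V X r * W X r - V' X r * W' X r = V X r * (W X r - W' X r) + (V X r - V' X r) * W' X r"
      by (simp add: algebra_simps)
    also have "\<bar>\<dots>\<bar> \<le> \<bar>V X r\<bar> * \<bar>W X r - W' X r\<bar> + \<bar>V X r - V' X r\<bar> * \<bar>W' X r\<bar>"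
      by (metis abs_mult abs_triangle_ineq)
    also have "\<dots> \<le> B * (\<epsilon> / (2 * B)) + \<epsilon> / (2 * C) * C"
      using B C V' W' that \<epsilon> by (intro add_mono mult_mono) auto
    also have "\<dots> = \<epsilon>" using B C by simp
    finally show ?thesis .
  qed
  then show "\<exists>U. ES U \<and> (\<forall>X\<in>fin_measures. \<forall>r. \<bar>V X r * W X r - U X r\<bar> \<le> \<epsilon>)"
    using ES_mult[OF V'(1) W'(1)] by blast
qed

text \<open>The substitution y_i = exp(- <X, f_i>), for nonnegative f_i, sends all measures into the
  compact cube, and polynomials in y are exponential sums since products add exponents.\<close>

definition expc :: "nat \<Rightarrow> (nat \<Rightarrow> 'e \<Rightarrow> real) \<Rightarrow> 'e measure \<Rightarrow> nat \<Rightarrow> real" where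
  "expc n f X i = (if i < n then exp (- pairing X (f i)) else 0)"

lemma expc_cube: "(\<And>i. i < n \<Longrightarrow> cnn (f i)) \<Longrightarrow> expc n f X \<in> cube n"
  by (auto simp: expc_def cube_def pairing_nonneg)

lemma ES_bernstein_op:
  assumes N: "0 < N" and f: "\<And>i. i < n \<Longrightarrow> cnn (f i)" and \<theta>: "\<And>y. y \<in> cube n \<Longrightarrow> continuous_on UNIV (\<lambda>r. \<theta> r y)"
  shows "ES (\<lambda>X r. bernstein_op N n (\<theta> r) (expc n f X))"
proof -
  \<comment> \<open>Generalised to coordinates from i on frozen at a point of the cube, so that the
    induction can insert grid values there.\<close>
  have "ES (\<lambda>X r. bernstein_op N i (\<theta> r) (\<lambda>j. if j < i then exp (- pairing X (f j)) else c j))" if "i \<le> n" "c \<in> cube n" for i c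
    using that
  proof (induction i arbitrary: c)
    case 0
    then show ?case using \<theta> by (auto intro: ES_coeff)
  next
    case (Suc i)
    have e: "(\<lambda>j. if j < Suc i then exp (- pairing X (f j)) else c j)(i := x) =
        (\<lambda>j. if j < i then exp (- pairing X (f j)) else (c(i := x)) j)" for x X
      by (auto simp: fun_eq_iff)
    show ?case unfolding bernstein_op.simps e
    proof (intro ES_sum finite_atMost ES_mult)
      fix k assume "k \<in> {..N}"
      then show "ES (\<lambda>X r. bernstein_op N i (\<theta> r) (\<lambda>j. if j < i then exp (- pairing X (f j)) else (c(i := real k / real N)) j))"
        using Suc.prems grid[OF N, of k] by (intro Suc.IH cube_update) auto
      have "ES (\<lambda>X r. Bernstein N k (exp (- pairing X (f i))))"
        using Suc.prems by (intro ES_Bernstein ES_exp f) auto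
      then show "ES (\<lambda>X r. Bernstein N k (if i < Suc i then exp (- pairing X (f i)) else c i))" by simp
    qed
  qed
  from this[of n "\<lambda>_. 0"] show ?thesis by (simp add: expc_def[abs_def] cube_def)
qed

text \<open>A Stone-Weierstrass statement with a parameter r, by explicit Bernstein polynomials,
  whose coefficients are values of \<theta> at grid points and so depend continuously on r.\<close>

lemma NN_continuous:
  assumes f: "\<And>i. i < n \<Longrightarrow> cnn (f i)" and \<theta>: "continuous_on (UNIV \<times> cube n) (\<lambda>(r, y). \<theta> r y)"
  shows "NN (\<lambda>X r. \<theta> r (expc n f X))"
  unfolding NN_def
proof (intro allI impI)
  fix \<epsilon> :: real assume \<epsilon>: "0 < \<epsilon>"
  have K: "compact ((UNIV :: 'e set) \<times> cube n)" by (intro compact_Times compact_E compact_cube)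
  have "bounded ((\<lambda>(r, y). \<theta> r y) ` (UNIV \<times> cube n))"
    by (intro compact_imp_bounded compact_continuous_image \<theta> K)
  then obtain M where M: "\<And>r y. y \<in> cube n \<Longrightarrow> \<bar>\<theta> r y\<bar> \<le> M" by (fastforce simp: bounded_iff)
  define \<epsilon>' where "\<epsilon>' = \<epsilon> / (2 * (real n + 1))"
  have \<epsilon>': "0 < \<epsilon>'" using \<epsilon> by (simp add: \<epsilon>'_def)
  have "uniformly_continuous_on (UNIV \<times> cube n) (\<lambda>(r, y). \<theta> r y)"
    by (rule compact_uniformly_continuous[OF \<theta> K])
  then obtain d where d: "0 < d" "\<And>r y r' y'. y \<in> cube n \<Longrightarrow> y' \<in> cube n \<Longrightarrow> dist (r', y') (r, y) < d \<Longrightarrow> dist (\<theta> r' y') (\<theta> r y) < \<epsilon>'"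
    using \<epsilon>' unfolding uniformly_continuous_on_def by fastforce
  \<comment> \<open>When uniform continuity gives nothing, 2 |s - t| >= d and C (s - t)^2 is at
    least 2 |M|, the largest possible oscillation. The 4 comes from the factor 2 in
    \<open>dist_fun_upd_le\<close>.\<close>
  define C where "C = 2 * \<bar>M\<bar> * (4 / d\<^sup>2)"
  have C: "0 \<le> C" by (simp add: C_def)
  have mod: "\<bar>\<theta> r (y(j := s)) - \<theta> r (y(j := t))\<bar> \<le> \<epsilon>' + C * (s - t)\<^sup>2"
    if y: "y \<in> cube n" "j < n" "s \<in> {0..1}" "t \<in> {0..1}" for r y j s t
  proof (cases "2 * \<bar>s - t\<bar> < d")
    case True
    have "dist (r, y(j := s)) (r, y(j := t)) = dist (y(j := s)) (y(j := t))" by (simp add: dist_Pair_Pair)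
    also have "\<dots> < d" using dist_fun_upd_le[of y j s t] True by linarith
    finally have "dist (\<theta> r (y(j := s))) (\<theta> r (y(j := t))) < \<epsilon>'"
      using y by (intro d cube_update) auto
    moreover have "0 \<le> C * (s - t)\<^sup>2" using C by simp
    ultimately show ?thesis unfolding dist_real_def by linarith
  next
    case False
    then have "d\<^sup>2 \<le> (2 * \<bar>s - t\<bar>)\<^sup>2" using d by (intro power_mono) auto
    then have "1 \<le> 4 / d\<^sup>2 * (s - t)\<^sup>2" using d by (simp add: power_mult_distrib le_divide_eq)
    from mult_left_mono[OF this, of "2 * \<bar>M\<bar>"] have "2 * \<bar>M\<bar> \<le> C * (s - t)\<^sup>2" by (simp add: C_def mult.assoc)
    moreover have "\<bar>\<theta> r (y(j := s))\<bar> \<le> M" "\<bar>\<theta> r (y(j := t))\<bar> \<le> M"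
      using y by (auto intro!: M cube_update)
    ultimately show ?thesis using \<epsilon>' by linarith
  qed
  obtain N :: nat where N: "C / \<epsilon>' < real N" using reals_Archimedean2 by blast
  have N0: "0 < N" using N C \<epsilon>' by (metis divide_nonneg_pos not_gr_zero not_le of_nat_0)
  have CN: "C / real N \<le> \<epsilon>'" using N N0 \<epsilon>' by (simp add: field_simps)
  have "\<bar>\<theta> r (expc n f X) - bernstein_op N n (\<theta> r) (expc n f X)\<bar> \<le> \<epsilon>" for X r
  proof -
    have "\<bar>bernstein_op N n (\<theta> r) (expc n f X) - \<theta> r (expc n f X)\<bar> \<le> real n * (\<epsilon>' + C / real N)"
      by (rule bernstein_op_error[OF N0 C mod order_refl expc_cube[OF f]])
    also have "\<dots> \<le> real n * (2 * \<epsilon>')" using CN by (intro mult_left_mono) auto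
    also have "\<dots> \<le> (real n + 1) * (2 * \<epsilon>')" using \<epsilon>' by (intro mult_right_mono) auto
    also have "\<dots> = \<epsilon>"
    proof -
      have h: "x * (2 * (\<epsilon> / (2 * x))) = \<epsilon>" if "0 < x" for x :: real using that by simp
      show ?thesis unfolding \<epsilon>'_def by (rule h) simp
    qed
    finally show ?thesis by (simp add: abs_minus_commute)
  qed
  moreover have "ES (\<lambda>X r. bernstein_op N n (\<theta> r) (expc n f X))"
  proof (rule ES_bernstein_op[OF N0 f])
    fix y assume "y \<in> cube n"
    then have "continuous_on UNIV (\<lambda>r. (\<lambda>(r, y). \<theta> r y) (r, y))"
      by (intro continuous_on_compose2[OF \<theta>] continuous_intros) auto
    then show "continuous_on UNIV (\<lambda>r. \<theta> r y)" by simp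
  qed auto
  ultimately show "\<exists>W. ES W \<and> (\<forall>X\<in>fin_measures. \<forall>r. \<bar>\<theta> r (expc n f X) - W X r\<bar> \<le> \<epsilon>)"
    by blast
qed

end

text \<open>The inverse x = - ln y of the substitution, truncated to values between 0 and
  \<open>R\<close>. The cuts at 1 and at exp(- R) keep the argument of ln away from 0, so the map is
  continuous on the whole sequence space.\<close>

definition clip :: "nat \<Rightarrow> real \<Rightarrow> (nat \<Rightarrow> real) \<Rightarrow> nat \<Rightarrow> real" where
  "clip n R y i = (if i < n then - ln (max (min (y i) 1) (exp (- R))) else 0)"

lemma clip_continuous: "continuous_on UNIV (clip n R)"
proof (rule continuous_on_coordinatewise_then_product)
  fix i
  have p: "0 < max (min (y i) 1) (exp (- R))" for y :: "nat \<Rightarrow> real" by (simp add: less_max_iff_disj)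
  have "continuous_on UNIV (\<lambda>y :: nat \<Rightarrow> real. - ln (max (min (y i) 1) (exp (- R))))"
    using p by (intro continuous_intros continuous_on_product_coordinates) (auto simp: less_imp_neq[symmetric])
  then show "continuous_on UNIV (\<lambda>y. clip n R y i)"
    by (cases "i < n") (simp_all add: clip_def)
qed

lemma clip_bounds:
  assumes "0 \<le> R"
  shows "clip n R y \<in> orthant n" "0 \<le> clip n R y i" "clip n R y i \<le> R"
proof -
  have p: "0 < max (min (y i) 1) (exp (- R))" for i by (simp add: less_max_iff_disj)
  have 0: "0 \<le> clip n R y i" for i
  proof -
    have "max (min (y i) 1) (exp (- R)) \<le> 1" using assms by simp
    then have "ln (max (min (y i) 1) (exp (- R))) \<le> 0" using p[of i] by simp
    then show ?thesis by (simp add: clip_def)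
  qed
  then show "0 \<le> clip n R y i" .
  show "clip n R y \<in> orthant n" using 0 by (auto simp: orthant_def) (simp add: clip_def)
  have "ln (exp (- R)) \<le> ln (max (min (y i) 1) (exp (- R)))"
    by (intro ln_mono) (auto simp: p)
  then show "clip n R y i \<le> R" using assms by (simp add: clip_def)
qed

lemma ln_max_exp:
  fixes p R :: real
  assumes "0 \<le> p" "0 \<le> R"
  shows "- ln (max (min (exp (- p)) 1) (exp (- R))) = min p R"
proof -
  have "min (exp (- p)) 1 = exp (- p)" using assms by simp
  then show ?thesis by (cases "p \<le> R") (auto simp: max_def min_def)
qed

text \<open>On arguments at least exp(- R) the slope of ln is at most exp R, and clamping does not
  increase distances.\<close>

lemma clip_Lipschitz_coordinate:
  fixes s t R :: real
  assumes "0 \<le> R"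
  shows "\<bar>- ln (max (min s 1) (exp (- R))) - - ln (max (min t 1) (exp (- R)))\<bar> \<le> exp R * \<bar>s - t\<bar>"
proof -
  have *: "ln u - ln v \<le> exp R * (u - v)" if "exp (- R) \<le> v" "v \<le> u" for u v
  proof -
    have v: "0 < v" using that(1) exp_gt_zero[of "- R"] by linarith
    have "ln u - ln v = ln (u / v)" using v that by (simp add: ln_div)
    also have "\<dots> \<le> u / v - 1" using v that by (intro ln_le_minus_one) auto
    also have "\<dots> = (1 / v) * (u - v)" using v by (simp add: field_simps)
    also have "\<dots> \<le> exp R * (u - v)"
    proof (rule mult_right_mono)
      have "1 / v \<le> 1 / exp (- R)" using that by (intro divide_left_mono) (auto simp: v)
      then show "1 / v \<le> exp R" by (simp add: exp_minus divide_inverse)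
    qed (use that in simp)
    finally show ?thesis .
  qed
  let ?u = "max (min s 1) (exp (- R))" and ?v = "max (min t 1) (exp (- R))"
  have "\<bar>ln ?u - ln ?v\<bar> \<le> exp R * \<bar>?u - ?v\<bar>"
  proof (cases "?v \<le> ?u")
    case True
    then have "ln ?v \<le> ln ?u" by (intro ln_mono) (auto simp: less_max_iff_disj)
    then show ?thesis using *[of ?v ?u] True by simp
  next
    case False
    then have "ln ?u \<le> ln ?v" by (intro ln_mono) (auto simp: less_max_iff_disj)
    then show ?thesis using *[of ?u ?v] False by simp
  qed
  also have "\<dots> \<le> exp R * \<bar>s - t\<bar>" by (intro mult_left_mono) auto
  finally show ?thesis by (simp only: minus_diff_minus abs_minus_cancel)
qed

section \<open>Compactly supported functions of pairings as limits of exponential sums\<close>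

context cir
begin

definition xvec :: "nat \<Rightarrow> (nat \<Rightarrow> 'e \<Rightarrow> real) \<Rightarrow> 'e measure \<Rightarrow> nat \<Rightarrow> real" where
  "xvec n f X i = (if i < n then pairing X (f i) else 0)"

abbreviation mass :: "'e measure \<Rightarrow> real" where
  "mass X \<equiv> pairing X (\<lambda>_. 1)"

lemma one_cnn: "cnn (\<lambda>_. 1)" by (simp add: cnn_def)

lemma one_Cpp: "(\<lambda>_. 1) \<in> Cpp" by (auto simp: Cpp_def intro: exI[of _ 1])

lemma xvec_orthant: "(\<And>i. i < n \<Longrightarrow> cnn (f i)) \<Longrightarrow> xvec n f X \<in> orthant n"
  by (auto simp: xvec_def orthant_def pairing_nonneg)

lemma clip_expc:
  assumes "\<And>i. i < n \<Longrightarrow> cnn (f i)" "0 \<le> R" "i < n"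
  shows "clip n R (expc n f X) i = min (pairing X (f i)) R"
  using ln_max_exp[OF pairing_nonneg[OF assms(1)[OF assms(3)]] assms(2)] assms(3) by (simp add: clip_def expc_def)

text \<open>Where truncation alters a coordinate it sets it to \<open>R\<close> exactly, and there
  \<open>A\<close> still vanishes; hence the non-strict R \<le> x i in the hypothesis.\<close>

lemma vanishing_clip:
  assumes f: "\<And>i. i < n \<Longrightarrow> cnn (f i)" and R: "0 \<le> R" and A: "\<And>x i. x \<in> orthant n \<Longrightarrow> i < n \<Longrightarrow> R \<le> x i \<Longrightarrow> A x = 0"
  shows "A (clip n R (expc n f X)) = (A (xvec n f X) :: real)"
proof (cases "\<exists>i<n. R < pairing X (f i)")
  case True
  then obtain i where i: "i < n" "R < pairing X (f i)" by blast
  have "A (xvec n f X) = 0" using i by (intro A[of _ i] xvec_orthant f) (auto simp: xvec_def)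
  moreover have "A (clip n R (expc n f X)) = 0"
    using i clip_expc[where n = n and f = f and R = R and i = i and X = X, OF f R i(1)] by (intro A[of _ i] clip_bounds R) auto
  ultimately show ?thesis by simp
next
  case False
  have "clip n R (expc n f X) i = xvec n f X i" for i
  proof (cases "i < n")
    case True
    have "pairing X (f i) \<le> R" using False True by (meson not_less)
    then show ?thesis using True clip_expc[where n = n and f = f and R = R and i = i and X = X, OF f R True] by (auto simp: xvec_def min_def not_less)
  qed (simp add: clip_def xvec_def)
  then have "clip n R (expc n f X) = xvec n f X" by (rule ext)
  then show ?thesis by simp
qed

text \<open>\<open>A\<close> is pulled back to the cube by \<open>clip\<close>, where
  \<open>NN_continuous\<close> applies; its vanishing beyond \<open>R\<close> makes the truncation
  invisible.\<close>

lemma NN_member: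
  assumes f: "\<And>i. i < n \<Longrightarrow> cnn (f i)" and R: "0 \<le> R"
    and c: "continuous_on (orthant n \<times> UNIV) (\<lambda>(x, r). A x r)"
    and A: "\<And>x i r. x \<in> orthant n \<Longrightarrow> i < n \<Longrightarrow> R \<le> x i \<Longrightarrow> A x r = 0"
  shows "NN (\<lambda>X r. A (xvec n f X) r)"
proof -
  have "continuous_on (UNIV \<times> cube n) (\<lambda>q. (\<lambda>(x, r). A x r) (clip n R (snd q), fst q))"
    by (intro continuous_on_compose2[OF c] continuous_on_Pair continuous_on_compose2[OF clip_continuous] continuous_intros)
      (auto simp: clip_bounds R)
  then have "NN (\<lambda>X r. A (clip n R (expc n f X)) r)"
    by (intro NN_continuous[where n = n and f = f and \<theta> = "\<lambda>r y. A (clip n R y) r", OF f]) (auto simp: case_prod_unfold)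
  moreover have "A (clip n R (expc n f X)) r = A (xvec n f X) r" for X r
    using f R A by (intro vanishing_clip[where A = "\<lambda>x. A x r"]) auto
  ultimately show ?thesis by simp
qed

text \<open>The factor that later cancels the weight exp(- mass X) on functions vanishing for large
  mass.\<close>

lemma NN_exp_mass:
  assumes R: "0 \<le> R"
  shows "NN (\<lambda>X r. exp (min (mass X) R))"
proof -
  have "continuous_on (UNIV \<times> cube 1) (\<lambda>q :: 'e \<times> (nat \<Rightarrow> real). exp (clip 1 R (snd q) 0))"
    by (intro continuous_intros continuous_on_compose2[OF continuous_on_product_then_coordinatewise[OF clip_continuous, of 1 R 0]]) auto
  then have "NN (\<lambda>X r. exp (clip 1 R (expc 1 (\<lambda>_ _. 1) X) 0))"
    by (intro NN_continuous[where n = 1 and f = "\<lambda>_ _. 1" and \<theta> = "\<lambda>r y. exp (clip 1 R y 0)"]) (auto simp: case_prod_unfold one_cnn)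
  moreover have "clip 1 R (expc 1 (\<lambda>_ _. 1) X) 0 = min (mass X) R" for X
    using clip_expc[where n = 1 and f = "\<lambda>_ _. 1" and R = R and i = 0 and X = X] R one_cnn by simp
  ultimately show ?thesis by simp
qed

text \<open>The point is that \<open>C\<close> does not depend on \<epsilon>: Bernstein operators
  keep the Lipschitz constant, so all approximants have jumps at most C min(1, z), which makes
  dominated convergence under the infinite measure \<open>\<nu>\<close> possible.\<close>

lemma Lipschitz_approximation:
  assumes f: "\<And>i. i < n \<Longrightarrow> cnn (f i)" and R: "0 \<le> R" and L: "0 \<le> L"
    and \<phi>0: "\<And>x i. x \<in> orthant n \<Longrightarrow> i < n \<Longrightarrow> R \<le> x i \<Longrightarrow> \<phi> x = 0"
    and \<phi>L: "\<And>x i s t. x \<in> orthant n \<Longrightarrow> i < n \<Longrightarrow> 0 \<le> s \<Longrightarrow> 0 \<le> t \<Longrightarrow> \<bar>\<phi> (x(i := s)) - \<phi> (x(i := t))\<bar> \<le> L * \<bar>s - t\<bar>"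
  obtains C where "0 \<le> C" "\<And>\<epsilon>. 0 < \<epsilon> \<Longrightarrow> \<exists>W. ES (\<lambda>X r. W X) \<and> (\<forall>X\<in>fin_measures. \<bar>\<phi> (xvec n f X) - W X\<bar> \<le> \<epsilon>)
     \<and> (\<forall>X\<in>fin_measures. \<forall>z\<ge>0. \<forall>r. \<bar>W (add_dirac X z r) - W X\<bar> \<le> C * min 1 z)"
proof -
  define \<theta> where "\<theta> y = \<phi> (clip n R y)" for y
  define L' where "L' = L * exp R"
  have L': "0 \<le> L'" using L by (simp add: L'_def)
  have \<theta>L: "\<bar>\<theta> (y(j := s)) - \<theta> (y(j := t))\<bar> \<le> L' * \<bar>s - t\<bar>" if "j < n" for y j s t
  proof -
    let ?c = "\<lambda>s. - ln (max (min s 1) (exp (- R)))"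
    have e: "clip n R (y(j := s)) = (clip n R y)(j := ?c s)" for s
      using that by (auto simp: clip_def fun_eq_iff)
    have c0: "0 \<le> ?c s" for s using clip_bounds(2)[OF R, of n "y(j := s)" j] that by (simp add: clip_def)
    have "\<bar>\<theta> (y(j := s)) - \<theta> (y(j := t))\<bar> \<le> L * \<bar>?c s - ?c t\<bar>"
      unfolding \<theta>_def e by (intro \<phi>L clip_bounds R that c0)
    also have "\<dots> \<le> L * (exp R * \<bar>s - t\<bar>)" by (intro mult_left_mono clip_Lipschitz_coordinate R L)
    finally show ?thesis by (simp add: L'_def)
  qed
  have "\<exists>F>0. \<forall>i<n. \<forall>r. f i r \<le> F"
  proof -
    have "\<exists>F>0. \<forall>r. \<bar>f i r\<bar> \<le> F" if "i < n" for i
      using continuous_bound[OF cnn_continuous[OF f[OF that]]] by metis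
    then obtain F where F: "\<And>i. i < n \<Longrightarrow> 0 < F i \<and> (\<forall>r. \<bar>f i r\<bar> \<le> F i)" by metis
    have "f i r \<le> 1 + (\<Sum>j<n. F j)" if "i < n" for i r
    proof -
      have "f i r \<le> F i" using F[OF that] by (meson abs_le_D1)
      also have "\<dots> \<le> (\<Sum>j<n. F j)" using that F by (intro member_le_sum) (auto intro: less_imp_le)
      finally show ?thesis by simp
    qed
    moreover have "0 < 1 + (\<Sum>j<n. F j)" using F by (intro add_pos_nonneg sum_nonneg) (auto intro: less_imp_le)
    ultimately show ?thesis by blast
  qed
  then obtain F where F: "0 < F" "\<And>i r. i < n \<Longrightarrow> f i r \<le> F" by blast
  define C where "C = real n * (L' * (1 + F))"
  have C: "0 \<le> C" using F L' by (simp add: C_def)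
  have diff: "\<bar>expc n f (add_dirac X z r) j - expc n f X j\<bar> \<le> (1 + F) * min 1 z" if "j < n" "X \<in> fin_measures" "0 \<le> z" for X z r j
  proof -
    let ?p = "pairing X (f j)" and ?d = "z * f j r"
    have p: "0 \<le> ?p" by (intro pairing_nonneg f that)
    have d: "0 \<le> ?d" using that cnn_nonneg[OF f[OF that(1)]] by simp
    have pd: "pairing (add_dirac X z r) (f j) = ?p + ?d"
      using that by (intro pairing_add_dirac cnn_continuous f)
    have "\<bar>exp (- (?p + ?d)) - exp (- ?p)\<bar> = exp (- ?p) * (1 - exp (- ?d))"
    proof -
      have e: "exp (- (?p + ?d)) = exp (- ?p) * exp (- ?d)" by (simp add: exp_add[symmetric])
      have "exp (- (?p + ?d)) - exp (- ?p) = - (exp (- ?p) * (1 - exp (- ?d)))"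
        unfolding e right_diff_distrib by simp
      moreover have "0 \<le> exp (- ?p) * (1 - exp (- ?d))" using d by (intro mult_nonneg_nonneg) auto
      ultimately show ?thesis by simp
    qed
    also have "\<dots> \<le> 1 * (1 - exp (- ?d))" using p d by (intro mult_right_mono) auto
    finally have 1: "\<bar>exp (- (?p + ?d)) - exp (- ?p)\<bar> \<le> 1 - exp (- ?d)" by simp
    have "1 - exp (- ?d) \<le> ?d" using exp_ge_add_one_self[of "- ?d"] by linarith
    also have "\<dots> \<le> z * F" using that F by (intro mult_left_mono) auto
    also have "\<dots> \<le> (1 + F) * z" using that by (simp add: algebra_simps)
    finally have 2: "1 - exp (- ?d) \<le> (1 + F) * z" .
    have 3: "1 - exp (- ?d) \<le> (1 + F) * 1" unfolding mult_1_right using F exp_gt_zero[of "- ?d"] by linarith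
    show ?thesis using 1 2 3 that(1) unfolding expc_def by (auto simp: pd min_def)
  qed
  show ?thesis
  proof (rule that[OF C])
    fix \<epsilon> :: real assume \<epsilon>: "0 < \<epsilon>"
    define \<epsilon>' where "\<epsilon>' = \<epsilon> / (2 * (real n + 1))"
    have \<epsilon>': "0 < \<epsilon>'" using \<epsilon> by (simp add: \<epsilon>'_def)
    \<comment> \<open>From 2 L' |s - t| \<le> \<epsilon>' + (L'^2 / \<epsilon>') (s - t)^2: a
      Lipschitz bound in the quadratic form that \<open>bernstein_op_error\<close> expects.\<close>
    define D where "D = L'\<^sup>2 / \<epsilon>'"
    have D: "0 \<le> D" using \<epsilon>' by (simp add: D_def)
    have mod: "\<bar>\<theta> (y(j := s)) - \<theta> (y(j := t))\<bar> \<le> \<epsilon>' + D * (s - t)\<^sup>2" if "j < n" for y j s t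
    proof -
      have "0 \<le> (\<epsilon>' - L' * \<bar>s - t\<bar>)\<^sup>2" by simp
      then have "\<epsilon>' * (2 * (L' * \<bar>s - t\<bar>)) \<le> \<epsilon>' * \<epsilon>' + L'\<^sup>2 * (s - t)\<^sup>2"
        by (simp add: power2_eq_square algebra_simps flip: abs_mult)
      also have "\<dots> = \<epsilon>' * (\<epsilon>' + D * (s - t)\<^sup>2)"
        using \<epsilon>' by (simp add: D_def distrib_left)
      finally have "2 * (L' * \<bar>s - t\<bar>) \<le> \<epsilon>' + D * (s - t)\<^sup>2" using \<epsilon>' by simp
      moreover have "0 \<le> L' * \<bar>s - t\<bar>" using L' by simp
      ultimately show ?thesis using \<theta>L[OF that, of y s t] by linarith
    qed
    obtain N :: nat where N: "D / \<epsilon>' < real N" using reals_Archimedean2 by blast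
    have N0: "0 < N" using N D \<epsilon>' by (metis divide_nonneg_pos not_gr_zero not_le of_nat_0)
    have DN: "D / real N \<le> \<epsilon>'" using N N0 \<epsilon>' by (simp add: field_simps)
    define W where "W X = bernstein_op N n \<theta> (expc n f X)" for X
    have "ES (\<lambda>X r. W X)" unfolding W_def by (intro ES_bernstein_op N0 f) auto
    moreover have "\<bar>\<phi> (xvec n f X) - W X\<bar> \<le> \<epsilon>" for X
    proof -
      have "\<theta> (expc n f X) = \<phi> (xvec n f X)"
        unfolding \<theta>_def by (rule vanishing_clip[OF f R \<phi>0])
      moreover have "\<bar>bernstein_op N n \<theta> (expc n f X) - \<theta> (expc n f X)\<bar> \<le> real n * (\<epsilon>' + D / real N)"
        by (rule bernstein_op_error[OF N0 D mod order_refl expc_cube[OF f]])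
      moreover have "real n * (\<epsilon>' + D / real N) \<le> \<epsilon>"
      proof -
        have "real n * (\<epsilon>' + D / real N) \<le> real n * (2 * \<epsilon>')" using DN by (intro mult_left_mono) auto
        also have "\<dots> \<le> (real n + 1) * (2 * \<epsilon>')" using \<epsilon>' by (intro mult_right_mono) auto
        also have "\<dots> = \<epsilon>"
        proof -
          have h: "x * (2 * (\<epsilon> / (2 * x))) = \<epsilon>" if "0 < x" for x :: real using that by simp
          show ?thesis unfolding \<epsilon>'_def by (rule h) simp
        qed
        finally show ?thesis .
      qed
      ultimately show ?thesis unfolding W_def by linarith
    qed
    moreover have "\<bar>W (add_dirac X z r) - W X\<bar> \<le> C * min 1 z" if X: "X \<in> fin_measures" and z: "0 \<le> z" for X z r
    proof -
      have "\<bar>W (add_dirac X z r) - W X\<bar> \<le> (\<Sum>j<n. L' * \<bar>expc n f (add_dirac X z r) j - expc n f X j\<bar>)"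
        unfolding W_def
        by (intro coordinatewise_Lipschitz[of n] expc_cube f bernstein_op_Lipschitz[OF N0 \<theta>L order_refl])
      also have "\<dots> \<le> (\<Sum>j<n. L' * ((1 + F) * min 1 z))"
        using L' X z by (intro sum_mono mult_left_mono diff) auto
      also have "\<dots> = C * min 1 z" by (simp add: C_def)
      finally show ?thesis .
    qed
    ultimately show "\<exists>W. ES (\<lambda>X r. W X) \<and> (\<forall>X\<in>fin_measures. \<bar>\<phi> (xvec n f X) - W X\<bar> \<le> \<epsilon>)
       \<and> (\<forall>X\<in>fin_measures. \<forall>z\<ge>0. \<forall>r. \<bar>W (add_dirac X z r) - W X\<bar> \<le> C * min 1 z)"
      by blast
  qed
qed

section \<open>Measurability and integrals of uniform limits\<close>

lemma valid_NN: "valid xs \<Longrightarrow> NN (exp_sum xs)"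
  by (rule ES_NN) (auto simp: ES_def)

lemma NN_sequence:
  assumes "NN V"
  obtains W where "\<And>k. ES (W k)" "\<And>k X r. X \<in> fin_measures \<Longrightarrow> \<bar>V X r - W k X r\<bar> \<le> 1 / real (Suc k)"
proof -
  have "\<exists>W. ES W \<and> (\<forall>X\<in>fin_measures. \<forall>r. \<bar>V X r - W X r\<bar> \<le> 1 / real (Suc k))" for k
    using assms unfolding NN_def by simp
  then obtain W where "\<And>k. ES (W k) \<and> (\<forall>X\<in>fin_measures. \<forall>r. \<bar>V X r - W k X r\<bar> \<le> 1 / real (Suc k))"
    by metis
  then show ?thesis using that by blast
qed

lemma tendsto_of_bound:
  fixes w :: "nat \<Rightarrow> real"
  assumes "\<And>k. \<bar>v - w k\<bar> \<le> 1 / real (Suc k)"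
  shows "w \<longlonglongrightarrow> v"
proof -
  have "(\<lambda>k. w k - v) \<longlonglongrightarrow> 0"
  proof (rule Lim_null_comparison)
    show "\<forall>\<^sub>F k in sequentially. norm (w k - v) \<le> 1 / real (Suc k)"
      using assms by (intro always_eventually allI) (simp add: abs_minus_commute)
    show "(\<lambda>k. 1 / real (Suc k)) \<longlonglongrightarrow> 0" using LIMSEQ_Suc[OF lim_1_over_n] by simp
  qed
  then show ?thesis by (simp add: LIM_zero_iff)
qed

lemma pairing_add_dirac':
  assumes "continuous_on UNIV g" "X \<in> fin_measures"
  shows "pairing (add_dirac X z r) g = pairing X g + max 0 z * g r"
  using assms by (cases "0 \<le> z") (auto simp: pairing_add_dirac add_dirac_nonpos max_def)

lemma ES_jump_measurable:
  assumes "ES V" and X: "X \<in> fin_measures"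
  shows "(\<lambda>x. V (add_dirac X (snd x) (fst x)) (fst x)) \<in> borel_measurable (borel \<Otimes>\<^sub>M borel)"
proof -
  obtain xs where xs: "valid xs" "\<And>X r. X \<in> fin_measures \<Longrightarrow> V X r = exp_sum xs X r"
    using assms by (auto simp: ES_def)
  have "(\<lambda>x. exp_sum xs (add_dirac X (snd x) (fst x)) (fst x)) \<in> borel_measurable (borel \<Otimes>\<^sub>M borel)"
    using xs(1)
  proof (induction xs)
    case (Cons x xs)
    obtain c g where x: "x = (c, g)" by (cases x)
    have c: "continuous_on UNIV c" "continuous_on UNIV g" using Cons.prems by (auto simp: x valid_simps cnn_def)
    note [measurable] = continuous_measurable[OF c(1)] continuous_measurable[OF c(2)]
    have [measurable]: "(\<lambda>x. exp_sum xs (add_dirac X (snd x) (fst x)) (fst x)) \<in> borel_measurable (borel \<Otimes>\<^sub>M borel)"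
      using Cons by (simp add: x valid_simps)
    show ?case unfolding x exp_sum_simps pairing_add_dirac'[OF c(2) X] by measurable
  qed (simp add: exp_sum_simps)
  then show ?thesis using xs(2)[OF add_dirac_fin[OF X]] by simp
qed

lemma NN_jump_measurable:
  assumes "NN V" and X: "X \<in> fin_measures"
  shows "(\<lambda>x. V (add_dirac X (snd x) (fst x)) (fst x)) \<in> borel_measurable (borel \<Otimes>\<^sub>M borel)"
proof -
  obtain W where W: "\<And>k. ES (W k)" "\<And>k X r. X \<in> fin_measures \<Longrightarrow> \<bar>V X r - W k X r\<bar> \<le> 1 / real (Suc k)"
    using NN_sequence[OF assms(1)] by blast
  show ?thesis
  proof (rule borel_measurable_LIMSEQ_real)
    show "(\<lambda>x. W k (add_dirac X (snd x) (fst x)) (fst x)) \<in> borel_measurable (borel \<Otimes>\<^sub>M borel)" for k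
      by (rule ES_jump_measurable[OF W(1) X])
    show "(\<lambda>k. W k (add_dirac X (snd x) (fst x)) (fst x)) \<longlonglongrightarrow> V (add_dirac X (snd x) (fst x)) (fst x)" for x
      by (intro tendsto_of_bound W add_dirac_fin X)
  qed
qed

lemma NN_measurable_point:
  assumes "NN V" and X: "X \<in> fin_measures"
  shows "V X \<in> borel_measurable borel"
proof -
  have "(\<lambda>r. (r, 0 :: real)) \<in> borel \<rightarrow>\<^sub>M borel \<Otimes>\<^sub>M borel" by measurable
  from measurable_compose[OF this NN_jump_measurable[OF assms]]
  show ?thesis by (simp add: add_dirac_nonpos[OF X])
qed

lemma NN_integrable:
  assumes "NN V" and X: "X \<in> fin_measures" and \<mu>: "\<mu> \<in> fin_measures"
  shows "integrable \<mu> (V X)"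
proof -
  interpret finite_measure \<mu> using \<mu> by (simp add: fin_measures_def)
  obtain B where "0 < B" and "\<And>X r. X \<in> fin_measures \<Longrightarrow> \<bar>V X r\<bar> \<le> B" using NN_bounded[OF assms(1)] by blast
  moreover have "V X \<in> borel_measurable \<mu>"
    using NN_measurable_point[OF assms(1) X] unfolding measurable_cong_sets[OF fin_measuresD(1)[OF \<mu>] refl] .
  ultimately show ?thesis using X by (intro integrable_const_bound[of _ B]) auto
qed

lemma NN_integral_le:
  assumes "NN V" "X \<in> fin_measures" "\<mu> \<in> fin_measures" "\<And>r. \<bar>V X r\<bar> \<le> B"
  shows "\<bar>\<integral>r. V X r \<partial>\<mu>\<bar> \<le> B * mass \<mu>"
proof -
  have "\<bar>\<integral>r. V X r \<partial>\<mu>\<bar> \<le> (\<integral>r. B * 1 \<partial>\<mu>)"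
    using assms NN_integrable[OF assms(1-3)] continuous_integrable[of "\<lambda>_. 1", OF _ assms(3)]
    by (intro integral_abs_bound[THEN order_trans] integral_mono integrable_abs integrable_mult_right) auto
  then show ?thesis by (simp only: integral_mult_right_zero)
qed

lemma NN_diff_ES: "NN V \<Longrightarrow> ES W \<Longrightarrow> NN (\<lambda>X r. V X r - W X r)"
  using NN_add[of V "\<lambda>X r. - 1 * W X r"] ES_mult[OF ES_const[of "- 1"], of W] ES_NN by simp

lemma NN_integral_tendsto:
  assumes V: "NN V" and W: "\<And>k. ES (W k)" "\<And>k X r. X \<in> fin_measures \<Longrightarrow> \<bar>V X r - W k X r\<bar> \<le> 1 / real (Suc k)"
    and X: "X \<in> fin_measures" and \<mu>: "\<mu> \<in> fin_measures"
  shows "(\<lambda>k. \<integral>r. W k X r \<partial>\<mu>) \<longlonglongrightarrow> (\<integral>r. V X r \<partial>\<mu>)"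
proof -
  have "(\<lambda>k. (\<integral>r. W k X r \<partial>\<mu>) - (\<integral>r. V X r \<partial>\<mu>)) \<longlonglongrightarrow> 0"
  proof (rule Lim_null_comparison)
    show "\<forall>\<^sub>F k in sequentially. norm ((\<integral>r. W k X r \<partial>\<mu>) - (\<integral>r. V X r \<partial>\<mu>)) \<le> 1 / real (Suc k) * mass \<mu>"
    proof (intro always_eventually allI)
      fix k
      have "(\<integral>r. V X r \<partial>\<mu>) - (\<integral>r. W k X r \<partial>\<mu>) = (\<integral>r. V X r - W k X r \<partial>\<mu>)"
        by (intro Bochner_Integration.integral_diff[symmetric] NN_integrable V ES_NN W X \<mu>)
      moreover have "\<bar>\<integral>r. V X r - W k X r \<partial>\<mu>\<bar> \<le> 1 / real (Suc k) * mass \<mu>"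
        by (intro NN_integral_le[where V = "\<lambda>X r. V X r - W k X r"] NN_diff_ES V W X \<mu>)
      ultimately show "norm ((\<integral>r. W k X r \<partial>\<mu>) - (\<integral>r. V X r \<partial>\<mu>)) \<le> 1 / real (Suc k) * mass \<mu>"
        unfolding real_norm_def by linarith
    qed
    have "(\<lambda>k. 1 / real (Suc k) * mass \<mu>) \<longlonglongrightarrow> 0 * mass \<mu>"
      by (intro tendsto_mult tendsto_const) (use LIMSEQ_Suc[OF lim_1_over_n] in simp)
    then show "(\<lambda>k. 1 / real (Suc k) * mass \<mu>) \<longlonglongrightarrow> 0" by simp
  qed
  then show ?thesis by (simp add: LIM_zero_iff)
qed

lemma exp_sum_integral:
  assumes "valid ((c, g) # xs)" "\<mu> \<in> fin_measures" "X \<in> fin_measures"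
  shows "(\<integral>r. exp_sum ((c, g) # xs) X r \<partial>\<mu>) = pairing \<mu> c * exp (- pairing X g) + (\<integral>r. exp_sum xs X r \<partial>\<mu>)"
proof -
  have "ES (exp_sum xs)" using assms by (auto simp: ES_def valid_simps)
  then have "integrable \<mu> (exp_sum xs X)" by (intro NN_integrable ES_NN assms)
  moreover have "integrable \<mu> c" using assms by (auto simp: valid_simps intro: continuous_integrable)
  ultimately show ?thesis unfolding exp_sum_simps
    by (subst Bochner_Integration.integral_add) auto
qed

text \<open>In the first claim X is both the argument and the integrating measure. On an exponential
  sum the integral splits into terms <X, c> exp(- <X, g>), which are measurable, and limits do the
  rest.\<close>

lemma NN_measurable_Q:
  assumes V: "NN V"
  shows "(\<lambda>X. \<integral>r. V X r \<partial>X) \<in> borel_measurable Q" (is ?A)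
    and "(\<lambda>X. \<integral>r. V X r \<partial>m) \<in> borel_measurable Q" (is ?B)
    and "(\<lambda>X. V X r) \<in> borel_measurable Q" (is ?C)
proof -
  have es: "(\<lambda>X. \<integral>r. exp_sum xs X r \<partial>X) \<in> borel_measurable Q \<and> (\<lambda>X. \<integral>r. exp_sum xs X r \<partial>m) \<in> borel_measurable Q \<and> (\<lambda>X. exp_sum xs X r) \<in> borel_measurable Q"
    if "valid xs" for xs using that
  proof (induction xs)
    case (Cons x xs)
    obtain c g where x: "x = (c, g)" by (cases x)
    have c: "continuous_on UNIV c" "continuous_on UNIV g" using Cons.prems by (auto simp: x valid_simps cnn_def)
    note [measurable] = pairing_measurable[OF c(1)] pairing_measurable[OF c(2)]
    have [measurable]: "(\<lambda>X. \<integral>r. exp_sum xs X r \<partial>X) \<in> borel_measurable Q" "(\<lambda>X. \<integral>r. exp_sum xs X r \<partial>m) \<in> borel_measurable Q"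
        "(\<lambda>X. exp_sum xs X r) \<in> borel_measurable Q"
      using Cons by (auto simp: x valid_simps)
    have "(\<lambda>X. \<integral>r. exp_sum (x # xs) X r \<partial>X) \<in> borel_measurable Q"
      by (subst measurable_cong[where g = "\<lambda>X. pairing X c * exp (- pairing X g) + (\<integral>r. exp_sum xs X r \<partial>X)"])
        (use Cons.prems in \<open>simp_all add: x exp_sum_integral space_Q_fin\<close>)
    moreover have "(\<lambda>X. \<integral>r. exp_sum (x # xs) X r \<partial>m) \<in> borel_measurable Q"
      by (subst measurable_cong[where g = "\<lambda>X. pairing m c * exp (- pairing X g) + (\<integral>r. exp_sum xs X r \<partial>m)"])
        (use Cons.prems in \<open>simp_all add: x exp_sum_integral space_Q_fin m_fin\<close>)
    moreover have "(\<lambda>X. exp_sum (x # xs) X r) \<in> borel_measurable Q" unfolding x exp_sum_simps by measurable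
    ultimately show ?case by simp
  qed (simp add: exp_sum_def[abs_def])
  obtain W where W: "\<And>k. ES (W k)" "\<And>k X r. X \<in> fin_measures \<Longrightarrow> \<bar>V X r - W k X r\<bar> \<le> 1 / real (Suc k)"
    using NN_sequence[OF V] by blast
  have ES: "(\<lambda>X. \<integral>r. W k X r \<partial>X) \<in> borel_measurable Q \<and> (\<lambda>X. \<integral>r. W k X r \<partial>m) \<in> borel_measurable Q \<and> (\<lambda>X. W k X r) \<in> borel_measurable Q" for k
  proof -
    obtain xs where xs: "valid xs" "\<And>X r. X \<in> fin_measures \<Longrightarrow> W k X r = exp_sum xs X r"
      using W(1)[of k] by (auto simp: ES_def)
    show ?thesis using es[OF xs(1)] xs(2) space_Q_fin
      by (simp add: measurable_cong[of Q "\<lambda>X. \<integral>r. W k X r \<partial>X" "\<lambda>X. \<integral>r. exp_sum xs X r \<partial>X"]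
        measurable_cong[of Q "\<lambda>X. \<integral>r. W k X r \<partial>m" "\<lambda>X. \<integral>r. exp_sum xs X r \<partial>m"]
        measurable_cong[of Q "\<lambda>X. W k X r" "\<lambda>X. exp_sum xs X r"])
  qed
  show ?A
    by (rule borel_measurable_LIMSEQ_real[where u = "\<lambda>k X. \<integral>r. W k X r \<partial>X"])
      (use ES in \<open>auto intro!: NN_integral_tendsto V W space_Q_fin\<close>)
  show ?B
    by (rule borel_measurable_LIMSEQ_real[where u = "\<lambda>k X. \<integral>r. W k X r \<partial>m"])
      (use ES in \<open>auto intro!: NN_integral_tendsto V W space_Q_fin m_fin\<close>)
  show ?C
    by (rule borel_measurable_LIMSEQ_real[where u = "\<lambda>k X. W k X r"])
      (use ES in \<open>auto intro!: tendsto_of_bound W space_Q_fin\<close>)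
qed

section \<open>The Mecke formula for uniform limits\<close>

lemma AE_\<nu>_pos: "AE x in \<nu>. 0 < snd x"
  unfolding \<nu>_def by (subst AE_density) (auto intro!: AE_I2 simp: dens_def indicator_def)

text \<open>exp(- mass X - w) is exp(- mass) evaluated at X + w \<delta>_r. The weight keeps both
  sides of the Mecke formula finite for merely bounded functions.\<close>

definition weighted_jump :: "('e measure \<Rightarrow> 'e \<Rightarrow> real) \<Rightarrow> 'e measure \<Rightarrow> real" where
  "weighted_jump V X = (\<integral>x. snd x * exp (- mass X - snd x) * V (add_dirac X (snd x) (fst x)) (fst x) \<partial>\<nu>)"

lemma \<nu>_size_one: "integrable \<nu> (\<lambda>x. snd x * exp (- snd x))"
  using \<nu>_size[OF one_Cpp one_cnn] by simp

lemma NN_weighted_integrable: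
  assumes V: "NN V" and X: "X \<in> fin_measures" and B: "\<And>X r. X \<in> fin_measures \<Longrightarrow> \<bar>V X r\<bar> \<le> B"
  shows "integrable \<nu> (\<lambda>x. snd x * exp (- mass X - snd x) * V (add_dirac X (snd x) (fst x)) (fst x))" (is "integrable _ ?f")
    and "AE x in \<nu>. norm (snd x * exp (- mass X - snd x) * V (add_dirac X (snd x) (fst x)) (fst x)) \<le> B * (snd x * exp (- snd x))"
    and "\<bar>weighted_jump V X\<bar> \<le> B * (\<integral>x. snd x * exp (- snd x) \<partial>\<nu>)"
proof -
  have [measurable]: "(\<lambda>x. V (add_dirac X (snd x) (fst x)) (fst x)) \<in> borel_measurable (borel \<Otimes>\<^sub>M borel)"
    by (rule NN_jump_measurable[OF V X])
  have m0: "0 \<le> mass X" by (rule pairing_nonneg[OF one_cnn])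
  have B0: "0 \<le> B" using B[OF X] by (meson abs_ge_zero order_trans)
  show le: "AE x in \<nu>. norm (?f x) \<le> B * (snd x * exp (- snd x))"
    using AE_\<nu>_pos
  proof eventually_elim
    case (elim x)
    have "exp (- mass X - snd x) * \<bar>V (add_dirac X (snd x) (fst x)) (fst x)\<bar> \<le> exp (- snd x) * B"
      using m0 by (intro mult_mono B add_dirac_fin X) auto
    from mult_left_mono[OF this, of "snd x"] show ?case using elim by (simp add: abs_mult mult_ac)
  qed
  have i: "integrable \<nu> (\<lambda>x. B * (snd x * exp (- snd x)))" by (intro integrable_mult_right \<nu>_size_one)
  show "integrable \<nu> ?f"
  proof (rule Bochner_Integration.integrable_bound[OF i])
    show "AE x in \<nu>. norm (?f x) \<le> norm (B * (snd x * exp (- snd x)))"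
      using le by eventually_elim (metis abs_ge_self order_trans real_norm_def)
    show "?f \<in> borel_measurable \<nu>" by measurable
  qed
  have "\<bar>weighted_jump V X\<bar> \<le> (\<integral>x. \<bar>?f x\<bar> \<partial>\<nu>)" unfolding weighted_jump_def by (rule integral_abs_bound)
  also have "\<dots> \<le> (\<integral>x. B * (snd x * exp (- snd x)) \<partial>\<nu>)"
    using le i \<open>integrable \<nu> ?f\<close> by (intro integral_mono_AE integrable_abs) auto
  finally show "\<bar>weighted_jump V X\<bar> \<le> B * (\<integral>x. snd x * exp (- snd x) \<partial>\<nu>)" by simp
qed

text \<open>Term by term from \<open>mecke_exp\<close>: the weight raises each exponent g to 1 + g,
  which lies in \<open>Cpp\<close> even if g has zeros.\<close>

lemma mecke_exp_sum:
  assumes "valid xs"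
  shows "\<exists>I. has_bochner_integral Q (\<lambda>X. exp (- mass X) * (\<integral>r. exp_sum xs X r \<partial>X)) I \<and>
     has_bochner_integral Q (weighted_jump (exp_sum xs)) I"
  using assms
proof (induction xs)
  case Nil
  show ?case by (auto simp: exp_sum_simps weighted_jump_def[abs_def] has_bochner_integral_zero intro!: exI[of _ 0])
next
  case (Cons x xs)
  obtain c g where x: "x = (c, g)" by (cases x)
  have c: "continuous_on UNIV c" and g: "cnn g" and xs: "valid xs" using Cons.prems by (auto simp: x valid_simps)
  have g1: "(\<lambda>r. 1 + g r) \<in> Cpp"
    using g by (auto simp: Cpp_def cnn_def intro!: continuous_intros exI[of _ 1])
  obtain I where I: "has_bochner_integral Q (\<lambda>X. exp (- mass X) * (\<integral>r. exp_sum xs X r \<partial>X)) I"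
     "has_bochner_integral Q (weighted_jump (exp_sum xs)) I" using Cons xs by auto
  let ?\<kappa> = "\<integral>x. snd x * c (fst x) * exp (- (snd x * (1 + g (fst x)))) \<partial>\<nu>"
  let ?J = "exp (- \<psi> (\<lambda>r. 1 + g r)) * ?\<kappa>"
  have p: "pairing X (\<lambda>r. 1 + g r) = mass X + pairing X g" if "X \<in> fin_measures" for X
    by (rule pairing_add[OF one_cnn g that])
  have "has_bochner_integral Q (\<lambda>X. pairing X c * exp (- pairing X (\<lambda>r. 1 + g r)) + exp (- mass X) * (\<integral>r. exp_sum xs X r \<partial>X)) (?J + I)"
    by (intro has_bochner_integral_add I mecke_exp g1 c)
  then have 1: "has_bochner_integral Q (\<lambda>X. exp (- mass X) * (\<integral>r. exp_sum (x # xs) X r \<partial>X)) (?J + I)"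
  proof (rule has_bochner_integral_cong[THEN iffD1, rotated -1])
    fix X assume "X \<in> space Q"
    then have X: "X \<in> fin_measures" by (rule space_Q_fin)
    have "valid ((c, g) # xs)" using Cons.prems by (simp add: x)
    from exp_sum_integral[OF this X X]
    show "pairing X c * exp (- pairing X (\<lambda>r. 1 + g r)) + exp (- mass X) * (\<integral>r. exp_sum xs X r \<partial>X) = exp (- mass X) * (\<integral>r. exp_sum (x # xs) X r \<partial>X)"
      unfolding p[OF X] x by (simp add: distrib_left exp_add mult_ac minus_add_distrib exp_diff exp_minus divide_inverse)
  qed auto
  have ESxs: "NN (exp_sum xs)" by (rule valid_NN[OF xs])
  obtain B where "0 < B" and B: "\<And>X r. X \<in> fin_measures \<Longrightarrow> \<bar>exp_sum xs X r\<bar> \<le> B" using NN_bounded[OF ESxs] by blast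
  have wj: "weighted_jump (exp_sum (x # xs)) X = exp (- pairing X (\<lambda>r. 1 + g r)) * ?\<kappa> + weighted_jump (exp_sum xs) X" if X: "X \<in> fin_measures" for X
  proof -
    let ?f = "\<lambda>x. exp (- pairing X (\<lambda>r. 1 + g r)) * (snd x * c (fst x) * exp (- (snd x * (1 + g (fst x)))))"
    let ?h = "\<lambda>x. snd x * exp (- mass X - snd x) * exp_sum xs (add_dirac X (snd x) (fst x)) (fst x)"
    have ESx: "NN (exp_sum (x # xs))" by (rule valid_NN[OF Cons.prems])
    obtain B' where "0 < B'" and B': "\<And>X r. X \<in> fin_measures \<Longrightarrow> \<bar>exp_sum (x # xs) X r\<bar> \<le> B'" using NN_bounded[OF ESx] by blast
    have i1: "integrable \<nu> ?f" by (intro integrable_mult_right mecke_exp g1 c)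
    have i2: "integrable \<nu> ?h" by (rule NN_weighted_integrable[OF ESxs X B])
    have i3: "integrable \<nu> (\<lambda>y. snd y * exp (- mass X - snd y) * exp_sum (x # xs) (add_dirac X (snd y) (fst y)) (fst y))"
      by (rule NN_weighted_integrable[OF ESx X B'])
    have "weighted_jump (exp_sum (x # xs)) X = (\<integral>x. ?f x + ?h x \<partial>\<nu>)"
      unfolding weighted_jump_def
    proof (rule integral_cong_AE)
      show "AE y in \<nu>. snd y * exp (- mass X - snd y) * exp_sum (x # xs) (add_dirac X (snd y) (fst y)) (fst y) = ?f y + ?h y"
        using AE_\<nu>_pos
      proof eventually_elim
        case (elim y)
        have "pairing (add_dirac X (snd y) (fst y)) g = pairing X g + snd y * g (fst y)"
          using elim by (intro pairing_add_dirac cnn_continuous g X) simp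
        then show ?case unfolding x exp_sum_simps p[OF X]
          by (simp add: distrib_left exp_add exp_diff exp_minus divide_inverse mult_ac)
      qed
    qed (use i1 i2 i3 in \<open>auto intro: borel_measurable_integrable\<close>)
    also have "\<dots> = exp (- pairing X (\<lambda>r. 1 + g r)) * ?\<kappa> + weighted_jump (exp_sum xs) X"
      unfolding weighted_jump_def using Bochner_Integration.integral_add[OF i1 i2] by (simp only: integral_mult_right_zero)
    finally show ?thesis .
  qed
  have "has_bochner_integral Q (\<lambda>X. exp (- pairing X (\<lambda>r. 1 + g r)) * ?\<kappa> + weighted_jump (exp_sum xs) X) (?J + I)"
    by (intro has_bochner_integral_add I has_bochner_integral_mult_left laplace_Q Cpp_cnn g1)
  then have "has_bochner_integral Q (weighted_jump (exp_sum (x # xs))) (?J + I)"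
    by (rule has_bochner_integral_cong[THEN iffD1, rotated -1]) (use wj space_Q_fin in auto)
  with 1 show ?case by blast
qed


lemma weighted_jump_tendsto:
  assumes V: "NN V" and W: "\<And>k. ES (W k)" "\<And>k X r. X \<in> fin_measures \<Longrightarrow> \<bar>V X r - W k X r\<bar> \<le> 1 / real (Suc k)"
    and X: "X \<in> fin_measures"
  shows "(\<lambda>k. weighted_jump (W k) X) \<longlonglongrightarrow> weighted_jump V X"
proof -
  define \<kappa> where "\<kappa> = (\<integral>x. snd x * exp (- snd x) \<partial>\<nu>)"
  have "(\<lambda>k. weighted_jump (W k) X - weighted_jump V X) \<longlonglongrightarrow> 0"
  proof (rule Lim_null_comparison)
    show "\<forall>\<^sub>F k in sequentially. norm (weighted_jump (W k) X - weighted_jump V X) \<le> 1 / real (Suc k) * \<kappa>"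
    proof (intro always_eventually allI)
      fix k
      obtain B where "0 < B" and B: "\<And>X r. X \<in> fin_measures \<Longrightarrow> \<bar>V X r\<bar> \<le> B" using NN_bounded[OF V] by blast
      obtain C where "0 < C" and C: "\<And>X r. X \<in> fin_measures \<Longrightarrow> \<bar>W k X r\<bar> \<le> C" using ES_bounded[OF W(1)] by blast
      have "weighted_jump V X - weighted_jump (W k) X = weighted_jump (\<lambda>X r. V X r - W k X r) X"
        unfolding weighted_jump_def right_diff_distrib
        by (intro Bochner_Integration.integral_diff[symmetric] NN_weighted_integrable[OF V X B] NN_weighted_integrable[OF ES_NN[OF W(1)] X C])
      moreover have "\<bar>weighted_jump (\<lambda>X r. V X r - W k X r) X\<bar> \<le> 1 / real (Suc k) * \<kappa>"
        unfolding \<kappa>_def by (rule NN_weighted_integrable(3)[OF NN_diff_ES[OF V W(1)] X W(2)])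
      ultimately show "norm (weighted_jump (W k) X - weighted_jump V X) \<le> 1 / real (Suc k) * \<kappa>"
        unfolding real_norm_def by linarith
    qed
    have "(\<lambda>k. 1 / real (Suc k) * \<kappa>) \<longlonglongrightarrow> 0 * \<kappa>"
      by (intro tendsto_mult tendsto_const) (use LIMSEQ_Suc[OF lim_1_over_n] in simp)
    then show "(\<lambda>k. 1 / real (Suc k) * \<kappa>) \<longlonglongrightarrow> 0" by simp
  qed
  then show ?thesis by (simp add: LIM_zero_iff)
qed

text \<open>Dominated convergence along exponential sums: mass X exp(- mass X) \<le> 1 bounds the
  left side, the finite \<open>\<nu>\<close>-integral of w exp(- w) the right side.\<close>

lemma mecke_weighted:
  assumes V: "NN V"
  shows "integrable Q (\<lambda>X. exp (- mass X) * (\<integral>r. V X r \<partial>X))"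
    and "integrable Q (weighted_jump V)"
    and "(\<integral>X. exp (- mass X) * (\<integral>r. V X r \<partial>X) \<partial>Q) = (\<integral>X. weighted_jump V X \<partial>Q)"
proof -
  obtain W where W: "\<And>k. ES (W k)" "\<And>k X r. X \<in> fin_measures \<Longrightarrow> \<bar>V X r - W k X r\<bar> \<le> 1 / real (Suc k)"
    using NN_sequence[OF V] by blast
  obtain B where B0: "0 < B" and B: "\<And>X r. X \<in> fin_measures \<Longrightarrow> \<bar>V X r\<bar> \<le> B" using NN_bounded[OF V] by blast
  have WB: "\<bar>W k X r\<bar> \<le> B + 1" if "X \<in> fin_measures" for k X r
  proof -
    have "1 / real (Suc k) \<le> 1" by simp
    then show ?thesis using W(2)[OF that, of r k] B[OF that, of r] by linarith
  qed
  define l where "l U X = exp (- mass X) * (\<integral>r. U X r \<partial>X)" for U :: "'e measure \<Rightarrow> 'e \<Rightarrow> real" and X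
  define \<kappa> where "\<kappa> = (\<integral>x. snd x * exp (- snd x) \<partial>\<nu>)"
  have [measurable]: "(\<lambda>X. mass X) \<in> borel_measurable Q" by (rule pairing_measurable) simp
  have ex: "\<exists>I. has_bochner_integral Q (l (W k)) I \<and> has_bochner_integral Q (weighted_jump (W k)) I" for k
  proof -
    obtain xs where xs: "valid xs" "\<And>X r. X \<in> fin_measures \<Longrightarrow> W k X r = exp_sum xs X r"
      using W(1)[of k] by (auto simp: ES_def)
    obtain I where I: "has_bochner_integral Q (\<lambda>X. exp (- mass X) * (\<integral>r. exp_sum xs X r \<partial>X)) I"
       "has_bochner_integral Q (weighted_jump (exp_sum xs)) I" using mecke_exp_sum[OF xs(1)] by blast
    have "has_bochner_integral Q (l (W k)) I"
      by (rule has_bochner_integral_cong[THEN iffD1, OF refl _ refl I(1)]) (simp add: l_def xs(2) space_Q_fin)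
    moreover have "has_bochner_integral Q (weighted_jump (W k)) I"
      by (rule has_bochner_integral_cong[THEN iffD1, OF refl _ refl I(2)])
        (simp add: weighted_jump_def xs(2)[OF add_dirac_fin] space_Q_fin)
    ultimately show ?thesis by blast
  qed
  have m1: "l V \<in> borel_measurable Q" unfolding l_def using NN_measurable_Q(1)[OF V] by measurable
  have m2: "l (W k) \<in> borel_measurable Q" for k using ex[of k] by (auto simp: has_bochner_integral_iff)
  have m3: "weighted_jump (W k) \<in> borel_measurable Q" for k using ex[of k] by (auto simp: has_bochner_integral_iff)
  have lim1: "(\<lambda>k. l (W k) X) \<longlonglongrightarrow> l V X" if "X \<in> space Q" for X
    unfolding l_def using space_Q_fin[OF that] by (intro tendsto_mult tendsto_const NN_integral_tendsto[OF V W])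
  have lim2: "(\<lambda>k. weighted_jump (W k) X) \<longlonglongrightarrow> weighted_jump V X" if "X \<in> space Q" for X
    by (rule weighted_jump_tendsto[OF V W space_Q_fin[OF that]])
  have m4: "weighted_jump V \<in> borel_measurable Q"
    by (rule borel_measurable_LIMSEQ_real[OF lim2 m3])
  have b1: "norm (l (W k) X) \<le> B + 1" if "X \<in> space Q" for k X
  proof -
    have X: "X \<in> fin_measures" by (rule space_Q_fin[OF that])
    have "\<bar>\<integral>r. W k X r \<partial>X\<bar> \<le> (B + 1) * mass X"
      by (rule NN_integral_le[OF ES_NN[OF W(1)] X X WB[OF X]])
    then have "norm (l (W k) X) \<le> exp (- mass X) * ((B + 1) * mass X)"
      by (simp add: l_def abs_mult)
    also have "\<dots> = (B + 1) * (mass X * exp (- mass X))" by simp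
    also have "\<dots> \<le> (B + 1) * 1"
      using B0 by (intro mult_left_mono size_times_exp_le pairing_nonneg one_cnn) auto
    finally show ?thesis by simp
  qed
  have b2: "norm (weighted_jump (W k) X) \<le> (B + 1) * \<kappa>" if "X \<in> space Q" for k X
    unfolding \<kappa>_def real_norm_def by (rule NN_weighted_integrable(3)[OF ES_NN[OF W(1)] space_Q_fin[OF that] WB])
  have d1: "integrable Q (l V)" "(\<lambda>k. \<integral>X. l (W k) X \<partial>Q) \<longlonglongrightarrow> (\<integral>X. l V X \<partial>Q)"
    using integrable_dominated_convergence[where w = "\<lambda>_. B + 1", OF m1 m2 _ AE_I2[OF lim1] AE_I2[OF b1]]
      integral_dominated_convergence[where w = "\<lambda>_. B + 1", OF m1 m2 _ AE_I2[OF lim1] AE_I2[OF b1]] by simp_all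
  have d2: "integrable Q (weighted_jump V)" "(\<lambda>k. \<integral>X. weighted_jump (W k) X \<partial>Q) \<longlonglongrightarrow> (\<integral>X. weighted_jump V X \<partial>Q)"
    using integrable_dominated_convergence[where w = "\<lambda>_. (B + 1) * \<kappa>", OF m4 m3 _ AE_I2[OF lim2] AE_I2[OF b2]]
      integral_dominated_convergence[where w = "\<lambda>_. (B + 1) * \<kappa>", OF m4 m3 _ AE_I2[OF lim2] AE_I2[OF b2]] by simp_all
  have "(\<integral>X. l (W k) X \<partial>Q) = (\<integral>X. weighted_jump (W k) X \<partial>Q)" for k
    using ex[of k] by (auto simp: has_bochner_integral_iff)
  then have "(\<integral>X. l V X \<partial>Q) = (\<integral>X. weighted_jump V X \<partial>Q)"
    using d1(2) d2(2) LIMSEQ_unique by simp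
  then show "integrable Q (\<lambda>X. exp (- mass X) * (\<integral>r. V X r \<partial>X))"
    "integrable Q (weighted_jump V)"
    "(\<integral>X. exp (- mass X) * (\<integral>r. V X r \<partial>X) \<partial>Q) = (\<integral>X. weighted_jump V X \<partial>Q)"
    using d1(1) d2(1) by (simp_all add: l_def[abs_def])
qed

text \<open>Apply the weighted formula to \<open>V\<close> times exp(min(mass, R)): where
  \<open>V\<close> is nonzero the two exponentials cancel, on the right at the shifted measure X + w
  \<delta>_r.\<close>

lemma mecke:
  assumes V: "NN V" and R: "0 \<le> R" and V0: "\<And>X r. X \<in> fin_measures \<Longrightarrow> R < mass X \<Longrightarrow> V X r = 0"
  defines "J \<equiv> \<lambda>X. \<integral>x. snd x * V (add_dirac X (snd x) (fst x)) (fst x) \<partial>\<nu>"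
  shows "integrable Q (\<lambda>X. \<integral>r. V X r \<partial>X)"
    and "\<And>X. X \<in> fin_measures \<Longrightarrow> integrable \<nu> (\<lambda>x. snd x * V (add_dirac X (snd x) (fst x)) (fst x))"
    and "integrable Q J"
    and "(\<integral>X. \<integral>r. V X r \<partial>X \<partial>Q) = (\<integral>X. J X \<partial>Q)"
proof -
  define U where "U X r = exp (min (mass X) R) * V X r" for X r
  have U: "NN U" unfolding U_def by (intro NN_mult NN_exp_mass R V)
  have e: "exp (- mass X) * U X r = V X r" if "X \<in> fin_measures" for X r
    using V0[OF that, of r] by (cases "R < mass X") (auto simp: U_def min_def exp_minus)
  obtain B where "0 < B" and B: "\<And>X r. X \<in> fin_measures \<Longrightarrow> \<bar>U X r\<bar> \<le> B" using NN_bounded[OF U] by blast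
  have e1: "exp (- mass X) * (\<integral>r. U X r \<partial>X) = (\<integral>r. V X r \<partial>X)" if "X \<in> space Q" for X
    using e[OF space_Q_fin[OF that]] by (subst integral_mult_right_zero[symmetric]) simp
  have AE: "AE x in \<nu>. snd x * exp (- mass X - snd x) * U (add_dirac X (snd x) (fst x)) (fst x) = snd x * V (add_dirac X (snd x) (fst x)) (fst x)"
    if X: "X \<in> fin_measures" for X
    using AE_\<nu>_pos
  proof eventually_elim
    case (elim x)
    have "mass (add_dirac X (snd x) (fst x)) = mass X + snd x"
      using pairing_add_dirac[of "\<lambda>_. 1" X "snd x" "fst x"] X elim by simp
    then have "exp (- mass X - snd x) = exp (- mass (add_dirac X (snd x) (fst x)))" by simp
    then show ?case using e[OF add_dirac_fin[OF X], of "snd x" "fst x" "fst x"] by (simp add: mult.assoc)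
  qed
  have mV: "(\<lambda>x. snd x * V (add_dirac X (snd x) (fst x)) (fst x)) \<in> borel_measurable \<nu>" if X: "X \<in> fin_measures" for X
    using NN_jump_measurable[OF V X] by measurable
  show "integrable \<nu> (\<lambda>x. snd x * V (add_dirac X (snd x) (fst x)) (fst x))" if X: "X \<in> fin_measures" for X
    by (rule integrable_cong_AE_imp[OF NN_weighted_integrable(1)[OF U X B] mV[OF X]])
      (use AE[OF X] in \<open>auto elim: eventually_mono\<close>)
  have e2: "weighted_jump U X = J X" if "X \<in> space Q" for X
    unfolding weighted_jump_def J_def using space_Q_fin[OF that]
    by (intro integral_cong_AE AE mV borel_measurable_integrable[OF NN_weighted_integrable(1)[OF U _ B]])
  note mw = mecke_weighted[OF U]
  show "integrable Q (\<lambda>X. \<integral>r. V X r \<partial>X)"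
    by (rule Bochner_Integration.integrable_cong[THEN iffD1, OF refl _ mw(1)]) (rule e1)
  show "integrable Q J"
    by (rule Bochner_Integration.integrable_cong[THEN iffD1, OF refl _ mw(2)]) (rule e2)
  show "(\<integral>X. \<integral>r. V X r \<partial>X \<partial>Q) = (\<integral>X. J X \<partial>Q)"
    using mw(3) Bochner_Integration.integral_cong[OF refl e1, of Q] Bochner_Integration.integral_cong[OF refl e2, of Q] by simp
qed

section \<open>The Poincare inequality\<close>

text \<open>Schur's product argument by induction on the power: one factor \<open>K\<close> is a
  \<open>\<nu>\<close>-average of rank-one kernels u_i u_j, and these are absorbed into the
  coefficients \<open>d\<close>.\<close>

lemma K_power_psd:
  assumes g: "\<And>i. i < n \<Longrightarrow> cnn (g i)"
  shows "0 \<le> (\<Sum>i<n. \<Sum>j<n. d i * d j * K (g i) (g j) ^ p)"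
proof (induction p arbitrary: d)
  case 0
  have "(\<Sum>i<n. \<Sum>j<n. d i * d j) = (\<Sum>i<n. d i)\<^sup>2"
    by (simp add: power2_eq_square sum_product)
  then show ?case by simp
next
  case (Suc p)
  define u where "u i x = 1 - exp (- (snd x * g i (fst x)))" for i x
  have hb: "has_bochner_integral \<nu> (\<lambda>x. \<Sum>i<n. \<Sum>j<n. (d i * u i x) * (d j * u j x) * K (g i) (g j) ^ p)
      (\<Sum>i<n. \<Sum>j<n. d i * d j * K (g i) (g j) ^ p * K (g i) (g j))"
  proof (intro has_bochner_integral_sum)
    fix i j assume "i \<in> {..<n}" "j \<in> {..<n}"
    then have "has_bochner_integral \<nu> (\<lambda>x. d i * d j * K (g i) (g j) ^ p * (u i x * u j x)) (d i * d j * K (g i) (g j) ^ p * K (g i) (g j))"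
      unfolding u_def by (intro has_bochner_integral_mult_right \<nu>_K g) auto
    then show "has_bochner_integral \<nu> (\<lambda>x. (d i * u i x) * (d j * u j x) * K (g i) (g j) ^ p) (d i * d j * K (g i) (g j) ^ p * K (g i) (g j))"
      by (simp add: mult_ac)
  qed
  have "0 \<le> (\<Sum>i<n. \<Sum>j<n. d i * d j * K (g i) (g j) ^ p * K (g i) (g j))"
    by (rule has_bochner_integral_nonneg[OF hb]) (rule Suc.IH)
  then show ?case by (simp add: mult_ac)
qed

text \<open>The coefficients (k - 1) / k! are nonnegative from k = 1 on; the one negative
  coefficient, - 1 at k = 0, is what the summand 1 cancels.\<close>

lemma entropy_series:
  "(\<lambda>k. (if k = 0 then 0 else (real k - 1) / fact k) * x ^ k) sums (x * exp x - exp x + 1)" for x :: real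
proof -
  have e: "(\<lambda>k. x ^ k / fact k) sums exp x"
    using exp_converges[of x] by (simp add: divide_inverse mult.commute)
  have 1: "(\<lambda>k. x * (x ^ k / fact k)) sums (x * exp x)" by (rule sums_mult[OF e])
  have "(\<lambda>k. real k * (x ^ k / fact k)) sums (x * exp x)"
  proof -
    have "(\<lambda>k. real (Suc k) * (x ^ Suc k / fact (Suc k))) sums (x * exp x)"
    proof (rule sums_cong[THEN iffD1, OF _ 1])
      fix k
      show "x * (x ^ k / fact k) = real (Suc k) * (x ^ Suc k / fact (Suc k))"
        by (simp add: field_simps del: of_nat_Suc)
    qed
    from sums_Suc[OF this] show ?thesis by simp
  qed
  from sums_diff[OF this e]
  have "(\<lambda>k. real k * (x ^ k / fact k) - x ^ k / fact k) sums (x * exp x - exp x)" .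
  moreover have "(\<lambda>k. if k = 0 then 1 else 0 :: real) sums 1"
    using sums_single[of 0 "\<lambda>_. 1 :: real"] by simp
  ultimately have "(\<lambda>k. (real k * (x ^ k / fact k) - x ^ k / fact k) + (if k = 0 then 1 else 0)) sums (x * exp x - exp x + 1)"
    by (rule sums_add)
  moreover have "(real k * (x ^ k / fact k) - x ^ k / fact k) + (if k = 0 then 1 else 0) = (if k = 0 then 0 else (real k - 1) / fact k) * x ^ k" for k
    by (cases "k = 0") (auto simp: diff_divide_distrib left_diff_distrib)
  ultimately show ?thesis by simp
qed

definition jump_sq :: "('e measure \<Rightarrow> real) \<Rightarrow> 'e measure \<Rightarrow> real" where
  "jump_sq \<Psi> X = (\<integral>x. (\<Psi> (add_dirac X (snd x) (fst x)) - \<Psi> X)\<^sup>2 \<partial>\<nu>)"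

text \<open>For exponential sums the difference of the two sides is a quadratic form with kernel
  \<open>K e\<^sup>K - e\<^sup>K + 1\<close>, a power series in the positive semidefinite kernel \<open>K\<close> with nonnegative
  coefficients.\<close>

lemma poincare_exp_sum:
  assumes "ES (\<lambda>X r. W X)"
  shows "integrable Q (jump_sq W)" "var Q W \<le> (\<integral>X. jump_sq W X \<partial>Q)"
proof -
  obtain xs where xs: "valid xs" "\<And>X r. X \<in> fin_measures \<Longrightarrow> W X = exp_sum xs X r"
    using assms by (auto simp: ES_def)
  define n where "n = length xs"
  \<comment> \<open>\<open>W\<close> does not depend on the site, so the coefficients may be read
    off at an arbitrary one.\<close>
  define c where "c i = fst (xs ! i) undefined" for i
  define g where "g i = snd (xs ! i)" for i
  have g: "cnn (g i)" if "i < n" for i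
    using xs(1) that nth_mem[of i xs] by (auto simp: valid_def g_def n_def case_prod_unfold)
  have W: "W X = (\<Sum>i<n. c i * exp (- pairing X (g i)))" if "X \<in> fin_measures" for X
  proof -
    have "W X = (\<Sum>x\<leftarrow>xs. fst x undefined * exp (- pairing X (snd x)))"
      using xs(2)[OF that, of undefined] by (simp add: exp_sum_def case_prod_unfold)
    also have "\<dots> = (\<Sum>i<n. c i * exp (- pairing X (g i)))"
      by (simp add: sum_list_sum_nth n_def c_def g_def atLeast0LessThan)
    finally show ?thesis .
  qed
  \<comment> \<open>The means of the summands. Normalised by them, mean square and jump form have
    kernels exp K and K exp K, and the squared mean has kernel 1.\<close>
  define d where "d i = c i * exp (- \<psi> (g i))" for i
  have hb1: "has_bochner_integral Q W (\<Sum>i<n. d i)"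
  proof -
    have "has_bochner_integral Q (\<lambda>X. \<Sum>i<n. c i * exp (- pairing X (g i))) (\<Sum>i<n. d i)"
      unfolding d_def by (intro has_bochner_integral_sum has_bochner_integral_mult_right laplace_Q g) auto
    then show ?thesis by (rule has_bochner_integral_cong[THEN iffD1, OF refl _ refl, rotated]) (simp add: W space_Q_fin)
  qed
  have ee: "exp (- pairing X (g i)) * exp (- pairing X (g j)) = exp (- pairing X (\<lambda>r. g i r + g j r))" if "X \<in> fin_measures" "i < n" "j < n" for X i j
    using pairing_add[OF g g that(1)] that by (simp add: exp_add[symmetric])
  have expK: "exp (- \<psi> (\<lambda>r. g i r + g j r)) = exp (- \<psi> (g i)) * exp (- \<psi> (g j)) * exp (K (g i) (g j))" for i j
    by (simp add: K_def exp_add[symmetric])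
  have hb2: "has_bochner_integral Q (\<lambda>X. (W X)\<^sup>2) (\<Sum>i<n. \<Sum>j<n. d i * d j * exp (K (g i) (g j)))"
  proof -
    have "has_bochner_integral Q (\<lambda>X. \<Sum>i<n. \<Sum>j<n. c i * c j * exp (- pairing X (\<lambda>r. g i r + g j r))) (\<Sum>i<n. \<Sum>j<n. c i * c j * exp (- \<psi> (\<lambda>r. g i r + g j r)))"
      by (intro has_bochner_integral_sum has_bochner_integral_mult_right laplace_Q cnn_add g) auto
    moreover have "(\<Sum>i<n. \<Sum>j<n. c i * c j * exp (- pairing X (\<lambda>r. g i r + g j r))) = (W X)\<^sup>2" if "X \<in> space Q" for X
    proof -
      have X: "X \<in> fin_measures" by (rule space_Q_fin[OF that])
      show ?thesis unfolding W[OF X] power2_eq_square sum_product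
        by (intro sum.cong refl) (simp add: ee[OF X, symmetric] mult_ac)
    qed
    moreover have "c i * c j * exp (- \<psi> (\<lambda>r. g i r + g j r)) = d i * d j * exp (K (g i) (g j))" for i j
      unfolding expK d_def by simp
    ultimately show ?thesis by (simp cong: has_bochner_integral_cong)
  qed
  have js: "jump_sq W X = (\<Sum>i<n. \<Sum>j<n. c i * c j * exp (- pairing X (\<lambda>r. g i r + g j r)) * K (g i) (g j))" if X: "X \<in> fin_measures" for X
  proof -
    have hb: "has_bochner_integral \<nu> (\<lambda>x. \<Sum>i<n. \<Sum>j<n. c i * c j * exp (- pairing X (\<lambda>r. g i r + g j r)) * ((1 - exp (- (snd x * g i (fst x)))) * (1 - exp (- (snd x * g j (fst x))))))
        (\<Sum>i<n. \<Sum>j<n. c i * c j * exp (- pairing X (\<lambda>r. g i r + g j r)) * K (g i) (g j))"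
      by (intro has_bochner_integral_sum has_bochner_integral_mult_right \<nu>_K g) auto
    have AE: "AE x in \<nu>. (W (add_dirac X (snd x) (fst x)) - W X)\<^sup>2 =
        (\<Sum>i<n. \<Sum>j<n. c i * c j * exp (- pairing X (\<lambda>r. g i r + g j r)) * ((1 - exp (- (snd x * g i (fst x)))) * (1 - exp (- (snd x * g j (fst x))))))"
      using AE_\<nu>_pos
    proof eventually_elim
      case (elim x)
      have "exp (- pairing (add_dirac X (snd x) (fst x)) (g i)) = exp (- pairing X (g i)) * exp (- (snd x * g i (fst x)))" if "i < n" for i
        using pairing_add_dirac[OF cnn_continuous[OF g[OF that]] X, of "snd x" "fst x"] elim by (simp add: exp_add[symmetric])
      then have "W X - W (add_dirac X (snd x) (fst x)) = (\<Sum>i<n. c i * exp (- pairing X (g i)) * (1 - exp (- (snd x * g i (fst x)))))"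
        unfolding W[OF X] W[OF add_dirac_fin[OF X]] sum_subtractf[symmetric]
        by (intro sum.cong) (auto simp: algebra_simps)
      then have "(W (add_dirac X (snd x) (fst x)) - W X)\<^sup>2 = (\<Sum>i<n. c i * exp (- pairing X (g i)) * (1 - exp (- (snd x * g i (fst x)))))\<^sup>2"
        by (metis power2_commute)
      also have "\<dots> = (\<Sum>i<n. \<Sum>j<n. c i * c j * exp (- pairing X (\<lambda>r. g i r + g j r)) * ((1 - exp (- (snd x * g i (fst x)))) * (1 - exp (- (snd x * g j (fst x))))))"
        unfolding power2_eq_square sum_product
        by (intro sum.cong refl) (simp add: ee[OF X, symmetric] mult_ac)
      finally show ?case .
    qed
    have [measurable]: "(\<lambda>x. W (add_dirac X (snd x) (fst x))) \<in> borel_measurable (borel \<Otimes>\<^sub>M borel)"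
      using ES_jump_measurable[OF assms X] .
    have "has_bochner_integral \<nu> (\<lambda>x. (W (add_dirac X (snd x) (fst x)) - W X)\<^sup>2)
        (\<Sum>i<n. \<Sum>j<n. c i * c j * exp (- pairing X (\<lambda>r. g i r + g j r)) * K (g i) (g j))"
      using hb by (rule has_bochner_integral_cong_AE[THEN iffD1, rotated -1])
        (use AE hb in \<open>auto simp: has_bochner_integral_iff elim: eventually_mono intro: borel_measurable_integrable\<close>)
    then show ?thesis by (simp add: jump_sq_def has_bochner_integral_iff)
  qed
  have hb3: "has_bochner_integral Q (jump_sq W) (\<Sum>i<n. \<Sum>j<n. d i * d j * (K (g i) (g j) * exp (K (g i) (g j))))"
  proof -
    have "has_bochner_integral Q (\<lambda>X. \<Sum>i<n. \<Sum>j<n. c i * c j * K (g i) (g j) * exp (- pairing X (\<lambda>r. g i r + g j r))) (\<Sum>i<n. \<Sum>j<n. c i * c j * K (g i) (g j) * exp (- \<psi> (\<lambda>r. g i r + g j r)))"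
      by (intro has_bochner_integral_sum has_bochner_integral_mult_right laplace_Q cnn_add g) auto
    moreover have "(\<Sum>i<n. \<Sum>j<n. c i * c j * K (g i) (g j) * exp (- pairing X (\<lambda>r. g i r + g j r))) = jump_sq W X" if "X \<in> space Q" for X
      using js[OF space_Q_fin[OF that]] by (simp add: mult_ac)
    moreover have "c i * c j * K (g i) (g j) * exp (- \<psi> (\<lambda>r. g i r + g j r)) = d i * d j * (K (g i) (g j) * exp (K (g i) (g j)))" for i j
      unfolding expK d_def by simp
    ultimately show ?thesis by (simp cong: has_bochner_integral_cong)
  qed
  show "integrable Q (jump_sq W)" using hb3 by (simp add: has_bochner_integral_iff)
  have "var Q W = (\<integral>X. (W X)\<^sup>2 \<partial>Q) - (\<integral>X. W X \<partial>Q)\<^sup>2"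
    using hb1 hb2 unfolding var_def by (intro Q.variance_eq) (auto simp: has_bochner_integral_iff)
  also have "\<dots> = (\<Sum>i<n. \<Sum>j<n. d i * d j * exp (K (g i) (g j))) - (\<Sum>i<n. \<Sum>j<n. d i * d j)"
    using hb1 hb2 by (simp add: has_bochner_integral_iff power2_eq_square sum_product)
  finally have var: "var Q W = (\<Sum>i<n. \<Sum>j<n. d i * d j * exp (K (g i) (g j))) - (\<Sum>i<n. \<Sum>j<n. d i * d j)" .
  let ?b = "\<lambda>k. if k = 0 then 0 else (real k - 1) / fact k :: real"
  have "(\<lambda>k. \<Sum>i<n. \<Sum>j<n. d i * d j * (?b k * K (g i) (g j) ^ k)) sums
      (\<Sum>i<n. \<Sum>j<n. d i * d j * (K (g i) (g j) * exp (K (g i) (g j)) - exp (K (g i) (g j)) + 1))"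
    by (intro sums_sum sums_mult entropy_series)
  moreover have "0 \<le> (\<Sum>i<n. \<Sum>j<n. d i * d j * (?b k * K (g i) (g j) ^ k))" for k
  proof -
    have "(\<Sum>i<n. \<Sum>j<n. d i * d j * (?b k * K (g i) (g j) ^ k)) = ?b k * (\<Sum>i<n. \<Sum>j<n. d i * d j * K (g i) (g j) ^ k)"
      unfolding sum_distrib_left by (intro sum.cong refl) simp
    moreover have "0 \<le> ?b k" by auto
    moreover have "0 \<le> (\<Sum>i<n. \<Sum>j<n. d i * d j * K (g i) (g j) ^ k)" by (rule K_power_psd[OF g])
    ultimately show ?thesis by (simp only: mult_nonneg_nonneg)
  qed
  ultimately have "0 \<le> (\<Sum>i<n. \<Sum>j<n. d i * d j * (K (g i) (g j) * exp (K (g i) (g j)) - exp (K (g i) (g j)) + 1))"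
    by (rule sums_le[OF _ sums_zero, rotated])
  also have "\<dots> = (\<Sum>i<n. \<Sum>j<n. d i * d j * (K (g i) (g j) * exp (K (g i) (g j)))) - var Q W"
    unfolding var sum_subtractf[symmetric] sum.distrib[symmetric]
    by (simp add: sum_subtractf[symmetric] sum.distrib[symmetric] algebra_simps)
  finally show "var Q W \<le> (\<integral>X. jump_sq W X \<partial>Q)"
    using hb3 by (simp add: has_bochner_integral_iff)
qed

lemma min_one_le_exp: "0 \<le> w \<Longrightarrow> min 1 w \<le> 2 * (1 - exp (- w))" for w :: real
proof -
  assume w: "0 \<le> w"
  have "exp (- w) * (1 + w) \<le> exp (- w) * exp w" by (intro mult_left_mono exp_ge_add_one_self) auto
  then have e: "exp (- w) * (1 + w) \<le> 1" by (simp add: exp_minus)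
  have "min 1 w * (1 + w) \<le> 2 * w"
    using w mult_left_le[of w w] by (auto simp: min_def algebra_simps)
  also have "\<dots> \<le> 2 * (1 - exp (- w)) * (1 + w)" using e by (simp add: algebra_simps)
  finally show "min 1 w \<le> 2 * (1 - exp (- w))" using w by (simp add: mult_le_cancel_right)
qed

text \<open>min(1, w) is at most 2 (1 - exp(- w)), whose square has a finite integral by
  \<open>\<nu>_K\<close>.\<close>

lemma \<nu>_min_sq: "integrable \<nu> (\<lambda>x. (min 1 (snd x))\<^sup>2)"
proof (rule Bochner_Integration.integrable_bound)
  show "integrable \<nu> (\<lambda>x. 4 * ((1 - exp (- (snd x * 1))) * (1 - exp (- (snd x * 1)))))"
    using \<nu>_K[OF one_cnn one_cnn] by (intro integrable_mult_right) (simp add: has_bochner_integral_iff)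
  show "AE x in \<nu>. norm ((min 1 (snd x))\<^sup>2) \<le> norm (4 * ((1 - exp (- (snd x * 1))) * (1 - exp (- (snd x * 1)))))"
    using AE_\<nu>_pos
  proof eventually_elim
    case (elim x)
    have "(min 1 (snd x))\<^sup>2 \<le> (2 * (1 - exp (- snd x)))\<^sup>2"
      using elim by (intro power_mono min_one_le_exp) auto
    then show ?case unfolding power_mult_distrib by (simp add: power2_eq_square)
  qed
qed measurable

text \<open>Uniform approximation with one jump bound \<open>C\<close> for all approximants; C^2
  min(1, w)^2 then dominates their squared jumps under \<open>\<nu>\<close>.\<close>

definition lip_approx :: "('e measure \<Rightarrow> real) \<Rightarrow> bool" where
  "lip_approx \<Psi> \<longleftrightarrow> (\<exists>C\<ge>0. \<forall>\<epsilon>>0. \<exists>W. ES (\<lambda>X r. W X) \<and> (\<forall>X\<in>fin_measures. \<bar>\<Psi> X - W X\<bar> \<le> \<epsilon>)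
     \<and> (\<forall>X\<in>fin_measures. \<forall>z\<ge>0. \<forall>r. \<bar>W (add_dirac X z r) - W X\<bar> \<le> C * min 1 z))"

text \<open>Limits are taken twice: under \<open>\<nu>\<close> for fixed X, dominated by C^2 min(1,
  w)^2, and then under \<open>Q\<close>, where the bounds are constants.\<close>

lemma poincare:
  assumes \<Psi>: "lip_approx \<Psi>"
  shows "\<And>X. X \<in> fin_measures \<Longrightarrow> integrable \<nu> (\<lambda>x. (\<Psi> (add_dirac X (snd x) (fst x)) - \<Psi> X)\<^sup>2)"
    and "integrable Q (jump_sq \<Psi>)" and "var Q \<Psi> \<le> (\<integral>X. jump_sq \<Psi> X \<partial>Q)"
proof -
  obtain C where C: "0 \<le> C" and ex: "\<And>\<epsilon>. 0 < \<epsilon> \<Longrightarrow> \<exists>W. ES (\<lambda>X r. W X) \<and> (\<forall>X\<in>fin_measures. \<bar>\<Psi> X - W X\<bar> \<le> \<epsilon>)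
     \<and> (\<forall>X\<in>fin_measures. \<forall>z\<ge>0. \<forall>r. \<bar>W (add_dirac X z r) - W X\<bar> \<le> C * min 1 z)"
    using \<Psi> unfolding lip_approx_def by metis
  have "\<exists>W. ES (\<lambda>X r. W X) \<and> (\<forall>X\<in>fin_measures. \<bar>\<Psi> X - W X\<bar> \<le> 1 / real (Suc k))
     \<and> (\<forall>X\<in>fin_measures. \<forall>z\<ge>0. \<forall>r. \<bar>W (add_dirac X z r) - W X\<bar> \<le> C * min 1 z)" for k
    by (rule ex) simp
  then obtain W where W: "\<And>k. ES (\<lambda>X r. W k X)" "\<And>k X. X \<in> fin_measures \<Longrightarrow> \<bar>\<Psi> X - W k X\<bar> \<le> 1 / real (Suc k)"
    and WL: "\<And>k X z r. X \<in> fin_measures \<Longrightarrow> 0 \<le> z \<Longrightarrow> \<bar>W k (add_dirac X z r) - W k X\<bar> \<le> C * min 1 z"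
    by metis
  have W_lim: "(\<lambda>k. W k X) \<longlonglongrightarrow> \<Psi> X" if "X \<in> fin_measures" for X
    by (rule tendsto_of_bound[OF W(2)[OF that]])
  define q where "q = (\<integral>x. (min 1 (snd x))\<^sup>2 \<partial>\<nu>)"
  have iC: "integrable \<nu> (\<lambda>x. C\<^sup>2 * (min 1 (snd x))\<^sup>2)" by (intro integrable_mult_right \<nu>_min_sq)
  have b: "AE x in \<nu>. norm ((W k (add_dirac X (snd x) (fst x)) - W k X)\<^sup>2) \<le> C\<^sup>2 * (min 1 (snd x))\<^sup>2" if X: "X \<in> fin_measures" for k X
    using AE_\<nu>_pos
  proof eventually_elim
    case (elim x)
    have "\<bar>W k (add_dirac X (snd x) (fst x)) - W k X\<bar>\<^sup>2 \<le> (C * min 1 (snd x))\<^sup>2"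
      using elim by (intro power_mono WL X) auto
    then show ?case by (simp add: power_mult_distrib)
  qed
  have mW: "(\<lambda>x. (W k (add_dirac X (snd x) (fst x)) - W k X)\<^sup>2) \<in> borel_measurable \<nu>" if "X \<in> fin_measures" for k X
    using ES_jump_measurable[OF W(1) that, of k] by measurable
  have lim: "AE x in \<nu>. (\<lambda>k. (W k (add_dirac X (snd x) (fst x)) - W k X)\<^sup>2) \<longlonglongrightarrow> (\<Psi> (add_dirac X (snd x) (fst x)) - \<Psi> X)\<^sup>2" if X: "X \<in> fin_measures" for X
    by (intro AE_I2 tendsto_power tendsto_diff W_lim add_dirac_fin X)
  have m\<Psi>: "(\<lambda>x. (\<Psi> (add_dirac X (snd x) (fst x)) - \<Psi> X)\<^sup>2) \<in> borel_measurable \<nu>" if X: "X \<in> fin_measures" for X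
    by (rule borel_measurable_LIMSEQ_real[where u = "\<lambda>k x. (W k (add_dirac X (snd x) (fst x)) - W k X)\<^sup>2", OF _ mW[OF X]])
      (intro tendsto_power tendsto_diff W_lim add_dirac_fin X)
  show "integrable \<nu> (\<lambda>x. (\<Psi> (add_dirac X (snd x) (fst x)) - \<Psi> X)\<^sup>2)" if X: "X \<in> fin_measures" for X
    by (rule integrable_dominated_convergence[OF m\<Psi>[OF X] mW[OF X] iC lim[OF X] b[OF X]])
  have js_lim: "(\<lambda>k. jump_sq (W k) X) \<longlonglongrightarrow> jump_sq \<Psi> X" if "X \<in> space Q" for X
  proof -
    have X: "X \<in> fin_measures" by (rule space_Q_fin[OF that])
    show ?thesis unfolding jump_sq_def
      by (rule integral_dominated_convergence[OF m\<Psi>[OF X] mW[OF X] iC lim[OF X] b[OF X]])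
  qed
  have js_b: "norm (jump_sq (W k) X) \<le> C\<^sup>2 * q" if "X \<in> space Q" for k X
  proof -
    have X: "X \<in> fin_measures" by (rule space_Q_fin[OF that])
    have i: "integrable \<nu> (\<lambda>x. (W k (add_dirac X (snd x) (fst x)) - W k X)\<^sup>2)"
    proof (rule Bochner_Integration.integrable_bound[OF iC mW[OF X]])
      show "AE x in \<nu>. norm ((W k (add_dirac X (snd x) (fst x)) - W k X)\<^sup>2) \<le> norm (C\<^sup>2 * (min 1 (snd x))\<^sup>2)"
        using b[OF X, of k] by eventually_elim simp
    qed
    have "jump_sq (W k) X \<le> (\<integral>x. C\<^sup>2 * (min 1 (snd x))\<^sup>2 \<partial>\<nu>)"
      unfolding jump_sq_def using b[OF X, of k] by (intro integral_mono_AE i iC) (auto elim: eventually_mono)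
    moreover have "0 \<le> jump_sq (W k) X" unfolding jump_sq_def by (intro Bochner_Integration.integral_nonneg) simp
    ultimately show ?thesis by (simp add: q_def)
  qed
  have js_m: "jump_sq (W k) \<in> borel_measurable Q" for k
    using poincare_exp_sum(1)[OF W(1)] by (rule borel_measurable_integrable)
  have js_m': "jump_sq \<Psi> \<in> borel_measurable Q" by (rule borel_measurable_LIMSEQ_real[OF js_lim js_m])
  have iq: "integrable Q (\<lambda>_. C\<^sup>2 * q)" by simp
  show "integrable Q (jump_sq \<Psi>)"
    by (rule integrable_dominated_convergence[OF js_m' js_m iq AE_I2[OF js_lim] AE_I2[OF js_b]])
  have L1: "(\<lambda>k. \<integral>X. jump_sq (W k) X \<partial>Q) \<longlonglongrightarrow> (\<integral>X. jump_sq \<Psi> X \<partial>Q)"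
    by (rule integral_dominated_convergence[OF js_m' js_m iq AE_I2[OF js_lim] AE_I2[OF js_b]])
  obtain B where B0: "0 < B" and B: "\<And>X r. X \<in> fin_measures \<Longrightarrow> \<bar>W 0 X\<bar> \<le> B" using ES_bounded[OF W(1)[of 0]] by metis
  \<comment> \<open>\<open>W 0\<close> and \<open>W k\<close> are both within 1 of \<Psi>, hence the
    2.\<close>
  have WB: "\<bar>W k X\<bar> \<le> B + 2" if "X \<in> fin_measures" for k X
  proof -
    have "1 / real (Suc k) \<le> 1" by simp
    moreover have "\<bar>\<Psi> X - W 0 X\<bar> \<le> 1" using W(2)[OF that, of 0] by simp
    ultimately show ?thesis using W(2)[OF that, of k] B[OF that] by linarith
  qed
  have Wm: "W k \<in> borel_measurable Q" for k using NN_measurable_Q(3)[OF ES_NN[OF W(1)[of k]]] by simp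
  have \<Psi>m: "\<Psi> \<in> borel_measurable Q" by (rule borel_measurable_LIMSEQ_real[OF W_lim[OF space_Q_fin] Wm])
  have iB: "integrable Q (\<lambda>_. B + 2)" "integrable Q (\<lambda>_. (B + 2)\<^sup>2)" by simp_all
  have l1: "AE X in Q. (\<lambda>k. W k X) \<longlonglongrightarrow> \<Psi> X" by (rule AE_I2) (rule W_lim[OF space_Q_fin])
  have l2: "AE X in Q. norm (W k X) \<le> B + 2" for k by (rule AE_I2) (simp add: WB space_Q_fin)
  have l3: "AE X in Q. (\<lambda>k. (W k X)\<^sup>2) \<longlonglongrightarrow> (\<Psi> X)\<^sup>2" using l1 by eventually_elim (rule tendsto_power)
  have l4: "AE X in Q. norm ((W k X)\<^sup>2) \<le> (B + 2)\<^sup>2" for k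
    using l2[of k]
  proof eventually_elim
    case (elim X)
    then have "\<bar>W k X\<bar>\<^sup>2 \<le> (B + 2)\<^sup>2" by (intro power_mono) auto
    then show ?case by simp
  qed
  have sm: "(\<lambda>X. (W k X)\<^sup>2) \<in> borel_measurable Q" "(\<lambda>X. (\<Psi> X)\<^sup>2) \<in> borel_measurable Q" for k
    using Wm[of k] \<Psi>m by measurable
  have v: "var Q U = (\<integral>X. (U X)\<^sup>2 \<partial>Q) - (\<integral>X. U X \<partial>Q)\<^sup>2" if "integrable Q U" "integrable Q (\<lambda>X. (U X)\<^sup>2)" for U
    unfolding var_def using that by (intro Q.variance_eq)
  have iW: "integrable Q (W k)" "integrable Q (\<lambda>X. (W k X)\<^sup>2)" for k
    using Q.integrable_const_bound[OF l2 Wm] Q.integrable_const_bound[OF l4 sm(1)] by auto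
  have i\<Psi>: "integrable Q \<Psi>" "integrable Q (\<lambda>X. (\<Psi> X)\<^sup>2)"
    using integrable_dominated_convergence[OF \<Psi>m Wm iB(1) l1 l2] integrable_dominated_convergence[OF sm(2,1) iB(2) l3 l4] by auto
  have L2: "(\<lambda>k. var Q (W k)) \<longlonglongrightarrow> var Q \<Psi>"
    unfolding v[OF iW] v[OF i\<Psi>]
    by (intro tendsto_diff tendsto_power integral_dominated_convergence[OF \<Psi>m Wm iB(1) l1 l2] integral_dominated_convergence[OF sm(2,1) iB(2) l3 l4])
  show "var Q \<Psi> \<le> (\<integral>X. jump_sq \<Psi> X \<partial>Q)"
    by (rule LIMSEQ_le[OF L2 L1]) (use poincare_exp_sum(2)[OF W(1)] in auto)
qed

end

section \<open>Differentiation on the orthant\<close>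

lemma tendsto_coordinatewise:
  fixes f :: "'a \<Rightarrow> nat \<Rightarrow> real"
  assumes "\<And>i. ((\<lambda>c. f c i) \<longlongrightarrow> l i) F"
  shows "(f \<longlongrightarrow> l) F"
proof -
  have "limitin (product_topology (\<lambda>_. euclidean) UNIV) f l F"
    using assms by (subst limitin_componentwise) auto
  then show ?thesis by (simp add: euclidean_product_topology)
qed

text \<open>Covers both orders of u and w, with the intermediate point inside the half-line on which
  the one-sided derivatives are given.\<close>

lemma halfline_mvt:
  fixes f :: "real \<Rightarrow> real"
  assumes d: "\<And>u. 0 \<le> u \<Longrightarrow> (f has_real_derivative f' u) (at u within {0..})" and "0 \<le> u" "0 \<le> w"
  shows "\<exists>c\<ge>0. \<bar>c - u\<bar> \<le> \<bar>w - u\<bar> \<and> f w - f u = (w - u) * f' c"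
proof -
  have *: "\<exists>c\<ge>0. u \<le> c \<and> c \<le> w \<and> f w - f u = (w - u) * f' c" if uw: "0 \<le> u" "u < w" for u w
  proof -
    have "\<exists>c\<in>{u<..<w}. f w - f u = f' c * (w - u)"
    proof (rule mvt_simple[OF uw(2)])
      fix x assume "u \<le> x" "x \<le> w"
      then have "(f has_real_derivative f' x) (at x within {u..w})"
        using uw by (intro DERIV_subset[OF d]) auto
      then show "(f has_derivative (\<lambda>h. f' x * h)) (at x within {u..w})"
        by (simp add: has_field_derivative_def)
    qed
    then obtain c where "c \<in> {u<..<w}" "f w - f u = f' c * (w - u)" ..
    then show ?thesis using uw by (intro exI[of _ c]) (auto simp: mult.commute)
  qed
  consider "u = w" | "u < w" | "w < u" by linarith
  then show ?thesis
  proof cases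
    case 1
    then show ?thesis using assms by auto
  next
    case 2
    from *[OF assms(2) 2] obtain c where "0 \<le> c" "u \<le> c" "c \<le> w" "f w - f u = (w - u) * f' c" by auto
    then show ?thesis by (intro exI[of _ c]) auto
  next
    case 3
    from *[OF assms(3) 3] obtain c where c: "0 \<le> c" "w \<le> c" "c \<le> u" "f u - f w = (u - w) * f' c" by auto
    then have "f w - f u = (w - u) * f' c" by (simp add: algebra_simps)
    then show ?thesis using c by (intro exI[of _ c]) auto
  qed
qed

lemma halfline_derivative_unique:
  assumes "(f has_real_derivative c) (at t within {0..})" "(f has_real_derivative d) (at t within {0..})" "0 \<le> t"
  shows "c = d"
proof -
  have "t islimpt {t..t + 1}" by (simp add: islimpt_Icc)
  then have "t islimpt {0..}" by (rule islimpt_subset) (use assms(3) in auto)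
  then have "at t within {0..} \<noteq> bot" by (simp add: trivial_limit_within)
  then show ?thesis
    using assms(1,2) vector_derivative_unique_within by (metis has_real_derivative_iff_has_vector_derivative)
qed

definition ray :: "(nat \<Rightarrow> real) \<Rightarrow> (nat \<Rightarrow> real) \<Rightarrow> real \<Rightarrow> nat \<Rightarrow> real" where
  "ray x v t i = x i + t * v i"

lemma ray_orthant: "x \<in> orthant n \<Longrightarrow> v \<in> orthant n \<Longrightarrow> 0 \<le> t \<Longrightarrow> ray x v t \<in> orthant n"
  by (auto simp: orthant_def ray_def)

text \<open>\<open>C2_orthant\<close> speaks of partial derivatives only, one-sided at the faces.
  The chain rule is obtained from one mean value step per coordinate and continuity of the partials,
  staying inside the orthant throughout.\<close>

lemma ray_derivative:
  assumes p: "\<And>i. i < n \<Longrightarrow> partial_on_orthant n i \<phi> (g i)" and c: "\<And>i. i < n \<Longrightarrow> continuous_on (orthant n) (g i)"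
    and x: "x \<in> orthant n" and v: "v \<in> orthant n" and t: "0 \<le> t"
  shows "((\<lambda>t. \<phi> (ray x v t)) has_real_derivative (\<Sum>i<n. v i * g i (ray x v t))) (at t within {0..})"
proof -
  \<comment> \<open>Hybrid between times s and t: the first k coordinates have moved to time
    s.\<close>
  define h where "h k s i = (if i < k then ray x v s i else ray x v t i)" for k s i
  have ho: "h k s \<in> orthant n" if "0 \<le> s" for k s
    using ray_orthant[OF x v that] ray_orthant[OF x v t] by (auto simp: orthant_def h_def)
  have "\<exists>c\<ge>0. \<bar>c - ray x v t k\<bar> \<le> \<bar>ray x v s k - ray x v t k\<bar> \<and> \<phi> (h (Suc k) s) - \<phi> (h k s) = (ray x v s k - ray x v t k) * g k ((h k s)(k := c))"
    if k: "k < n" and s: "0 \<le> s" for k s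
  proof -
    have e: "h (Suc k) s = (h k s)(k := ray x v s k)" "h k s = (h k s)(k := ray x v t k)"
      by (auto simp: h_def fun_eq_iff)
    have d: "((\<lambda>u. \<phi> ((h k s)(k := u))) has_real_derivative g k ((h k s)(k := u))) (at u within {0..})" if "0 \<le> u" for u
    proof -
      have "(h k s)(k := u) \<in> orthant n" using ho[OF s, of k] that k by (auto simp: orthant_def)
      then show ?thesis using p[OF k] unfolding partial_on_orthant_def by (auto dest!: bspec)
    qed
    have "0 \<le> ray x v t k" "0 \<le> ray x v s k"
      using ray_orthant[OF x v t] ray_orthant[OF x v s] k by (auto simp: orthant_def)
    from halfline_mvt[OF d this] show ?thesis using e by metis
  qed
  then obtain \<xi> where \<xi>: "\<And>k s. k < n \<Longrightarrow> 0 \<le> s \<Longrightarrow> 0 \<le> \<xi> k s \<and> \<bar>\<xi> k s - ray x v t k\<bar> \<le> \<bar>ray x v s k - ray x v t k\<bar> \<and>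
      \<phi> (h (Suc k) s) - \<phi> (h k s) = (ray x v s k - ray x v t k) * g k ((h k s)(k := \<xi> k s))"
    by metis
  have diff: "\<phi> (ray x v s) - \<phi> (ray x v t) = (s - t) * (\<Sum>k<n. v k * g k ((h k s)(k := \<xi> k s)))" if s: "0 \<le> s" for s
  proof -
    have "h n s = ray x v s" "h 0 s = ray x v t"
      using x v by (auto simp: h_def fun_eq_iff ray_def orthant_def)
    then have "\<phi> (ray x v s) - \<phi> (ray x v t) = (\<Sum>k<n. \<phi> (h (Suc k) s) - \<phi> (h k s))"
      using sum_lessThan_telescope[of "\<lambda>k. \<phi> (h k s)" n] by simp
    also have "\<dots> = (\<Sum>k<n. (s - t) * (v k * g k ((h k s)(k := \<xi> k s))))"
    proof (rule sum.cong[OF refl])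
      fix k assume "k \<in> {..<n}"
      then have "\<phi> (h (Suc k) s) - \<phi> (h k s) = (ray x v s k - ray x v t k) * g k ((h k s)(k := \<xi> k s))" using \<xi> s by auto
      moreover have "ray x v s k - ray x v t k = (s - t) * v k" by (simp add: ray_def algebra_simps)
      ultimately show "\<phi> (h (Suc k) s) - \<phi> (h k s) = (s - t) * (v k * g k ((h k s)(k := \<xi> k s)))" by simp
    qed
    finally show ?thesis by (simp add: sum_distrib_left)
  qed
  have ge: "\<forall>\<^sub>F s in at t within {0..}. 0 \<le> s" by (auto simp: eventually_at_filter)
  have ray_lim: "((\<lambda>s. ray x v s i) \<longlongrightarrow> ray x v t i) (at t within {0..})" for i
    unfolding ray_def by (intro tendsto_intros)
  have lim: "((\<lambda>s. g k ((h k s)(k := \<xi> k s))) \<longlongrightarrow> g k (ray x v t)) (at t within {0..})" if k: "k < n" for k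
  proof (rule continuous_on_tendsto_compose[OF c[OF k]])
    show "ray x v t \<in> orthant n" by (rule ray_orthant[OF x v t])
    show "\<forall>\<^sub>F s in at t within {0..}. (h k s)(k := \<xi> k s) \<in> orthant n"
      using ge
    proof eventually_elim
      case (elim s)
      then show ?case using ho[OF elim, of k] \<xi>[OF k elim] k by (auto simp: orthant_def)
    qed
    show "((\<lambda>s. (h k s)(k := \<xi> k s)) \<longlongrightarrow> ray x v t) (at t within {0..})"
    proof (rule tendsto_coordinatewise)
      fix i
      have \<xi>lim: "(\<xi> k \<longlongrightarrow> ray x v t k) (at t within {0..})"
      proof -
        have "((\<lambda>s. \<xi> k s - ray x v t k) \<longlongrightarrow> 0) (at t within {0..})"
        proof (rule Lim_null_comparison)
          show "\<forall>\<^sub>F s in at t within {0..}. norm (\<xi> k s - ray x v t k) \<le> \<bar>ray x v s k - ray x v t k\<bar>"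
            using ge by eventually_elim (use \<xi>[OF k] in auto)
          show "((\<lambda>s. \<bar>ray x v s k - ray x v t k\<bar>) \<longlongrightarrow> 0) (at t within {0..})"
            using tendsto_rabs[OF tendsto_diff[OF ray_lim[of k] tendsto_const[of "ray x v t k"]]] by simp
        qed
        then show ?thesis by (simp add: LIM_zero_iff)
      qed
      consider "i = k" | "i \<noteq> k" "i < k" | "i \<noteq> k" "\<not> i < k" by blast
      then show "((\<lambda>s. ((h k s)(k := \<xi> k s)) i) \<longlongrightarrow> ray x v t i) (at t within {0..})"
        by cases (use \<xi>lim ray_lim in \<open>simp_all add: h_def\<close>)
    qed
  qed
  have "((\<lambda>s. \<Sum>k<n. v k * g k ((h k s)(k := \<xi> k s))) \<longlongrightarrow> (\<Sum>k<n. v k * g k (ray x v t))) (at t within {0..})"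
    by (intro tendsto_sum tendsto_mult tendsto_const lim) auto
  moreover have "\<forall>\<^sub>F s in at t within {0..}. (\<Sum>k<n. v k * g k ((h k s)(k := \<xi> k s))) = (\<phi> (ray x v s) - \<phi> (ray x v t)) / (s - t)"
  proof -
    have "\<forall>\<^sub>F s in at t within {0..}. 0 \<le> s \<and> s \<noteq> t" by (auto simp: eventually_at_filter)
    then show ?thesis by eventually_elim (simp add: diff)
  qed
  ultimately have "((\<lambda>s. (\<phi> (ray x v s) - \<phi> (ray x v t)) / (s - t)) \<longlongrightarrow> (\<Sum>k<n. v k * g k (ray x v t))) (at t within {0..})"
    by (rule Lim_transform_eventually)
  then show ?thesis by (simp add: has_field_derivative_iff)
qed

lemma compact_box:
  fixes n :: nat and R :: real
  assumes "0 < R"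
  shows "compact {x. (\<forall>i<n. 0 \<le> x i \<and> x i \<le> R) \<and> (\<forall>i\<ge>n. x i = (0::real))}"
proof -
  have c: "continuous_on (cube n) (\<lambda>y i. R * y i)"
    by (intro continuous_on_coordinatewise_then_product continuous_intros continuous_on_product_coordinates continuous_on_subset[OF continuous_on_product_coordinates]) auto
  have "{x. (\<forall>i<n. 0 \<le> x i \<and> x i \<le> R) \<and> (\<forall>i\<ge>n. x i = 0)} = (\<lambda>y i. R * y i) ` cube n"
  proof (intro set_eqI iffI)
    fix x assume x: "x \<in> {x. (\<forall>i<n. 0 \<le> x i \<and> x i \<le> R) \<and> (\<forall>i\<ge>n. x i = 0)}"
    have "(\<lambda>i. x i / R) \<in> cube n" using x assms by (auto simp: cube_def)
    moreover have "x = (\<lambda>i. R * (x i / R))" using assms by auto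
    ultimately show "x \<in> (\<lambda>y i. R * y i) ` cube n" by (intro image_eqI[of _ _ "\<lambda>i. x i / R"])
  next
    fix x assume "x \<in> (\<lambda>y i. R * y i) ` cube n"
    then obtain y where y: "y \<in> cube n" "x = (\<lambda>i. R * y i)" by blast
    have "R * y i \<le> R" if "i < n" for i using y(1) that \<open>0 < R\<close> by (auto simp: cube_def mult_left_le)
    then show "x \<in> {x. (\<forall>i<n. 0 \<le> x i \<and> x i \<le> R) \<and> (\<forall>i\<ge>n. x i = 0)}"
      using y assms by (auto simp: cube_def)
  qed
  then show ?thesis using compact_continuous_image[OF c compact_cube] by simp
qed

lemma orthant_bounded:
  fixes u :: "(nat \<Rightarrow> real) \<Rightarrow> real"
  assumes "continuous_on (orthant n) u" "0 < R" "\<And>x i. x \<in> orthant n \<Longrightarrow> i < n \<Longrightarrow> R \<le> x i \<Longrightarrow> u x = 0"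
  shows "\<exists>B>0. \<forall>x\<in>orthant n. \<bar>u x\<bar> \<le> B"
proof -
  let ?S = "{x. (\<forall>i<n. 0 \<le> x i \<and> x i \<le> R) \<and> (\<forall>i\<ge>n. x i = (0::real))}"
  have "?S \<subseteq> orthant n" by (auto simp: orthant_def)
  then have "bounded (u ` ?S)"
    using assms by (intro compact_imp_bounded compact_continuous_image compact_box continuous_on_subset[OF assms(1)])
  then obtain B where B: "\<And>x. x \<in> ?S \<Longrightarrow> \<bar>u x\<bar> \<le> B" by (auto simp: bounded_iff)
  have "\<bar>u x\<bar> \<le> max B 1" if x: "x \<in> orthant n" for x
  proof (cases "\<exists>i<n. R \<le> x i")
    case True
    then show ?thesis using assms(3)[OF x] by auto
  next
    case False
    then have "x i \<le> R" if "i < n" for i using that by (meson linear)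
    then have "x \<in> ?S" using x by (auto simp: orthant_def)
    then show ?thesis using B by (meson max.coboundedI1)
  qed
  then show ?thesis by (intro exI[of _ "max B 1"]) auto
qed

text \<open>The strict inequality R < x j leaves room: \<open>u\<close> vanishes in a neighbourhood
  along the i-th direction, also when i = j.\<close>

lemma partial_vanishes:
  assumes p: "partial_on_orthant n i u g" and i: "i < n"
    and u: "\<And>x j. x \<in> orthant n \<Longrightarrow> j < n \<Longrightarrow> R < x j \<Longrightarrow> u x = 0"
    and x: "x \<in> orthant n" "j < n" "R < x j"
  shows "g x = 0"
proof -
  have xi: "0 \<le> x i" using x i by (auto simp: orthant_def)
  have "((\<lambda>t. u (x(i := t))) has_real_derivative g x) (at (x i) within {0..})"
    using p x unfolding partial_on_orthant_def by auto
  moreover have "((\<lambda>t. u (x(i := t))) has_real_derivative 0) (at (x i) within {0..})"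
  proof (rule has_field_derivative_transform_within[OF DERIV_const[where k = 0], where d = "x j - R"])
    show "0 < x j - R" using x by simp
    show "x i \<in> {0..}" using xi by simp
    fix t assume t: "t \<in> {0..}" "dist t (x i) < x j - R"
    have o: "x(i := t) \<in> orthant n" using x t i by (auto simp: orthant_def)
    have "R < (x(i := t)) j" using x t by (cases "j = i") (auto simp: dist_real_def)
    then show "0 = u (x(i := t))" using u[OF o x(2)] by simp
  qed
  ultimately show ?thesis using halfline_derivative_unique xi by blast
qed

lemma test_function_data:
  assumes "C2_orthant n \<phi>" "compact_support_orthant n \<phi>"
  obtains g h R B where "0 < R" "0 < B" "continuous_on (orthant n) \<phi>"
    "\<And>i. i < n \<Longrightarrow> partial_on_orthant n i \<phi> (g i)" "\<And>i. i < n \<Longrightarrow> continuous_on (orthant n) (g i)"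
    "\<And>i j. i < n \<Longrightarrow> j < n \<Longrightarrow> partial_on_orthant n j (g i) (h i j)" "\<And>i j. i < n \<Longrightarrow> j < n \<Longrightarrow> continuous_on (orthant n) (h i j)"
    "\<And>x k. x \<in> orthant n \<Longrightarrow> k < n \<Longrightarrow> R \<le> x k \<Longrightarrow> \<phi> x = 0"
    "\<And>x k i. x \<in> orthant n \<Longrightarrow> k < n \<Longrightarrow> R \<le> x k \<Longrightarrow> i < n \<Longrightarrow> g i x = 0"
    "\<And>x k i j. x \<in> orthant n \<Longrightarrow> k < n \<Longrightarrow> R \<le> x k \<Longrightarrow> i < n \<Longrightarrow> j < n \<Longrightarrow> h i j x = 0"
    "\<And>x. x \<in> orthant n \<Longrightarrow> \<bar>\<phi> x\<bar> \<le> B" "\<And>x i. x \<in> orthant n \<Longrightarrow> i < n \<Longrightarrow> \<bar>g i x\<bar> \<le> B"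
    "\<And>x i j. x \<in> orthant n \<Longrightarrow> i < n \<Longrightarrow> j < n \<Longrightarrow> \<bar>h i j x\<bar> \<le> B"
proof -
  obtain g h where cont: "continuous_on (orthant n) \<phi>"
    and g: "\<And>i. i < n \<Longrightarrow> partial_on_orthant n i \<phi> (g i)" "\<And>i. i < n \<Longrightarrow> continuous_on (orthant n) (g i)"
    and h: "\<And>i j. i < n \<Longrightarrow> j < n \<Longrightarrow> partial_on_orthant n j (g i) (h i j)" "\<And>i j. i < n \<Longrightarrow> j < n \<Longrightarrow> continuous_on (orthant n) (h i j)"
    using assms(1) unfolding C2_orthant_def by blast
  let ?K = "closure {x \<in> orthant n. \<phi> x \<noteq> 0}"
  have "\<exists>B. \<forall>x\<in>?K. \<bar>x i\<bar> \<le> B" for i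
  proof -
    have "compact ((\<lambda>x. x i) ` ?K)"
      using assms(2) unfolding compact_support_orthant_def
      by (intro compact_continuous_image continuous_on_subset[OF continuous_on_product_coordinates]) auto
    then show ?thesis by (auto dest!: compact_imp_bounded simp: bounded_iff)
  qed
  then obtain b where b: "\<And>i x. x \<in> ?K \<Longrightarrow> \<bar>x i\<bar> \<le> b i" by metis
  define R where "R = (\<Sum>i<n. \<bar>b i\<bar>)"
  have \<phi>0: "\<phi> x = 0" if "x \<in> orthant n" "k < n" "R < x k" for x k
  proof (rule ccontr)
    assume "\<phi> x \<noteq> 0"
    then have "x \<in> {x \<in> orthant n. \<phi> x \<noteq> 0}" using that by simp
    then have "x \<in> ?K" by (rule closure_subset[THEN subsetD])
    then have "x k \<le> \<bar>b k\<bar>" using b[of x k] by linarith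
    also have "\<dots> \<le> R" unfolding R_def using that by (intro member_le_sum) auto
    finally show False using that by simp
  qed
  have g0: "g i x = 0" if "x \<in> orthant n" "k < n" "R < x k" "i < n" for x k i
    by (rule partial_vanishes[OF g(1)[OF that(4)] that(4) \<phi>0 that(1,2,3)])
  have h0: "h i j x = 0" if "x \<in> orthant n" "k < n" "R < x k" "i < n" "j < n" for x k i j
    by (rule partial_vanishes[OF h(1)[OF that(4,5)] that(5) g0[OF _ _ _ that(4)] that(1,2,3)])
  have R0: "0 \<le> R" by (simp add: R_def sum_nonneg)
  obtain B0 where B0: "0 < B0" "\<And>x. x \<in> orthant n \<Longrightarrow> \<bar>\<phi> x\<bar> \<le> B0"
    using orthant_bounded[OF cont, of "R + 1"] \<phi>0 R0 by force
  have "\<exists>B>0. \<forall>x\<in>orthant n. \<bar>g i x\<bar> \<le> B" if "i < n" for i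
    by (rule orthant_bounded[OF g(2)[OF that], of "R + 1"]) (use g0 that R0 in force)+
  then obtain B1 where B1: "\<And>i x. i < n \<Longrightarrow> 0 < B1 i \<and> (x \<in> orthant n \<longrightarrow> \<bar>g i x\<bar> \<le> B1 i)" by metis
  have "\<exists>B>0. \<forall>x\<in>orthant n. \<bar>h i j x\<bar> \<le> B" if "i < n" "j < n" for i j
    by (rule orthant_bounded[OF h(2)[OF that], of "R + 1"]) (use h0 that R0 in force)+
  then obtain B2 where B2: "\<And>i j x. i < n \<Longrightarrow> j < n \<Longrightarrow> 0 < B2 i j \<and> (x \<in> orthant n \<longrightarrow> \<bar>h i j x\<bar> \<le> B2 i j)" by metis
  define B where "B = B0 + (\<Sum>i<n. B1 i) + (\<Sum>i<n. \<Sum>j<n. B2 i j)"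
  have s1: "0 \<le> (\<Sum>i<n. B1 i)" using B1 by (intro sum_nonneg) (auto intro: less_imp_le)
  have s2: "0 \<le> (\<Sum>i<n. \<Sum>j<n. B2 i j)" using B2 by (intro sum_nonneg) (auto intro: less_imp_le)
  have B: "0 < B" using B0 s1 s2 by (simp add: B_def)
  have b1: "\<bar>g i x\<bar> \<le> B" if "x \<in> orthant n" "i < n" for i x
  proof -
    have "\<bar>g i x\<bar> \<le> B1 i" using B1 that by blast
    also have "\<dots> \<le> (\<Sum>i<n. B1 i)" using that B1 by (intro member_le_sum) (auto intro: less_imp_le)
    also have "\<dots> \<le> B" using B0 s2 by (simp add: B_def)
    finally show ?thesis .
  qed
  have b2: "\<bar>h i j x\<bar> \<le> B" if "x \<in> orthant n" "i < n" "j < n" for i j x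
  proof -
    have "\<bar>h i j x\<bar> \<le> B2 i j" using B2 that by blast
    also have "\<dots> \<le> (\<Sum>j<n. B2 i j)" using that B2 by (intro member_le_sum) (auto intro: less_imp_le)
    also have "\<dots> \<le> (\<Sum>i<n. \<Sum>j<n. B2 i j)" using that B2 by (intro member_le_sum[where f = "\<lambda>i. \<Sum>j<n. B2 i j"]) (auto intro!: sum_nonneg intro: less_imp_le)
    also have "\<dots> \<le> B" using B0 s1 by (simp add: B_def)
    finally show ?thesis .
  qed
  have b0: "\<bar>\<phi> x\<bar> \<le> B" if "x \<in> orthant n" for x
    using B0(2)[OF that] s1 s2 by (simp add: B_def)
  have lt: "R + 1 \<le> y \<Longrightarrow> R < y" for y :: real by linarith
  show ?thesis
  \<comment> \<open>R + 1 converts the strict thresholds above into the non-strict ones required by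
    \<open>vanishing_clip\<close>.\<close>
  proof (rule that[of "R + 1" B g h])
    show "0 < R + 1" using R0 by simp
    show "\<phi> x = 0" if "x \<in> orthant n" "k < n" "R + 1 \<le> x k" for x k
      by (rule \<phi>0[OF that(1,2) lt[OF that(3)]])
    show "g i x = 0" if "x \<in> orthant n" "k < n" "R + 1 \<le> x k" "i < n" for x k i
      by (rule g0[OF that(1,2) lt[OF that(3)] that(4)])
    show "h i j x = 0" if "x \<in> orthant n" "k < n" "R + 1 \<le> x k" "i < n" "j < n" for x k i j
      by (rule h0[OF that(1,2) lt[OF that(3)] that(4,5)])
  qed (fact B cont g h b0 b1 b2)+
qed

section \<open>The operator and its energy\<close>

lemma C2_compact_lin:
  assumes "C2_compact F F' F''" "C2_compact H H' H''"
  shows "C2_compact (\<lambda>t. p * F t + q * H t) (\<lambda>t. p * F' t + q * H' t) (\<lambda>t. p * F'' t + q * H'' t)"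
proof -
  obtain R where R: "0 < R" "\<And>t. R \<le> t \<Longrightarrow> F t = 0 \<and> F' t = 0 \<and> F'' t = 0" using assms(1) by (auto simp: C2_compact_def)
  obtain S where S: "0 < S" "\<And>t. S \<le> t \<Longrightarrow> H t = 0 \<and> H' t = 0 \<and> H'' t = 0" using assms(2) by (auto simp: C2_compact_def)
  show ?thesis unfolding C2_compact_def
  proof (intro conjI allI impI)
    show "\<exists>R>0. \<forall>t\<ge>R. p * F t + q * H t = 0 \<and> p * F' t + q * H' t = 0 \<and> p * F'' t + q * H'' t = 0"
      using R S by (intro exI[of _ "max R S"]) auto
  qed (use assms in \<open>auto simp: C2_compact_def intro!: continuous_intros derivative_eq_intros\<close>)
qed

context cir
begin

definition \<Gamma>\<^sub>\<alpha> :: real where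
  "\<Gamma>\<^sub>\<alpha> = Gamma (1 - \<alpha>)"

lemma \<Gamma>_pos: "0 < \<Gamma>\<^sub>\<alpha>"
  unfolding \<Gamma>\<^sub>\<alpha>_def using \<alpha> by (intro Gamma_real_pos) simp

text \<open>Envelopes for the two jump integrals. Compensated increments are quadratic for small z
  and linear for large z, plain ones linear and bounded; multiplied by their powers of z both give
  the same integrable function.\<close>

definition kern1 :: "real \<Rightarrow> real" where
  "kern1 z = pos z * (z powr (- 2 - \<alpha>) * min (z\<^sup>2) z)"

definition kern2 :: "real \<Rightarrow> real" where
  "kern2 z = pos z * (z powr (- 1 - \<alpha>) * min 1 z)"

lemma kern_eq: "kern1 z = kern2 z"
proof (cases "0 < z")
  case True
  have "z powr (- 2 - \<alpha>) * z = z powr (- 1 - \<alpha>)"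
    using True powr_mult_base[of z "- 2 - \<alpha>"] by (simp add: mult.commute)
  moreover have "min (z\<^sup>2) z = z * min 1 z"
    using True by (auto simp: min_def power2_eq_square)
  ultimately show ?thesis by (simp add: kern1_def kern2_def mult.assoc[symmetric])
qed (simp add: kern1_def kern2_def)

lemma kern2_integrable: "integrable lborel kern2"
proof -
  have "has_bochner_integral lborel (\<lambda>x. indicator {0..1} x * x powr (- \<alpha>)) (1 powr (- \<alpha> + 1) / (- \<alpha> + 1))"
    using \<alpha> has_integral_powr_from_0[of "- \<alpha>" 1] by (intro has_bochner_integral_of_has_integral) auto
  moreover have "has_bochner_integral lborel (\<lambda>z. indicator {1..} z * z powr (- 1 - \<alpha>)) (1 powr (- \<alpha>) / \<alpha>)"
    using \<alpha> by (intro has_bochner_integral_powr_tail) auto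
  ultimately have "integrable lborel (\<lambda>x. indicator {0..1} x * x powr (- \<alpha>) + indicator {1..} x * x powr (- 1 - \<alpha>))"
    by (auto simp: has_bochner_integral_iff)
  then show ?thesis
  proof (rule Bochner_Integration.integrable_bound)
    show "AE x in lborel. norm (kern2 x) \<le> norm (indicator {0..1} x * x powr (- \<alpha>) + indicator {1..} x * x powr (- 1 - \<alpha>))"
    proof (rule AE_I2)
      fix x :: real
      have "x powr (- 1 - \<alpha>) * x = x powr (- \<alpha>)" if "0 < x"
        using that powr_mult_base[of x "- 1 - \<alpha>"] by (simp add: mult.commute)
      then show "norm (kern2 x) \<le> norm (indicator {0..1} x * x powr (- \<alpha>) + indicator {1..} x * x powr (- 1 - \<alpha>))"
        by (cases "0 < x"; cases "x \<le> 1") (auto simp: kern2_def indicator_def)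
    qed
  qed (auto simp: kern2_def[abs_def])
qed

text \<open>\<open>opA\<close> is what remains to be integrated against X, and \<open>opB\<close>
  against m, once the z-integral is moved inside; the Mecke formula needs the operator in this
  shape. The derivative \<open>D\<close> is an explicit argument in place of
  \<open>fun_deriv \<Psi>\<close>.\<close>

definition opA :: "('e measure \<Rightarrow> real) \<Rightarrow> ('e measure \<Rightarrow> 'e \<Rightarrow> real) \<Rightarrow> 'e measure \<Rightarrow> 'e \<Rightarrow> real" where
  "opA \<Psi> D X r = (\<alpha> + 1) / \<Gamma>\<^sub>\<alpha> * a r *
     (LBINT z. pos z * (z powr (- 2 - \<alpha>) * (\<Psi> (add_dirac X z r) - \<Psi> X - z * D X r)))
     - (1 / \<alpha>) * (b r * D X r)"

definition opB :: "('e measure \<Rightarrow> real) \<Rightarrow> 'e measure \<Rightarrow> 'e \<Rightarrow> real" where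
  "opB \<Psi> X r = \<alpha> / \<Gamma>\<^sub>\<alpha> * (LBINT z. pos z * (z powr (- 1 - \<alpha>) * (\<Psi> (add_dirac X z r) - \<Psi> X)))"

text \<open>The properties of \<open>\<Psi>\<close> and of its derivative \<open>D\<close> on which the computation of the energy
  rests; unlike the class of test functions they are visibly stable under linear combinations.\<close>

definition nice :: "('e measure \<Rightarrow> real) \<Rightarrow> ('e measure \<Rightarrow> 'e \<Rightarrow> real) \<Rightarrow> bool" where
  "nice \<Psi> D \<longleftrightarrow>
     (\<exists>D2. \<forall>X\<in>fin_measures. \<forall>r. C2_compact (\<lambda>t. \<Psi> (add_dirac X t r)) (\<lambda>t. D (add_dirac X t r) r) (\<lambda>t. D2 (add_dirac X t r) r)) \<and>
     NN (\<lambda>X r. \<Psi> X) \<and> NN D \<and> NN (opA \<Psi> D) \<and> NN (opB \<Psi>) \<and>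
     (\<exists>K\<ge>0. \<forall>X\<in>fin_measures. \<forall>r. \<forall>z>0. \<bar>\<Psi> (add_dirac X z r) - \<Psi> X - z * D X r\<bar> \<le> K * min (z\<^sup>2) z \<and>
        \<bar>\<Psi> (add_dirac X z r) - \<Psi> X\<bar> \<le> K * min 1 z) \<and>
     (\<exists>R\<ge>0. \<forall>X\<in>fin_measures. R < mass X \<longrightarrow> \<Psi> X = 0 \<and> (\<forall>r. D X r = 0))"

lemma fubini_dominated:
  fixes f :: "real \<Rightarrow> 'e \<Rightarrow> real" and w :: "real \<Rightarrow> real"
  assumes X: "X \<in> fin_measures" and f: "(\<lambda>x. f (fst x) (snd x)) \<in> borel_measurable (borel \<Otimes>\<^sub>M borel)"
    and w: "integrable lborel w" and le: "\<And>z r. \<bar>f z r\<bar> \<le> w z"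
  shows "integrable X (\<lambda>r. LBINT z. f z r)"
    and "(LBINT z. (\<integral>r. f z (r :: 'e) \<partial>X)) = (\<integral>r. (LBINT z. f z r) \<partial>X)"
proof -
  interpret X: finite_measure X using X by (simp add: fin_measures_def)
  interpret P: pair_sigma_finite lborel X ..
  have s: "sets (lborel \<Otimes>\<^sub>M X) = sets (borel \<Otimes>\<^sub>M borel)"
    by (rule sets_pair_measure_cong[OF sets_lborel fin_measuresD(1)[OF X]])
  have fm: "(\<lambda>x. f (fst x) (snd x)) \<in> borel_measurable (lborel \<Otimes>\<^sub>M X)"
    using f unfolding measurable_cong_sets[OF s refl] .
  have fz: "f z \<in> borel_measurable X" for z
    using measurable_compose[OF measurable_Pair1' fm, of z] by simp
  have i1: "integrable X (f z)" for z
    using le fz by (intro X.integrable_const_bound[of _ "w z"]) auto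
  have "integrable lborel (\<lambda>z. \<integral>r. norm (f z r) \<partial>X)"
  proof (rule Bochner_Integration.integrable_bound)
    show "integrable lborel (\<lambda>z. measure X (space X) * w z)" by (intro integrable_mult_right w)
    have "(\<lambda>x. norm (f (fst x) (snd x))) \<in> borel_measurable (lborel \<Otimes>\<^sub>M X)" using fm by measurable
    then show "(\<lambda>z. \<integral>r. norm (f z r) \<partial>X) \<in> borel_measurable lborel"
      using X.borel_measurable_lebesgue_integral[of "\<lambda>z r. norm (f z r)" lborel] by (simp add: case_prod_unfold)
    show "AE z in lborel. norm (\<integral>r. norm (f z r) \<partial>X) \<le> norm (measure X (space X) * w z)"
    proof (rule AE_I2)
      fix z
      have w0: "0 \<le> w z" using le[of z undefined] by linarith
      have "(\<integral>r. norm (f z r) \<partial>X) \<le> (\<integral>r. w z \<partial>X)"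
        using i1 le by (intro integral_mono integrable_norm) auto
      moreover have "0 \<le> (\<integral>r. norm (f z r) \<partial>X)" by (intro Bochner_Integration.integral_nonneg) simp
      ultimately show "norm (\<integral>r. norm (f z r) \<partial>X) \<le> norm (measure X (space X) * w z)"
        using w0 by (simp add: abs_mult)
    qed
  qed
  then have i: "integrable (lborel \<Otimes>\<^sub>M X) (\<lambda>x. f (fst x) (snd x))"
    using i1 fm by (intro P.Fubini_integrable) auto
  have i': "integrable (lborel \<Otimes>\<^sub>M X) (\<lambda>(z, r). f z r)" using i by (simp add: case_prod_unfold)
  show "integrable X (\<lambda>r. LBINT z. f z r)" by (rule P.integrable_snd[OF i'])
  show "(LBINT z. (\<integral>r. f z r \<partial>X)) = (\<integral>r. (LBINT z. f z r) \<partial>X)"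
    by (rule P.Fubini_integral[OF i', symmetric])
qed

lemma nice_measurable:
  assumes "NN (\<lambda>X r. \<Psi> X)" "X \<in> fin_measures"
  shows "(\<lambda>x. \<Psi> (add_dirac X (fst x) (snd x))) \<in> borel_measurable (borel \<Otimes>\<^sub>M borel)"
  using measurable_compose[OF measurable_Pair[OF measurable_snd measurable_fst] NN_jump_measurable[OF assms]] by simp

lemma nice_integrable:
  assumes "nice \<Psi> D" "X \<in> fin_measures"
  shows "integrable lborel (\<lambda>z. pos z * (z powr (- 2 - \<alpha>) * (\<Psi> (add_dirac X z r) - \<Psi> X - z * D X r)))"
    and "integrable lborel (\<lambda>z. pos z * (z powr (- 1 - \<alpha>) * (\<Psi> (add_dirac X z r) - \<Psi> X)))"
proof -
  obtain K where K: "0 \<le> K" "\<And>z. 0 < z \<Longrightarrow> \<bar>\<Psi> (add_dirac X z r) - \<Psi> X - z * D X r\<bar> \<le> K * min (z\<^sup>2) z"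
    "\<And>z. 0 < z \<Longrightarrow> \<bar>\<Psi> (add_dirac X z r) - \<Psi> X\<bar> \<le> K * min 1 z"
    using assms unfolding nice_def by blast
  have NN: "NN (\<lambda>X r. \<Psi> X)" using assms by (simp add: nice_def)
  have "(\<lambda>z. (z, r)) \<in> borel \<rightarrow>\<^sub>M borel \<Otimes>\<^sub>M borel" by measurable
  from measurable_compose[OF this nice_measurable[OF NN assms(2)]]
  have [measurable]: "(\<lambda>z. \<Psi> (add_dirac X z r)) \<in> borel_measurable borel" by simp
  show "integrable lborel (\<lambda>z. pos z * (z powr (- 2 - \<alpha>) * (\<Psi> (add_dirac X z r) - \<Psi> X - z * D X r)))"
  proof (rule Bochner_Integration.integrable_bound[OF integrable_mult_right[OF kern2_integrable, of K]])
    show "AE z in lborel. norm (pos z * (z powr (- 2 - \<alpha>) * (\<Psi> (add_dirac X z r) - \<Psi> X - z * D X r))) \<le> norm (K * kern2 z)"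
    proof (rule AE_I2)
      fix z :: real
      show "norm (pos z * (z powr (- 2 - \<alpha>) * (\<Psi> (add_dirac X z r) - \<Psi> X - z * D X r))) \<le> norm (K * kern2 z)"
        unfolding kern_eq[symmetric] using mult_left_mono[OF K(2)[of z], of "z powr (- 2 - \<alpha>)"] K(1)
        by (cases "0 < z") (auto simp: abs_mult kern1_def mult_ac)
    qed
  qed measurable
  show "integrable lborel (\<lambda>z. pos z * (z powr (- 1 - \<alpha>) * (\<Psi> (add_dirac X z r) - \<Psi> X)))"
  proof (rule Bochner_Integration.integrable_bound[OF integrable_mult_right[OF kern2_integrable, of K]])
    show "AE z in lborel. norm (pos z * (z powr (- 1 - \<alpha>) * (\<Psi> (add_dirac X z r) - \<Psi> X))) \<le> norm (K * kern2 z)"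
    proof (rule AE_I2)
      fix z :: real
      show "norm (pos z * (z powr (- 1 - \<alpha>) * (\<Psi> (add_dirac X z r) - \<Psi> X))) \<le> norm (K * kern2 z)"
        using mult_left_mono[OF K(3)[of z], of "z powr (- 1 - \<alpha>)"] K(1)
        by (cases "0 < z") (auto simp: abs_mult kern2_def mult_ac)
    qed
  qed measurable
qed

lemma NN_cmult: "NN V \<Longrightarrow> NN (\<lambda>X r. c * V X r)"
  by (intro NN_mult ES_NN[OF ES_const])

lemma NN_cong: "NN V \<Longrightarrow> (\<And>X r. X \<in> fin_measures \<Longrightarrow> V X r = W X r) \<Longrightarrow> NN W"
  by (auto simp: NN_def)

lemma opA_lin:
  assumes 1: "nice \<Psi> D" and 2: "nice \<Phi> D'" and X: "X \<in> fin_measures"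
  shows "opA (\<lambda>X. p * \<Psi> X + q * \<Phi> X) (\<lambda>X r. p * D X r + q * D' X r) X r = p * opA \<Psi> D X r + q * opA \<Phi> D' X r"
    and "opB (\<lambda>X. p * \<Psi> X + q * \<Phi> X) X r = p * opB \<Psi> X r + q * opB \<Phi> X r"
proof -
  note i1 = nice_integrable[OF 1 X, of r] and i2 = nice_integrable[OF 2 X, of r]
  let ?I = "\<lambda>\<Psi> D. LBINT z. pos z * (z powr (- 2 - \<alpha>) * (\<Psi> (add_dirac X z r) - \<Psi> X - z * D X r))"
  let ?J = "\<lambda>\<Psi>. LBINT z. pos z * (z powr (- 1 - \<alpha>) * (\<Psi> (add_dirac X z r) - \<Psi> X))"
  have I: "?I (\<lambda>X. p * \<Psi> X + q * \<Phi> X) (\<lambda>X r. p * D X r + q * D' X r) = p * ?I \<Psi> D + q * ?I \<Phi> D'"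
  proof -
    have "?I (\<lambda>X. p * \<Psi> X + q * \<Phi> X) (\<lambda>X r. p * D X r + q * D' X r) =
      (LBINT z. p * (pos z * (z powr (- 2 - \<alpha>) * (\<Psi> (add_dirac X z r) - \<Psi> X - z * D X r)))
        + q * (pos z * (z powr (- 2 - \<alpha>) * (\<Phi> (add_dirac X z r) - \<Phi> X - z * D' X r))))"
      by (intro Bochner_Integration.integral_cong) (auto simp: algebra_simps)
    then show ?thesis
      using Bochner_Integration.integral_add[OF integrable_mult_right[OF i1(1), of p] integrable_mult_right[OF i2(1), of q]] by simp
  qed
  have J: "?J (\<lambda>X. p * \<Psi> X + q * \<Phi> X) = p * ?J \<Psi> + q * ?J \<Phi>"
  proof -
    have "?J (\<lambda>X. p * \<Psi> X + q * \<Phi> X) =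
      (LBINT z. p * (pos z * (z powr (- 1 - \<alpha>) * (\<Psi> (add_dirac X z r) - \<Psi> X)))
        + q * (pos z * (z powr (- 1 - \<alpha>) * (\<Phi> (add_dirac X z r) - \<Phi> X))))"
      by (intro Bochner_Integration.integral_cong) (auto simp: algebra_simps)
    then show ?thesis
      using Bochner_Integration.integral_add[OF integrable_mult_right[OF i1(2), of p] integrable_mult_right[OF i2(2), of q]] by simp
  qed
  have alg: "g * (p * x + q * y) - k * (bb * (p * u + q * v)) = p * (g * x - k * (bb * u)) + q * (g * y - k * (bb * v))" for g x y k bb u v :: real
    by (simp add: algebra_simps)
  show "opA (\<lambda>X. p * \<Psi> X + q * \<Phi> X) (\<lambda>X r. p * D X r + q * D' X r) X r = p * opA \<Psi> D X r + q * opA \<Phi> D' X r"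
    unfolding opA_def I by (rule alg)
  show "opB (\<lambda>X. p * \<Psi> X + q * \<Phi> X) X r = p * opB \<Psi> X r + q * opB \<Phi> X r"
    unfolding opB_def J by (simp add: distrib_left mult.left_commute)
qed

lemma nice_lin:
  assumes 1: "nice \<Psi> D" and 2: "nice \<Phi> D'"
  shows "nice (\<lambda>X. p * \<Psi> X + q * \<Phi> X) (\<lambda>X r. p * D X r + q * D' X r)"
proof -
  obtain D2 where D2: "\<And>X r. X \<in> fin_measures \<Longrightarrow> C2_compact (\<lambda>t. \<Psi> (add_dirac X t r)) (\<lambda>t. D (add_dirac X t r) r) (\<lambda>t. D2 (add_dirac X t r) r)"
    using 1 unfolding nice_def by blast
  obtain E2 where E2: "\<And>X r. X \<in> fin_measures \<Longrightarrow> C2_compact (\<lambda>t. \<Phi> (add_dirac X t r)) (\<lambda>t. D' (add_dirac X t r) r) (\<lambda>t. E2 (add_dirac X t r) r)"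
    using 2 unfolding nice_def by blast
  obtain K where K: "0 \<le> K" "\<And>X r z. X \<in> fin_measures \<Longrightarrow> 0 < z \<Longrightarrow> \<bar>\<Psi> (add_dirac X z r) - \<Psi> X - z * D X r\<bar> \<le> K * min (z\<^sup>2) z"
    "\<And>X r z. X \<in> fin_measures \<Longrightarrow> 0 < z \<Longrightarrow> \<bar>\<Psi> (add_dirac X z r) - \<Psi> X\<bar> \<le> K * min 1 z"
    using 1 unfolding nice_def by blast
  obtain L where L: "0 \<le> L" "\<And>X r z. X \<in> fin_measures \<Longrightarrow> 0 < z \<Longrightarrow> \<bar>\<Phi> (add_dirac X z r) - \<Phi> X - z * D' X r\<bar> \<le> L * min (z\<^sup>2) z"
    "\<And>X r z. X \<in> fin_measures \<Longrightarrow> 0 < z \<Longrightarrow> \<bar>\<Phi> (add_dirac X z r) - \<Phi> X\<bar> \<le> L * min 1 z"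
    using 2 unfolding nice_def by blast
  obtain R where R: "0 \<le> R" "\<And>X. X \<in> fin_measures \<Longrightarrow> R < mass X \<Longrightarrow> \<Psi> X = 0 \<and> (\<forall>r. D X r = 0)"
    using 1 unfolding nice_def by blast
  obtain S where S: "0 \<le> S" "\<And>X. X \<in> fin_measures \<Longrightarrow> S < mass X \<Longrightarrow> \<Phi> X = 0 \<and> (\<forall>r. D' X r = 0)"
    using 2 unfolding nice_def by blast
  have NN: "NN (\<lambda>X r. \<Psi> X)" "NN D" "NN (opA \<Psi> D)" "NN (opB \<Psi>)" "NN (\<lambda>X r. \<Phi> X)" "NN D'" "NN (opA \<Phi> D')" "NN (opB \<Phi>)"
    using 1 2 by (auto simp: nice_def)
  have lin: "\<bar>p * x + q * y\<bar> \<le> (\<bar>p\<bar> * K + \<bar>q\<bar> * L) * t" if "\<bar>x\<bar> \<le> K * t" "\<bar>y\<bar> \<le> L * t" for x y t :: real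
  proof -
    have "\<bar>p * x + q * y\<bar> \<le> \<bar>p\<bar> * \<bar>x\<bar> + \<bar>q\<bar> * \<bar>y\<bar>" by (metis abs_mult abs_triangle_ineq)
    also have "\<dots> \<le> \<bar>p\<bar> * (K * t) + \<bar>q\<bar> * (L * t)" using that by (intro add_mono mult_left_mono) auto
    finally show ?thesis by (simp add: algebra_simps)
  qed
  show ?thesis unfolding nice_def
  proof (intro conjI)
    show "\<exists>D2. \<forall>X\<in>fin_measures. \<forall>r. C2_compact (\<lambda>t. p * \<Psi> (add_dirac X t r) + q * \<Phi> (add_dirac X t r))
        (\<lambda>t. p * D (add_dirac X t r) r + q * D' (add_dirac X t r) r) (\<lambda>t. D2 (add_dirac X t r) r)"
      using C2_compact_lin[OF D2 E2] by (intro exI[of _ "\<lambda>X r. p * D2 X r + q * E2 X r"]) auto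
    show "NN (\<lambda>X r. p * \<Psi> X + q * \<Phi> X)" by (intro NN_add NN_cmult NN)
    show "NN (\<lambda>X r. p * D X r + q * D' X r)" by (intro NN_add NN_cmult NN)
    show "NN (opA (\<lambda>X. p * \<Psi> X + q * \<Phi> X) (\<lambda>X r. p * D X r + q * D' X r))"
      by (rule NN_cong[OF NN_add[OF NN_cmult[OF NN(3), of p] NN_cmult[OF NN(7), of q]]]) (simp add: opA_lin[OF 1 2])
    show "NN (opB (\<lambda>X. p * \<Psi> X + q * \<Phi> X))"
      by (rule NN_cong[OF NN_add[OF NN_cmult[OF NN(4), of p] NN_cmult[OF NN(8), of q]]]) (simp add: opA_lin[OF 1 2])
    show "\<exists>K\<ge>0. \<forall>X\<in>fin_measures. \<forall>r. \<forall>z>0.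
       \<bar>p * \<Psi> (add_dirac X z r) + q * \<Phi> (add_dirac X z r) - (p * \<Psi> X + q * \<Phi> X) - z * (p * D X r + q * D' X r)\<bar> \<le> K * min (z\<^sup>2) z \<and>
       \<bar>p * \<Psi> (add_dirac X z r) + q * \<Phi> (add_dirac X z r) - (p * \<Psi> X + q * \<Phi> X)\<bar> \<le> K * min 1 z"
    proof (intro exI[of _ "\<bar>p\<bar> * K + \<bar>q\<bar> * L"] conjI ballI allI impI)
      show "0 \<le> \<bar>p\<bar> * K + \<bar>q\<bar> * L" using K(1) L(1) by simp
      fix X :: "'e measure" and r and z :: real assume X: "X \<in> fin_measures" and z: "0 < z"
      have e: "p * \<Psi> (add_dirac X z r) + q * \<Phi> (add_dirac X z r) - (p * \<Psi> X + q * \<Phi> X) - z * (p * D X r + q * D' X r) =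
         p * (\<Psi> (add_dirac X z r) - \<Psi> X - z * D X r) + q * (\<Phi> (add_dirac X z r) - \<Phi> X - z * D' X r)"
        "p * \<Psi> (add_dirac X z r) + q * \<Phi> (add_dirac X z r) - (p * \<Psi> X + q * \<Phi> X) =
         p * (\<Psi> (add_dirac X z r) - \<Psi> X) + q * (\<Phi> (add_dirac X z r) - \<Phi> X)"
        by (simp_all add: algebra_simps)
      show "\<bar>p * \<Psi> (add_dirac X z r) + q * \<Phi> (add_dirac X z r) - (p * \<Psi> X + q * \<Phi> X) - z * (p * D X r + q * D' X r)\<bar> \<le> (\<bar>p\<bar> * K + \<bar>q\<bar> * L) * min (z\<^sup>2) z"
        unfolding e(1) by (intro lin K L X z)
      show "\<bar>p * \<Psi> (add_dirac X z r) + q * \<Phi> (add_dirac X z r) - (p * \<Psi> X + q * \<Phi> X)\<bar> \<le> (\<bar>p\<bar> * K + \<bar>q\<bar> * L) * min 1 z"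
        unfolding e(2) by (intro lin K L X z)
    qed
    show "\<exists>R\<ge>0. \<forall>X\<in>fin_measures. R < mass X \<longrightarrow> p * \<Psi> X + q * \<Phi> X = 0 \<and> (\<forall>r. p * D X r + q * D' X r = 0)"
      using R S by (intro exI[of _ "max R S"]) auto
  qed
qed

lemma nice_fun_deriv:
  assumes "nice \<Psi> D" "X \<in> fin_measures"
  shows "fun_deriv \<Psi> X r = D X r"
proof -
  obtain D2 where "C2_compact (\<lambda>t. \<Psi> (add_dirac X t r)) (\<lambda>t. D (add_dirac X t r) r) (\<lambda>t. D2 (add_dirac X t r) r)"
    using assms unfolding nice_def by blast
  then have "((\<lambda>t. \<Psi> (add_dirac X t r)) has_real_derivative D (add_dirac X 0 r) r) (at 0 within {0..})"
    unfolding C2_compact_def by (meson order_refl)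
  then have d: "((\<lambda>t. \<Psi> (add_dirac X t r)) has_vector_derivative D X r) (at 0 within {0..})"
    by (simp add: has_real_derivative_iff_has_vector_derivative add_dirac_nonpos[OF assms(2)])
  have "(0::real) islimpt {0..1}" by (simp add: islimpt_Icc)
  then have "(0::real) islimpt {0..}" by (rule islimpt_subset) auto
  then have "at (0::real) within {0..} \<noteq> bot" by (simp add: trivial_limit_within)
  then show ?thesis unfolding fun_deriv_def by (rule vector_derivative_within[OF _ d])
qed

text \<open>Fubini with the envelope \<open>kern2\<close>, since \<open>cir_op\<close> has the
  z-integral outside.\<close>

lemma nice_cir_op:
  assumes n: "nice \<Psi> D" and X: "X \<in> fin_measures"
  shows "cir_op \<alpha> a b m \<Psi> X = (\<integral>r. opA \<Psi> D X r \<partial>X) + (\<integral>r. opB \<Psi> X r \<partial>m)"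
proof -
  obtain K where K: "0 \<le> K" "\<And>r z. 0 < z \<Longrightarrow> \<bar>\<Psi> (add_dirac X z r) - \<Psi> X - z * D X r\<bar> \<le> K * min (z\<^sup>2) z"
    "\<And>r z. 0 < z \<Longrightarrow> \<bar>\<Psi> (add_dirac X z r) - \<Psi> X\<bar> \<le> K * min 1 z"
    using n X unfolding nice_def by blast
  have NN: "NN (\<lambda>X r. \<Psi> X)" "NN D" using n by (auto simp: nice_def)
  have [measurable]: "(\<lambda>x. \<Psi> (add_dirac X (fst x) (snd x))) \<in> borel_measurable (borel \<Otimes>\<^sub>M borel)"
    by (rule nice_measurable[OF NN(1) X])
  have [measurable]: "D X \<in> borel_measurable borel" by (rule NN_measurable_point[OF NN(2) X])
  obtain A where A: "0 < A" "\<And>r. \<bar>a r\<bar> \<le> A" using continuous_bound[OF a_cont] by blast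
  define f where "f z r = pos z * (z powr (- 2 - \<alpha>) * (a r * (\<Psi> (add_dirac X z r) - \<Psi> X - z * D X r)))" for z r
  define h where "h z r = pos z * (z powr (- 1 - \<alpha>) * (\<Psi> (add_dirac X z r) - \<Psi> X))" for z r
  have f_le: "\<bar>f z r\<bar> \<le> A * K * kern2 z" for z r
  proof (cases "0 < z")
    case True
    have "\<bar>a r\<bar> * \<bar>\<Psi> (add_dirac X z r) - \<Psi> X - z * D X r\<bar> \<le> A * (K * min (z\<^sup>2) z)"
      using A K(2)[OF True, of r] by (intro mult_mono) auto
    from mult_left_mono[OF this, of "z powr (- 2 - \<alpha>)"] show ?thesis
      using True unfolding kern_eq[symmetric] by (simp add: f_def abs_mult kern1_def mult_ac)
  qed (simp add: f_def kern2_def)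
  have h_le: "\<bar>h z r\<bar> \<le> K * kern2 z" for z r
    using mult_left_mono[OF K(3)[of z r], of "z powr (- 1 - \<alpha>)"]
    by (cases "0 < z") (auto simp: h_def abs_mult kern2_def mult_ac)
  have fm: "(\<lambda>x. f (fst x) (snd x)) \<in> borel_measurable (borel \<Otimes>\<^sub>M borel)" unfolding f_def by measurable
  have hm: "(\<lambda>x. h (fst x) (snd x)) \<in> borel_measurable (borel \<Otimes>\<^sub>M borel)" unfolding h_def by measurable
  note F = fubini_dominated[OF X fm integrable_mult_right[OF kern2_integrable] f_le]
  note H = fubini_dominated[OF m_fin hm integrable_mult_right[OF kern2_integrable] h_le]
  have p: "1 / z powr (2 + \<alpha>) = z powr (- 2 - \<alpha>)" "1 / z powr (1 + \<alpha>) = z powr (- 1 - \<alpha>)" for z :: real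
    using powr_minus_divide[of z "2 + \<alpha>"] powr_minus_divide[of z "1 + \<alpha>"] by (simp_all add: minus_add_distrib)
  have 1: "(LINT z:{0<..}|lborel. (1 / z powr (2 + \<alpha>)) * (\<integral>r. a r * (\<Psi> (add_dirac X z r) - \<Psi> X - z * fun_deriv \<Psi> X r) \<partial>X)) = (\<integral>r. (LBINT z. f z r) \<partial>X)"
  proof -
    have "(LINT z:{0<..}|lborel. (1 / z powr (2 + \<alpha>)) * (\<integral>r. a r * (\<Psi> (add_dirac X z r) - \<Psi> X - z * fun_deriv \<Psi> X r) \<partial>X)) = (LBINT z. (\<integral>r. f z r \<partial>X))"
      unfolding set_lebesgue_integral_def p nice_fun_deriv[OF n X] f_def by simp
    then show ?thesis using F(2) by simp
  qed
  have 2: "(LINT z:{0<..}|lborel. (1 / z powr (1 + \<alpha>)) * (\<integral>r. (\<Psi> (add_dirac X z r) - \<Psi> X) \<partial>m)) = (\<integral>r. (LBINT z. h z r) \<partial>m)"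
  proof -
    have "(LINT z:{0<..}|lborel. (1 / z powr (1 + \<alpha>)) * (\<integral>r. (\<Psi> (add_dirac X z r) - \<Psi> X) \<partial>m)) = (LBINT z. (\<integral>r. h z r \<partial>m))"
      unfolding set_lebesgue_integral_def p h_def by simp
    then show ?thesis using H(2) by simp
  qed
  have A: "opA \<Psi> D X r = (\<alpha> + 1) / \<Gamma>\<^sub>\<alpha> * (LBINT z. f z r) - (1 / \<alpha>) * (b r * D X r)" for r
  proof -
    have "(LBINT z. f z r) = a r * (LBINT z. pos z * (z powr (- 2 - \<alpha>) * (\<Psi> (add_dirac X z r) - \<Psi> X - z * D X r)))"
      unfolding f_def by (subst integral_mult_right_zero[symmetric], intro Bochner_Integration.integral_cong) auto
    then show ?thesis by (simp add: opA_def)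
  qed
  have ib: "integrable X (\<lambda>r. b r * D X r)"
    using NN_integrable[OF NN_mult[OF ES_NN[OF ES_coeff[OF b_cont]] NN(2)] X X] .
  have iA: "(\<integral>r. opA \<Psi> D X r \<partial>X) = (\<alpha> + 1) / \<Gamma>\<^sub>\<alpha> * (\<integral>r. (LBINT z. f z r) \<partial>X) - (1 / \<alpha>) * (\<integral>r. b r * D X r \<partial>X)"
    unfolding A using Bochner_Integration.integral_diff[OF integrable_mult_right[OF F(1), of "(\<alpha> + 1) / \<Gamma>\<^sub>\<alpha>"] integrable_mult_right[OF ib, of "1 / \<alpha>"]]
    by (simp only: integral_mult_right_zero)
  have iB: "(\<integral>r. opB \<Psi> X r \<partial>m) = \<alpha> / \<Gamma>\<^sub>\<alpha> * (\<integral>r. (LBINT z. h z r) \<partial>m)"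
    unfolding opB_def h_def by (simp only: integral_mult_right_zero)
  show ?thesis
    unfolding cir_op_def 1 2 unfolding iA iB nice_fun_deriv[OF n X] \<Gamma>\<^sub>\<alpha>_def ..
qed


lemma bounded_L2:
  assumes "u \<in> borel_measurable Q" "\<And>X. X \<in> space Q \<Longrightarrow> \<bar>u X\<bar> \<le> B"
  shows "u \<in> L2 Q"
proof -
  have "(u X)\<^sup>2 \<le> B\<^sup>2" if "X \<in> space Q" for X
    using power_mono[OF assms(2)[OF that] abs_ge_zero, of 2] by simp
  then show ?thesis using assms(1) by (auto simp: L2_def intro!: Q.integrable_const_bound[of _ "B\<^sup>2"])
qed

text \<open>Jumps only add mass, so a measure beyond the threshold cannot reach the support of
  \<Psi> by a jump.\<close>

lemma op_vanishes:
  assumes \<Psi>: "\<And>X r. X \<in> fin_measures \<Longrightarrow> R < mass X \<Longrightarrow> \<Psi> X = 0 \<and> D X r = 0" and X: "X \<in> fin_measures" "R < mass X"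
  shows "opA \<Psi> D X r = 0" "opB \<Psi> X r = 0"
proof -
  have "\<Psi> (add_dirac X z r) = 0" if "0 < z" for z
    using that X pairing_add_dirac[of "\<lambda>_. 1" X z r] by (intro \<Psi>[THEN conjunct1] add_dirac_fin) auto
  then have 1: "(\<lambda>z. pos z * (z powr (- 2 - \<alpha>) * (\<Psi> (add_dirac X z r) - \<Psi> X - z * D X r))) = (\<lambda>_. 0)"
    "(\<lambda>z. pos z * (z powr (- 1 - \<alpha>) * (\<Psi> (add_dirac X z r) - \<Psi> X))) = (\<lambda>_. 0)"
    using \<Psi>[OF X] by (auto simp: fun_eq_iff indicator_def)
  show "opA \<Psi> D X r = 0" "opB \<Psi> X r = 0" unfolding opA_def opB_def 1 using \<Psi>[OF X] by simp_all
qed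

text \<open>Integrating \<open>opA\<close> over X costs a factor mass X, harmless because only
  masses up to \<open>R\<close> contribute.\<close>

lemma nice_bounded:
  assumes n: "nice \<Psi> D"
  shows "\<exists>B. \<forall>X\<in>space Q. \<bar>\<Psi> X\<bar> \<le> B \<and> \<bar>\<integral>r. opB \<Psi> X r \<partial>m\<bar> \<le> B \<and> \<bar>cir_op \<alpha> a b m \<Psi> X\<bar> \<le> B"
proof -
  have NN: "NN (\<lambda>X r. \<Psi> X)" "NN (opA \<Psi> D)" "NN (opB \<Psi>)" using n by (auto simp: nice_def)
  obtain R where R: "0 \<le> R" "\<And>X r. X \<in> fin_measures \<Longrightarrow> R < mass X \<Longrightarrow> \<Psi> X = 0 \<and> D X r = 0"
    using n unfolding nice_def by blast
  obtain B1 where B1: "0 < B1" "\<And>X r :: 'e. X \<in> fin_measures \<Longrightarrow> \<bar>\<Psi> X\<bar> \<le> B1" using NN_bounded[OF NN(1)] by blast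
  obtain B2 where B2: "0 < B2" "\<And>X r. X \<in> fin_measures \<Longrightarrow> \<bar>opA \<Psi> D X r\<bar> \<le> B2" using NN_bounded[OF NN(2)] by blast
  obtain B3 where B3: "0 < B3" "\<And>X r. X \<in> fin_measures \<Longrightarrow> \<bar>opB \<Psi> X r\<bar> \<le> B3" using NN_bounded[OF NN(3)] by blast
  have mass0: "0 \<le> mass m" by (intro Bochner_Integration.integral_nonneg) simp
  have A: "\<bar>\<integral>r. opA \<Psi> D X r \<partial>X\<bar> \<le> B2 * R" if X: "X \<in> fin_measures" for X
  proof (cases "R < mass X")
    case True
    have z: "opA \<Psi> D X = (\<lambda>_. 0)" using op_vanishes(1)[OF R(2) X True] by auto
    show ?thesis unfolding z using B2(1) R(1) by simp
  next
    case False
    have "\<bar>\<integral>r. opA \<Psi> D X r \<partial>X\<bar> \<le> B2 * mass X" by (rule NN_integral_le[OF NN(2) X X B2(2)[OF X]])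
    also have "\<dots> \<le> B2 * R" using False B2(1) by (intro mult_left_mono) auto
    finally show ?thesis .
  qed
  have B: "\<bar>\<integral>r. opB \<Psi> X r \<partial>m\<bar> \<le> B3 * mass m" if X: "X \<in> fin_measures" for X
    by (rule NN_integral_le[OF NN(3) X m_fin B3(2)[OF X]])
  show ?thesis
  proof (intro exI[of _ "B1 + B2 * R + B3 * mass m"] ballI conjI)
    fix X assume "X \<in> space Q"
    then have X: "X \<in> fin_measures" by (rule space_Q_fin)
    have nn: "0 \<le> B2 * R" "0 \<le> B3 * mass m" using B2(1) B3(1) R(1) mass0 by auto
    show "\<bar>\<Psi> X\<bar> \<le> B1 + B2 * R + B3 * mass m" using B1(2)[OF X] nn by linarith
    show "\<bar>\<integral>r. opB \<Psi> X r \<partial>m\<bar> \<le> B1 + B2 * R + B3 * mass m" using B[OF X] B1(1) nn by linarith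
    show "\<bar>cir_op \<alpha> a b m \<Psi> X\<bar> \<le> B1 + B2 * R + B3 * mass m"
      unfolding nice_cir_op[OF n X] using A[OF X] B[OF X] B1(1) by linarith
  qed
qed

lemma nice_measurable_Q:
  assumes n: "nice \<Psi> D"
  shows "\<Psi> \<in> borel_measurable Q" "(\<lambda>X. \<integral>r. opB \<Psi> X r \<partial>m) \<in> borel_measurable Q" "cir_op \<alpha> a b m \<Psi> \<in> borel_measurable Q"
proof -
  have NN: "NN (\<lambda>X r. \<Psi> X)" "NN (opA \<Psi> D)" "NN (opB \<Psi>)" using n by (auto simp: nice_def)
  show "\<Psi> \<in> borel_measurable Q" by (rule NN_measurable_Q(3)[OF NN(1)])
  show B: "(\<lambda>X. \<integral>r. opB \<Psi> X r \<partial>m) \<in> borel_measurable Q" by (rule NN_measurable_Q(2)[OF NN(3)])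
  have "(\<lambda>X. (\<integral>r. opA \<Psi> D X r \<partial>X) + (\<integral>r. opB \<Psi> X r \<partial>m)) \<in> borel_measurable Q"
    by (intro borel_measurable_add NN_measurable_Q(1)[OF NN(2)] B)
  then show "cir_op \<alpha> a b m \<Psi> \<in> borel_measurable Q"
    by (subst measurable_cong[OF nice_cir_op[OF n space_Q_fin]])
qed

lemma nice_L2:
  assumes n: "nice \<Psi> D"
  shows "\<Psi> \<in> L2 Q" "cir_op \<alpha> a b m \<Psi> \<in> L2 Q"
proof -
  obtain B where B: "\<And>X. X \<in> space Q \<Longrightarrow> \<bar>\<Psi> X\<bar> \<le> B" "\<And>X. X \<in> space Q \<Longrightarrow> \<bar>cir_op \<alpha> a b m \<Psi> X\<bar> \<le> B"
    using nice_bounded[OF n] by auto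
  show "\<Psi> \<in> L2 Q" by (rule bounded_L2[OF nice_measurable_Q(1)[OF n] B(1)])
  show "cir_op \<alpha> a b m \<Psi> \<in> L2 Q" by (rule bounded_L2[OF nice_measurable_Q(3)[OF n] B(2)])
qed

lemma \<nu>_iterated:
  assumes u: "integrable \<nu> u"
  shows "integrable m (\<lambda>r. LBINT w. dens r w * u (r, w))"
    and "(\<integral>x. u x \<partial>\<nu>) = (\<integral>r. (LBINT w. dens r w * u (r, w)) \<partial>m)"
proof -
  have [measurable]: "u \<in> borel_measurable (m \<Otimes>\<^sub>M lborel)" using borel_measurable_integrable[OF u] by (simp add: \<nu>_def)
  have [measurable]: "(\<lambda>x. dens (fst x) (snd x)) \<in> borel_measurable (m \<Otimes>\<^sub>M lborel)"
    using dens_measurable unfolding measurable_cong_sets[OF sets_mlborel refl] .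
  have i: "integrable (m \<Otimes>\<^sub>M lborel) (\<lambda>(r, w). dens r w * u (r, w))"
    using u unfolding \<nu>_def by (subst (asm) integrable_density) (auto simp: dens_nonneg case_prod_unfold)
  show "integrable m (\<lambda>r. LBINT w. dens r w * u (r, w))" by (rule mlb.integrable_fst[OF i])
  have "(\<integral>x. u x \<partial>\<nu>) = (\<integral>x. (\<lambda>(r, w). dens r w * u (r, w)) x \<partial>(m \<Otimes>\<^sub>M lborel))"
    unfolding \<nu>_def by (subst integral_density) (auto simp: dens_nonneg case_prod_unfold)
  then show "(\<integral>x. u x \<partial>\<nu>) = (\<integral>r. (LBINT w. dens r w * u (r, w)) \<partial>m)"
    using mlb.integral_fst[OF i] by simp
qed

abbreviation site_energy :: "('e measure \<Rightarrow> real) \<Rightarrow> ('e measure \<Rightarrow> 'e \<Rightarrow> real) \<Rightarrow> 'e measure \<Rightarrow> 'e \<Rightarrow> real" where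
  "site_energy \<Psi> D X r \<equiv> relaxation.energy \<alpha> (\<beta> r) (\<lambda>t. \<Psi> (add_dirac X t r)) (\<lambda>t. D (add_dirac X t r) r)"

text \<open>The Mecke formula moves \<Psi> times \<open>opA\<close> from X to X + w \<delta>_r,
  where it only involves the path t |-> \<Psi> (X + t \<delta>_r). Since w \<open>dens r w\<close> =
  (\<alpha> / a r) G r w for w > 0, the result is the one-site \<open>energy\<close> with \<beta> =
  b / a, integrated over r and X.\<close>

lemma energy_identity:
  assumes n: "nice \<Psi> D"
  shows "\<And>X. X \<in> fin_measures \<Longrightarrow> integrable m (site_energy \<Psi> D X)"
    and "integrable Q (\<lambda>X. \<integral>r. site_energy \<Psi> D X r \<partial>m)"
    and "(\<integral>X. cir_op \<alpha> a b m \<Psi> X * \<Psi> X \<partial>Q) = - (\<integral>X. \<integral>r. site_energy \<Psi> D X r \<partial>m \<partial>Q)"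
proof -
  have NN: "NN (\<lambda>X r. \<Psi> X)" "NN (opA \<Psi> D)" "NN (opB \<Psi>)" using n by (auto simp: nice_def)
  obtain R where R: "0 \<le> R" "\<And>X r. X \<in> fin_measures \<Longrightarrow> R < mass X \<Longrightarrow> \<Psi> X = 0 \<and> D X r = 0"
    using n unfolding nice_def by blast
  define V where "V X r = \<Psi> X * opA \<Psi> D X r" for X r
  have V: "NN V" unfolding V_def[abs_def] by (rule NN_mult[OF NN(1,2)])
  have V0: "V X r = 0" if "X \<in> fin_measures" "R < mass X" for X r using R(2)[OF that] by (simp add: V_def)
  let ?J = "\<lambda>X. \<integral>x. snd x * V (add_dirac X (snd x) (fst x)) (fst x) \<partial>\<nu>"
  have M: "integrable Q (\<lambda>X. \<integral>r. V X r \<partial>X)" "integrable Q ?J" "(\<integral>X. \<integral>r. V X r \<partial>X \<partial>Q) = (\<integral>X. ?J X \<partial>Q)"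
    and M\<nu>: "\<And>X. X \<in> fin_measures \<Longrightarrow> integrable \<nu> (\<lambda>x. snd x * V (add_dirac X (snd x) (fst x)) (fst x))"
    using mecke[OF V R(1)] V0 by simp_all
  let ?B = "\<lambda>X. \<integral>r. opB \<Psi> X r \<partial>m"
  have se: "site_energy \<Psi> D X r = - (LBINT w. dens r w * (w * V (add_dirac X w r) r)) - \<Psi> X * opB \<Psi> X r"
    if X: "X \<in> fin_measures" for X r
  proof -
    let ?F = "\<lambda>t. \<Psi> (add_dirac X t r)" and ?F' = "\<lambda>t. D (add_dirac X t r) r"
    have "dens r w * (w * V (add_dirac X w r) r) =
       pos w * (G r w * (?F w * (\<alpha> * ((\<alpha> + 1) / Gamma (1 - \<alpha>)) * relaxation.jump \<alpha> ?F ?F' w - \<beta> r * ?F' w)))" for w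
    proof (cases "0 < w")
      case True
      have o: "opA \<Psi> D (add_dirac X w r) r = (\<alpha> + 1) / \<Gamma>\<^sub>\<alpha> * a r * relaxation.jump \<alpha> ?F ?F' w - (1 / \<alpha>) * (b r * ?F' w)"
      proof -
        have "(LBINT z. pos z * (z powr (- 2 - \<alpha>) * (\<Psi> (add_dirac (add_dirac X w r) z r) - \<Psi> (add_dirac X w r) - z * D (add_dirac X w r) r)))
          = relaxation.jump \<alpha> ?F ?F' w"
          unfolding relaxation.jump_def[OF relaxation[of r]]
          using True X by (intro Bochner_Integration.integral_cong) (auto simp: indicator_def add_dirac_add_dirac)
        then show ?thesis by (simp add: opA_def)
      qed
      have alg: "(\<alpha> / aa * g / w) * (w * (f * (k * aa * j - (1 / \<alpha>) * (bb * d)))) = g * (f * (\<alpha> * k * j - bb / aa * d))"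
        if "aa \<noteq> 0" for aa g f k j bb d :: real
        using that True \<alpha> by (simp add: field_simps)
      have d: "dens r w = \<alpha> / a r * G r w / w" using True by (simp add: dens_def)
      have "dens r w * (w * V (add_dirac X w r) r) = G r w * (?F w * (\<alpha> * ((\<alpha> + 1) / \<Gamma>\<^sub>\<alpha>) * relaxation.jump \<alpha> ?F ?F' w - b r / a r * ?F' w))"
        unfolding V_def d o using a_pos[of r] by (intro alg) simp
      moreover have "pos w = (1 :: real)" using True by simp
      ultimately show ?thesis by (simp only: \<beta>_def \<Gamma>\<^sub>\<alpha>_def mult_1_left)
    qed (simp add: dens_def)
    moreover have "add_dirac X 0 r = X" by (rule add_dirac_nonpos[OF X]) simp
    ultimately show ?thesis
      unfolding relaxation.energy_def[OF relaxation] by (simp add: opB_def \<Gamma>\<^sub>\<alpha>_def)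
  qed
  have it: "integrable m (\<lambda>r. LBINT w. dens r w * (w * V (add_dirac X w r) r))"
    "?J X = (\<integral>r. (LBINT w. dens r w * (w * V (add_dirac X w r) r)) \<partial>m)" if X: "X \<in> fin_measures" for X
    using \<nu>_iterated[OF M\<nu>[OF X]] by simp_all
  have iB: "integrable m (opB \<Psi> X)" if "X \<in> fin_measures" for X by (rule NN_integrable[OF NN(3) that m_fin])
  show im: "integrable m (site_energy \<Psi> D X)" if X: "X \<in> fin_measures" for X
    unfolding se[OF X] using it(1)[OF X] iB[OF X]
    by (intro Bochner_Integration.integrable_diff integrable_minus integrable_mult_right)
  have em: "(\<integral>r. site_energy \<Psi> D X r \<partial>m) = - ?J X - \<Psi> X * ?B X" if X: "X \<in> fin_measures" for X
    unfolding se[OF X] using it[OF X] iB[OF X] by (simp add: integrable_minus)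
  obtain B where B: "\<And>X. X \<in> space Q \<Longrightarrow> \<bar>\<Psi> X\<bar> \<le> B" "\<And>X. X \<in> space Q \<Longrightarrow> \<bar>?B X\<bar> \<le> B"
    using nice_bounded[OF n] by auto
  have iQ: "integrable Q (\<lambda>X. \<Psi> X * ?B X)"
  proof (rule Q.integrable_const_bound)
    show "AE X in Q. norm (\<Psi> X * ?B X) \<le> B * B"
      using mult_mono[OF B(1) B(2) order_trans[OF abs_ge_zero B(1)] abs_ge_zero] by (auto simp: abs_mult)
  qed (intro borel_measurable_times nice_measurable_Q[OF n])
  have iE: "integrable Q (\<lambda>X. - ?J X - \<Psi> X * ?B X)"
    using M(2) iQ by (intro Bochner_Integration.integrable_diff integrable_minus)
  then show "integrable Q (\<lambda>X. \<integral>r. site_energy \<Psi> D X r \<partial>m)"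
    by (subst Bochner_Integration.integrable_cong[OF refl em[OF space_Q_fin]])
  have "(\<integral>X. cir_op \<alpha> a b m \<Psi> X * \<Psi> X \<partial>Q) = (\<integral>X. (\<integral>r. V X r \<partial>X) + \<Psi> X * ?B X \<partial>Q)"
    by (intro Bochner_Integration.integral_cong refl) (simp add: nice_cir_op[OF n space_Q_fin] V_def distrib_left mult.commute[of _ "\<Psi> _"])
  also have "\<dots> = (\<integral>X. ?J X \<partial>Q) + (\<integral>X. \<Psi> X * ?B X \<partial>Q)"
    using M(1,3) iQ by simp
  also have "\<dots> = - (\<integral>X. - ?J X - \<Psi> X * ?B X \<partial>Q)"
    using M(2) iQ by (simp add: integrable_minus)
  also have "(\<integral>X. - ?J X - \<Psi> X * ?B X \<partial>Q) = (\<integral>X. \<integral>r. site_energy \<Psi> D X r \<partial>m \<partial>Q)"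
    by (intro Bochner_Integration.integral_cong refl) (simp add: em[OF space_Q_fin])
  finally show "(\<integral>X. cir_op \<alpha> a b m \<Psi> X * \<Psi> X \<partial>Q) = - (\<integral>X. \<integral>r. site_energy \<Psi> D X r \<partial>m \<partial>Q)" .
qed

lemma nice_C2_compact:
  assumes "nice \<Psi> D" "X \<in> fin_measures"
  obtains F'' where "C2_compact (\<lambda>t. \<Psi> (add_dirac X t r)) (\<lambda>t. D (add_dirac X t r) r) F''"
  using assms unfolding nice_def by blast

lemma dissipative:
  assumes n: "nice \<Psi> D"
  shows "(\<integral>X. cir_op \<alpha> a b m \<Psi> X * \<Psi> X \<partial>Q) \<le> 0"
proof -
  have "0 \<le> (\<integral>r. site_energy \<Psi> D X r \<partial>m)" if "X \<in> fin_measures" for X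
  proof (rule Bochner_Integration.integral_nonneg)
    fix r
    obtain F'' where "C2_compact (\<lambda>t. \<Psi> (add_dirac X t r)) (\<lambda>t. D (add_dirac X t r) r) F''"
      by (rule nice_C2_compact[OF n \<open>X \<in> fin_measures\<close>])
    then show "0 \<le> site_energy \<Psi> D X r" by (rule relaxation.energy_nonneg[OF relaxation])
  qed
  then have "0 \<le> (\<integral>X. \<integral>r. site_energy \<Psi> D X r \<partial>m \<partial>Q)"
    using space_Q_fin by (intro Bochner_Integration.integral_nonneg[of Q]) simp
  then show ?thesis using energy_identity(3)[OF n] by simp
qed

text \<open>\<alpha> \<beta> / 2 against G w / w dw is b / 2 against \<open>dens\<close>, so
  \<open>energy_ge\<close> bounds each site energy from below by b r / 2 times the squared jumps at
  r; b is replaced by c almost everywhere and the Poincare inequality concludes.\<close>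

lemma gap_lower:
  assumes n: "nice \<Psi> D" and l: "lip_approx \<Psi>" and c: "0 \<le> c" "AE r in m. c \<le> b r"
  shows "c / 2 * var Q \<Psi> \<le> - (\<integral>X. cir_op \<alpha> a b m \<Psi> X * \<Psi> X \<partial>Q)"
proof -
  note P = poincare[OF l] and E = energy_identity[OF n]
  have site: "c / 2 * jump_sq \<Psi> X \<le> (\<integral>r. site_energy \<Psi> D X r \<partial>m)" if X: "X \<in> fin_measures" for X
  proof -
    let ?Y = "\<lambda>r. LBINT w. dens r w * (\<Psi> (add_dirac X w r) - \<Psi> X)\<^sup>2"
    have it: "integrable m ?Y" "jump_sq \<Psi> X = (\<integral>r. ?Y r \<partial>m)"
      using \<nu>_iterated[OF P(1)[OF X]] by (simp_all add: jump_sq_def)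
    have "b r / 2 * ?Y r \<le> site_energy \<Psi> D X r" for r
    proof -
      let ?F = "\<lambda>t. \<Psi> (add_dirac X t r)"
      obtain F'' where F: "C2_compact ?F (\<lambda>t. D (add_dirac X t r) r) F''" using nice_C2_compact[OF n X] .
      have F0: "?F 0 = \<Psi> X" using add_dirac_nonpos[OF X, of 0] by simp
      have "?Y r = (LBINT w. \<alpha> / a r * (pos w * (G r w / w * (?F w - ?F 0)\<^sup>2)))"
        unfolding F0 by (intro Bochner_Integration.integral_cong) (auto simp: dens_def)
      also have "\<dots> = \<alpha> / a r * (LBINT w. pos w * (G r w / w * (?F w - ?F 0)\<^sup>2))"
        by (rule integral_mult_right_zero)
      finally have "b r / 2 * ?Y r = \<alpha> * \<beta> r / 2 * (LBINT w. pos w * (G r w / w * (?F w - ?F 0)\<^sup>2))"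
        by (simp add: \<beta>_def field_simps)
      then show ?thesis using relaxation.energy_ge(2)[OF relaxation F] by simp
    qed
    moreover have "0 \<le> ?Y r" for r by (intro Bochner_Integration.integral_nonneg mult_nonneg_nonneg dens_nonneg) auto
    ultimately have "AE r in m. c / 2 * ?Y r \<le> site_energy \<Psi> D X r"
      using c(2) by (auto elim!: eventually_mono intro: order_trans[OF mult_right_mono])
    then have "(\<integral>r. c / 2 * ?Y r \<partial>m) \<le> (\<integral>r. site_energy \<Psi> D X r \<partial>m)"
      using it(1) E(1)[OF X] by (intro integral_mono_AE integrable_mult_right)
    then show ?thesis unfolding it(2) by (simp only: integral_mult_right_zero)
  qed
  have "c / 2 * var Q \<Psi> \<le> c / 2 * (\<integral>X. jump_sq \<Psi> X \<partial>Q)" using P(3) c(1) by (intro mult_left_mono) auto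
  also have "\<dots> = (\<integral>X. c / 2 * jump_sq \<Psi> X \<partial>Q)" by (simp only: integral_mult_right_zero)
  also have "\<dots> \<le> (\<integral>X. \<integral>r. site_energy \<Psi> D X r \<partial>m \<partial>Q)"
    using P(2) E(2) site by (intro integral_mono integrable_mult_right) (auto dest: space_Q_fin)
  finally show ?thesis using E(3) by simp
qed

end

section \<open>Test functions\<close>

lemma continuous_on_integral_dominated:
  fixes f :: "'a::metric_space \<Rightarrow> real \<Rightarrow> real"
  assumes c: "\<And>z. continuous_on S (\<lambda>p. f p z)" and [measurable]: "\<And>p. p \<in> S \<Longrightarrow> f p \<in> borel_measurable borel"
    and w: "integrable lborel w" and le: "\<And>p z. p \<in> S \<Longrightarrow> \<bar>f p z\<bar> \<le> w z"
  shows "continuous_on S (\<lambda>p. LBINT z. f p z)"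
proof (rule continuous_on_sequentiallyI)
  fix u q assume u: "\<forall>k. u k \<in> S" and q: "q \<in> S" and l: "u \<longlonglongrightarrow> q"
  show "(\<lambda>k. LBINT z. f (u k) z) \<longlonglongrightarrow> (LBINT z. f q z)"
  proof (rule integral_dominated_convergence[where w = w])
    show "AE z in lborel. (\<lambda>k. f (u k) z) \<longlonglongrightarrow> f q z"
      using u q l by (intro AE_I2 continuous_on_tendsto_compose[OF c]) auto
    show "AE z in lborel. norm (f (u k) z) \<le> w z" for k using u le by simp
  qed (use u q w in auto)
qed

text \<open>For small z the bounds on F'' and F' are used, for large z those on F' and F; the sum of
  the constants serves all cases.\<close>

lemma Taylor_bounds:
  assumes F: "\<And>t. 0 \<le> t \<Longrightarrow> (F has_real_derivative F' t) (at t within {0..})"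
    and F': "\<And>t. 0 \<le> t \<Longrightarrow> (F' has_real_derivative F'' t) (at t within {0..})"
    and B: "\<And>t. 0 \<le> t \<Longrightarrow> \<bar>F t\<bar> \<le> B" "\<And>t. 0 \<le> t \<Longrightarrow> \<bar>F' t\<bar> \<le> M" "\<And>t. 0 \<le> t \<Longrightarrow> \<bar>F'' t\<bar> \<le> N"
    and z: "0 < z"
  shows "\<bar>F z - F 0 - z * F' 0\<bar> \<le> (2 * B + 2 * M + N) * min (z\<^sup>2) z" "\<bar>F z - F 0\<bar> \<le> (2 * B + 2 * M + N) * min 1 z"
proof -
  have nn: "0 \<le> B" "0 \<le> M" "0 \<le> N" using B[of 0] by auto
  obtain c where c: "0 \<le> c" "c \<le> z" "F z - F 0 = z * F' c" using halfline_mvt[OF F, of 0 z] z by auto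
  obtain d where d: "0 \<le> d" "F' c - F' 0 = c * F'' d" using halfline_mvt[OF F', of 0 c] c by auto
  have 1: "\<bar>F z - F 0\<bar> \<le> z * M" unfolding c(3) using z B(2)[OF c(1)] by (simp add: abs_mult)
  have 2: "\<bar>F z - F 0\<bar> \<le> 2 * B" using B(1)[of z] B(1)[of 0] z by simp
  have "F z - F 0 - z * F' 0 = z * (F' c - F' 0)" unfolding c(3) by (simp add: algebra_simps)
  then have "\<bar>F z - F 0 - z * F' 0\<bar> = z * (c * \<bar>F'' d\<bar>)" using z c d by (simp add: abs_mult)
  also have "\<dots> \<le> z * (z * N)" using z c B(3)[OF d(1)] by (intro mult_left_mono mult_mono) auto
  finally have 3: "\<bar>F z - F 0 - z * F' 0\<bar> \<le> N * z\<^sup>2" by (simp add: power2_eq_square mult_ac)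
  have "\<bar>z * F' 0\<bar> \<le> z * M" using z B(2)[of 0] by (simp add: abs_mult)
  then have 4: "\<bar>F z - F 0 - z * F' 0\<bar> \<le> (2 * M) * z" using 1 by (simp only: mult.commute[of z] mult.assoc)
  let ?K = "2 * B + 2 * M + N"
  have "N * z\<^sup>2 \<le> ?K * z\<^sup>2" "(2 * M) * z \<le> ?K * z" "M * z \<le> ?K * z" "2 * B \<le> ?K * 1"
    using nn z by (auto intro!: mult_right_mono)
  then show "\<bar>F z - F 0 - z * F' 0\<bar> \<le> ?K * min (z\<^sup>2) z" "\<bar>F z - F 0\<bar> \<le> ?K * min 1 z"
    using 1 2 3 4 by (auto simp: min_def mult.commute)
qed

lemma continuous_on_ray:
  assumes v: "\<And>i. continuous_on UNIV (\<lambda>r. v r i)"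
  shows "continuous_on (orthant n \<times> UNIV) (\<lambda>(x, r). ray x (v r) z)"
proof (rule continuous_on_coordinatewise_then_product)
  fix i
  have "continuous_on (orthant n \<times> UNIV) (\<lambda>p. fst p i)"
    by (intro continuous_on_compose2[OF continuous_on_product_coordinates continuous_on_fst[OF continuous_on_id]]) auto
  moreover have "continuous_on (orthant n \<times> UNIV) (\<lambda>p. v (snd p) i)"
    by (intro continuous_on_compose2[OF v continuous_on_snd[OF continuous_on_id]]) auto
  ultimately show "continuous_on (orthant n \<times> UNIV) (\<lambda>p. (\<lambda>(x, r). ray x (v r) z) p i)"
    by (auto simp: ray_def case_prod_unfold intro!: continuous_intros)
qed

lemma C2_compact_ray:
  assumes p: "\<And>i. i < n \<Longrightarrow> partial_on_orthant n i \<phi> (g i)" "\<And>i j. i < n \<Longrightarrow> j < n \<Longrightarrow> partial_on_orthant n j (g i) (h i j)"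
    and c: "continuous_on (orthant n) \<phi>" "\<And>i. i < n \<Longrightarrow> continuous_on (orthant n) (g i)"
      "\<And>i j. i < n \<Longrightarrow> j < n \<Longrightarrow> continuous_on (orthant n) (h i j)"
    and R: "0 < R" "\<And>x. x \<in> orthant n \<Longrightarrow> R \<le> x k \<Longrightarrow> \<phi> x = 0" "\<And>x i. x \<in> orthant n \<Longrightarrow> R \<le> x k \<Longrightarrow> i < n \<Longrightarrow> g i x = 0"
      "\<And>x i j. x \<in> orthant n \<Longrightarrow> R \<le> x k \<Longrightarrow> i < n \<Longrightarrow> j < n \<Longrightarrow> h i j x = 0"
    and x: "x \<in> orthant n" and v: "v \<in> orthant n" "k < n" "0 < v k"
  shows "C2_compact (\<lambda>t. \<phi> (ray x v (max 0 t))) (\<lambda>t. \<Sum>i<n. v i * g i (ray x v (max 0 t)))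
    (\<lambda>t. \<Sum>i<n. v i * (\<Sum>j<n. v j * h i j (ray x v (max 0 t))))"
  unfolding C2_compact_def
proof (intro conjI allI impI)
  have o: "ray x v (max 0 t) \<in> orthant n" for t by (intro ray_orthant x v) simp
  have r: "continuous_on UNIV (\<lambda>t. ray x v (max 0 t))"
    by (intro continuous_on_coordinatewise_then_product) (auto simp: ray_def intro!: continuous_intros)
  have cr: "continuous_on UNIV (\<lambda>t. u (ray x v (max 0 t)))" if "continuous_on (orthant n) u" for u :: "(nat \<Rightarrow> real) \<Rightarrow> real"
    by (rule continuous_on_compose2[OF that r]) (auto simp: o)
  show "continuous_on UNIV (\<lambda>t. \<phi> (ray x v (max 0 t)))" by (rule cr[OF c(1)])
  show "continuous_on UNIV (\<lambda>t. \<Sum>i<n. v i * g i (ray x v (max 0 t)))"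
    by (intro continuous_intros cr c) simp
  show "continuous_on UNIV (\<lambda>t. \<Sum>i<n. v i * (\<Sum>j<n. v j * h i j (ray x v (max 0 t))))"
    by (intro continuous_intros cr c) simp_all
  have d: "((\<lambda>t. u (ray x v (max 0 t))) has_real_derivative (\<Sum>i<n. v i * u' i (ray x v (max 0 t)))) (at t within {0..})"
    if "\<And>i. i < n \<Longrightarrow> partial_on_orthant n i u (u' i)" "\<And>i. i < n \<Longrightarrow> continuous_on (orthant n) (u' i)" "0 \<le> t" for u u' t
  proof (rule has_field_derivative_transform_within[OF _ zero_less_one])
    show "((\<lambda>t. u (ray x v t)) has_real_derivative (\<Sum>i<n. v i * u' i (ray x v (max 0 t)))) (at t within {0..})"
      using ray_derivative[OF that(1,2) x v(1) that(3)] that(3) by (simp add: max_def)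
  qed (use that in auto)
  show "((\<lambda>t. \<phi> (ray x v (max 0 t))) has_real_derivative (\<Sum>i<n. v i * g i (ray x v (max 0 t)))) (at t within {0..})" if "0 \<le> t" for t
    by (rule d[OF p(1) c(2) that])
  show "((\<lambda>t. \<Sum>i<n. v i * g i (ray x v (max 0 t))) has_real_derivative (\<Sum>i<n. v i * (\<Sum>j<n. v j * h i j (ray x v (max 0 t))))) (at t within {0..})"
    if "0 \<le> t" for t
    by (intro DERIV_sum DERIV_cmult d that p c) simp_all
  show "\<exists>S>0. \<forall>t\<ge>S. \<phi> (ray x v (max 0 t)) = 0 \<and> (\<Sum>i<n. v i * g i (ray x v (max 0 t))) = 0 \<and>
    (\<Sum>i<n. v i * (\<Sum>j<n. v j * h i j (ray x v (max 0 t)))) = 0"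
  \<comment> \<open>Coordinate k grows along the ray at the positive rate \<open>v k\<close>, so it
    has passed \<open>R\<close> by this time.\<close>
  proof (intro exI[of _ "R / v k"] conjI allI impI)
    show "0 < R / v k" using R(1) v(3) by simp
    fix t assume t: "R / v k \<le> t"
    then have "R \<le> t * v k" using v(3) by (simp add: pos_divide_le_eq)
    moreover have "0 \<le> t" using t R(1) v(3) by (meson divide_nonneg_pos le_less order_trans)
    moreover have "0 \<le> x k" using x v(2) by (simp add: orthant_def)
    ultimately have "R \<le> ray x v (max 0 t) k" by (simp add: ray_def)
    then show "\<phi> (ray x v (max 0 t)) = 0" "(\<Sum>i<n. v i * g i (ray x v (max 0 t))) = 0"
      "(\<Sum>i<n. v i * (\<Sum>j<n. v j * h i j (ray x v (max 0 t)))) = 0"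
      using R o by auto
  qed
qed

context cir
begin

lemma pairing_ge:
  assumes "continuous_on UNIV f" "\<And>r. c \<le> f r" "X \<in> fin_measures"
  shows "c * mass X \<le> pairing X f"
proof -
  have "(\<integral>r. c * 1 \<partial>X) \<le> pairing X f"
    using assms by (intro integral_mono integrable_mult_right continuous_integrable) auto
  then show ?thesis by (simp only: integral_mult_right_zero)
qed

text \<open>Under x_i = <X, f_i> the path X + t \<delta>_r becomes the ray from x in direction (f_i
  r)_i. The jump integrals and the derivative are thus continuous functions of (x, r) vanishing
  outside a box, to which \<open>NN_member\<close> applies.\<close>

lemma test_function_nice:
  assumes "\<Psi> \<in> test_functions"
  obtains D where "nice \<Psi> D" "lip_approx \<Psi>"
proof -
  obtain n \<phi> f where n: "1 \<le> n" "C2_orthant n \<phi>" "compact_support_orthant n \<phi>" and f: "\<And>i. i < n \<Longrightarrow> f i \<in> Cpp"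
    and \<Psi>0: "\<And>X. X \<in> fin_measures \<Longrightarrow> \<Psi> X = \<phi> (\<lambda>i. if i < n then pairing X (f i) else 0)"
    using assms unfolding test_functions_def by blast
  have \<Psi>: "\<Psi> X = \<phi> (xvec n f X)" if "X \<in> fin_measures" for X using \<Psi>0[OF that] by (simp add: xvec_def[abs_def])
  obtain g h R B where R: "0 < R" and B: "0 < B" and c\<phi>: "continuous_on (orthant n) \<phi>"
    and pg: "\<And>i. i < n \<Longrightarrow> partial_on_orthant n i \<phi> (g i)" and cg: "\<And>i. i < n \<Longrightarrow> continuous_on (orthant n) (g i)"
    and ph: "\<And>i j. i < n \<Longrightarrow> j < n \<Longrightarrow> partial_on_orthant n j (g i) (h i j)" and ch: "\<And>i j. i < n \<Longrightarrow> j < n \<Longrightarrow> continuous_on (orthant n) (h i j)"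
    and \<phi>0: "\<And>x k. x \<in> orthant n \<Longrightarrow> k < n \<Longrightarrow> R \<le> x k \<Longrightarrow> \<phi> x = 0"
    and g0: "\<And>x k i. x \<in> orthant n \<Longrightarrow> k < n \<Longrightarrow> R \<le> x k \<Longrightarrow> i < n \<Longrightarrow> g i x = 0"
    and h0: "\<And>x k i j. x \<in> orthant n \<Longrightarrow> k < n \<Longrightarrow> R \<le> x k \<Longrightarrow> i < n \<Longrightarrow> j < n \<Longrightarrow> h i j x = 0"
    and b\<phi>: "\<And>x. x \<in> orthant n \<Longrightarrow> \<bar>\<phi> x\<bar> \<le> B" and bg: "\<And>x i. x \<in> orthant n \<Longrightarrow> i < n \<Longrightarrow> \<bar>g i x\<bar> \<le> B"
    and bh: "\<And>x i j. x \<in> orthant n \<Longrightarrow> i < n \<Longrightarrow> j < n \<Longrightarrow> \<bar>h i j x\<bar> \<le> B"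
    by (rule test_function_data[OF n(2,3)], rule that)
  have n0: "0 < n" using n(1) by simp
  have cnn: "\<And>i. i < n \<Longrightarrow> cnn (f i)" by (rule Cpp_cnn[OF f])
  have cf: "\<And>i. i < n \<Longrightarrow> continuous_on UNIV (f i)" using f by (auto simp: Cpp_def)
  define v where "v r i = (if i < n then f i r else 0)" for r i
  have v: "v r \<in> orthant n" for r using cnn by (auto simp: v_def orthant_def cnn_nonneg)
  have cv: "continuous_on UNIV (\<lambda>r. v r i)" for i using cf by (cases "i < n") (auto simp: v_def)
  \<comment> \<open>The positive lower bound of f 0 makes every ray leave the support, and makes
    \<Psi> vanish once mass X exceeds R / \<rho>.\<close>
  obtain \<rho> where \<rho>: "0 < \<rho>" "\<And>r. \<rho> \<le> f 0 r" using f[OF n0] by (auto simp: Cpp_def)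
  have xv: "xvec n f (add_dirac X t r) = ray (xvec n f X) (v r) (max 0 t)" if "X \<in> fin_measures" for X t r
    using that cf by (auto simp: fun_eq_iff xvec_def ray_def v_def pairing_add_dirac add_dirac_nonpos max_def not_le)
  have xo: "xvec n f X \<in> orthant n" for X by (rule xvec_orthant[OF cnn])
  define U where "U x r = (\<Sum>i<n. v r i * g i x)" for x r
  define D where "D X r = U (xvec n f X) r" for X r
  define D2 where "D2 X r = (\<Sum>i<n. v r i * (\<Sum>j<n. v r j * h i j (xvec n f X)))" for X r
  have C: "C2_compact (\<lambda>t. \<phi> (ray x (v r) (max 0 t))) (\<lambda>t. U (ray x (v r) (max 0 t)) r)
      (\<lambda>t. \<Sum>i<n. v r i * (\<Sum>j<n. v r j * h i j (ray x (v r) (max 0 t))))" if x: "x \<in> orthant n" for x r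
    unfolding U_def using \<rho>(1) \<rho>(2)[of r] n0
    by (intro C2_compact_ray[where k = 0 and R = R] R x v) (auto intro: pg ph c\<phi> cg ch \<phi>0 g0[OF _ n0] h0[OF _ n0] simp: v_def)
  obtain V where V: "0 \<le> V" "\<And>r i. \<bar>v r i\<bar> \<le> V"
  proof -
    have "\<exists>V. \<forall>r. \<bar>f i r\<bar> \<le> V" if "i < n" for i
      using continuous_bounded[OF cf[OF that]] unfolding bounded_iff by auto
    then obtain V where "\<And>i r. i < n \<Longrightarrow> \<bar>f i r\<bar> \<le> V i" by metis
    then have "\<bar>v r i\<bar> \<le> (\<Sum>i<n. \<bar>V i\<bar>)" for r i
    proof (cases "i < n")
      case True
      assume *: "\<And>i r. i < n \<Longrightarrow> \<bar>f i r\<bar> \<le> V i"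
      have "\<bar>v r i\<bar> \<le> \<bar>V i\<bar>" using *[OF True, of r] True by (simp add: v_def)
      also have "\<dots> \<le> (\<Sum>i<n. \<bar>V i\<bar>)" using True by (intro member_le_sum) auto
      finally show ?thesis .
    qed (simp add: v_def sum_nonneg)
    then show ?thesis by (intro that[of "\<Sum>i<n. \<bar>V i\<bar>"]) (auto intro: sum_nonneg)
  qed
  define M where "M = n * (V * B)"
  define N where "N = n * (V * M)"
  have M0: "0 \<le> M" "0 \<le> N" using V B by (auto simp: M_def N_def)
  have sum_le: "\<bar>\<Sum>i<n. v r i * q i\<bar> \<le> n * (V * L)" if "\<And>i. i < n \<Longrightarrow> \<bar>q i\<bar> \<le> L" for r q L
  proof -
    have "\<bar>\<Sum>i<n. v r i * q i\<bar> \<le> (\<Sum>i<n. \<bar>v r i * q i\<bar>)" by (rule sum_abs)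
    also have "\<dots> \<le> (\<Sum>i<n. V * L)" using that V by (intro sum_mono) (auto simp: abs_mult intro!: mult_mono)
    finally show ?thesis by simp
  qed
  have bU: "\<bar>U x r\<bar> \<le> M" if "x \<in> orthant n" for x r
    unfolding U_def M_def by (intro sum_le bg that)
  have bD2: "\<bar>\<Sum>i<n. v r i * (\<Sum>j<n. v r j * h i j x)\<bar> \<le> N" if "x \<in> orthant n" for x r
    unfolding N_def M_def by (intro sum_le bh that)
  define K where "K = 2 * B + 2 * M + N"
  have K0: "0 \<le> K" using B M0 by (simp add: K_def)
  have T: "\<bar>\<phi> (ray x (v r) z) - \<phi> x - z * U x r\<bar> \<le> K * min (z\<^sup>2) z" "\<bar>\<phi> (ray x (v r) z) - \<phi> x\<bar> \<le> K * min 1 z"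
    if x: "x \<in> orthant n" and z: "0 < z" for x r z
  proof -
    have o: "ray x (v r) (max 0 t) \<in> orthant n" for t by (intro ray_orthant x v) simp
    have r0: "ray x (v r) 0 = x" by (simp add: ray_def fun_eq_iff)
    note c2 = C[OF x, of r, unfolded C2_compact_def, THEN conjunct2, THEN conjunct2, THEN conjunct2]
    note TB = Taylor_bounds[OF c2[THEN conjunct1, rule_format] c2[THEN conjunct2, THEN conjunct1, rule_format] b\<phi>[OF o] bU[OF o] bD2[OF o] z]
    have "max 0 z = z" using z by simp
    then show "\<bar>\<phi> (ray x (v r) z) - \<phi> x - z * U x r\<bar> \<le> K * min (z\<^sup>2) z" "\<bar>\<phi> (ray x (v r) z) - \<phi> x\<bar> \<le> K * min 1 z"
      using TB by (simp_all only: r0 K_def max.idem)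
  qed
  have cU: "continuous_on (orthant n \<times> UNIV) (\<lambda>(x, r). U x r)"
    unfolding U_def case_prod_unfold
    by (intro continuous_on_sum continuous_on_mult continuous_on_compose2[OF cv continuous_on_snd[OF continuous_on_id]]
        continuous_on_compose2[OF cg continuous_on_fst[OF continuous_on_id]]) auto
  have c\<phi>x: "continuous_on (orthant n \<times> UNIV) (\<lambda>(x, r :: 'e). \<phi> x)"
    unfolding case_prod_unfold by (intro continuous_on_compose2[OF c\<phi> continuous_on_fst[OF continuous_on_id]]) auto
  have c\<phi>r: "continuous_on (orthant n \<times> UNIV) (\<lambda>(x, r). \<phi> (ray x (v r) z))" if "0 \<le> z" for z
  proof -
    have "continuous_on (orthant n \<times> UNIV) (\<lambda>p. \<phi> ((\<lambda>(x, r). ray x (v r) z) p))"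
      by (rule continuous_on_compose2[OF c\<phi> continuous_on_ray[OF cv]]) (auto intro!: ray_orthant v that)
    then show ?thesis by (simp add: case_prod_unfold)
  qed
  have m\<phi>: "(\<lambda>z. pos z * \<phi> (ray x (v r) z)) \<in> borel_measurable borel" if x: "x \<in> orthant n" for x r
  proof -
    have "(\<lambda>t. \<phi> (ray x (v r) (max 0 t))) \<in> borel_measurable borel"
      using C[OF x, of r] by (intro borel_measurable_continuous_onI) (auto simp: C2_compact_def)
    then have "(\<lambda>z. pos z * \<phi> (ray x (v r) (max 0 z))) \<in> borel_measurable borel" by measurable
    moreover have "(\<lambda>z. pos z * \<phi> (ray x (v r) (max 0 z))) = (\<lambda>z. pos z * \<phi> (ray x (v r) z))"
      by (auto simp: fun_eq_iff indicator_def)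
    ultimately show ?thesis by simp
  qed
  define I where "I x r = (LBINT z. pos z * (z powr (- 2 - \<alpha>) * (\<phi> (ray x (v r) z) - \<phi> x - z * U x r)))" for x r
  define J where "J x r = (LBINT z. pos z * (z powr (- 1 - \<alpha>) * (\<phi> (ray x (v r) z) - \<phi> x)))" for x r
  \<comment> \<open>Serves both jump integrals: k = 1 is the compensated one, k = 0 the plain one,
    and \<open>q\<close> is the corresponding bound on the increment.\<close>
  have c_int: "continuous_on (orthant n \<times> UNIV) (\<lambda>p. LBINT z. pos z * (z powr s * (\<phi> (ray (fst p) (v (snd p)) z) - \<phi> (fst p) - k * z * U (fst p) (snd p))))"
    if b: "\<And>x r z. x \<in> orthant n \<Longrightarrow> 0 < z \<Longrightarrow> \<bar>\<phi> (ray x (v r) z) - \<phi> x - k * z * U x r\<bar> \<le> K * q z"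
      and q: "\<And>z. pos z * (z powr s * q z) = kern2 z" for s k :: real and q
  proof (rule continuous_on_integral_dominated[OF _ _ integrable_mult_right[OF kern2_integrable, of K]])
    fix p :: "(nat \<Rightarrow> real) \<times> 'e" and z :: real assume p: "p \<in> orthant n \<times> UNIV"
    then have x: "fst p \<in> orthant n" by auto
    have "(\<lambda>z. z powr s * (pos z * \<phi> (ray (fst p) (v (snd p)) z) + pos z * (- \<phi> (fst p) - k * z * U (fst p) (snd p)))) \<in> borel_measurable borel"
      using m\<phi>[OF x, of "snd p"] by measurable
    then show "(\<lambda>z. pos z * (z powr s * (\<phi> (ray (fst p) (v (snd p)) z) - \<phi> (fst p) - k * z * U (fst p) (snd p)))) \<in> borel_measurable borel"
      by (rule measurable_cong[THEN iffD1, rotated]) (auto simp: indicator_def)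
    show "\<bar>pos z * (z powr s * (\<phi> (ray (fst p) (v (snd p)) z) - \<phi> (fst p) - k * z * U (fst p) (snd p)))\<bar> \<le> K * kern2 z"
      unfolding q[symmetric] using mult_left_mono[OF b[OF x, of z "snd p"], of "z powr s"]
      by (cases "0 < z") (auto simp: abs_mult mult_ac)
  next
    fix z :: real
    show "continuous_on (orthant n \<times> UNIV) (\<lambda>p. pos z * (z powr s * (\<phi> (ray (fst p) (v (snd p)) z) - \<phi> (fst p) - k * z * U (fst p) (snd p))))"
    proof (cases "0 < z")
      case True
      show ?thesis using c\<phi>r[of z] c\<phi>x cU True
        by (intro continuous_on_mult continuous_on_diff continuous_on_const) (auto simp: case_prod_unfold)
    qed simp
  qed
  have cI: "continuous_on (orthant n \<times> UNIV) (\<lambda>(x, r). I x r)"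
    using c_int[of 1 "\<lambda>z. min (z\<^sup>2) z" "- 2 - \<alpha>"] T(1) unfolding I_def case_prod_unfold by (simp add: kern1_def[symmetric] kern_eq)
  have cJ: "continuous_on (orthant n \<times> UNIV) (\<lambda>(x, r). J x r)"
    using c_int[of 0 "min 1" "- 1 - \<alpha>"] T(2) unfolding J_def case_prod_unfold by (simp add: kern2_def)
  have ray0: "\<phi> (ray x (v r) z) = 0" "U x r = 0" "\<phi> x = 0" if "x \<in> orthant n" "i < n" "R \<le> x i" "0 < z" for x r z i
  proof -
    have "ray x (v r) z \<in> orthant n" using that by (intro ray_orthant v) auto
    moreover have "R \<le> ray x (v r) z i" using that v[of r] by (simp add: ray_def orthant_def add_increasing2)
    ultimately show "\<phi> (ray x (v r) z) = 0" using \<phi>0 that(2) by blast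
    show "\<phi> x = 0" using \<phi>0 that by blast
    show "U x r = 0" unfolding U_def using g0[OF that(1-3)] by simp
  qed
  have I0: "I x r = 0" if "x \<in> orthant n" "i < n" "R \<le> x i" for x r i
  proof -
    have z: "(\<lambda>z. pos z * (z powr (- 2 - \<alpha>) * (\<phi> (ray x (v r) z) - \<phi> x - z * U x r))) = (\<lambda>_. 0)"
      using ray0[OF that] by (auto simp: fun_eq_iff indicator_def)
    show ?thesis unfolding I_def z by simp
  qed
  have J0: "J x r = 0" if "x \<in> orthant n" "i < n" "R \<le> x i" for x r i
  proof -
    have z: "(\<lambda>z. pos z * (z powr (- 1 - \<alpha>) * (\<phi> (ray x (v r) z) - \<phi> x))) = (\<lambda>_. 0)"
      using ray0[OF that] by (auto simp: fun_eq_iff indicator_def)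
    show ?thesis unfolding J_def z by simp
  qed
  have jumpz: "\<Psi> (add_dirac X z r) = \<phi> (ray (xvec n f X) (v r) z)" if "X \<in> fin_measures" "0 < z" for X z r
    using that by (simp add: \<Psi> add_dirac_fin xv)
  have NND: "NN D" unfolding D_def[abs_def]
    by (rule NN_member[OF cnn less_imp_le[OF R] cU]) (assumption, rule ray0(2)[OF _ _ _ zero_less_one])
  have NN\<Psi>: "NN (\<lambda>X r. \<Psi> X)"
    by (rule NN_cong[OF NN_member[where f = f and n = n and A = "\<lambda>x r. \<phi> x", OF cnn less_imp_le[OF R] c\<phi>x]])
      (use \<phi>0 \<Psi> in auto)
  have NNI: "NN (\<lambda>X r. I (xvec n f X) r)" by (rule NN_member[OF cnn less_imp_le[OF R] cI I0])
  have NNJ: "NN (\<lambda>X r. J (xvec n f X) r)" by (rule NN_member[OF cnn less_imp_le[OF R] cJ J0])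
  have lin: "NN (\<lambda>X r. ((\<alpha> + 1) / \<Gamma>\<^sub>\<alpha> * a r) * I (xvec n f X) r + (- (1 / \<alpha>) * b r) * D X r)"
    by (intro NN_add NN_mult ES_NN[OF ES_coeff] NNI NND continuous_on_mult continuous_on_const a_cont b_cont)
  have opA: "opA \<Psi> D X r = ((\<alpha> + 1) / \<Gamma>\<^sub>\<alpha> * a r) * I (xvec n f X) r + (- (1 / \<alpha>) * b r) * D X r" if X: "X \<in> fin_measures" for X r
  proof -
    have "(LBINT z. pos z * (z powr (- 2 - \<alpha>) * (\<Psi> (add_dirac X z r) - \<Psi> X - z * D X r))) = I (xvec n f X) r"
      unfolding I_def using X by (intro Bochner_Integration.integral_cong) (auto simp: indicator_def jumpz \<Psi> D_def)
    then show ?thesis by (simp add: opA_def)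
  qed
  have NNA: "NN (opA \<Psi> D)" by (rule NN_cong[OF lin]) (simp only: opA)
  have NNB: "NN (opB \<Psi>)"
  proof (rule NN_cong[OF NN_cmult[OF NNJ, of "\<alpha> / \<Gamma>\<^sub>\<alpha>"]])
    fix X :: "'e measure" and r assume X: "X \<in> fin_measures"
    have "(LBINT z. pos z * (z powr (- 1 - \<alpha>) * (\<Psi> (add_dirac X z r) - \<Psi> X))) = J (xvec n f X) r"
      unfolding J_def using X by (intro Bochner_Integration.integral_cong) (auto simp: indicator_def jumpz \<Psi>)
    then show "\<alpha> / \<Gamma>\<^sub>\<alpha> * J (xvec n f X) r = opB \<Psi> X r" by (simp add: opB_def)
  qed
  have "nice \<Psi> D" unfolding nice_def
  proof (intro conjI NN\<Psi> NND NNA NNB)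
    show "\<exists>D2. \<forall>X\<in>fin_measures. \<forall>r. C2_compact (\<lambda>t. \<Psi> (add_dirac X t r)) (\<lambda>t. D (add_dirac X t r) r) (\<lambda>t. D2 (add_dirac X t r) r)"
      using C[OF xo] by (intro exI[of _ D2]) (simp add: \<Psi> add_dirac_fin D_def D2_def xv)
    show "\<exists>K\<ge>0. \<forall>X\<in>fin_measures. \<forall>r. \<forall>z>0. \<bar>\<Psi> (add_dirac X z r) - \<Psi> X - z * D X r\<bar> \<le> K * min (z\<^sup>2) z \<and>
        \<bar>\<Psi> (add_dirac X z r) - \<Psi> X\<bar> \<le> K * min 1 z"
      using K0 T[OF xo] by (intro exI[of _ K]) (simp add: jumpz \<Psi> D_def)
    show "\<exists>R\<ge>0. \<forall>X\<in>fin_measures. R < mass X \<longrightarrow> \<Psi> X = 0 \<and> (\<forall>r. D X r = 0)"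
    proof (intro exI[of _ "R / \<rho>"] conjI ballI impI allI)
      show "0 \<le> R / \<rho>" using R \<rho> by simp
      fix X :: "'e measure" and r assume X: "X \<in> fin_measures" "R / \<rho> < mass X"
      have "R < \<rho> * mass X" using X(2) \<rho>(1) by (simp add: pos_divide_less_eq mult.commute)
      also have "\<dots> \<le> xvec n f X 0" using pairing_ge[OF cf[OF n0] \<rho>(2) X(1)] n0 by (simp add: xvec_def)
      finally have "R \<le> xvec n f X 0" by simp
      from ray0(2,3)[OF xo n0 this zero_less_one] show "\<Psi> X = 0" "D X r = 0" by (simp_all add: \<Psi> X D_def)
    qed
  qed
  moreover have "lip_approx \<Psi>"
  proof -
    have L: "\<bar>\<phi> (x(i := s)) - \<phi> (x(i := t))\<bar> \<le> B * \<bar>s - t\<bar>" if x: "x \<in> orthant n" "i < n" and st: "0 \<le> s" "0 \<le> t" for x i s t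
    proof -
      have o: "x(i := u) \<in> orthant n" if "0 \<le> u" for u using x that by (auto simp: orthant_def)
      have "((\<lambda>u. \<phi> (x(i := u))) has_real_derivative g i (x(i := u))) (at u within {0..})" if "0 \<le> u" for u
        using pg[OF x(2)] o[OF that] unfolding partial_on_orthant_def by force
      from halfline_mvt[OF this st(2,1)] obtain c where c: "0 \<le> c" "\<phi> (x(i := s)) - \<phi> (x(i := t)) = (s - t) * g i (x(i := c))" by blast
      have "\<bar>s - t\<bar> * \<bar>g i (x(i := c))\<bar> \<le> \<bar>s - t\<bar> * B" by (intro mult_left_mono bg o c x) simp
      then show ?thesis unfolding c(2) by (simp add: abs_mult mult.commute)
    qed
    obtain C where "0 \<le> C" and W: "\<And>\<epsilon>. 0 < \<epsilon> \<Longrightarrow> \<exists>W. ES (\<lambda>X r. W X) \<and> (\<forall>X\<in>fin_measures. \<bar>\<phi> (xvec n f X) - W X\<bar> \<le> \<epsilon>)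
     \<and> (\<forall>X\<in>fin_measures. \<forall>z\<ge>0. \<forall>r. \<bar>W (add_dirac X z r) - W X\<bar> \<le> C * min 1 z)"
      by (rule Lipschitz_approximation[where n = n and f = f and \<phi> = \<phi> and R = R and L = B, OF cnn less_imp_le[OF R] less_imp_le[OF B] \<phi>0 L]) auto
    then show ?thesis unfolding lip_approx_def by (intro exI[of _ C]) (simp add: \<Psi>)
  qed
  ultimately show ?thesis by (rule that)
qed

end

section \<open>The upper bound\<close>

text \<open>The Levy-Khintchine formula of the stable subordinator, from the Gamma integral of z^(-
  \<alpha>) by integrating its Laplace transform.\<close>

lemma stable_levy:
  fixes \<alpha> c :: real
  assumes \<alpha>: "0 < \<alpha>" "\<alpha> < 1" and c: "0 < c"
  shows "has_bochner_integral lborel (\<lambda>z. pos z * (z powr (- 1 - \<alpha>) * (1 - exp (- c * z)))) (c powr \<alpha> * Gamma (1 - \<alpha>) / \<alpha>)"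
proof -
  have "has_bochner_integral lborel (\<lambda>z. pos z * (z powr (- \<alpha>) / z * (1 - exp (- c * z)))) (Gamma (1 - \<alpha>) * (c powr (\<alpha> - 1 + 1) / (\<alpha> - 1 + 1)))"
  proof (rule has_bochner_integral_laplace_primitive[where L = "\<lambda>s. Gamma (1 - \<alpha>) * s powr (\<alpha> - 1)"])
    fix s :: real assume s: "0 < s"
    have "Gamma (1 - \<alpha>) / s powr (1 - \<alpha>) = Gamma (1 - \<alpha>) * s powr (\<alpha> - 1)"
      using s powr_minus_divide[of s "1 - \<alpha>"] by simp
    then show "has_bochner_integral lborel (\<lambda>w. pos w * (w powr (- \<alpha>) * exp (- s * w))) (Gamma (1 - \<alpha>) * s powr (\<alpha> - 1))"
      using has_bochner_integral_Gamma[of "1 - \<alpha>" s] \<alpha> s by simp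
  next
    have "has_bochner_integral lborel (\<lambda>s. indicator {0<..<c} s * s powr (\<alpha> - 1)) (c powr (\<alpha> - 1 + 1) / (\<alpha> - 1 + 1))"
      using \<alpha> c has_integral_powr_from_0[of "\<alpha> - 1" c]
      by (intro has_bochner_integral_of_has_integral) (auto simp: has_integral_Icc_iff_Ioo)
    from has_bochner_integral_mult_right[OF this, of "Gamma (1 - \<alpha>)"]
    show "has_bochner_integral lborel (\<lambda>s. indicator {0<..<c} s * (Gamma (1 - \<alpha>) * s powr (\<alpha> - 1))) (Gamma (1 - \<alpha>) * (c powr (\<alpha> - 1 + 1) / (\<alpha> - 1 + 1)))"
      by (simp add: mult.left_commute)
  qed (use c in auto)
  moreover have "z powr (- \<alpha>) / z = z powr (- 1 - \<alpha>)" if "0 < z" for z :: real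
    using that powr_mult_base[of z "- 1 - \<alpha>"] by (simp add: divide_eq_eq mult.commute)
  then have "pos z * (z powr (- \<alpha>) / z * (1 - exp (- c * z))) = pos z * (z powr (- 1 - \<alpha>) * (1 - exp (- c * z)))" for z :: real
    by (cases "0 < z") auto
  ultimately show ?thesis by (simp add: mult.commute)
qed

lemma one_minus_exp_squared: "(1 - exp (- x))\<^sup>2 = 2 * (1 - exp (- x)) - (1 - exp (- (2 * x)))" for x :: real
proof -
  have "exp (- (2 * x)) = (exp (- x))\<^sup>2" by (simp add: power2_eq_square exp_add[symmetric])
  then show ?thesis by (simp add: power2_eq_square algebra_simps)
qed

context relaxation
begin

text \<open>The energy is monotone in the increments, so \<open>F\<close> is compared with E exp(- l
  t), which itself has no compact support. For small l the immigration part is of order l^\<alpha>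
  and the branching part of order (l^\<alpha>)^2, so only the former needs its exact
  constant.\<close>

lemma energy_le:
  assumes F: "C2_compact F F' F''" and l: "0 < l" and E: "0 \<le> E"
    and le: "\<And>w z. 0 \<le> w \<Longrightarrow> 0 < z \<Longrightarrow> \<bar>F (w + z) - F w\<bar> \<le> E * exp (- l * w) * (1 - exp (- l * z))"
  shows "energy F F' \<le> E\<^sup>2 / 2 * ((2 - 2 powr \<alpha>) * l powr \<alpha> + 2 / \<beta> * (l powr \<alpha>)\<^sup>2)"
proof -
  note L1 = stable_levy[OF \<alpha> l] and e = energy_eq[OF F]
  have l2: "0 < 2 * l" using l by simp
  have sq: "sq_jump F w \<le> E\<^sup>2 * l * (l powr \<alpha> * \<Gamma>\<^sub>\<alpha> / \<alpha>) * exp (- (2 * l) * w)" if w: "0 \<le> w" for w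
  proof -
    have "sq_jump F w \<le> (LBINT z. E\<^sup>2 * l * exp (- (2 * l) * w) * (pos z * (z powr (- 1 - \<alpha>) * (1 - exp (- l * z)))))"
      unfolding sq_jump_def
    proof (rule integral_mono[OF sq_jump_eq(1)[OF F w]])
      show "integrable lborel (\<lambda>z. E\<^sup>2 * l * exp (- (2 * l) * w) * (pos z * (z powr (- 1 - \<alpha>) * (1 - exp (- l * z)))))"
        using L1 by (intro integrable_mult_right) (simp add: has_bochner_integral_iff)
      fix z :: real
      show "pos z * (z powr (- 2 - \<alpha>) * (F (w + z) - F w)\<^sup>2) \<le> E\<^sup>2 * l * exp (- (2 * l) * w) * (pos z * (z powr (- 1 - \<alpha>) * (1 - exp (- l * z))))"
      proof (cases "0 < z")
        case True
        have x: "0 \<le> 1 - exp (- l * z)" "1 - exp (- l * z) \<le> l * z"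
          using l True exp_ge_add_one_self[of "- l * z"] by (auto simp: mult_nonneg_nonneg)
        have "(F (w + z) - F w)\<^sup>2 \<le> (E * exp (- l * w) * (1 - exp (- l * z)))\<^sup>2"
          using power_mono[OF le[OF w True] abs_ge_zero, of 2] by simp
        also have "\<dots> = E\<^sup>2 * exp (- (2 * l) * w) * ((1 - exp (- l * z)) * (1 - exp (- l * z)))"
          by (simp add: power_mult_distrib power2_eq_square exp_add[symmetric])
        \<comment> \<open>One of the two factors 1 - exp(- l z) is given up for l z, which lowers
          the kernel to z^(-1 - \<alpha>), where \<open>stable_levy\<close> applies.\<close>
        also have "\<dots> \<le> E\<^sup>2 * exp (- (2 * l) * w) * ((l * z) * (1 - exp (- l * z)))"
          using x by (intro mult_left_mono mult_right_mono) auto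
        finally have "z powr (- 2 - \<alpha>) * (F (w + z) - F w)\<^sup>2 \<le> z powr (- 2 - \<alpha>) * (E\<^sup>2 * exp (- (2 * l) * w) * ((l * z) * (1 - exp (- l * z))))"
          by (intro mult_left_mono) auto
        also have "\<dots> = E\<^sup>2 * l * exp (- (2 * l) * w) * ((z * z powr (- 2 - \<alpha>)) * (1 - exp (- l * z)))"
          by (simp only: mult_ac)
        also have "z * z powr (- 2 - \<alpha>) = z powr (- 1 - \<alpha>)" using True powr_mult_base[of z "- 2 - \<alpha>"] by simp
        finally show ?thesis using True by simp
      qed simp
    qed
    also have "\<dots> = E\<^sup>2 * l * exp (- (2 * l) * w) * (l powr \<alpha> * \<Gamma>\<^sub>\<alpha> / \<alpha>)"
      using L1 unfolding integral_mult_right_zero by (simp only: has_bochner_integral_iff)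
    finally show ?thesis by (simp only: mult_ac)
  qed
  have 1: "(LBINT w. pos w * (G w * sq_jump F w)) \<le> E\<^sup>2 * l * (l powr \<alpha> * \<Gamma>\<^sub>\<alpha> / \<alpha>) * ((2 * l) powr (\<alpha> - 1) / (\<beta> + (2 * l) powr \<alpha>))"
  proof -
    let ?k = "E\<^sup>2 * l * (l powr \<alpha> * \<Gamma>\<^sub>\<alpha> / \<alpha>)"
    note GL = G_laplace[OF l2, unfolded has_bochner_integral_iff]
    have "(LBINT w. pos w * (G w * sq_jump F w)) \<le> (LBINT w. ?k * (pos w * (G w * exp (- (2 * l) * w))))"
    proof (rule integral_mono[OF e(1) integrable_mult_right[OF GL[THEN conjunct1]]])
      fix w :: real
      show "pos w * (G w * sq_jump F w) \<le> ?k * (pos w * (G w * exp (- (2 * l) * w)))"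
        using mult_left_mono[OF sq[of w] G_nonneg[of w]] by (cases "0 < w") (simp_all add: mult_ac)
    qed
    also have "\<dots> = ?k * ((2 * l) powr (\<alpha> - 1) / (\<beta> + (2 * l) powr \<alpha>))"
      unfolding integral_mult_right_zero by (simp only: GL[THEN conjunct2])
    finally show ?thesis .
  qed
  have 2: "(LBINT z. pos z * (z powr (- 1 - \<alpha>) * (F z - F 0)\<^sup>2)) \<le> E\<^sup>2 * ((2 - 2 powr \<alpha>) * l powr \<alpha> * \<Gamma>\<^sub>\<alpha> / \<alpha>)"
  proof -
    have "has_bochner_integral lborel (\<lambda>z. 2 * (pos z * (z powr (- 1 - \<alpha>) * (1 - exp (- l * z)))) - pos z * (z powr (- 1 - \<alpha>) * (1 - exp (- (2 * l) * z))))
      (2 * (l powr \<alpha> * \<Gamma>\<^sub>\<alpha> / \<alpha>) - (2 * l) powr \<alpha> * \<Gamma>\<^sub>\<alpha> / \<alpha>)"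
      by (intro has_bochner_integral_diff has_bochner_integral_mult_right L1 stable_levy[OF \<alpha> l2])
    moreover have "2 * (i * (p * (1 - exp (- l * z)))) - i * (p * (1 - exp (- (2 * l) * z))) = i * (p * (1 - exp (- l * z))\<^sup>2)" for i p z :: real
    proof -
      have s: "(1 - exp (- l * z))\<^sup>2 = 2 * (1 - exp (- l * z)) - (1 - exp (- (2 * l) * z))"
        using one_minus_exp_squared[of "l * z"] by (simp add: mult.assoc)
      have "2 * (i * (p * x)) - i * (p * y) = i * (p * (2 * x - y))" for x y :: real by (simp add: algebra_simps)
      then show ?thesis unfolding s .
    qed
    moreover have "2 * (l powr \<alpha> * \<Gamma>\<^sub>\<alpha> / \<alpha>) - (2 * l) powr \<alpha> * \<Gamma>\<^sub>\<alpha> / \<alpha> = (2 - 2 powr \<alpha>) * l powr \<alpha> * \<Gamma>\<^sub>\<alpha> / \<alpha>"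
      using l by (simp add: powr_mult diff_divide_distrib left_diff_distrib)
    ultimately have L2: "has_bochner_integral lborel (\<lambda>z. pos z * (z powr (- 1 - \<alpha>) * (1 - exp (- l * z))\<^sup>2)) ((2 - 2 powr \<alpha>) * l powr \<alpha> * \<Gamma>\<^sub>\<alpha> / \<alpha>)"
      by simp
    have "(LBINT z. pos z * (z powr (- 1 - \<alpha>) * (F z - F 0)\<^sup>2)) \<le> (LBINT z. E\<^sup>2 * (pos z * (z powr (- 1 - \<alpha>) * (1 - exp (- l * z))\<^sup>2)))"
    proof (rule integral_mono[OF e(2)])
      show "integrable lborel (\<lambda>z. E\<^sup>2 * (pos z * (z powr (- 1 - \<alpha>) * (1 - exp (- l * z))\<^sup>2)))"
        using L2 by (intro integrable_mult_right) (simp add: has_bochner_integral_iff)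
      fix z :: real
      show "pos z * (z powr (- 1 - \<alpha>) * (F z - F 0)\<^sup>2) \<le> E\<^sup>2 * (pos z * (z powr (- 1 - \<alpha>) * (1 - exp (- l * z))\<^sup>2))"
      proof (cases "0 < z")
        case True
        have "(F z - F 0)\<^sup>2 \<le> (E * (1 - exp (- l * z)))\<^sup>2"
          using power_mono[OF le[of 0 z] abs_ge_zero, of 2] True by simp
        then have "z powr (- 1 - \<alpha>) * (F z - F 0)\<^sup>2 \<le> z powr (- 1 - \<alpha>) * (E * (1 - exp (- l * z)))\<^sup>2" by (intro mult_left_mono) auto
        then show ?thesis using True by (simp add: power_mult_distrib mult_ac)
      qed simp
    qed
    then show ?thesis using L2 unfolding integral_mult_right_zero by (simp only: has_bochner_integral_iff)
  qed
  have p1: "l * (2 * l) powr (\<alpha> - 1) = 2 powr (\<alpha> - 1) * l powr \<alpha>"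
    using l powr_mult_base[of l "\<alpha> - 1"] by (simp add: powr_mult mult_ac)
  have p2: "(2 :: real) powr (\<alpha> - 1) \<le> 1" using \<alpha> powr_mono[of "\<alpha> - 1" 0 "2 :: real"] by simp
  \<comment> \<open>l (2 l)^(\<alpha> - 1) is of order l^\<alpha>, which produces the square;
    2^(\<alpha> - 1) \<le> 1 and \<alpha> + 1 \<le> 2 give the constant.\<close>
  have q: "l powr \<alpha> * (l * (2 * l) powr (\<alpha> - 1)) * (\<alpha> + 1) / (\<beta> + (2 * l) powr \<alpha>) \<le> 2 / \<beta> * (l powr \<alpha>)\<^sup>2"
  proof -
    have "l powr \<alpha> * (l * (2 * l) powr (\<alpha> - 1)) * (\<alpha> + 1) = (2 powr (\<alpha> - 1) * (\<alpha> + 1)) * (l powr \<alpha>)\<^sup>2"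
      unfolding p1 by (simp only: power2_eq_square mult_ac)
    also have "\<dots> \<le> (1 * 2) * (l powr \<alpha>)\<^sup>2" using p2 \<alpha> by (intro mult_right_mono mult_mono) auto
    finally have "l powr \<alpha> * (l * (2 * l) powr (\<alpha> - 1)) * (\<alpha> + 1) / (\<beta> + (2 * l) powr \<alpha>) \<le> (1 * 2) * (l powr \<alpha>)\<^sup>2 / \<beta>"
      using \<beta> by (intro frac_le) auto
    then show ?thesis by simp
  qed
  have alg1: "\<alpha> * ((\<alpha> + 1) / g) * (e2 * l * (x * g / \<alpha>) * (y / d)) = e2 * (x * (l * y) * (\<alpha> + 1) / d)" if "g \<noteq> 0" for e2 x y d g :: real
    using that \<alpha> by simp
  have alg2: "\<alpha> / g * (e2 * (k * g / \<alpha>)) = e2 * k" if "g \<noteq> 0" for g e2 k :: real using that \<alpha> by simp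
  have "energy F F' \<le> 1 / 2 * (\<alpha> * ((\<alpha> + 1) / \<Gamma>\<^sub>\<alpha>) * (E\<^sup>2 * l * (l powr \<alpha> * \<Gamma>\<^sub>\<alpha> / \<alpha>) * ((2 * l) powr (\<alpha> - 1) / (\<beta> + (2 * l) powr \<alpha>)))
      + \<alpha> / \<Gamma>\<^sub>\<alpha> * (E\<^sup>2 * ((2 - 2 powr \<alpha>) * l powr \<alpha> * \<Gamma>\<^sub>\<alpha> / \<alpha>)))"
    unfolding e(3) using 1 2 \<alpha> \<Gamma>_pos by (intro mult_left_mono add_mono) auto
  also have "\<dots> = 1 / 2 * (E\<^sup>2 * (l powr \<alpha> * (l * (2 * l) powr (\<alpha> - 1)) * (\<alpha> + 1) / (\<beta> + (2 * l) powr \<alpha>)) + E\<^sup>2 * ((2 - 2 powr \<alpha>) * l powr \<alpha>))"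
    using \<Gamma>_pos by (simp only: alg1[OF less_imp_neq[symmetric]] alg2[OF less_imp_neq[symmetric]])
  also have "\<dots> \<le> 1 / 2 * (E\<^sup>2 * (2 / \<beta> * (l powr \<alpha>)\<^sup>2) + E\<^sup>2 * ((2 - 2 powr \<alpha>) * l powr \<alpha>))"
    using q by (intro mult_left_mono add_mono order_refl) auto
  also have "\<dots> = E\<^sup>2 / 2 * ((2 - 2 powr \<alpha>) * l powr \<alpha> + 2 / \<beta> * (l powr \<alpha>)\<^sup>2)" by (simp add: distrib_left)
  finally show ?thesis .
qed

end

lemma has_real_derivative_max_power:
  "((\<lambda>u :: real. max 0 u ^ Suc (Suc k)) has_real_derivative real (Suc (Suc k)) * max 0 u ^ Suc k) (at u)"
proof -
  consider "0 < u" | "u < 0" | "u = 0" by linarith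
  then show ?thesis
  proof cases
    case 1
    have "((\<lambda>u. u ^ Suc (Suc k)) has_real_derivative real (Suc (Suc k)) * u ^ Suc k) (at u)"
      using DERIV_pow[of "Suc (Suc k)" u] by simp
    then have "((\<lambda>u. max 0 u ^ Suc (Suc k)) has_real_derivative real (Suc (Suc k)) * u ^ Suc k) (at u)"
      by (rule has_field_derivative_transform_within_open[of _ _ _ "{0<..}"]) (use 1 in auto)
    then show ?thesis using 1 by simp
  next
    case 2
    have "((\<lambda>u. max 0 u ^ Suc (Suc k)) has_real_derivative 0) (at u)"
      by (rule has_field_derivative_transform_within_open[OF DERIV_const[where k = "0 :: real"], where S = "{..<0}"]) (use 2 in auto)
    then show ?thesis using 2 by simp
  next
    case 3
    have "((\<lambda>u :: real. max 0 u ^ Suc (Suc k)) has_real_derivative 0) (at 0)"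
      unfolding CARAT_DERIV
    proof (intro exI[of _ "\<lambda>u. max 0 u ^ Suc k"] conjI allI)
      show "isCont (\<lambda>u :: real. max 0 u ^ Suc k) 0" by (intro continuous_intros)
    qed (auto simp: max_def)
    then show ?thesis using 3 by simp
  qed
qed

text \<open>A twice continuously differentiable, compactly supported approximation of \<open>exp (- t)\<close> whose
  increments are dominated by those of \<open>exp (- t)\<close>.\<close>

definition cut_exp :: "real \<Rightarrow> real \<Rightarrow> real" where
  "cut_exp \<delta> t = (max 0 (exp (- t / 3) - \<delta>)) ^ 3"

text \<open>The third power is what makes the truncation twice continuously differentiable where
  exp(- t / 3) meets \<delta>; the 3 in the exponent compensates it.\<close>

lemma cut_exp_derivatives:
  "(cut_exp \<delta> has_real_derivative - exp (- t / 3) * (max 0 (exp (- t / 3) - \<delta>))\<^sup>2) (at t)"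
  "((\<lambda>t. - exp (- t / 3) * (max 0 (exp (- t / 3) - \<delta>))\<^sup>2) has_real_derivative
     exp (- t / 3) / 3 * (max 0 (exp (- t / 3) - \<delta>))\<^sup>2 + 2 / 3 * (exp (- t / 3))\<^sup>2 * max 0 (exp (- t / 3) - \<delta>)) (at t)"
proof -
  have e: "((\<lambda>t. exp (- t / 3) - \<delta>) has_real_derivative - exp (- t / 3) / 3) (at t)"
    by (auto intro!: derivative_eq_intros)
  have e': "((\<lambda>t. - exp (- t / 3)) has_real_derivative exp (- t / 3) / 3) (at t)"
    by (auto intro!: derivative_eq_intros)
  have m3: "((\<lambda>u :: real. max 0 u ^ 3) has_real_derivative 3 * (max 0 u)\<^sup>2) (at u)" for u
    using has_real_derivative_max_power[of 1 u] by (simp add: eval_nat_numeral)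
  have m2: "((\<lambda>u :: real. (max 0 u)\<^sup>2) has_real_derivative 2 * max 0 u) (at u)" for u
    using has_real_derivative_max_power[of 0 u] by (simp add: eval_nat_numeral)
  show "(cut_exp \<delta> has_real_derivative - exp (- t / 3) * (max 0 (exp (- t / 3) - \<delta>))\<^sup>2) (at t)"
    unfolding cut_exp_def[abs_def] by (rule DERIV_cong, rule DERIV_chain2[OF m3 e]) simp
  show "((\<lambda>t. - exp (- t / 3) * (max 0 (exp (- t / 3) - \<delta>))\<^sup>2) has_real_derivative
     exp (- t / 3) / 3 * (max 0 (exp (- t / 3) - \<delta>))\<^sup>2 + 2 / 3 * (exp (- t / 3))\<^sup>2 * max 0 (exp (- t / 3) - \<delta>)) (at t)"
    by (rule DERIV_cong, rule DERIV_mult[OF e' DERIV_chain2[OF m2 e]]) (simp add: power2_eq_square)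
qed

text \<open>With x = exp(- t / 3) and p = max 0 (x - \<delta>), and y, q likewise for s, compare p^3
  - q^3 with x^3 - y^3 factor by factor in (p - q) (p^2 + p q + q^2).\<close>

lemma cut_exp_increment:
  assumes "0 \<le> \<delta>" "t \<le> s"
  shows "0 \<le> cut_exp \<delta> t - cut_exp \<delta> s" "cut_exp \<delta> t - cut_exp \<delta> s \<le> exp (- t) - exp (- s)"
proof -
  have cube: "p ^ 3 - q ^ 3 = (p - q) * (p\<^sup>2 + p * q + q\<^sup>2)" for p q :: real
    by (simp add: power2_eq_square power3_eq_cube algebra_simps)
  define x where "x = exp (- t / 3)"
  define y where "y = exp (- s / 3)"
  have yx: "0 < y" "y \<le> x" using assms by (auto simp: x_def y_def)
  have e: "exp (- t) = x ^ 3" "exp (- s) = y ^ 3" by (simp_all add: x_def y_def exp_of_nat_mult[symmetric])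
  define p where "p = max 0 (x - \<delta>)"
  define q where "q = max 0 (y - \<delta>)"
  have pq: "0 \<le> q" "q \<le> p" "p \<le> x" "q \<le> y" "p - q \<le> x - y" using yx assms(1) by (auto simp: p_def q_def max_def)
  have c: "cut_exp \<delta> t = p ^ 3" "cut_exp \<delta> s = q ^ 3" by (simp_all add: cut_exp_def p_def q_def x_def y_def)
  show "0 \<le> cut_exp \<delta> t - cut_exp \<delta> s" unfolding c using pq by (simp add: power_mono)
  show "cut_exp \<delta> t - cut_exp \<delta> s \<le> exp (- t) - exp (- s)"
    unfolding c e cube using pq yx by (intro mult_mono add_mono power_mono) auto
qed

lemma cut_exp_bounds: "0 \<le> \<delta> \<Longrightarrow> 0 \<le> t \<Longrightarrow> 0 \<le> cut_exp \<delta> t \<and> cut_exp \<delta> t \<le> 1"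
proof -
  assume "0 \<le> \<delta>" "0 \<le> t"
  moreover from this have "exp (- t / 3) \<le> 1" by simp
  ultimately have "max 0 (exp (- t / 3) - \<delta>) \<le> 1" by linarith
  then show ?thesis by (auto simp: cut_exp_def intro!: power_le_one)
qed

lemma cut_exp_zero: "0 < \<delta> \<Longrightarrow> - 3 * ln \<delta> \<le> t \<Longrightarrow> cut_exp \<delta> t = 0"
proof -
  assume "0 < \<delta>" "- 3 * ln \<delta> \<le> t"
  then have "exp (- t / 3) \<le> exp (ln \<delta>)" by (subst exp_le_cancel_iff) simp
  then show ?thesis using \<open>0 < \<delta>\<close> by (simp add: cut_exp_def)
qed

text \<open>The shift by 2 keeps every level strictly below 1, as \<open>cut_exp_energy\<close>
  demands.\<close>

lemma cut_exp_tendsto: "(\<lambda>k. cut_exp (1 / real (k + 2)) t) \<longlonglongrightarrow> exp (- t)"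
proof -
  have "(\<lambda>k. 1 / real (k + 2)) \<longlonglongrightarrow> 0"
    using LIMSEQ_ignore_initial_segment[OF lim_const_over_n[of 1], of 2] by simp
  then have "(\<lambda>k. cut_exp (1 / real (k + 2)) t) \<longlonglongrightarrow> (max 0 (exp (- t / 3) - 0)) ^ 3"
    unfolding cut_exp_def by (intro tendsto_intros)
  moreover have "(max 0 (exp (- t / 3) - 0)) ^ 3 = exp (- t)" by (simp add: exp_of_nat_mult[symmetric])
  ultimately show ?thesis by simp
qed

lemma test_function_profile:
  fixes g :: "'e::topological_space \<Rightarrow> real"
  assumes d: "\<And>t. (p has_real_derivative p' t) (at t)" "\<And>t. (p' has_real_derivative p'' t) (at t)"
    and c: "continuous_on UNIV p''" and R: "0 < R" "\<And>t. R \<le> t \<Longrightarrow> p t = 0" and g: "g \<in> Cpp"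
  shows "(\<lambda>X. p (\<integral>r. g r \<partial>X)) \<in> test_functions"
  unfolding test_functions_def
proof (intro CollectI exI[of _ 1] exI[of _ "\<lambda>x. p (x 0)"] exI[of _ "\<lambda>_. g"] conjI allI impI ballI)
  have cp: "continuous_on UNIV p" "continuous_on UNIV p'"
    using DERIV_isCont[OF d(1)] DERIV_isCont[OF d(2)] by (auto intro!: continuous_at_imp_continuous_on)
  have co: "continuous_on (orthant 1) (\<lambda>x. u (x 0))" if "continuous_on UNIV u" for u :: "real \<Rightarrow> real"
    by (rule continuous_on_compose2[OF that continuous_on_subset[OF continuous_on_product_coordinates]]) auto
  have po: "partial_on_orthant 1 0 (\<lambda>x. u (x 0)) (\<lambda>x. u' (x 0))" if "\<And>t. (u has_real_derivative u' t) (at t)" for u u'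
    unfolding partial_on_orthant_def using has_field_derivative_at_within[OF that] by simp
  show "C2_orthant 1 (\<lambda>x. p (x 0))"
    unfolding C2_orthant_def
    by (intro conjI exI[of _ "\<lambda>_ x. p' (x 0)"] exI[of _ "\<lambda>_ _ x. p'' (x 0)"] co cp c allI impI) (simp_all add: po[unfolded One_nat_def] d co[unfolded One_nat_def] cp c)
  let ?K = "{x. (\<forall>i<1 :: nat. 0 \<le> x i \<and> x i \<le> R) \<and> (\<forall>i\<ge>1. x i = (0::real))}"
  have K: "compact ?K" by (rule compact_box[OF R(1)])
  have "closure {x \<in> orthant 1. p (x 0) \<noteq> 0} \<subseteq> ?K"
  proof (intro closure_minimal compact_imp_closed K subsetI)
    fix x assume x: "x \<in> {x \<in> orthant 1. p (x 0) \<noteq> 0}"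
    then have "\<not> R \<le> x 0" using R(2) by auto
    then show "x \<in> ?K" using x by (auto simp: orthant_def)
  qed
  then have "?K \<inter> closure {x \<in> orthant 1. p (x 0) \<noteq> 0} = closure {x \<in> orthant 1. p (x 0) \<noteq> 0}" by (rule Int_absorb1)
  with compact_Int_closed[OF K closed_closure[of "{x \<in> orthant 1. p (x 0) \<noteq> 0}"]]
  show "compact_support_orthant 1 (\<lambda>x. p (x 0))"
    unfolding compact_support_orthant_def by (simp only:)
qed (use g in auto)

context cir
begin

lemma K_nonneg: "cnn f \<Longrightarrow> 0 \<le> K f f"
  by (rule has_bochner_integral_nonneg[OF \<nu>_K]) simp_all

text \<open>With t = (a / b) f^\<alpha>, the integrand of K f f is 1 / a times 2 ln(1 + t) - ln(1 +
  2^\<alpha> t), and t - t^2 \<le> ln(1 + t) \<le> t bounds this below by (2 - 2^\<alpha>) t - 2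
  t^2. The cruder upper bound serves to control (K f f)^2.\<close>

lemma K_bounds:
  assumes f: "cnn f" and c: "continuous_on UNIV (\<lambda>r. f r powr \<alpha>)"
  shows "K f f \<le> 2 * (\<integral>r. f r powr \<alpha> / b r \<partial>m)"
    and "(2 - 2 powr \<alpha>) * (\<integral>r. f r powr \<alpha> / b r \<partial>m) - (\<integral>r. 2 * a r / (b r)\<^sup>2 * (f r powr \<alpha>)\<^sup>2 \<partial>m) \<le> K f f"
proof -
  have ff: "cnn (\<lambda>r. f r + f r)" by (rule cnn_add[OF f f])
  let ?y = "\<lambda>r. f r powr \<alpha>"
  have bn: "b r \<noteq> 0" "a r \<noteq> 0" for r using b_pos[of r] a_pos[of r] by auto
  have i1: "integrable m (\<lambda>r. ?y r / b r)"
    using bn by (intro continuous_integrable m_fin continuous_on_divide c b_cont) auto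
  have i2: "integrable m (\<lambda>r. 2 * a r / (b r)\<^sup>2 * (?y r)\<^sup>2)"
    using bn by (intro continuous_integrable m_fin continuous_intros c b_cont a_cont) auto
  note I = \<psi>_integrable[OF f, unfolded has_bochner_integral_iff] \<psi>_integrable[OF ff, unfolded has_bochner_integral_iff]
  have two: "(f r + f r) powr \<alpha> = 2 powr \<alpha> * ?y r" for r
    using powr_mult[of 2 "f r" \<alpha>] cnn_nonneg[OF f, of r] by simp
  let ?l = "\<lambda>r. inverse (a r) * ln (1 + a r * inverse (b r) * ?y r)"
  let ?l2 = "\<lambda>r. inverse (a r) * ln (1 + a r * inverse (b r) * (f r + f r) powr \<alpha>)"
  have t0: "0 \<le> a r * inverse (b r) * ?y r" "0 \<le> a r * inverse (b r) * (f r + f r) powr \<alpha>" for r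
    using a_pos[of r] b_pos[of r] by auto
  have up: "?l r \<le> ?y r / b r" for r
  proof -
    have "?l r \<le> inverse (a r) * (a r * inverse (b r) * ?y r)"
      using a_pos[of r] by (intro mult_left_mono ln_add_one_self_le_self t0) auto
    also have "inverse (a r) * (a r * inverse (b r) * ?y r) = ?y r / b r" using bn[of r] by (simp add: field_simps)
    finally show ?thesis .
  qed
  have "\<psi> f \<le> (\<integral>r. ?y r / b r \<partial>m)"
    using I(1) i1 up by (auto simp: \<psi>_def intro!: integral_mono)
  moreover have "0 \<le> \<psi> (\<lambda>r. f r + f r)"
    unfolding \<psi>_def using a_pos t0 by (intro Bochner_Integration.integral_nonneg mult_nonneg_nonneg ln_ge_zero) (auto simp: less_imp_le)
  ultimately show "K f f \<le> 2 * (\<integral>r. ?y r / b r \<partial>m)" by (simp add: K_def)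
  have low: "(2 - 2 powr \<alpha>) * (?y r / b r) - 2 * a r / (b r)\<^sup>2 * (?y r)\<^sup>2 \<le> 2 * ?l r - ?l2 r" for r
  proof -
    define t where "t = a r * inverse (b r) * ?y r"
    have t: "0 \<le> t" using t0 by (simp add: t_def)
    have "t - t\<^sup>2 \<le> ln (1 + t)"
    proof (cases "t \<le> 1")
      case True
      then show ?thesis using ln_one_plus_pos_lower_bound[OF t] by simp
    next
      case False
      then have "t * 1 \<le> t * t" by (intro mult_left_mono) auto
      moreover have "0 \<le> ln (1 + t)" using t by simp
      ultimately show ?thesis unfolding power2_eq_square by linarith
    qed
    moreover have "ln (1 + 2 powr \<alpha> * t) \<le> 2 powr \<alpha> * t" using t by (intro ln_add_one_self_le_self) simp
    ultimately have "2 * (t - t\<^sup>2) - 2 powr \<alpha> * t \<le> 2 * ln (1 + t) - ln (1 + 2 powr \<alpha> * t)"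
      by (intro diff_mono mult_left_mono) simp_all
    then have "inverse (a r) * (2 * (t - t\<^sup>2) - 2 powr \<alpha> * t) \<le> inverse (a r) * (2 * ln (1 + t) - ln (1 + 2 powr \<alpha> * t))"
      using a_pos[of r] by (intro mult_left_mono) auto
    moreover have "a r * inverse (b r) * (f r + f r) powr \<alpha> = 2 powr \<alpha> * t" unfolding two t_def by simp
    moreover have "inverse A * (2 * (A * inverse B * y - (A * inverse B * y)\<^sup>2) - k * (A * inverse B * y)) = (2 - k) * (y / B) - 2 * A / B\<^sup>2 * y\<^sup>2"
      if "A \<noteq> 0" "B \<noteq> 0" for A B y k :: real
      using that by (simp add: field_simps power2_eq_square)
    note this[OF bn(2)[of r] bn(1)[of r], of "?y r" "2 powr \<alpha>", folded t_def]
    ultimately show ?thesis by (simp add: t_def[symmetric] right_diff_distrib)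
  qed
  have "(\<integral>r. (2 - 2 powr \<alpha>) * (?y r / b r) - 2 * a r / (b r)\<^sup>2 * (?y r)\<^sup>2 \<partial>m) \<le> (\<integral>r. 2 * ?l r - ?l2 r \<partial>m)"
    using I i1 i2 low by (intro integral_mono Bochner_Integration.integrable_diff integrable_mult_right) auto
  also have "\<dots> = K f f"
    using I by (subst Bochner_Integration.integral_diff) (auto simp: K_def)
  finally show "(2 - 2 powr \<alpha>) * (\<integral>r. ?y r / b r \<partial>m) - (\<integral>r. 2 * a r / (b r)\<^sup>2 * (?y r)\<^sup>2 \<partial>m) \<le> K f f"
    using i1 i2 by (subst (asm) Bochner_Integration.integral_diff) (auto simp del: times_divide_eq_right times_divide_eq_left)
qed

text \<open>The profile \<open>f\<close> with \<open>f\<^sup>\<alpha> = \<epsilon> (\<tau> + max 0 (c\<^sub>1 - b))\<close> concentrates, as \<open>\<epsilon>\<close> and \<open>\<tau>\<close> become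
  small, on the region where \<open>b\<close> is below \<open>c\<^sub>1\<close>.\<close>

lemma upper_profile:
  assumes c1: "\<not> (AE r in m. c1 \<le> b r)" and c12: "c1 < c2"
  obtains f where "f \<in> Cpp" "continuous_on UNIV (\<lambda>r. f r powr \<alpha>)"
    "(\<integral>r. (2 - 2 powr \<alpha>) * f r powr \<alpha> + 2 / \<beta> r * (f r powr \<alpha>)\<^sup>2 \<partial>m) < c2 * (1 - exp (- K f f))"
proof -
  have c1pos: "0 < c1"
  proof (rule ccontr)
    assume "\<not> 0 < c1"
    then have "c1 \<le> b r" for r using b_pos[of r] by linarith
    then show False using c1 by simp
  qed
  have bn: "b r \<noteq> 0" for r using b_pos[of r] by auto
  let ?M = "measure m (space m)"
  \<comment> \<open>Positive precisely because c1 is not an almost sure lower bound of b.\<close>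
  define P where "P = (\<integral>r. max 0 (c1 - b r) / b r \<partial>m)"
  have iP: "integrable m (\<lambda>r. max 0 (c1 - b r) / b r)"
    using bn by (intro continuous_integrable m_fin continuous_intros b_cont) auto
  have nnP: "0 \<le> max 0 (c1 - b r) / b r" for r using b_pos[of r] by simp
  have P: "0 < P"
  proof -
    have "P \<noteq> 0"
    proof
      assume "P = 0"
      then have "AE r in m. max 0 (c1 - b r) / b r = 0"
        using integral_nonneg_eq_0_iff_AE[OF iP] nnP by (simp add: P_def)
      then have "AE r in m. c1 \<le> b r" using bn by (auto simp: max_def split: if_splits elim!: eventually_mono)
      then show False using c1 by simp
    qed
    moreover have "0 \<le> P" unfolding P_def by (intro Bochner_Integration.integral_nonneg nnP)
    ultimately show ?thesis by simp
  qed
  \<comment> \<open>The floor \<tau> makes the profile uniformly positive; it is small enough that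
    \<tau> times the mass of m stays below the gain (c2 - c1) P.\<close>
  define \<tau> where "\<tau> = (c2 - c1) * P / (2 * (?M + 1))"
  have M1: "0 < ?M + 1" by (simp add: add_nonneg_pos)
  have \<tau>: "0 < \<tau>" using P c12 M1 by (simp add: \<tau>_def)
  have \<tau>M: "\<tau> * ?M < (c2 - c1) * P"
  proof -
    have "\<tau> * ?M < \<tau> * (2 * (?M + 1))" using \<tau> measure_nonneg[of m "space m"] by (intro mult_strict_left_mono) (simp_all add: add_nonneg_pos)
    also have "\<dots> = (c2 - c1) * P" using M1 by (simp add: \<tau>_def)
    finally show ?thesis .
  qed
  define h where "h r = \<tau> + max 0 (c1 - b r)" for r
  have h: "0 < h r" "\<tau> \<le> h r" for r using \<tau> by (auto simp: h_def)
  have ch: "continuous_on UNIV h" unfolding h_def by (intro continuous_intros b_cont)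
  define u where "u = (\<integral>r. h r \<partial>m)"
  define p where "p = (\<integral>r. h r / b r \<partial>m)"
  have ih: "integrable m h" by (rule continuous_integrable[OF ch m_fin])
  have ip: "integrable m (\<lambda>r. h r / b r)"
    using bn by (intro continuous_integrable m_fin continuous_on_divide ch b_cont) auto
  \<comment> \<open>The desired inequality to first order: with f^\<alpha> = \<epsilon> h and up to
    the common factor (2 - 2^\<alpha>) \<epsilon>, the energy side is u and the variance side c2
    p.\<close>
  have d: "0 < c2 * p - u"
  proof -
    have "- \<tau> + (c2 - c1) * (max 0 (c1 - b r) / b r) \<le> c2 * (h r / b r) - h r" for r
    proof (cases "b r < c1")
      case True
      have "c2 * (h r / b r) - h r = (c2 - b r) * (h r / b r)" using bn[of r] by (simp add: field_simps)
      moreover have "(c2 - c1) * ((c1 - b r) / b r) \<le> (c2 - b r) * (h r / b r)"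
        using True c12 b_pos[of r] \<tau> by (intro mult_mono divide_right_mono) (auto simp: h_def)
      ultimately show ?thesis using True \<tau> by simp
    next
      case False
      then have "h r = \<tau>" by (simp add: h_def)
      moreover have "0 \<le> c2 * (\<tau> / b r)" using c1pos c12 \<tau> b_pos[of r] by simp
      moreover have "max 0 (c1 - b r) = 0" using False by simp
      ultimately show ?thesis by simp
    qed
    then have "(\<integral>r. - \<tau> + (c2 - c1) * (max 0 (c1 - b r) / b r) \<partial>m) \<le> (\<integral>r. c2 * (h r / b r) - h r \<partial>m)"
      using iP ip ih by (intro integral_mono Bochner_Integration.integrable_add Bochner_Integration.integrable_diff integrable_mult_right) auto
    also have "\<dots> = c2 * p - u"
      using ip ih by (subst Bochner_Integration.integral_diff) (auto simp: p_def u_def simp del: times_divide_eq_right)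
    also have "(\<integral>r. - \<tau> + (c2 - c1) * (max 0 (c1 - b r) / b r) \<partial>m) = - \<tau> * ?M + (c2 - c1) * P"
      using iP by (subst Bochner_Integration.integral_add) (auto simp: P_def simp del: times_divide_eq_right)
    finally show ?thesis using \<tau>M by simp
  qed
  define \<kappa> where "\<kappa> = 2 - 2 powr \<alpha>"
  have \<kappa>: "0 < \<kappa>" using \<alpha> powr_less_mono[of \<alpha> 1 2] by (simp add: \<kappa>_def)
  define C1 where "C1 = (\<integral>r. 2 / \<beta> r * (h r)\<^sup>2 \<partial>m)"
  define C2 where "C2 = (\<integral>r. 2 * a r / (b r)\<^sup>2 * (h r)\<^sup>2 \<partial>m)"
  have i1: "integrable m (\<lambda>r. 2 / \<beta> r * (h r)\<^sup>2)"
    unfolding \<beta>_def using bn a_pos by (intro continuous_integrable m_fin continuous_intros ch a_cont b_cont) (auto simp: less_imp_neq[symmetric])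
  have C0: "0 \<le> C1" "0 \<le> C2" "0 \<le> p"
    unfolding C1_def C2_def p_def using \<beta>_pos a_pos b_pos h
    by (auto intro!: Bochner_Integration.integral_nonneg mult_nonneg_nonneg divide_nonneg_nonneg simp: less_imp_le)
  \<comment> \<open>All second-order errors: \<open>C1\<close> from the energy, \<open>C2\<close>
    from the lower bound of K, and 4 p^2 from exp(- K) \<le> 1 - K + K^2 with K \<le> 2 \<epsilon>
    p. Then \<epsilon> is taken so small that \<epsilon> \<open>C3\<close> stays below the
    first-order gain.\<close>
  define C3 where "C3 = C1 + c2 * (C2 + 4 * p\<^sup>2)"
  have C3: "0 \<le> C3" using C0 c1pos c12 by (simp add: C3_def)
  define \<epsilon> where "\<epsilon> = \<kappa> * (c2 * p - u) / (2 * (C3 + 1))"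
  have \<epsilon>: "0 < \<epsilon>" using \<kappa> d C3 by (simp add: \<epsilon>_def)
  have \<epsilon>C: "\<epsilon> * C3 < \<kappa> * (c2 * p - u)"
  proof -
    have "\<epsilon> * C3 < \<epsilon> * (2 * (C3 + 1))" using \<epsilon> C3 by (intro mult_strict_left_mono) simp_all
    also have "\<dots> = \<kappa> * (c2 * p - u)" using C3 by (simp add: \<epsilon>_def)
    finally show ?thesis .
  qed
  define f where "f r = (\<epsilon> * h r) powr (1 / \<alpha>)" for r
  have fp: "f r powr \<alpha> = \<epsilon> * h r" for r using \<alpha> \<epsilon> h[of r] by (simp add: f_def powr_powr)
  have cf: "continuous_on UNIV f"
    unfolding f_def using \<epsilon> h \<alpha> by (intro continuous_on_powr continuous_intros ch) (auto simp: less_imp_neq[symmetric])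
  have f: "f \<in> Cpp" unfolding Cpp_def
  proof (intro CollectI conjI cf exI[of _ "(\<epsilon> * \<tau>) powr (1 / \<alpha>)"] allI)
    show "0 < (\<epsilon> * \<tau>) powr (1 / \<alpha>)" using \<epsilon> \<tau> by simp
    show "(\<epsilon> * \<tau>) powr (1 / \<alpha>) \<le> f r" for r
      unfolding f_def using \<epsilon> \<tau> h(2)[of r] \<alpha> by (intro powr_mono2 mult_left_mono) auto
  qed
  have cfp: "continuous_on UNIV (\<lambda>r. f r powr \<alpha>)" unfolding fp by (intro continuous_intros ch)
  note cnn = Cpp_cnn[OF f]
  have pK: "(\<integral>r. f r powr \<alpha> / b r \<partial>m) = \<epsilon> * p"
    unfolding fp p_def by (subst integral_mult_right_zero[symmetric]) simp
  have qK: "(\<integral>r. 2 * a r / (b r)\<^sup>2 * (f r powr \<alpha>)\<^sup>2 \<partial>m) = \<epsilon>\<^sup>2 * C2"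
    unfolding fp C2_def by (subst integral_mult_right_zero[symmetric]) (simp add: power_mult_distrib mult.left_commute)
  have Kl: "\<kappa> * (\<epsilon> * p) - \<epsilon>\<^sup>2 * C2 \<le> K f f" and Ku: "K f f \<le> 2 * (\<epsilon> * p)"
    using K_bounds[OF cnn cfp] unfolding pK qK \<kappa>_def by simp_all
  have A: "(\<integral>r. (2 - 2 powr \<alpha>) * f r powr \<alpha> + 2 / \<beta> r * (f r powr \<alpha>)\<^sup>2 \<partial>m) = \<kappa> * \<epsilon> * u + \<epsilon>\<^sup>2 * C1"
  proof -
    have "(2 - 2 powr \<alpha>) * f r powr \<alpha> + 2 / \<beta> r * (f r powr \<alpha>)\<^sup>2 = \<kappa> * \<epsilon> * h r + \<epsilon>\<^sup>2 * (2 / \<beta> r * (h r)\<^sup>2)" for r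
      unfolding fp \<kappa>_def by (simp add: power_mult_distrib mult_ac)
    then have "(\<integral>r. (2 - 2 powr \<alpha>) * f r powr \<alpha> + 2 / \<beta> r * (f r powr \<alpha>)\<^sup>2 \<partial>m) = (\<integral>r. \<kappa> * \<epsilon> * h r + \<epsilon>\<^sup>2 * (2 / \<beta> r * (h r)\<^sup>2) \<partial>m)" by simp
    also have "\<dots> = \<kappa> * \<epsilon> * u + \<epsilon>\<^sup>2 * C1"
      using ih i1 unfolding u_def C1_def integral_mult_right_zero[symmetric]
      by (intro Bochner_Integration.integral_add integrable_mult_right)
    finally show ?thesis .
  qed
  have K0: "0 \<le> K f f" by (rule K_nonneg[OF cnn])
  have "exp (- K f f) \<le> 1 - K f f + (K f f)\<^sup>2"
  proof -
    have "(1 - K f f + (K f f)\<^sup>2) * (1 + K f f) = 1 + (K f f) ^ 3"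
      by (simp add: power2_eq_square power3_eq_cube algebra_simps)
    moreover have "0 \<le> (K f f) ^ 3" using K0 by simp
    ultimately have "1 / (1 + K f f) \<le> 1 - K f f + (K f f)\<^sup>2" using K0 by (simp add: pos_divide_le_eq)
    moreover have "exp (- K f f) \<le> 1 / (1 + K f f)"
      unfolding exp_minus inverse_eq_divide using K0 by (intro frac_le exp_ge_add_one_self) auto
    ultimately show ?thesis by linarith
  qed
  moreover have "(K f f)\<^sup>2 \<le> (2 * (\<epsilon> * p))\<^sup>2" using Ku K0 by (intro power_mono)
  ultimately have "\<kappa> * (\<epsilon> * p) - \<epsilon>\<^sup>2 * C2 - (2 * (\<epsilon> * p))\<^sup>2 \<le> 1 - exp (- K f f)" using Kl by linarith
  then have "c2 * (\<kappa> * (\<epsilon> * p) - \<epsilon>\<^sup>2 * C2 - (2 * (\<epsilon> * p))\<^sup>2) \<le> c2 * (1 - exp (- K f f))"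
    using c1pos c12 by (intro mult_left_mono) auto
  moreover have "c2 * (\<kappa> * (\<epsilon> * p) - \<epsilon>\<^sup>2 * C2 - (2 * (\<epsilon> * p))\<^sup>2) - (\<kappa> * \<epsilon> * u + \<epsilon>\<^sup>2 * C1) = \<epsilon> * (\<kappa> * (c2 * p - u) - \<epsilon> * C3)"
    by (simp add: C3_def power2_eq_square algebra_simps)
  moreover have "0 < \<epsilon> * (\<kappa> * (c2 * p - u) - \<epsilon> * C3)" using \<epsilon> \<epsilon>C by simp
  ultimately have "(\<integral>r. (2 - 2 powr \<alpha>) * f r powr \<alpha> + 2 / \<beta> r * (f r powr \<alpha>)\<^sup>2 \<partial>m) < c2 * (1 - exp (- K f f))"
    unfolding A by linarith
  then show ?thesis by (rule that[OF f cfp])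
qed

text \<open>\<open>energy_le\<close> at each site with l = f r and E = exp(- <X, f>); then E^2 =
  exp(- <X, 2 f>), whose \<open>Q\<close>-mean is the Laplace functional at 2 f.\<close>

lemma cut_exp_energy:
  assumes f: "f \<in> Cpp" and c: "continuous_on UNIV (\<lambda>r. f r powr \<alpha>)" and \<delta>: "0 < \<delta>" "\<delta> < 1"
  defines "\<Psi> \<equiv> \<lambda>X. cut_exp \<delta> (pairing X f)"
  shows "\<Psi> \<in> test_functions"
    and "- (\<integral>X. cir_op \<alpha> a b m \<Psi> X * \<Psi> X \<partial>Q)
      \<le> exp (- \<psi> (\<lambda>r. f r + f r)) / 2 * (\<integral>r. (2 - 2 powr \<alpha>) * f r powr \<alpha> + 2 / \<beta> r * (f r powr \<alpha>)\<^sup>2 \<partial>m)"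
proof -
  show t: "\<Psi> \<in> test_functions" unfolding \<Psi>_def
  proof (rule test_function_profile[OF cut_exp_derivatives])
    show "0 < - 3 * ln \<delta>" using \<delta> by (simp add: ln_less_zero)
    show "cut_exp \<delta> s = 0" if "- 3 * ln \<delta> \<le> s" for s using cut_exp_zero[OF \<delta>(1) that] .
  qed (intro continuous_intros f | simp)+
  obtain D where n: "nice \<Psi> D" using test_function_nice[OF t] .
  note E = energy_identity[OF n] and cnn = Cpp_cnn[OF f]
  have cf: "continuous_on UNIV f" by (rule cnn_continuous[OF cnn])
  obtain \<rho> where \<rho>: "0 < \<rho>" "\<And>r. \<rho> \<le> f r" using f by (auto simp: Cpp_def)
  let ?q = "\<lambda>r. (2 - 2 powr \<alpha>) * f r powr \<alpha> + 2 / \<beta> r * (f r powr \<alpha>)\<^sup>2"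
  have iq: "integrable m ?q"
    unfolding \<beta>_def using b_pos a_pos by (intro continuous_integrable m_fin continuous_intros c a_cont b_cont) (auto simp: less_imp_neq[symmetric])
  have site: "(\<integral>r. site_energy \<Psi> D X r \<partial>m) \<le> exp (- pairing X (\<lambda>r. f r + f r)) * (1 / 2 * (\<integral>r. ?q r \<partial>m))" if X: "X \<in> fin_measures" for X
  proof -
    have "site_energy \<Psi> D X r \<le> (exp (- pairing X f))\<^sup>2 / 2 * ?q r" for r
    proof -
      obtain F'' where F: "C2_compact (\<lambda>t. \<Psi> (add_dirac X t r)) (\<lambda>t. D (add_dirac X t r) r) F''" using nice_C2_compact[OF n X] .
      have fr: "0 < f r" using \<rho> by (meson less_le_trans)
      show ?thesis
      proof (rule relaxation.energy_le[OF relaxation F fr])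
        fix w z :: real assume wz: "0 \<le> w" "0 < z"
        have p: "pairing (add_dirac X t r) f = pairing X f + t * f r" if "0 \<le> t" for t
          by (rule pairing_add_dirac[OF cf X that])
        have "pairing X f + w * f r \<le> pairing X f + (w + z) * f r" using fr wz by simp
        from cut_exp_increment[OF less_imp_le[OF \<delta>(1)] this]
        have "\<bar>\<Psi> (add_dirac X (w + z) r) - \<Psi> (add_dirac X w r)\<bar> \<le> exp (- (pairing X f + w * f r)) - exp (- (pairing X f + (w + z) * f r))"
          using wz unfolding \<Psi>_def by (simp add: p)
        also have "\<dots> = exp (- pairing X f) * exp (- f r * w) * (1 - exp (- f r * z))"
          by (simp add: right_diff_distrib exp_add[symmetric] algebra_simps)
        finally show "\<bar>\<Psi> (add_dirac X (w + z) r) - \<Psi> (add_dirac X w r)\<bar> \<le> exp (- pairing X f) * exp (- f r * w) * (1 - exp (- f r * z))" .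
      qed simp
    qed
    then have "(\<integral>r. site_energy \<Psi> D X r \<partial>m) \<le> (\<integral>r. (exp (- pairing X f))\<^sup>2 / 2 * ?q r \<partial>m)"
      using E(1)[OF X] iq by (intro integral_mono integrable_mult_right)
    also have "\<dots> = (exp (- pairing X f))\<^sup>2 / 2 * (\<integral>r. ?q r \<partial>m)" by (rule integral_mult_right_zero)
    also have "(exp (- pairing X f))\<^sup>2 = exp (- pairing X (\<lambda>r. f r + f r))"
      unfolding pairing_add[OF cnn cnn X] by (simp add: power2_eq_square exp_add[symmetric])
    finally show ?thesis by simp
  qed
  note L = laplace_Q[OF cnn_add[OF cnn cnn], unfolded has_bochner_integral_iff]
  have "(\<integral>X. \<integral>r. site_energy \<Psi> D X r \<partial>m \<partial>Q) \<le> (\<integral>X. exp (- pairing X (\<lambda>r. f r + f r)) * (1 / 2 * (\<integral>r. ?q r \<partial>m)) \<partial>Q)"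
    using E(2) L site space_Q_fin by (intro integral_mono integrable_mult_left) auto
  also have "\<dots> = exp (- \<psi> (\<lambda>r. f r + f r)) / 2 * (\<integral>r. ?q r \<partial>m)"
    unfolding integral_mult_left_zero using L by simp
  finally show "- (\<integral>X. cir_op \<alpha> a b m \<Psi> X * \<Psi> X \<partial>Q) \<le> exp (- \<psi> (\<lambda>r. f r + f r)) / 2 * (\<integral>r. ?q r \<partial>m)"
    using E(3) by simp
qed

lemma var_bounded:
  assumes "u \<in> borel_measurable Q" "\<And>X. X \<in> space Q \<Longrightarrow> \<bar>u X\<bar> \<le> B"
  shows "var Q u = (\<integral>X. (u X)\<^sup>2 \<partial>Q) - (\<integral>X. u X \<partial>Q)\<^sup>2"
proof -
  have "integrable Q u" using assms by (intro Q.integrable_const_bound[of _ B]) auto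
  then show ?thesis unfolding var_def
    using bounded_L2[OF assms] by (intro Q.variance_eq) (auto simp: L2_def)
qed

text \<open>The limit is the variance of exp(- <X, f>), written with exp(- 2 \<psi> f) = exp(-
  \<psi> (2 f)) exp(- K f f).\<close>

lemma cut_exp_var:
  assumes f: "f \<in> Cpp"
  shows "(\<lambda>k. var Q (\<lambda>X. cut_exp (1 / real (k + 2)) (pairing X f))) \<longlonglongrightarrow> exp (- \<psi> (\<lambda>r. f r + f r)) * (1 - exp (- K f f))"
proof -
  note cnn = Cpp_cnn[OF f]
  define u where "u k X = cut_exp (1 / real (k + 2)) (pairing X f)" for k X
  have [measurable]: "(\<lambda>X. pairing X f) \<in> borel_measurable Q" by (rule pairing_measurable[OF cnn_continuous[OF cnn]])
  have um [measurable]: "u k \<in> borel_measurable Q" for k unfolding u_def cut_exp_def by measurable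
  have ub: "0 \<le> u k X \<and> u k X \<le> 1" for k X
    unfolding u_def using pairing_nonneg[OF cnn] by (intro cut_exp_bounds) auto
  have ul: "(\<lambda>k. u k X) \<longlonglongrightarrow> exp (- pairing X f)" for X unfolding u_def by (rule cut_exp_tendsto)
  have "(\<lambda>k. \<integral>X. u k X \<partial>Q) \<longlonglongrightarrow> (\<integral>X. exp (- pairing X f) \<partial>Q)"
    using ub by (intro integral_dominated_convergence[where w = "\<lambda>_. 1"] AE_I2 ul) auto
  moreover have "(\<lambda>k. \<integral>X. (u k X)\<^sup>2 \<partial>Q) \<longlonglongrightarrow> (\<integral>X. (exp (- pairing X f))\<^sup>2 \<partial>Q)"
    using ub by (intro integral_dominated_convergence[where w = "\<lambda>_. 1"] AE_I2 tendsto_power ul) (auto simp: abs_square_le_1)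
  ultimately have "(\<lambda>k. (\<integral>X. (u k X)\<^sup>2 \<partial>Q) - (\<integral>X. u k X \<partial>Q)\<^sup>2) \<longlonglongrightarrow> (\<integral>X. (exp (- pairing X f))\<^sup>2 \<partial>Q) - (\<integral>X. exp (- pairing X f) \<partial>Q)\<^sup>2"
    by (intro tendsto_diff tendsto_power)
  moreover have "var Q (u k) = (\<integral>X. (u k X)\<^sup>2 \<partial>Q) - (\<integral>X. u k X \<partial>Q)\<^sup>2" for k
    using ub by (intro var_bounded[where B = 1]) auto
  moreover have "(\<integral>X. exp (- pairing X f) \<partial>Q) = exp (- \<psi> f)"
    using laplace_Q[OF cnn] by (simp add: has_bochner_integral_iff)
  moreover have "(\<integral>X. (exp (- pairing X f))\<^sup>2 \<partial>Q) = exp (- \<psi> (\<lambda>r. f r + f r))"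
  proof -
    have "(\<integral>X. (exp (- pairing X f))\<^sup>2 \<partial>Q) = (\<integral>X. exp (- pairing X (\<lambda>r. f r + f r)) \<partial>Q)"
      by (intro Bochner_Integration.integral_cong refl)
        (simp only: pairing_add[OF cnn cnn space_Q_fin] power2_eq_square exp_add[symmetric] minus_add_distrib)
    then show ?thesis using laplace_Q[OF cnn_add[OF cnn cnn]] by (simp add: has_bochner_integral_iff)
  qed
  moreover have "exp (- \<psi> (\<lambda>r. f r + f r)) - (exp (- \<psi> f))\<^sup>2 = exp (- \<psi> (\<lambda>r. f r + f r)) * (1 - exp (- K f f))"
    by (simp add: K_def right_diff_distrib power2_eq_square exp_add[symmetric])
  ultimately show ?thesis by (simp add: u_def[abs_def])
qed

text \<open>The strict inequality of \<open>upper_profile\<close> is what survives the cut-off: the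
  energy bound is the same for all levels while the variances converge, so some level works.\<close>

lemma gap_upper:
  assumes c1: "\<not> (AE r in m. c1 \<le> b r)" and c12: "c1 < c2"
  obtains \<Psi> where "\<Psi> \<in> test_functions" "0 < var Q \<Psi>" "- (\<integral>X. cir_op \<alpha> a b m \<Psi> X * \<Psi> X \<partial>Q) \<le> c2 / 2 * var Q \<Psi>"
proof -
  obtain f where f: "f \<in> Cpp" "continuous_on UNIV (\<lambda>r. f r powr \<alpha>)"
    and A: "(\<integral>r. (2 - 2 powr \<alpha>) * f r powr \<alpha> + 2 / \<beta> r * (f r powr \<alpha>)\<^sup>2 \<partial>m) < c2 * (1 - exp (- K f f))" (is "?A < _")
    using upper_profile[OF c1 c12] .
  let ?e = "exp (- \<psi> (\<lambda>r. f r + f r))" and ?u = "\<lambda>k X. cut_exp (1 / real (k + 2)) (pairing X f)"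
  have A0: "0 \<le> ?A"
    using \<beta>_pos \<alpha> powr_less_mono[of \<alpha> 1 2] by (intro Bochner_Integration.integral_nonneg add_nonneg_nonneg mult_nonneg_nonneg) (auto simp: less_imp_le)
  have "?e / 2 * ?A < ?e / 2 * (c2 * (1 - exp (- K f f)))" using A by (intro mult_strict_left_mono) auto
  moreover have "(\<lambda>k. c2 / 2 * var Q (?u k)) \<longlonglongrightarrow> c2 / 2 * (?e * (1 - exp (- K f f)))"
    by (intro tendsto_mult_left cut_exp_var f)
  ultimately have "\<forall>\<^sub>F k in sequentially. ?e / 2 * ?A < c2 / 2 * var Q (?u k)"
    by (intro order_tendstoD(1)) (auto simp: mult_ac)
  then obtain k where k: "?e / 2 * ?A < c2 / 2 * var Q (?u k)" by (auto simp: eventually_sequentially)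
  note ce = cut_exp_energy[OF f, of "1 / real (k + 2)"]
  have c2: "0 < c2"
  proof (rule ccontr)
    assume "\<not> 0 < c2"
    then have "c1 \<le> b r" for r using b_pos[of r] c12 by linarith
    then show False using c1 by simp
  qed
  show ?thesis
  proof (rule that)
    show "?u k \<in> test_functions" by (rule ce(1)) auto
    have "0 < c2 / 2 * var Q (?u k)" using k A0 by (meson divide_nonneg_nonneg exp_ge_zero le_less_trans mult_nonneg_nonneg zero_le_numeral)
    then show "0 < var Q (?u k)" using c2 by (simp add: zero_less_mult_iff)
    have "- (\<integral>X. cir_op \<alpha> a b m (?u k) X * ?u k X \<partial>Q) \<le> ?e / 2 * ?A" by (rule ce(2)) auto
    then show "- (\<integral>X. cir_op \<alpha> a b m (?u k) X * ?u k X \<partial>Q) \<le> c2 / 2 * var Q (?u k)" using k by linarith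
  qed
qed

end

section \<open>Closure and spectral gap\<close>

lemma quadratic_nonneg_discriminant:
  fixes A B C :: real
  assumes "\<And>t. 0 \<le> t\<^sup>2 * A + 2 * t * B + C" "0 \<le> A"
  shows "B\<^sup>2 \<le> A * C"
proof (cases "A = 0")
  case True
  have "B = 0"
  proof (rule ccontr)
    assume "B \<noteq> 0"
    then show False using assms(1)[of "- (C + 1) / (2 * B)"] True by (simp add: field_simps)
  qed
  then show ?thesis using True by simp
next
  case False
  then have A: "0 < A" using assms(2) by simp
  have "(- B / A)\<^sup>2 * A + 2 * (- B / A) * B + C = C - B\<^sup>2 / A"
    using A by (simp add: power2_eq_square field_simps)
  then have "B\<^sup>2 / A \<le> C" using assms(1)[of "- B / A"] by simp
  then show ?thesis using A by (simp add: pos_divide_le_eq mult.commute)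
qed

lemma L2_measurable: "u \<in> L2 M \<Longrightarrow> u \<in> borel_measurable M"
  and L2_square_integrable: "u \<in> L2 M \<Longrightarrow> integrable M (\<lambda>x. (u x)\<^sup>2)"
  by (simp_all add: L2_def)

lemma L2_mult_integrable:
  assumes u: "u \<in> L2 M" and v: "v \<in> L2 M"
  shows "integrable M (\<lambda>x. u x * v x)"
proof (rule Bochner_Integration.integrable_bound)
  show "integrable M (\<lambda>x. (u x)\<^sup>2 + (v x)\<^sup>2)" using L2_square_integrable[OF u] L2_square_integrable[OF v] by simp
  show "AE x in M. norm (u x * v x) \<le> norm ((u x)\<^sup>2 + (v x)\<^sup>2)"
  proof (rule AE_I2)
    fix x
    have "2 * (\<bar>u x\<bar> * \<bar>v x\<bar>) \<le> (u x)\<^sup>2 + (v x)\<^sup>2"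
      using sum_squares_bound[of "\<bar>u x\<bar>" "\<bar>v x\<bar>"] by (simp add: mult.assoc)
    moreover have "0 \<le> \<bar>u x\<bar> * \<bar>v x\<bar>" by simp
    ultimately show "norm (u x * v x) \<le> norm ((u x)\<^sup>2 + (v x)\<^sup>2)"
      unfolding real_norm_def abs_mult by linarith
  qed
qed (use L2_measurable[OF u] L2_measurable[OF v] in measurable)

lemma L2_diff:
  assumes u: "u \<in> L2 M" and v: "v \<in> L2 M"
  shows "(\<lambda>x. u x - v x) \<in> L2 M"
proof -
  have "integrable M (\<lambda>x. (u x)\<^sup>2 - 2 * (u x * v x) + (v x)\<^sup>2)"
    using L2_square_integrable[OF u] L2_square_integrable[OF v] L2_mult_integrable[OF u v] by simp
  moreover have "(u x)\<^sup>2 - 2 * (u x * v x) + (v x)\<^sup>2 = (u x - v x)\<^sup>2" for x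
    by (simp add: power2_eq_square algebra_simps)
  ultimately show ?thesis using L2_measurable[OF u] L2_measurable[OF v] by (simp add: L2_def)
qed

lemma L2_Cauchy_Schwarz:
  assumes u: "u \<in> L2 M" and v: "v \<in> L2 M"
  shows "(\<integral>x. u x * v x \<partial>M)\<^sup>2 \<le> (\<integral>x. (u x)\<^sup>2 \<partial>M) * (\<integral>x. (v x)\<^sup>2 \<partial>M)"
proof (rule quadratic_nonneg_discriminant)
  fix t :: real
  have "0 \<le> (\<integral>x. (t * u x + v x)\<^sup>2 \<partial>M)" by (intro Bochner_Integration.integral_nonneg) simp
  also have "\<dots> = (\<integral>x. t\<^sup>2 * (u x)\<^sup>2 + 2 * t * (u x * v x) + (v x)\<^sup>2 \<partial>M)"
    by (intro Bochner_Integration.integral_cong) (auto simp: power2_eq_square algebra_simps)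
  also have "\<dots> = t\<^sup>2 * (\<integral>x. (u x)\<^sup>2 \<partial>M) + 2 * t * (\<integral>x. u x * v x \<partial>M) + (\<integral>x. (v x)\<^sup>2 \<partial>M)"
    using L2_square_integrable[OF u] L2_square_integrable[OF v] L2_mult_integrable[OF u v] by simp
  finally show "0 \<le> t\<^sup>2 * (\<integral>x. (u x)\<^sup>2 \<partial>M) + 2 * t * (\<integral>x. u x * v x \<partial>M) + (\<integral>x. (v x)\<^sup>2 \<partial>M)" .
qed (intro Bochner_Integration.integral_nonneg, simp)

lemma L2_product_tendsto_zero:
  assumes u: "\<And>k. u k \<in> L2 M" and v: "\<And>k. v k \<in> L2 M"
    and l: "(\<lambda>k. (\<integral>x. (u k x)\<^sup>2 \<partial>M) * (\<integral>x. (v k x)\<^sup>2 \<partial>M)) \<longlonglongrightarrow> 0"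
  shows "(\<lambda>k. \<integral>x. u k x * v k x \<partial>M) \<longlonglongrightarrow> 0"
proof -
  have "(\<lambda>k. (\<integral>x. u k x * v k x \<partial>M)\<^sup>2) \<longlonglongrightarrow> 0"
    by (rule tendsto_sandwich[OF _ _ tendsto_const l]) (auto intro!: always_eventually L2_Cauchy_Schwarz u v)
  from tendsto_real_sqrt[OF this] show ?thesis by (simp add: tendsto_rabs_zero_iff)
qed

text \<open>Expand in the differences us - u and vs - v; Cauchy-Schwarz sends every product
  containing one of them to 0.\<close>

lemma L2_inner_tendsto:
  assumes "L2_tendsto M us u" "L2_tendsto M vs v"
  shows "(\<lambda>k. \<integral>x. us k x * vs k x \<partial>M) \<longlonglongrightarrow> (\<integral>x. u x * v x \<partial>M)"
proof -
  have us: "us k \<in> L2 M" "vs k \<in> L2 M" and u: "u \<in> L2 M" "v \<in> L2 M" for k using assms by (auto simp: L2_tendsto_def)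
  note l = assms[unfolded L2_tendsto_def, THEN conjunct2, THEN conjunct2]
  let ?d = "\<lambda>k x. us k x - u x" and ?e = "\<lambda>k x. vs k x - v x"
  have d: "?d k \<in> L2 M" "?e k \<in> L2 M" for k by (intro L2_diff us u)+
  have "(\<lambda>k. (\<integral>x. ?d k x * ?e k x \<partial>M) + (\<integral>x. ?d k x * v x \<partial>M) + (\<integral>x. ?e k x * u x \<partial>M) + (\<integral>x. u x * v x \<partial>M)) \<longlonglongrightarrow> 0 + 0 + 0 + (\<integral>x. u x * v x \<partial>M)"
    using l by (intro tendsto_add tendsto_const L2_product_tendsto_zero d u) (auto intro: tendsto_mult_zero tendsto_mult_left_zero)
  moreover have "(\<integral>x. ?d k x * ?e k x \<partial>M) + (\<integral>x. ?d k x * v x \<partial>M) + (\<integral>x. ?e k x * u x \<partial>M) + (\<integral>x. u x * v x \<partial>M) = (\<integral>x. us k x * vs k x \<partial>M)" for k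
  proof -
    have "(\<integral>x. us k x * vs k x \<partial>M) = (\<integral>x. ?d k x * ?e k x + ?d k x * v x + ?e k x * u x + u x * v x \<partial>M)"
      by (intro Bochner_Integration.integral_cong) (auto simp: algebra_simps)
    then show ?thesis using d[of k] u by (simp add: L2_mult_integrable)
  qed
  ultimately show ?thesis by simp
qed

context prob_space
begin

lemma L2_const: "(\<lambda>_. c) \<in> L2 M"
  by (simp add: L2_def)

lemma L2_integrable: "u \<in> L2 M \<Longrightarrow> integrable M u"
  using L2_mult_integrable[OF _ L2_const[of 1], of u] by simp

lemma L2_var: "u \<in> L2 M \<Longrightarrow> var M u = (\<integral>x. u x * u x \<partial>M) - (\<integral>x. u x \<partial>M)\<^sup>2"
  unfolding var_def using variance_eq[OF L2_integrable L2_square_integrable] by (simp add: power2_eq_square)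

lemma L2_var_tendsto:
  assumes "L2_tendsto M us u"
  shows "(\<lambda>k. var M (us k)) \<longlonglongrightarrow> var M u"
proof -
  have us: "us k \<in> L2 M" "u \<in> L2 M" for k using assms by (auto simp: L2_tendsto_def)
  have one: "L2_tendsto M (\<lambda>_ _. 1) (\<lambda>_. 1)" by (simp add: L2_tendsto_def L2_const)
  have "(\<lambda>k. \<integral>x. us k x \<partial>M) \<longlonglongrightarrow> (\<integral>x. u x \<partial>M)" using L2_inner_tendsto[OF assms one] by simp
  then show ?thesis unfolding L2_var[OF us(1)] L2_var[OF us(2)]
    by (intro tendsto_diff tendsto_power L2_inner_tendsto assms)
qed

end

text \<open>Serves to normalise the variance to 1; s \<noteq> 0 keeps the support unchanged.\<close>

lemma test_functions_cmult:
  assumes \<Psi>: "\<Psi> \<in> test_functions" and s: "s \<noteq> 0"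
  shows "(\<lambda>X. s * \<Psi> X) \<in> test_functions"
proof -
  obtain n \<phi> f where n: "1 \<le> n" "C2_orthant n \<phi>" "compact_support_orthant n \<phi>" "\<forall>i<n. f i \<in> Cpp"
    and e: "\<forall>X \<in> fin_measures. \<Psi> X = \<phi> (\<lambda>i. if i < n then (\<integral>r. f i r \<partial>X) else 0)"
    using \<Psi> unfolding test_functions_def by blast
  have p: "partial_on_orthant n i u u' \<Longrightarrow> partial_on_orthant n i (\<lambda>x. s * u x) (\<lambda>x. s * u' x)" for i u u'
    unfolding partial_on_orthant_def by (auto intro: DERIV_cmult)
  have c: "continuous_on (orthant n) u \<Longrightarrow> continuous_on (orthant n) (\<lambda>x. s * u x)" for u :: "(nat \<Rightarrow> real) \<Rightarrow> real"
    by (intro continuous_on_mult continuous_on_const)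
  obtain g h where gh: "\<And>i. i < n \<Longrightarrow> partial_on_orthant n i \<phi> (g i) \<and> continuous_on (orthant n) (g i) \<and>
        (\<forall>j<n. partial_on_orthant n j (g i) (h i j) \<and> continuous_on (orthant n) (h i j))"
    using n(2) unfolding C2_orthant_def by blast
  have "C2_orthant n (\<lambda>x. s * \<phi> x)" unfolding C2_orthant_def
    using n(2) gh by (intro conjI exI[of _ "\<lambda>i x. s * g i x"] exI[of _ "\<lambda>i j x. s * h i j x"] allI impI c p)
      (auto simp: C2_orthant_def)
  moreover have "compact_support_orthant n (\<lambda>x. s * \<phi> x)"
    using n(3) s by (simp add: compact_support_orthant_def)
  ultimately show ?thesis unfolding test_functions_def using n(1,4) e
    by (intro CollectI exI[of _ n] exI[of _ "\<lambda>x. s * \<phi> x"] exI[of _ f]) auto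
qed

context cir
begin

lemma cir_op_lin:
  assumes 1: "nice \<Psi> D" and 2: "nice \<Phi> D'" and X: "X \<in> fin_measures"
  shows "cir_op \<alpha> a b m (\<lambda>X. p * \<Psi> X + q * \<Phi> X) X = p * cir_op \<alpha> a b m \<Psi> X + q * cir_op \<alpha> a b m \<Phi> X"
proof -
  have NN: "NN (opA \<Psi> D)" "NN (opB \<Psi>)" "NN (opA \<Phi> D')" "NN (opB \<Phi>)" using 1 2 by (auto simp: nice_def)
  note i = NN_integrable[OF NN(1) X X] NN_integrable[OF NN(3) X X] NN_integrable[OF NN(2) X m_fin] NN_integrable[OF NN(4) X m_fin]
  show ?thesis
    unfolding nice_cir_op[OF nice_lin[OF 1 2] X] nice_cir_op[OF 1 X] nice_cir_op[OF 2 X] opA_lin[OF 1 2 X]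
    using i by (simp add: distrib_left)
qed

text \<open>A combination of test functions is not visibly a test function: \<phi>(x) + \<phi>'(y)
  in general has no compact support in (x, y). It is therefore formed among \<open>nice\<close>
  functions, where \<open>dissipative\<close> applies.\<close>

lemma dissipative_lin:
  assumes \<Psi>: "\<Psi> \<in> test_functions" and \<Phi>: "\<Phi> \<in> test_functions"
  defines "L \<equiv> cir_op \<alpha> a b m"
  shows "p\<^sup>2 * (\<integral>X. L \<Psi> X * \<Psi> X \<partial>Q) + p * q * (\<integral>X. L \<Psi> X * \<Phi> X \<partial>Q) + p * q * (\<integral>X. L \<Phi> X * \<Psi> X \<partial>Q) + q\<^sup>2 * (\<integral>X. L \<Phi> X * \<Phi> X \<partial>Q) \<le> 0"
proof -
  obtain D where 1: "nice \<Psi> D" using test_function_nice[OF \<Psi>] .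
  obtain D' where 2: "nice \<Phi> D'" using test_function_nice[OF \<Phi>] .
  note l = nice_L2[OF 1] nice_L2[OF 2]
  note i = L2_mult_integrable[OF l(2) l(1)] L2_mult_integrable[OF l(2) l(3)] L2_mult_integrable[OF l(4) l(1)] L2_mult_integrable[OF l(4) l(3)]
  have "(\<integral>X. L (\<lambda>X. p * \<Psi> X + q * \<Phi> X) X * (p * \<Psi> X + q * \<Phi> X) \<partial>Q) =
    (\<integral>X. p\<^sup>2 * (L \<Psi> X * \<Psi> X) + p * q * (L \<Psi> X * \<Phi> X) + p * q * (L \<Phi> X * \<Psi> X) + q\<^sup>2 * (L \<Phi> X * \<Phi> X) \<partial>Q)"
    unfolding L_def
    by (intro Bochner_Integration.integral_cong refl) (simp add: cir_op_lin[OF 1 2 space_Q_fin] power2_eq_square algebra_simps)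
  also have "\<dots> = p\<^sup>2 * (\<integral>X. L \<Psi> X * \<Psi> X \<partial>Q) + p * q * (\<integral>X. L \<Psi> X * \<Phi> X \<partial>Q) + p * q * (\<integral>X. L \<Phi> X * \<Psi> X \<partial>Q) + q\<^sup>2 * (\<integral>X. L \<Phi> X * \<Phi> X \<partial>Q)"
    using i unfolding L_def by simp
  finally show ?thesis using dissipative[OF nice_lin[OF 1 2, of p q]] unfolding L_def by simp
qed

abbreviation closed_graph :: "(('e measure \<Rightarrow> real) \<times> ('e measure \<Rightarrow> real)) set" where
  "closed_graph \<equiv> graph_closure Q (cir_op \<alpha> a b m) test_functions"

text \<open>Passing to the limit in the dissipativity of \<open>(1 + t) \<Psi>\<^sub>k - t \<Psi>'\<^sub>k\<close>, an affine function of
  \<open>t\<close> turns out to be bounded above, so its slope vanishes.\<close>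

lemma closure_inner_unique:
  assumes v: "(u, v) \<in> closed_graph" and v': "(u, v') \<in> closed_graph"
  shows "(\<integral>X. v X * u X \<partial>Q) = (\<integral>X. v' X * u X \<partial>Q)"
proof -
  obtain us where us: "\<And>k. us k \<in> test_functions" "L2_tendsto Q us u" "L2_tendsto Q (\<lambda>k. cir_op \<alpha> a b m (us k)) v"
    using v unfolding graph_closure_def by blast
  obtain us' where us': "\<And>k. us' k \<in> test_functions" "L2_tendsto Q us' u" "L2_tendsto Q (\<lambda>k. cir_op \<alpha> a b m (us' k)) v'"
    using v' unfolding graph_closure_def by blast
  define I where "I = (\<integral>X. v X * u X \<partial>Q)"
  define J where "J = (\<integral>X. v' X * u X \<partial>Q)"
  have *: "I + t * (I - J) \<le> 0" for t
  proof -
    let ?p = "1 + t" and ?q = "- t"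
    have "?p\<^sup>2 * I + ?p * ?q * I + ?p * ?q * J + ?q\<^sup>2 * J \<le> 0"
    proof (rule LIMSEQ_le_const2)
      show "(\<lambda>k. ?p\<^sup>2 * (\<integral>X. cir_op \<alpha> a b m (us k) X * us k X \<partial>Q) + ?p * ?q * (\<integral>X. cir_op \<alpha> a b m (us k) X * us' k X \<partial>Q)
        + ?p * ?q * (\<integral>X. cir_op \<alpha> a b m (us' k) X * us k X \<partial>Q) + ?q\<^sup>2 * (\<integral>X. cir_op \<alpha> a b m (us' k) X * us' k X \<partial>Q))
        \<longlonglongrightarrow> ?p\<^sup>2 * I + ?p * ?q * I + ?p * ?q * J + ?q\<^sup>2 * J"
        unfolding I_def J_def by (intro tendsto_add tendsto_mult tendsto_const L2_inner_tendsto us us')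
    qed (use dissipative_lin[OF us(1) us'(1)] in blast)
    moreover have "?p\<^sup>2 * I + ?p * ?q * I + ?p * ?q * J + ?q\<^sup>2 * J = I + t * (I - J)"
      by (simp add: power2_eq_square algebra_simps)
    ultimately show ?thesis by simp
  qed
  have "I = J"
  proof (rule ccontr)
    assume "I \<noteq> J"
    then show False using *[of "(1 - I) / (I - J)"] by simp
  qed
  then show ?thesis by (simp add: I_def J_def)
qed

text \<open>Variance and <v, u> are both continuous under convergence in the graph, so
  \<open>gap_lower\<close> passes to the limit.\<close>

lemma closure_gap:
  assumes uv: "(u, v) \<in> closed_graph" and c: "0 \<le> c" "AE r in m. c \<le> b r"
  shows "c / 2 * var Q u \<le> - (\<integral>X. v X * u X \<partial>Q)"
proof -
  obtain us where us: "\<And>k. us k \<in> test_functions" "L2_tendsto Q us u" "L2_tendsto Q (\<lambda>k. cir_op \<alpha> a b m (us k)) v"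
    using uv unfolding graph_closure_def by blast
  have "c / 2 * var Q (us k) \<le> - (\<integral>X. cir_op \<alpha> a b m (us k) X * us k X \<partial>Q)" for k
  proof -
    obtain D where "nice (us k) D" "lip_approx (us k)" using test_function_nice[OF us(1)] .
    then show ?thesis by (rule gap_lower[OF _ _ c])
  qed
  then show ?thesis
    by (intro LIMSEQ_le[OF tendsto_mult_left[OF Q.L2_var_tendsto[OF us(2)]] tendsto_minus[OF L2_inner_tendsto[OF us(3,2)]]]) blast
qed

text \<open>\<open>closure_op\<close> is a choice, and membership in the graph is all that its
  definition says of the chosen value.\<close>

lemma closure_op_closure: "u \<in> closure_dom Q (cir_op \<alpha> a b m) test_functions \<Longrightarrow> (u, closure_op Q (cir_op \<alpha> a b m) test_functions u) \<in> closed_graph"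
  unfolding closure_dom_def closure_op_def by (elim DomainE) (rule someI[of "\<lambda>v. (u, v) \<in> closed_graph"])

lemma test_function_closure:
  assumes "\<Psi> \<in> test_functions"
  shows "(\<Psi>, cir_op \<alpha> a b m \<Psi>) \<in> closed_graph"
proof -
  obtain D where "nice \<Psi> D" using test_function_nice[OF assms] .
  then show ?thesis unfolding graph_closure_def using assms
    by (auto simp: L2_tendsto_def nice_L2 intro!: exI[of _ "\<lambda>_. \<Psi>"])
qed

lemma gap_attained:
  assumes c1: "\<not> (AE r in m. c1 \<le> b r)" and c12: "c1 < c2"
  shows "spectral_gap Q (cir_op \<alpha> a b m) test_functions \<le> ereal (c2 / 2)"
proof -
  let ?L = "cir_op \<alpha> a b m"
  obtain \<Psi> where \<Psi>: "\<Psi> \<in> test_functions" and v: "0 < var Q \<Psi>" and le: "- (\<integral>X. ?L \<Psi> X * \<Psi> X \<partial>Q) \<le> c2 / 2 * var Q \<Psi>"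
    using gap_upper[OF c1 c12] .
  define s where "s = 1 / sqrt (var Q \<Psi>)"
  have s: "s \<noteq> 0" "s\<^sup>2 * var Q \<Psi> = 1" using v by (auto simp: s_def power_divide)
  let ?u = "\<lambda>X. s * \<Psi> X"
  have u: "?u \<in> test_functions" by (rule test_functions_cmult[OF \<Psi> s(1)])
  obtain D where n: "nice \<Psi> D" using test_function_nice[OF \<Psi>] .
  have Lu: "?L ?u X = s * ?L \<Psi> X" if "X \<in> space Q" for X
    using cir_op_lin[OF n n space_Q_fin[OF that], of s 0] by simp
  have uv: "var Q ?u = 1"
  proof -
    have "var Q ?u = (\<integral>X. s\<^sup>2 * (\<Psi> X - (\<integral>y. \<Psi> y \<partial>Q))\<^sup>2 \<partial>Q)"
      unfolding var_def integral_mult_right_zero by (simp add: right_diff_distrib[symmetric] power_mult_distrib)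
    then show ?thesis using s(2) unfolding var_def integral_mult_right_zero by simp
  qed
  note uL = test_function_closure[OF u]
  have dom: "?u \<in> closure_dom Q ?L test_functions" using uL by (auto simp: closure_dom_def)
  have "dirichlet_form Q ?L test_functions ?u = - (\<integral>X. closure_op Q ?L test_functions ?u X * ?u X \<partial>Q)"
    by (simp add: dirichlet_form_def)
  \<comment> \<open>The chosen value may differ from \<open>cir_op\<close>; the quadratic form is
    the same for both.\<close>
  also have "(\<integral>X. closure_op Q ?L test_functions ?u X * ?u X \<partial>Q) = (\<integral>X. ?L ?u X * ?u X \<partial>Q)"
    by (rule closure_inner_unique[OF closure_op_closure[OF dom] uL])
  also have "\<dots> = (\<integral>X. s\<^sup>2 * (?L \<Psi> X * \<Psi> X) \<partial>Q)"
    by (intro Bochner_Integration.integral_cong refl) (simp add: Lu power2_eq_square)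
  also have "- \<dots> = s\<^sup>2 * - (\<integral>X. ?L \<Psi> X * \<Psi> X \<partial>Q)" by simp
  also have "\<dots> \<le> s\<^sup>2 * (c2 / 2 * var Q \<Psi>)" using le by (intro mult_left_mono) auto
  also have "\<dots> = c2 / 2" using s(2) by (simp add: mult.left_commute)
  finally have "ereal (dirichlet_form Q ?L test_functions ?u) \<le> ereal (c2 / 2)" by simp
  moreover have "spectral_gap Q ?L test_functions \<le> ereal (dirichlet_form Q ?L test_functions ?u)"
    unfolding spectral_gap_def using uv dom by (intro Inf_lower) blast
  ultimately show ?thesis by (rule order_trans[rotated])
qed

lemma spectral_gap_ge: "ereal (1 / 2) * essinf m b \<le> spectral_gap Q (cir_op \<alpha> a b m) test_functions"
  unfolding spectral_gap_def
proof (rule Inf_greatest, elim CollectE exE conjE)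
  fix E u assume E: "E = ereal (dirichlet_form Q (cir_op \<alpha> a b m) test_functions u)" and u: "var Q u = 1" "u \<in> closure_dom Q (cir_op \<alpha> a b m) test_functions"
  let ?d = "dirichlet_form Q (cir_op \<alpha> a b m) test_functions u"
  have low: "c / 2 \<le> ?d" if "0 \<le> c" "AE r in m. c \<le> b r" for c
    using closure_gap[OF closure_op_closure[OF u(2)] that] u(1) by (simp add: dirichlet_form_def)
  \<comment> \<open>Takes care of the negative candidates c, for which \<open>low\<close> says
    nothing.\<close>
  have "0 \<le> ?d" using low[of 0] b_pos by (simp add: less_imp_le)
  have "essinf m b \<le> ereal (2 * ?d)"
    unfolding essinf_def
  proof (rule Sup_least, elim CollectE)
    fix c assume c: "AE r in m. c \<le> ereal (b r)"
    show "c \<le> ereal (2 * ?d)"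
    proof (cases c)
      case (real x)
      show ?thesis
      proof (cases "0 \<le> x")
        case True
        then show ?thesis using low[of x] c real by simp
      next
        case False
        then show ?thesis using \<open>0 \<le> ?d\<close> real by simp
      qed
    next
      \<comment> \<open>An infinite almost sure lower bound of the finite b is possible only for
        null m.\<close>
      case PInf
      then have "AE r in m. False" using c by simp
      then have "emeasure m (space m) = 0" by (simp add: eventually_False ae_filter_eq_bot_iff)
      then show ?thesis using m by (simp add: nonnull_measures_def space_m)
    qed simp
  qed
  then have "ereal (1 / 2) * essinf m b \<le> ereal (1 / 2) * ereal (2 * ?d)" by (intro ereal_mult_left_mono) auto
  then show "ereal (1 / 2) * essinf m b \<le> E" by (simp add: E)
qed

lemma spectral_gap_le: "spectral_gap Q (cir_op \<alpha> a b m) test_functions \<le> ereal (1 / 2) * essinf m b"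
proof (rule dense_ge)
  fix y assume y: "ereal (1 / 2) * essinf m b < y"
  show "spectral_gap Q (cir_op \<alpha> a b m) test_functions \<le> y"
  proof (cases y)
    case (real x)
    have "essinf m b < ereal (2 * x)" using y real by (cases "essinf m b") auto
    \<comment> \<open>A level strictly between the essential infimum and 2 x: it is no almost sure
      lower bound, yet leaves room for \<open>gap_attained\<close>.\<close>
    then obtain c1 where c1: "essinf m b < ereal c1" "c1 < 2 * x" using ereal_dense2 by force
    have "\<not> (AE r in m. c1 \<le> b r)"
    proof
      assume "AE r in m. c1 \<le> b r"
      then have "ereal c1 \<le> essinf m b" unfolding essinf_def by (intro Sup_upper) simp
      then show False using c1(1) by simp
    qed
    from gap_attained[OF this c1(2)] show ?thesis using real by simp
  qed (use y in auto)
qed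

end

theorem theorem4p3:
  fixes \<alpha> :: real
    and a b :: "'e::metric_space \<Rightarrow> real"
    and m :: "'e measure"
    and Q :: "'e measure measure"
  assumes "compact (UNIV :: 'e set)"
    and "0 < \<alpha>" "\<alpha> < 1"
    and "a \<in> Cpp" "b \<in> Cpp"
    and "m \<in> nonnull_measures"
    and "cir_stationary \<alpha> a b m Q"
  shows "spectral_gap Q (cir_op \<alpha> a b m) test_functions = ereal (1 / 2) * essinf m b"
proof -
  interpret cir \<alpha> a b m Q using assms by unfold_locales
  show ?thesis by (intro antisym spectral_gap_le spectral_gap_ge)
qed

end
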